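(* Let $\mathcal{M}$ be a finite von Neumann algebra with a faithful normal tracial state $\tau$. Suppose $\alpha$ is a trace-preserving automorphism of $\mathcal{M}$ (i.e. $\tau\circ\alpha=\tau$). Then the Möbius function $\mu$ is weakly linearly disjoint from $(\mathcal{M},\alpha)$.
   Context: $\mu$ is the Möbius function: $\mu(1)=1$, $\mu(n)=0$ if $n$ is not square-free, and $\mu(n)=(-1)^t$ if $n$ is a product of $t$ distinct primes. Automorphisms are $*$-automorphisms. For a von Neumann algebra $\mathcal{M}$ and an automorphism $\alpha$ of $\mathcal{M}$, $\mu$ is weakly linearly disjoint from $(\mathcal{M},\alpha)$ if $\frac1N\sum_{n=1}^N\mu(n)\rho(\alpha^n(A))\to0$ as $N\to\infty$ for every normal state $\rho$ on $\mathcal{M}$ and every $A\in\mathcal{M}$. *)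

theory Defs
  imports "HOL-Analysis.Analysis" "HOL-Computational_Algebra.Squarefree"
begin

section \<open>Complex Hilbert spaces\<close>

class complex_vector = real_vector +
  fixes scaleC :: "complex \<Rightarrow> 'a \<Rightarrow> 'a"  (infixr "*\<^sub>C" 75)
  assumes scaleC_add_right: "c *\<^sub>C (x + y) = c *\<^sub>C x + c *\<^sub>C y"
    and scaleC_add_left: "(c + d) *\<^sub>C x = c *\<^sub>C x + d *\<^sub>C x"
    and scaleC_scaleC: "c *\<^sub>C (d *\<^sub>C x) = (c * d) *\<^sub>C x"
    and scaleC_one: "1 *\<^sub>C x = x"
    and scaleR_scaleC: "r *\<^sub>R x = complex_of_real r *\<^sub>C x"

text \<open>The complex inner product is linear in its first argument. Positive definiteness, and
  the fact that the norm is the one induced by the complex inner product, are inherited from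
  \<^class>\<open>real_inner\<close> through the last axiom.\<close>

class complex_inner = complex_vector + real_inner +
  fixes cinner :: "'a \<Rightarrow> 'a \<Rightarrow> complex"
  assumes cinner_add_left: "cinner (x + y) z = cinner x z + cinner y z"
    and cinner_scaleC_left: "cinner (c *\<^sub>C x) y = c * cinner x y"
    and cinner_commute: "cinner x y = cnj (cinner y x)"
    and inner_eq_Re_cinner: "inner x y = Re (cinner x y)"

class complex_hilbert_space = complex_inner + complete_space

instantiation complex :: complex_hilbert_space
begin
definition scaleC_complex :: "complex \<Rightarrow> complex \<Rightarrow> complex"
  where "scaleC_complex c x = c * x"
definition cinner_complex :: "complex \<Rightarrow> complex \<Rightarrow> complex"
  where "cinner_complex x y = x * cnj y"
instance
  by standard
    (simp_all add: scaleC_complex_def cinner_complex_def distrib_left distrib_right mult.assoc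
      inner_complex_def scaleR_conv_of_real mult.commute)
end

lemma cinner_add_right: "cinner x (y + z) = cinner x y + cinner x (z :: 'a::complex_inner)"
  by (simp add: cinner_commute[of x] cinner_add_left)

lemma cinner_scaleC_right: "cinner x (c *\<^sub>C y) = cnj c * cinner x (y :: 'a::complex_inner)"
  by (simp add: cinner_commute[of x] cinner_scaleC_left)

lemma cinner_self: "cinner x x = complex_of_real ((norm (x :: 'a::complex_inner))\<^sup>2)"
proof -
  have "Im (cinner x x) = 0"
    using arg_cong[OF cinner_commute[of x x], of Im] by simp
  then show ?thesis
    by (simp add: complex_eq_iff power2_norm_eq_inner inner_eq_Re_cinner)
qed

lemma norm_scaleC: "norm (c *\<^sub>C x) = cmod c * norm (x :: 'a::complex_inner)"
proof -
  have "complex_of_real ((norm (c *\<^sub>C x))\<^sup>2) = c * (cnj c * cinner x x)"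
    by (simp only: cinner_self[symmetric] cinner_scaleC_left cinner_scaleC_right mult.left_commute)
  also have "\<dots> = (c * cnj c) * complex_of_real ((norm x)\<^sup>2)"
    by (simp only: cinner_self mult.assoc)
  also have "\<dots> = complex_of_real ((cmod c * norm x)\<^sup>2)"
    by (simp only: complex_norm_square[symmetric] power_mult_distrib of_real_mult of_real_power)
  finally have "(norm (c *\<^sub>C x))\<^sup>2 = (cmod c * norm x)\<^sup>2"
    by (simp only: of_real_eq_iff)
  then show ?thesis
    by (rule power2_eq_imp_eq) simp_all
qed

lemma bounded_linear_scaleC: "bounded_linear (\<lambda>x :: 'a::complex_inner. c *\<^sub>C x)"
proof (rule bounded_linear_intro)
  show "c *\<^sub>C (r *\<^sub>R x) = r *\<^sub>R (c *\<^sub>C x)" for r and x :: 'a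
    by (simp add: scaleR_scaleC scaleC_scaleC mult.commute)
  show "norm (c *\<^sub>C x) \<le> norm x * cmod c" for x :: 'a
    by (simp add: norm_scaleC mult.commute)
qed (rule scaleC_add_right)

section \<open>Bounded operators\<close>

instantiation blinfun :: (real_normed_vector, complex_inner) complex_vector
begin
lift_definition scaleC_blinfun :: "complex \<Rightarrow> 'a \<Rightarrow>\<^sub>L 'b \<Rightarrow> 'a \<Rightarrow>\<^sub>L 'b"
  is "\<lambda>c T x. c *\<^sub>C T x"
  by (rule bounded_linear_compose[OF bounded_linear_scaleC])
instance
  by standard
    (rule blinfun_eqI, simp add: scaleC_blinfun.rep_eq blinfun.add_left blinfun.scaleR_left
      scaleC_add_right scaleC_add_left scaleC_scaleC scaleC_one scaleR_scaleC)+
end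

text \<open>\<^typ>\<open>'h \<Rightarrow>\<^sub>L 'h\<close> consists of the bounded \<^emph>\<open>real\<close>-linear operators, so
  complex linearity is imposed here.\<close>

definition bounded_ops :: "('h::complex_inner \<Rightarrow>\<^sub>L 'h) set" where
  "bounded_ops = {T. \<forall>c x. blinfun_apply T (c *\<^sub>C x) = c *\<^sub>C blinfun_apply T x}"

definition is_adjoint :: "('h::complex_inner \<Rightarrow>\<^sub>L 'h) \<Rightarrow> ('h \<Rightarrow>\<^sub>L 'h) \<Rightarrow> bool" where
  "is_adjoint T S \<longleftrightarrow> (\<forall>x y. cinner (T x) y = cinner x (S y))"

definition adj :: "('h::complex_inner \<Rightarrow>\<^sub>L 'h) \<Rightarrow> ('h \<Rightarrow>\<^sub>L 'h)" where
  "adj T = (THE S. is_adjoint T S)"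

lemma riesz_representation_real:
  fixes f :: "'h::{real_inner, complete_space} \<Rightarrow> real"
  assumes "bounded_linear f"
  obtains z where "\<And>x. f x = inner x z"
proof -
  interpret f: bounded_linear f by fact
  obtain K where K: "\<And>x. \<bar>f x\<bar> \<le> norm x * K" using f.bounded by auto
  define p where "p = (\<lambda>x. inner x x - 2 * f x)"
  have low: "- (K\<^sup>2) \<le> p x" for x
  proof -
    have "f x \<le> norm x * K" using K[of x] by linarith
    moreover have "0 \<le> (norm x - K)\<^sup>2" by simp
    ultimately show ?thesis
      unfolding p_def by (simp add: power2_diff power2_norm_eq_inner)
  qed
  define m where "m = Inf (range p)"
  have bdd: "bdd_below (range p)" using low by (meson bdd_below.I2)
  have m_le: "m \<le> p x" for x
    unfolding m_def by (rule cInf_lower) (use bdd in auto)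
  have "\<exists>x. p x < m + inverse (real (Suc n))" for n
    using cInf_lessD[of "range p" "m + inverse (real (Suc n))"] unfolding m_def by auto
  then obtain X where X: "\<And>n. p (X n) < m + inverse (real (Suc n))" by metis
  have par: "inner (x - y) (x - y) \<le> 2 * (p x + p y - 2 * m)" for x y
  proof -
    have "2 * (p x + p y - 2 * p ((1/2) *\<^sub>R (x + y))) = inner (x - y) (x - y)"
      unfolding p_def
      by (simp add: f.scaleR f.add inner_simps inner_commute algebra_simps)
    moreover have "2 * (p x + p y - 2 * p ((1/2) *\<^sub>R (x + y))) \<le> 2 * (p x + p y - 2 * m)"
      using m_le[of "(1/2) *\<^sub>R (x + y)"] by simp
    ultimately show ?thesis by (rule ord_eq_le_trans[OF sym])
  qed
  have "Cauchy X"
  proof (rule metric_CauchyI)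
    fix e :: real assume "0 < e"
    then obtain N where N: "N > 0" "inverse (real N) < e\<^sup>2 / 4"
      using ex_inverse_of_nat_less[of "e\<^sup>2 / 4"] by auto
    have "dist (X a) (X b) < e" if "a \<ge> N" "b \<ge> N" for a b
    proof -
      have small: "p (X k) < m + e\<^sup>2 / 4" if "k \<ge> N" for k
      proof -
        have "inverse (real (Suc k)) \<le> inverse (real N)"
          using that N by (intro le_imp_inverse_le) auto
        with X[of k] N(2) show ?thesis by linarith
      qed
      from small[OF that(1)] small[OF that(2)] have "2 * (p (X a) + p (X b) - 2 * m) < e\<^sup>2"
        by argo
      with par[of "X a" "X b"] have "(norm (X a - X b))\<^sup>2 < e\<^sup>2"
        unfolding power2_norm_eq_inner by (rule order_le_less_trans)
      then show ?thesis
        unfolding dist_norm by (rule power2_less_imp_less) (use \<open>0 < e\<close> in simp)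
    qed
    then show "\<exists>M. \<forall>a\<ge>M. \<forall>b\<ge>M. dist (X a) (X b) < e" by blast
  qed
  then obtain z where z: "X \<longlonglongrightarrow> z" unfolding Cauchy_convergent_iff convergent_def by (elim exE)
  have lim: "(\<lambda>n. p (X n)) \<longlonglongrightarrow> p z"
    unfolding p_def by (intro tendsto_intros f.tendsto z)
  have "p z \<le> m"
  proof (rule LIMSEQ_le[OF lim])
    have "(\<lambda>n. m + inverse (real (Suc n))) \<longlonglongrightarrow> m + 0"
      by (intro tendsto_intros LIMSEQ_inverse_real_of_nat)
    then show "(\<lambda>n. m + inverse (real (Suc n))) \<longlonglongrightarrow> m" by simp
  qed (rule exI allI impI less_imp_le[OF X])+
  then have min: "p z \<le> p x" for x using m_le[of x] by linarith
  have "f h = inner h z" for h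
  proof (rule ccontr)
    define b where "b = f h - inner h z"
    define q where "q = inner h h"
    assume "f h \<noteq> inner h z"
    then have b: "b \<noteq> 0" by (simp add: b_def)
    have q: "q \<ge> 0" by (simp add: q_def)
    have "0 \<le> t * t * q - 2 * t * b" for t
      using min[of "z + t *\<^sub>R h"] unfolding p_def b_def q_def
      by (simp add: f.add f.scaleR inner_simps inner_commute algebra_simps)
    from this[of "b / (q + 1)"]
    have "0 \<le> (b * b / (q + 1)) * (q / (q + 1) - 2)"
      by (simp add: right_diff_distrib mult_ac)
    moreover have "b * b / (q + 1) > 0"
      using q b not_real_square_gt_zero[of b] by (intro divide_pos_pos) linarith+
    moreover have "q / (q + 1) - 2 < 0" using q by (simp add: field_simps)
    ultimately show False using mult_pos_neg not_le by blast
  qed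
  then show thesis by (rule that)
qed

lemma cinner_eq_allI:
  assumes "\<And>x. cinner x y = cinner x (z :: 'h::complex_inner)"
  shows "y = z"
proof -
  have "inner (y - z) y = inner (y - z) z"
    using assms by (simp add: inner_eq_Re_cinner)
  then show ?thesis using inner_diff_right[of "y - z" y z] by simp
qed

lemma is_adjoint_unique:
  assumes "is_adjoint T S" "is_adjoint T S'" shows "S = S'"
proof (rule blinfun_eqI, rule cinner_eq_allI)
  show "cinner x (S y) = cinner x (S' y)" for x y
    using assms unfolding is_adjoint_def by metis
qed

lemma is_adjoint_adj:
  fixes T :: "'h::complex_hilbert_space \<Rightarrow>\<^sub>L 'h"
  assumes T: "T \<in> bounded_ops"
  shows "is_adjoint T (adj T)"
proof -
  have "\<exists>z. \<forall>x. cinner (T x) y = cinner x z" for y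
  proof -
    have "bounded_linear (\<lambda>x. inner (T x) y)"
      by (intro bounded_linear_intros)
    then obtain z where z: "\<And>x. inner (T x) y = inner x z"
      using riesz_representation_real by blast
    have re: "Re (cinner (T x) y) = Re (cinner x z)" for x
      using z[of x] by (simp add: inner_eq_Re_cinner)
    have "Im (cinner (T x) y) = Im (cinner x z)" for x
      using re[of "\<i> *\<^sub>C x"] T by (simp add: bounded_ops_def cinner_scaleC_left)
    with re show ?thesis by (metis complex_eqI)
  qed
  then obtain s where s: "\<And>x y. cinner (T x) y = cinner x (s y)" by metis
  have "bounded_linear s"
  proof (rule bounded_linear_intro)
    show "s (x + y) = s x + s y" for x y
      by (rule cinner_eq_allI) (simp add: s[symmetric] cinner_add_right)
    show "s (r *\<^sub>R x) = r *\<^sub>R s x" for r x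
      by (rule cinner_eq_allI) (simp add: s[symmetric] cinner_scaleC_right scaleR_scaleC)
    show "norm (s y) \<le> norm y * norm T" for y
    proof (cases "s y = 0")
      case False
      have "norm (s y) * norm (s y) = inner (s y) (s y)"
        by (simp add: power2_norm_eq_inner flip: power2_eq_square)
      also have "\<dots> = inner (T (s y)) y" by (simp add: inner_eq_Re_cinner s)
      also have "\<dots> \<le> norm (T (s y)) * norm y" by (rule norm_cauchy_schwarz)
      also have "\<dots> \<le> (norm T * norm (s y)) * norm y"
        by (intro mult_right_mono norm_blinfun) auto
      also have "\<dots> = (norm y * norm T) * norm (s y)" by simp
      finally show ?thesis using False by simp
    qed simp
  qed
  then have S: "is_adjoint T (Blinfun s)"
    unfolding is_adjoint_def by (simp add: bounded_linear_Blinfun_apply s)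
  then show ?thesis
    unfolding adj_def by (rule theI) (rule is_adjoint_unique[OF _ S])
qed

definition positive_op :: "('h::complex_inner \<Rightarrow>\<^sub>L 'h) \<Rightarrow> bool" where
  "positive_op T \<longleftrightarrow> (\<forall>x. cinner (T x) x \<in> \<real>\<^sub>\<ge>\<^sub>0)"

definition op_le :: "('h::complex_inner \<Rightarrow>\<^sub>L 'h) \<Rightarrow> ('h \<Rightarrow>\<^sub>L 'h) \<Rightarrow> bool" where
  "op_le A B \<longleftrightarrow> positive_op (B - A)"

text \<open>The coarsest topology on the bounded operators that makes all the maps
  \<open>T \<mapsto> cinner (T x) y\<close> continuous: the topology on functions is the product topology.\<close>

definition weak_operator_topology :: "('h::complex_inner \<Rightarrow>\<^sub>L 'h) topology" where
  "weak_operator_topology =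
     pullback_topology bounded_ops (\<lambda>T (x, y). cinner (blinfun_apply T x) y) euclidean"

section \<open>Von Neumann algebras\<close>

definition von_neumann_algebra :: "('h::complex_hilbert_space \<Rightarrow>\<^sub>L 'h) set \<Rightarrow> bool" where
  "von_neumann_algebra M \<longleftrightarrow>
     M \<subseteq> bounded_ops \<and> id_blinfun \<in> M \<and>
     (\<forall>A\<in>M. \<forall>B\<in>M. A + B \<in> M) \<and>
     (\<forall>c. \<forall>A\<in>M. c *\<^sub>C A \<in> M) \<and>
     (\<forall>A\<in>M. \<forall>B\<in>M. A o\<^sub>L B \<in> M) \<and>
     (\<forall>A\<in>M. adj A \<in> M) \<and>
     closedin weak_operator_topology M"

definition projections :: "('h::complex_hilbert_space \<Rightarrow>\<^sub>L 'h) set \<Rightarrow> ('h \<Rightarrow>\<^sub>L 'h) set" where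
  "projections M = {E \<in> M. E o\<^sub>L E = E \<and> adj E = E}"

text \<open>Murray--von Neumann equivalence relative to the algebra.\<close>

definition mvn_equivalent ::
    "('h::complex_hilbert_space \<Rightarrow>\<^sub>L 'h) set \<Rightarrow> ('h \<Rightarrow>\<^sub>L 'h) \<Rightarrow> ('h \<Rightarrow>\<^sub>L 'h) \<Rightarrow> bool" where
  "mvn_equivalent M E F \<longleftrightarrow> (\<exists>V\<in>M. adj V o\<^sub>L V = E \<and> V o\<^sub>L adj V = F)"

definition finite_projection ::
    "('h::complex_hilbert_space \<Rightarrow>\<^sub>L 'h) set \<Rightarrow> ('h \<Rightarrow>\<^sub>L 'h) \<Rightarrow> bool" where
  "finite_projection M E \<longleftrightarrow>
     E \<in> projections M \<and>
     (\<forall>F\<in>projections M. op_le F E \<longrightarrow> mvn_equivalent M E F \<longrightarrow> F = E)"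

definition finite_von_neumann_algebra :: "('h::complex_hilbert_space \<Rightarrow>\<^sub>L 'h) set \<Rightarrow> bool" where
  "finite_von_neumann_algebra M \<longleftrightarrow> von_neumann_algebra M \<and> finite_projection M id_blinfun"

section \<open>States and automorphisms\<close>

text \<open>Functionals and automorphisms are total HOL functions of which only the restriction to
  the algebra matters.\<close>

definition state_on ::
    "('h::complex_hilbert_space \<Rightarrow>\<^sub>L 'h) set \<Rightarrow> (('h \<Rightarrow>\<^sub>L 'h) \<Rightarrow> complex) \<Rightarrow> bool" where
  "state_on M \<rho> \<longleftrightarrow>
     (\<forall>A\<in>M. \<forall>B\<in>M. \<rho> (A + B) = \<rho> A + \<rho> B) \<and>
     (\<forall>c. \<forall>A\<in>M. \<rho> (c *\<^sub>C A) = c * \<rho> A) \<and>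
     (\<forall>A\<in>M. positive_op A \<longrightarrow> \<rho> A \<in> \<real>\<^sub>\<ge>\<^sub>0) \<and>
     \<rho> id_blinfun = 1"

definition self_adjoint_part :: "('h::complex_hilbert_space \<Rightarrow>\<^sub>L 'h) set \<Rightarrow> ('h \<Rightarrow>\<^sub>L 'h) set" where
  "self_adjoint_part M = {A \<in> M. adj A = A}"

text \<open>Increasing nets of self-adjoint operators are represented by their ranges, that is, by
  nonempty upward directed sets.\<close>

definition directed_in ::
    "('h::complex_hilbert_space \<Rightarrow>\<^sub>L 'h) set \<Rightarrow> ('h \<Rightarrow>\<^sub>L 'h) set \<Rightarrow> bool" where
  "directed_in M D \<longleftrightarrow>
     D \<noteq> {} \<and> D \<subseteq> self_adjoint_part M \<and>
     (\<forall>A\<in>D. \<forall>B\<in>D. \<exists>C\<in>D. op_le A C \<and> op_le B C)"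

definition is_lub_in ::
    "('h::complex_hilbert_space \<Rightarrow>\<^sub>L 'h) set \<Rightarrow> ('h \<Rightarrow>\<^sub>L 'h) set \<Rightarrow> ('h \<Rightarrow>\<^sub>L 'h) \<Rightarrow> bool" where
  "is_lub_in M D H \<longleftrightarrow>
     H \<in> self_adjoint_part M \<and> (\<forall>A\<in>D. op_le A H) \<and>
     (\<forall>K\<in>self_adjoint_part M. (\<forall>A\<in>D. op_le A K) \<longrightarrow> op_le H K)"

text \<open>A state is real and increasing on self-adjoint operators, so its limit along an
  increasing net is the supremum of its values.\<close>

definition normal_state_on ::
    "('h::complex_hilbert_space \<Rightarrow>\<^sub>L 'h) set \<Rightarrow> (('h \<Rightarrow>\<^sub>L 'h) \<Rightarrow> complex) \<Rightarrow> bool" where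
  "normal_state_on M \<rho> \<longleftrightarrow>
     state_on M \<rho> \<and>
     (\<forall>D H. directed_in M D \<longrightarrow> is_lub_in M D H \<longrightarrow> Re (\<rho> H) = (SUP A\<in>D. Re (\<rho> A)))"

definition tracial_on ::
    "('h::complex_hilbert_space \<Rightarrow>\<^sub>L 'h) set \<Rightarrow> (('h \<Rightarrow>\<^sub>L 'h) \<Rightarrow> complex) \<Rightarrow> bool" where
  "tracial_on M \<tau> \<longleftrightarrow> (\<forall>A\<in>M. \<forall>B\<in>M. \<tau> (A o\<^sub>L B) = \<tau> (B o\<^sub>L A))"

definition faithful_on ::
    "('h::complex_hilbert_space \<Rightarrow>\<^sub>L 'h) set \<Rightarrow> (('h \<Rightarrow>\<^sub>L 'h) \<Rightarrow> complex) \<Rightarrow> bool" where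
  "faithful_on M \<tau> \<longleftrightarrow> (\<forall>A\<in>M. positive_op A \<longrightarrow> \<tau> A = 0 \<longrightarrow> A = 0)"

definition star_automorphism ::
    "('h::complex_hilbert_space \<Rightarrow>\<^sub>L 'h) set \<Rightarrow> (('h \<Rightarrow>\<^sub>L 'h) \<Rightarrow> ('h \<Rightarrow>\<^sub>L 'h)) \<Rightarrow> bool" where
  "star_automorphism M \<alpha> \<longleftrightarrow>
     bij_betw \<alpha> M M \<and>
     (\<forall>A\<in>M. \<forall>B\<in>M. \<alpha> (A + B) = \<alpha> A + \<alpha> B) \<and>
     (\<forall>c. \<forall>A\<in>M. \<alpha> (c *\<^sub>C A) = c *\<^sub>C \<alpha> A) \<and>
     (\<forall>A\<in>M. \<forall>B\<in>M. \<alpha> (A o\<^sub>L B) = \<alpha> A o\<^sub>L \<alpha> B) \<and>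
     (\<forall>A\<in>M. \<alpha> (adj A) = adj (\<alpha> A))"

section \<open>Moebius disjointness\<close>

definition moebius_mu :: "nat \<Rightarrow> int" where
  "moebius_mu n = (if squarefree n then (- 1) ^ card (prime_factors n) else 0)"

definition weakly_linearly_disjoint ::
    "(nat \<Rightarrow> int) \<Rightarrow> ('h::complex_hilbert_space \<Rightarrow>\<^sub>L 'h) set \<Rightarrow>
      (('h \<Rightarrow>\<^sub>L 'h) \<Rightarrow> ('h \<Rightarrow>\<^sub>L 'h)) \<Rightarrow> bool" where
  "weakly_linearly_disjoint f M \<alpha> \<longleftrightarrow>
     (\<forall>\<rho>. normal_state_on M \<rho> \<longrightarrow> (\<forall>A\<in>M.
        (\<lambda>N. (1 / of_nat N) * (\<Sum>n=1..N. of_int (f n) * \<rho> ((\<alpha> ^^ n) A))) \<longlonglongrightarrow> 0))"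

end

theory Submission
  imports Defs "HOL-Probability.Probability" "HOL-Complex_Analysis.Complex_Analysis"
    "HOL-Number_Theory.Number_Theory" "HOL-Real_Asymp.Real_Asymp"
begin

text \<open>
A trace-preserving automorphism \<open>\<alpha>\<close> is an isometry for the seminorm
\<open>A \<mapsto> sqrt (\<tau>(A* A))\<close>, so the question becomes one about orbits of isometries: the averages
\<open>T\<^sub>N = (1/N) (\<mu>(1) \<alpha>(A) + \<dots> + \<mu>(N) \<alpha>\<^sup>N(A))\<close> are to be shown to tend to \<open>0\<close> in
this seminorm, and this is then to be transferred to an arbitrary normal state \<open>\<rho>\<close>.

\<^bold>\<open>Orbits of isometries.\<close> Split a vector \<open>x\<close> as \<open>y + z\<close>, with \<open>y\<close> of nearly least norm in the convex hull
of the orbit of \<open>x\<close> under a power \<open>U\<^sup>K\<close> of the isometry. By the parallelogram law near-minimisers are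
close to each other, which makes \<open>y\<close> almost invariant under \<open>U\<^sup>K\<close>; the averages of its orbit
are then controlled by the averages of \<open>\<mu>\<close> over residue classes mod \<open>K\<close>. If \<open>K\<close> is chosen so that
passing to multiples of \<open>K\<close> hardly raises the least norm, the ergodic averages of \<open>z\<close> under every power
\<open>U\<^sup>k\<close> are small. Hence the vectors \<open>U\<^sup>p\<^sup>m z\<close> and \<open>U\<^sup>q\<^sup>m z\<close> are almost uncorrelated on average over \<open>m\<close> for
distinct primes \<open>p\<close>, \<open>q\<close>, and Katai's criterion disposes of \<open>z\<close>. This is a substitute for the
spectral theorem: \<open>y\<close> approximates the projection of \<open>x\<close> to the span of the eigenvectors whose eigenvalues are
roots of unity. The result is \<open>mavg_orbit_tendsto_0\<close>, with \<open>Katai_criterion\<close> as its main tool.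

\<^bold>\<open>Residue classes.\<close> That \<open>\<mu>\<close> has mean value \<open>0\<close> against every periodic sequence
(\<open>moebius_orthogonal_periodic\<close>) is a form of the prime number theorem in arithmetic progressions. Periodic
sequences are decomposed into Dirichlet characters \<open>\<psi>\<close>; the series with coefficients \<open>\<mu> \<psi>\<close> is \<open>1/L(s, \<psi>)\<close>,
which extends continuously to \<open>Re s \<ge> 1\<close> because \<open>L\<close> has no zero there
(\<open>L_nonzero_by_341\<close>, and \<open>L_one_real_nonzero\<close> for real characters at \<open>s = 1\<close>), and the
Tauberian theorem \<open>Tauberian_bounded\<close> applies.

\<^bold>\<open>Normal states.\<close> Since \<open>\<alpha>\<close> is contractive, the operators \<open>T\<^sub>N\<close> are bounded in norm. On norm-bounded sets of
positive elements a normal state is absolutely continuous with respect to a faithful one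
(\<open>normal_state_absolutely_continuous\<close>): from \<open>\<tau>(T\<^sub>N* T\<^sub>N) \<longlonglongrightarrow> 0\<close> it follows that \<open>\<rho>(T\<^sub>N* T\<^sub>N) \<longlonglongrightarrow> 0\<close>,
and the Cauchy--Schwarz inequality for \<open>\<rho>\<close> gives \<open>\<rho>(T\<^sub>N) \<longlonglongrightarrow> 0\<close>. Everything about
positive operators is derived from Neumann series and quadratic forms: square roots and the
functional calculus are replaced by the operator monotone map \<open>S \<mapsto> 1 - (1 + S)\<^sup>-\<^sup>1\<close>.
\<close>

section \<open>A Tauberian theorem for bounded coefficients\<close>

lemma
  fixes s :: complex and c :: real
  assumes "Re s > 0"
  shows integrable_exp_tail: "integrable lborel (\<lambda>u. indicator {c..} u *\<^sub>R exp (- (s * of_real u)))"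
    and integral_exp_tail:
      "(\<integral>u. indicator {c..} u *\<^sub>R exp (- (s * of_real u)) \<partial>lborel) = exp (- (s * of_real c)) / s"
proof -
  have s: "s \<noteq> 0" using assms by auto
  show int: "integrable lborel (\<lambda>u. indicator {c..} u *\<^sub>R exp (- (s * of_real u)))"
  proof (rule integrableI_bounded)
    have "(\<integral>\<^sup>+u. ennreal (norm (indicator {c..} u *\<^sub>R exp (- (s * of_real u)))) \<partial>lborel)
        = (\<integral>\<^sup>+u. ennreal (exp (- (Re s * u))) * indicator {c..} u \<partial>lborel)"
      by (intro nn_integral_cong) (auto simp: indicator_def)
    also have "\<dots> = ennreal (0 - (- exp (- (Re s * c)) / Re s))"
    proof (rule nn_integral_FTC_atLeast)
      show "((\<lambda>u. - exp (- (Re s * u)) / Re s) has_field_derivative exp (- (Re s * x))) (at x)" for x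
        using assms by (auto intro!: derivative_eq_intros)
      show "((\<lambda>u. - exp (- (Re s * u)) / Re s) \<longlongrightarrow> 0) at_top"
        using assms by real_asymp
    qed (auto intro!: borel_measurable_continuous_onI continuous_intros)
    finally show "(\<integral>\<^sup>+u. ennreal (norm (indicator {c..} u *\<^sub>R exp (- (s * of_real u)))) \<partial>lborel) < \<infinity>"
      by simp
  qed measurable
  have lim: "((\<lambda>b. (LINT u:{c..b}|lborel. exp (- (s * of_real u)))) \<longlongrightarrow>
        (LINT u:{c..}|lborel. exp (- (s * of_real u)))) at_top"
    using int by (intro tendsto_set_lebesgue_integral_at_top) (auto simp: set_integrable_def)
  have val: "(LINT u:{c..b}|lborel. exp (- (s * of_real u)))
      = exp (- (s * of_real c)) / s - exp (- (s * of_real b)) / s" if "b \<ge> c" for b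
  proof -
    have "((\<lambda>u. exp (- (s * of_real u))) has_integral
        (- exp (- (s * of_real b)) / s - (- exp (- (s * of_real c)) / s))) {c..b}"
      using that s
      by (intro fundamental_theorem_of_calculus)
         (auto intro!: derivative_eq_intros has_vector_derivative_real_field)
    moreover have "set_integrable lborel {c..b} (\<lambda>u. exp (- (s * of_real u)))"
      by (intro borel_integrable_atLeastAtMost' continuous_intros)
    ultimately show ?thesis
      by (simp add: set_borel_integral_eq_integral integral_unique)
  qed
  have "((\<lambda>b. (LINT u:{c..b}|lborel. exp (- (s * of_real u)))) \<longlongrightarrow> exp (- (s * of_real c)) / s - 0) at_top"
  proof (rule Lim_transform_eventually)
    have "((\<lambda>b. exp (- (s * of_real b)) / s) \<longlongrightarrow> 0) at_top"
    proof (rule tendsto_norm_zero_cancel)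
      show "((\<lambda>b. norm (exp (- (s * complex_of_real b)) / s)) \<longlongrightarrow> 0) at_top"
        using assms s by (simp add: norm_divide) real_asymp
    qed
    then show "((\<lambda>b. exp (- (s * of_real c)) / s - exp (- (s * of_real b)) / s) \<longlongrightarrow>
        exp (- (s * of_real c)) / s - 0) at_top"
      by (intro tendsto_diff tendsto_const)
    show "\<forall>\<^sub>F b in at_top. exp (- (s * of_real c)) / s - exp (- (s * of_real b)) / s =
        (LINT u:{c..b}|lborel. exp (- (s * of_real u)))"
      using eventually_ge_at_top[of c] by eventually_elim (simp add: val)
  qed
  from tendsto_unique[OF _ lim this]
  show "(\<integral>u. indicator {c..} u *\<^sub>R exp (- (s * of_real u)) \<partial>lborel) = exp (- (s * of_real c)) / s"
    by (simp add: set_lebesgue_integral_def)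
qed

text \<open>
Shifting the variable by \<open>\<pi>/y\<close> changes the sign of the exponential, so twice the integral is bounded by the
\<open>L\<^sup>1\<close> distance of \<open>g\<close> to its shift; compact support makes \<open>g\<close> uniformly continuous.
\<close>

lemma Riemann_Lebesgue_compact_support:
  fixes g :: "real \<Rightarrow> complex"
  assumes cont: "continuous_on UNIV g" and supp: "\<And>t. \<bar>t\<bar> \<ge> T \<Longrightarrow> g t = 0"
  shows "((\<lambda>y. \<integral>t. g t * iexp (y * t) \<partial>lborel) \<longlongrightarrow> 0) at_top"
proof (rule tendstoI)
  fix e :: real assume e: "e > 0"
  define T' where "T' = max T 0 + 1"
  have T': "T' > 0" "\<And>t. \<bar>t\<bar> \<ge> T' \<Longrightarrow> g t = 0" using supp by (auto simp: T'_def)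
  have "uniformly_continuous_on {-T'-1..T'+1} g"
    using cont by (intro compact_uniformly_continuous) (auto intro: continuous_on_subset)
  then obtain d where d: "d > 0"
    "\<And>x y. x \<in> {-T'-1..T'+1} \<Longrightarrow> y \<in> {-T'-1..T'+1} \<Longrightarrow> dist y x < d \<Longrightarrow> dist (g y) (g x) < e / (2 * T' + 2)"
    unfolding uniformly_continuous_on_def using e T' 
    by (metis add_pos_pos divide_pos_pos mult_pos_pos zero_less_numeral)
  have gint: "integrable lborel (\<lambda>t. g t * iexp (y * t))" for y
  proof -
    have "integrable lborel (\<lambda>t. indicator {-T'..T'} t *\<^sub>R (g t * iexp (y * t)))"
      by (rule borel_integrable_compact)
         (auto intro!: continuous_intros continuous_on_subset[OF cont])
    also have "(\<lambda>t. indicator {-T'..T'} t *\<^sub>R (g t * iexp (y * t))) = (\<lambda>t. g t * iexp (y * t))"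
      using T' by (auto simp: indicator_def fun_eq_iff)
    finally show ?thesis .
  qed
  have "norm (\<integral>t. g t * iexp (y * t) \<partial>lborel) < e" if y: "y > pi / d + pi" for y
  proof -
    have y1: "y > pi / d" "y > pi" using y d pi_gt_zero divide_pos_pos[OF pi_gt_zero d(1)] by linarith+
    have y0: "y > 0" using y1 pi_gt_zero by linarith
    have h: "pi / y < d" "pi / y < 1" using y1 y0 d
      by (auto simp: field_simps)
    define h where "h = pi / y"
    have hpos: "h > 0" using y0 by (simp add: h_def)
    define I where "I = (\<integral>t. g t * iexp (y * t) \<partial>lborel)"
    have "I = (\<integral>t. g (h + 1 * t) * iexp (y * (h + 1 * t)) \<partial>lborel)"
      unfolding I_def by (subst lborel_integral_real_affine[where c = 1 and t = h]) auto
    also have "\<dots> = (\<integral>t. - (g (t + h) * iexp (y * t)) \<partial>lborel)"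
    proof (rule Bochner_Integration.integral_cong)
      fix t
      have "y * (h + 1 * t) = y * t + pi" using y0 by (simp add: h_def field_simps)
      then have "iexp (y * (h + 1 * t)) = iexp (y * t) * exp (\<i> * of_real pi)"
        by (simp only: of_real_add distrib_left exp_add)
      then show "g (h + 1 * t) * iexp (y * (h + 1 * t)) = - (g (t + h) * iexp (y * t))"
        by (simp add: add.commute)
    qed simp
    finally have I2: "I = - (\<integral>t. g (t + h) * iexp (y * t) \<partial>lborel)" by simp
    have gint2: "integrable lborel (\<lambda>t. g (t + h) * iexp (y * t))"
    proof -
      have "integrable lborel (\<lambda>t. g (h + 1 * t) * iexp (y * (h + 1 * t)))"
        using gint[of y] by (subst lborel_integrable_real_affine_iff) auto
      then have "integrable lborel (\<lambda>t. iexp (- (y * h)) * (g (h + 1 * t) * iexp (y * (h + 1 * t))))"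
        by (rule integrable_mult_right)
      also have "(\<lambda>t. iexp (- (y * h)) * (g (h + 1 * t) * iexp (y * (h + 1 * t)))) = (\<lambda>t. g (t + h) * iexp (y * t))"
      proof
        fix t
        have "iexp (- (y * h)) * iexp (y * (h + 1 * t)) = iexp (y * t)"
          by (simp add: algebra_simps flip: exp_add)
        then show "iexp (- (y * h)) * (g (h + 1 * t) * iexp (y * (h + 1 * t))) = g (t + h) * iexp (y * t)"
          by (simp add: algebra_simps)
      qed
      finally show ?thesis .
    qed
    have "2 * I = (\<integral>t. g t * iexp (y * t) - g (t + h) * iexp (y * t) \<partial>lborel)"
      using I2 gint[of y] gint2 by (subst Bochner_Integration.integral_diff) (auto simp: I_def)
    also have "norm \<dots> \<le> (\<integral>t. indicator {-T'-1..T'+1} t *\<^sub>R (e / (2 * T' + 2)) \<partial>lborel)"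
    proof (rule Bochner_Integration.integral_norm_bound_integral)
      show "integrable lborel (\<lambda>t. g t * iexp (y * t) - g (t + h) * iexp (y * t))"
        using gint gint2 by simp
      fix t :: real
      have "norm (g t * iexp (y * t) - g (t + h) * iexp (y * t)) = norm (g t - g (t + h))"
        by (simp add: norm_mult flip: left_diff_distrib)
      also have "\<dots> \<le> indicator {-T'-1..T'+1} t *\<^sub>R (e / (2 * T' + 2))"
      proof (cases "t \<in> {-T'-1..T'}")
        case True
        then have "dist (g t) (g (t + h)) < e / (2 * T' + 2)"
          using h hpos by (intro d(2)) (auto simp: h_def dist_norm)
        with True show ?thesis by (simp add: dist_norm indicator_def)
      next
        case False
        then have "g t = 0" "g (t + h) = 0"
          using T' h hpos unfolding h_def[symmetric] by (auto intro!: T'(2))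
        then show ?thesis using e T' by (simp add: indicator_def)
      qed
      finally show "norm (g t * iexp (y * t) - g (t + h) * iexp (y * t)) \<le> indicator {-T'-1..T'+1} t *\<^sub>R (e / (2 * T' + 2))" .
    qed (auto intro!: integrable_real_indicator simp: emeasure_lborel_Icc_eq)
    also have "\<dots> = e" using T' by (simp add: field_simps)
    finally have "2 * norm I \<le> e" by (simp add: norm_mult)
    then show ?thesis using e by (simp add: I_def)
  qed
  then show "\<forall>\<^sub>F y in at_top. dist (\<integral>t. g t * iexp (y * t) \<partial>lborel) 0 < e"
    by (intro eventually_mono[OF eventually_gt_at_top[of "pi / d + pi"]]) simp
qed

text \<open>
The Fejer kernel \<open>(sin(v/2)/(v/2))\<^sup>2\<close> is the Fourier transform of the tent function. Its value at \<open>0\<close> is the limit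
there. It is nonnegative and integrable while its Fourier transform has compact support, so smoothing with it only
involves a bounded piece of the line \<open>Re s = 1\<close>.
\<close>

definition tent :: "real \<Rightarrow> real" where "tent t = max 0 (1 - \<bar>t\<bar>)"

definition fejer :: "real \<Rightarrow> real" where
  "fejer v = (if v = 0 then 1 else 2 * (1 - cos v) / v\<^sup>2)"

lemma tent_integral: "(\<integral>t. of_real (tent t) * iexp (v * t) \<partial>lborel) = of_real (fejer v)"
proof -
  let ?f = "\<lambda>t. complex_of_real (tent t) * iexp (v * t)"
  define I where "I = {-1..1::real}"
  have cont: "continuous_on A ?f" for A
    unfolding tent_def by (intro continuous_intros)
  have "(\<integral>t. ?f t \<partial>lborel) = (LINT t:I|lborel. ?f t)"
    unfolding set_lebesgue_integral_def I_def
    by (intro Bochner_Integration.integral_cong) (auto simp: indicator_def tent_def)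
  also have "\<dots> = integral I ?f"
    unfolding I_def by (intro set_borel_integral_eq_integral borel_integrable_atLeastAtMost' cont)
  also have "\<dots> = of_real (fejer v)"
  proof (cases "v = 0")
    case True
    have "(?f has_integral ((of_real 0 + (of_real 0)\<^sup>2 / 2) - (of_real (-1) + (of_real (-1))\<^sup>2 / 2))) {-1..0}"
    proof (rule fundamental_theorem_of_calculus)
      show "((\<lambda>t. complex_of_real t + (of_real t)\<^sup>2 / 2) has_vector_derivative ?f t) (at t within {-1..0})"
        if "t \<in> {-1..0}" for t
      proof -
        have "?f t = 1 + of_real t" using that True by (simp add: tent_def)
        moreover have "((\<lambda>t. complex_of_real t + (of_real t)\<^sup>2 / 2) has_vector_derivative 1 + of_real t) (at t within {-1..0})"
          by (rule has_vector_derivative_real_field) (auto intro!: derivative_eq_intros)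
        ultimately show ?thesis by simp
      qed
    qed simp
    moreover have "(?f has_integral ((of_real 1 - (of_real 1)\<^sup>2 / 2) - (of_real 0 - (of_real 0)\<^sup>2 / 2))) {0..1}"
    proof (rule fundamental_theorem_of_calculus)
      show "((\<lambda>t. complex_of_real t - (of_real t)\<^sup>2 / 2) has_vector_derivative ?f t) (at t within {0..1})"
        if "t \<in> {0..1}" for t
      proof -
        have "?f t = 1 - of_real t" using that True by (simp add: tent_def)
        moreover have "((\<lambda>t. complex_of_real t - (of_real t)\<^sup>2 / 2) has_vector_derivative 1 - of_real t) (at t within {0..1})"
          by (rule has_vector_derivative_real_field) (auto intro!: derivative_eq_intros)
        ultimately show ?thesis by simp
      qed
    qed simp
    ultimately have "(?f has_integral (((of_real 0 + (of_real 0)\<^sup>2 / 2) - (of_real (-1) + (of_real (-1))\<^sup>2 / 2)) +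
        ((of_real 1 - (of_real 1)\<^sup>2 / 2) - (of_real 0 - (of_real 0)\<^sup>2 / 2)))) {-1..1}"
      by (intro has_integral_combine[where c = 0]) auto
    then show ?thesis using True by (simp add: integral_unique I_def fejer_def)
  next
    case False
    let ?G = "\<lambda>t. (1 + of_real t) * exp (\<i> * of_real v * of_real t) / (\<i> * of_real v) + exp (\<i> * of_real v * of_real t) / (of_real v)\<^sup>2"
    let ?H = "\<lambda>t. (1 - of_real t) * exp (\<i> * of_real v * of_real t) / (\<i> * of_real v) - exp (\<i> * of_real v * of_real t) / (of_real v)\<^sup>2"
    have "(?f has_integral (?G 0 - ?G (-1))) {-1..0}"
    proof (rule fundamental_theorem_of_calculus)
      show "(?G has_vector_derivative ?f t) (at t within {-1..0})" if "t \<in> {-1..0}" for t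
      proof -
        have "?f t = (1 + of_real t) * exp (\<i> * of_real v * of_real t)"
          using that by (simp add: tent_def mult.assoc)
        moreover have "(?G has_vector_derivative (1 + of_real t) * exp (\<i> * of_real v * of_real t)) (at t within {-1..0})"
          by (rule has_vector_derivative_real_field, use False in \<open>auto intro!: derivative_eq_intros simp: field_simps power2_eq_square\<close>)
        ultimately show ?thesis by simp
      qed
    qed simp
    moreover have "(?f has_integral (?H 1 - ?H 0)) {0..1}"
    proof (rule fundamental_theorem_of_calculus)
      show "(?H has_vector_derivative ?f t) (at t within {0..1})" if "t \<in> {0..1}" for t
      proof -
        have "?f t = (1 - of_real t) * exp (\<i> * of_real v * of_real t)"
          using that by (simp add: tent_def mult.assoc)
        moreover have "(?H has_vector_derivative (1 - of_real t) * exp (\<i> * of_real v * of_real t)) (at t within {0..1})"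
          by (rule has_vector_derivative_real_field, use False in \<open>auto intro!: derivative_eq_intros simp: field_simps power2_eq_square\<close>)
        ultimately show ?thesis by simp
      qed
    qed simp
    ultimately have *: "(?f has_integral ((?G 0 - ?G (-1)) + (?H 1 - ?H 0))) {-1..1}"
      by (intro has_integral_combine[where c = 0]) auto
    have "exp (\<i> * of_real v) + exp (- (\<i> * of_real v)) = 2 * cos (of_real v)"
      by (simp add: cos_exp_eq)
    moreover have "(?G 0 - ?G (-1)) + (?H 1 - ?H 0) = (2 - (exp (\<i> * of_real v) + exp (- (\<i> * of_real v)))) / (of_real v)\<^sup>2"
      using False by (simp add: field_simps)
    ultimately have "(?G 0 - ?G (-1)) + (?H 1 - ?H 0) = of_real (fejer v)"
      using False by (simp add: fejer_def cos_of_real)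
    with * show ?thesis by (simp add: integral_unique I_def)
  qed
  finally show ?thesis .
qed

lemma fejer_nonneg: "fejer v \<ge> 0" by (simp add: fejer_def)

lemma fejer_le: "fejer v \<le> 8 * inverse (1 + v\<^sup>2)"
proof (cases "\<bar>v\<bar> \<le> 1")
  case True
  have "2 * (1 - cos v) \<le> v\<^sup>2"
  proof -
    have "cos v = 1 - 2 * (sin (v/2))\<^sup>2" using cos_double_sin[of "v/2"] by simp
    moreover have "(sin (v/2))\<^sup>2 \<le> (v/2)\<^sup>2"
      using abs_sin_x_le_abs_x[of "v/2"] by (simp only: abs_le_square_iff)
    ultimately show ?thesis by (simp add: power_divide)
  qed
  then have "fejer v \<le> 1" by (auto simp: fejer_def field_simps)
  moreover have "v\<^sup>2 \<le> 1" using True by (simp add: abs_square_le_1)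
  then have "1 \<le> 8 * inverse (1 + v\<^sup>2)" by (simp add: field_simps add_pos_nonneg)
  ultimately show ?thesis by linarith
next
  case False
  then have v: "v\<^sup>2 \<ge> 1" using abs_square_le_1[of v] by linarith
  have "2 * (1 - cos v) \<le> 4" using cos_ge_minus_one[of v] by argo
  then have "2 * (1 - cos v) / v\<^sup>2 \<le> 4 / v\<^sup>2" by (intro divide_right_mono) auto
  then have "fejer v \<le> 4 / v\<^sup>2" using False by (auto simp: fejer_def)
  also have "4 / v\<^sup>2 = 8 / (2 * v\<^sup>2)" by simp
  also have "\<dots> \<le> 8 / (1 + v\<^sup>2)" 
  proof -
    have "v\<^sup>2 > 0" "1 + v\<^sup>2 > 0" using v by linarith+
    then show ?thesis using v by (intro divide_left_mono mult_pos_pos) auto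
  qed
  also have "\<dots> = 8 * inverse (1 + v\<^sup>2)" by (simp add: field_simps)
  finally show ?thesis .
qed

lemma fejer_measurable [measurable]: "fejer \<in> borel_measurable borel"
  unfolding fejer_def by measurable

lemma fejer_integrable: "integrable lborel fejer"
proof (rule Bochner_Integration.integrable_bound)
  show "integrable lborel (\<lambda>v::real. 8 * inverse (1 + v\<^sup>2))"
    using integrable_inverse_1_plus_square
    by (intro integrable_mult_right) (auto simp: set_integrable_def)
  show "AE v in lborel. norm (fejer v) \<le> norm (8 * inverse (1 + v\<^sup>2))"
    using fejer_le fejer_nonneg by (intro AE_I2) (auto simp: abs_mult add_nonneg_nonneg)
qed simp

lemma fejer_mass_pos: "(\<integral>v. fejer v \<partial>lborel) > 0"
proof -
  have "(\<integral>v. fejer v \<partial>lborel) \<noteq> 0"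
  proof
    have imp: "v \<notin> {0<..<1}" if "fejer v = 0" for v
    proof
      assume v: "v \<in> {0<..<1}"
      then have "cos v < cos 0" using pi_gt3 by (intro cos_monotone_0_pi) auto
      with v that show False by (auto simp: fejer_def)
    qed
    assume "(\<integral>v. fejer v \<partial>lborel) = 0"
    then have "AE v in lborel. fejer v = 0"
      using integral_nonneg_eq_0_iff_AE[OF fejer_integrable] fejer_nonneg by simp
    then have "AE v in lborel. v \<notin> {0<..<1::real}"
    proof (rule AE_mp)
      show "AE v in lborel. fejer v = 0 \<longrightarrow> v \<notin> {0<..<1::real}"
        using imp by (intro AE_I2) blast
    qed
    then have "emeasure lborel {0<..<1::real} = 0"
      by (subst (asm) AE_iff_measurable[where N = "{0<..<1}"]) auto
    then show False by simp
  qed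
  moreover have "(\<integral>v. fejer v \<partial>lborel) \<ge> 0" by (simp add: fejer_nonneg)
  ultimately show ?thesis by linarith
qed

lemma tent_measurable [measurable]: "tent \<in> borel_measurable borel"
  unfolding tent_def by measurable

lemma tent_nonneg: "tent t \<ge> 0" by (simp add: tent_def)

lemma tent_eq_0: "\<bar>t\<bar> \<ge> 1 \<Longrightarrow> tent t = 0" by (simp add: tent_def)

lemma tent_integrable: "integrable lborel (\<lambda>t. tent (t / T))" if T: "T > 0"
proof -
  have "integrable lborel (\<lambda>t. indicator {-T..T} t *\<^sub>R tent (t / T))"
    unfolding tent_def using T by (intro borel_integrable_compact) (auto intro!: continuous_intros)
  also have "(\<lambda>t. indicator {-T..T} t *\<^sub>R tent (t / T)) = (\<lambda>t. tent (t / T))"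
  proof
    fix t :: real
    show "indicator {-T..T} t *\<^sub>R tent (t / T) = tent (t / T)"
    proof (cases "\<bar>t\<bar> \<le> T")
      case False
      then have "tent (t / T) = 0" using T by (intro tent_eq_0) (auto simp: field_simps)
      then show ?thesis by simp
    qed (auto simp: indicator_def)
  qed
  finally show ?thesis .
qed

lemma tent_integral_scaled:
  assumes T: "T > 0"
  shows "(\<integral>t. of_real (tent (t / T)) * iexp (v * t) \<partial>lborel) = of_real (T * fejer (T * v))"
proof -
  have "(\<integral>t. of_real (tent (t / T)) * iexp (v * t) \<partial>lborel)
      = T *\<^sub>R (\<integral>t. of_real (tent t) * iexp (T * v * t) \<partial>lborel)"
    using T by (subst lborel_integral_real_affine[where c = T and t = 0]) (auto simp: mult_ac)
  also have "(\<integral>t. of_real (tent t) * iexp (T * v * t) \<partial>lborel) = of_real (fejer (T * v))"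
    by (rule tent_integral)
  finally show ?thesis by (simp add: scaleR_conv_of_real)
qed

text \<open>
Fubini: the integral of the Fourier transform of \<open>g\<close> against a tent is \<open>g\<close> convolved with the Fejer kernel.
\<close>

lemma Fourier_fejer:
  fixes g :: "real \<Rightarrow> complex"
  assumes g: "integrable lborel g" and T: "T > 0"
  shows "(\<integral>t. of_real (tent (t / T)) * iexp (y * t) * (\<integral>u. g u * iexp (- (t * u)) \<partial>lborel) \<partial>lborel)
    = (\<integral>u. g u * of_real (T * fejer (T * (y - u))) \<partial>lborel)"
proof -
  have [measurable]: "g \<in> borel_measurable borel" using g by auto
  define f where "f t u = of_real (tent (t / T)) * g u * iexp ((y - u) * t)" for t u
  have int: "integrable (lborel \<Otimes>\<^sub>M lborel) (case_prod f)"
  proof (rule lborel_pair.Fubini_integrable)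
    show "case_prod f \<in> borel_measurable (lborel \<Otimes>\<^sub>M lborel)"
      unfolding f_def by measurable
    have nf: "norm (f t u) = tent (t / T) * norm (g u)" for t u
      by (simp add: f_def norm_mult tent_nonneg)
    show "integrable lborel (\<lambda>t. \<integral>u. norm (case_prod f (t, u)) \<partial>lborel)"
      using tent_integrable[OF T] by (simp add: nf)
    have "integrable lborel (\<lambda>u. f t u)" for t
    proof (rule Bochner_Integration.integrable_bound)
      show "integrable lborel (\<lambda>u. tent (t / T) * norm (g u))" using g by simp
      show "(\<lambda>u. f t u) \<in> borel_measurable lborel" unfolding f_def by measurable
    qed (simp add: nf tent_nonneg)
    then show "AE t in lborel. integrable lborel (\<lambda>u. case_prod f (t, u))" by simp
  qed
  have "(\<integral>t. of_real (tent (t / T)) * iexp (y * t) * (\<integral>u. g u * iexp (- (t * u)) \<partial>lborel) \<partial>lborel)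
      = (\<integral>t. (\<integral>u. f t u \<partial>lborel) \<partial>lborel)"
  proof (rule Bochner_Integration.integral_cong)
    fix t
    have "f t u = of_real (tent (t / T)) * iexp (y * t) * (g u * iexp (- (t * u)))" for u
    proof -
      have "(y - u) * t = y * t + - (t * u)" by (simp add: algebra_simps)
      then have "iexp ((y - u) * t) = iexp (y * t) * iexp (- (t * u))"
        by (simp only: of_real_add distrib_left exp_add)
      then show ?thesis by (simp add: f_def)
    qed
    then show "of_real (tent (t / T)) * iexp (y * t) * (\<integral>u. g u * iexp (- (t * u)) \<partial>lborel) = (\<integral>u. f t u \<partial>lborel)"
      by simp
  qed simp
  also have "\<dots> = (\<integral>u. (\<integral>t. f t u \<partial>lborel) \<partial>lborel)"
    using lborel_pair.Fubini_integral[OF int] by simp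
  also have "\<dots> = (\<integral>u. g u * of_real (T * fejer (T * (y - u))) \<partial>lborel)"
  proof (rule Bochner_Integration.integral_cong)
    fix u
    have "(\<integral>t. f t u \<partial>lborel) = (\<integral>t. g u * (of_real (tent (t / T)) * iexp ((y - u) * t)) \<partial>lborel)"
      by (rule Bochner_Integration.integral_cong) (simp_all add: f_def mult_ac)
    also have "\<dots> = g u * (\<integral>t. of_real (tent (t / T)) * iexp ((y - u) * t) \<partial>lborel)"
      by simp
    finally show "(\<integral>t. f t u \<partial>lborel) = g u * of_real (T * fejer (T * (y - u)))"
      using tent_integral_scaled[OF T, of "y - u"] by simp
  qed simp
  finally show ?thesis .
qed

text \<open>
Partial sums in the logarithmic variable: with \<open>n \<le> exp u\<close> a Dirichlet series becomes a Laplace transform.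
\<close>

definition psum :: "(nat \<Rightarrow> complex) \<Rightarrow> real \<Rightarrow> complex" where
  "psum a u = (\<Sum>n=1..nat \<lfloor>exp u\<rfloor>. a n)"

lemma psum_measurable [measurable]: "psum a \<in> borel_measurable borel"
  unfolding psum_def by measurable

lemma
  fixes a :: "nat \<Rightarrow> complex"
  assumes bound: "\<And>n. norm (a n) \<le> 1" and s: "Re s > 1"
    and P: "(\<lambda>n. a (Suc n) / of_nat (Suc n) powr s) sums S"
  shows Laplace_psum_integrable: "integrable lborel (\<lambda>u. psum a u * exp (- (s * of_real u)))"
    and Laplace_psum: "(\<integral>u. psum a u * exp (- (s * of_real u)) \<partial>lborel) = S / s"
proof -
  define f where "f n u = a (Suc n) * (indicator {ln (real (Suc n))..} u *\<^sub>R exp (- (s * of_real u)))" for n u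
  have s0: "s \<noteq> 0" "Re s > 0" using s by auto
  have fin: "integrable lborel (f n)" for n
    unfolding f_def by (intro integrable_mult_right integrable_exp_tail s0)
  have iff: "ln (real (Suc n)) \<le> u \<longleftrightarrow> n < nat \<lfloor>exp u\<rfloor>" for n u
  proof -
    have "ln (real (Suc n)) \<le> u \<longleftrightarrow> real (Suc n) \<le> exp u"
      by (metis exp_le_cancel_iff exp_ln of_nat_0_less_iff zero_less_Suc)
    also have "\<dots> \<longleftrightarrow> int (Suc n) \<le> \<lfloor>exp u\<rfloor>" by (simp add: le_floor_iff)
    also have "\<dots> \<longleftrightarrow> n < nat \<lfloor>exp u\<rfloor>" by linarith
    finally show ?thesis .
  qed
  have fsum: "(\<lambda>n. f n u) sums (psum a u * exp (- (s * of_real u)))" for u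
  proof -
    have "(\<lambda>n. f n u) sums (\<Sum>n<nat \<lfloor>exp u\<rfloor>. f n u)"
      by (rule sums_finite) (auto simp: f_def indicator_def iff simp del: of_nat_Suc)
    also have "(\<Sum>n<nat \<lfloor>exp u\<rfloor>. f n u) = (\<Sum>n<nat \<lfloor>exp u\<rfloor>. a (Suc n) * exp (- (s * of_real u)))"
      by (intro sum.cong) (auto simp: f_def indicator_def iff simp del: of_nat_Suc)
    also have "\<dots> = psum a u * exp (- (s * of_real u))"
      unfolding psum_def sum_distrib_right by (rule sum.reindex_bij_witness[of _ "\<lambda>n. n - 1" Suc]) auto
    finally show ?thesis .
  qed
  have nsummable: "summable (\<lambda>n. norm (f n u))" for u
    by (rule summable_finite[of "{..<nat \<lfloor>exp u\<rfloor>}"]) (auto simp: f_def indicator_def iff simp del: of_nat_Suc)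
  have int_norm: "(\<integral>u. norm (f n u) \<partial>lborel) \<le> real (Suc n) powr (- Re s) / Re s" for n
  proof -
    have e: "exp (- (complex_of_real (Re s) * of_real u)) = of_real (exp (- (Re s * u)))" for u
      by (simp flip: exp_of_real)
    have "(\<integral>u. norm (f n u) \<partial>lborel) =
        norm (a (Suc n)) * (\<integral>u. Re (indicator {ln (real (Suc n))..} u *\<^sub>R exp (- (of_real (Re s) * of_real u))) \<partial>lborel)"
      by (subst integral_mult_right_zero[symmetric], intro Bochner_Integration.integral_cong)
         (auto simp: f_def norm_mult indicator_def e)
    also have "(\<integral>u. Re (indicator {ln (real (Suc n))..} u *\<^sub>R exp (- (of_real (Re s) * of_real u))) \<partial>lborel)
       = Re (exp (- (of_real (Re s) * of_real (ln (real (Suc n))))) / of_real (Re s))"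
      using s0 integrable_exp_tail[of "of_real (Re s)"] integral_exp_tail[of "of_real (Re s)"]
      by (subst integral_Re) auto
    also have "exp (- (of_real (Re s) * of_real (ln (real (Suc n))))) = complex_of_real (real (Suc n) powr (- Re s))"
      by (simp add: powr_def flip: of_real_mult of_real_minus exp_of_real)
    finally have "(\<integral>u. norm (f n u) \<partial>lborel) = norm (a (Suc n)) * (real (Suc n) powr (- Re s) / Re s)"
      by (simp flip: of_real_divide)
    also have "\<dots> \<le> 1 * (real (Suc n) powr (- Re s) / Re s)"
      using s0 bound by (intro mult_right_mono) auto
    finally show ?thesis by simp
  qed
  have summ: "summable (\<lambda>n. \<integral>u. norm (f n u) \<partial>lborel)"
  proof (rule summable_comparison_test)
    have "summable (\<lambda>n. real n powr (- Re s))" using s by (simp add: summable_real_powr_iff)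
    then have "summable (\<lambda>n. real (Suc n) powr (- Re s))" by (subst summable_Suc_iff)
    then show "summable (\<lambda>n. real (Suc n) powr (- Re s) / Re s)" by (rule summable_divide)
    show "\<exists>N. \<forall>n\<ge>N. norm (\<integral>u. norm (f n u) \<partial>lborel) \<le> real (Suc n) powr (- Re s) / Re s"
      using int_norm by simp
  qed
  have eq: "(\<lambda>u. \<Sum>n. f n u) = (\<lambda>u. psum a u * exp (- (s * of_real u)))"
    using fsum by (auto simp: sums_iff)
  show "integrable lborel (\<lambda>u. psum a u * exp (- (s * of_real u)))"
    using integrable_suminf[where M = lborel and f = f, OF fin AE_I2[OF nsummable] summ] by (simp add: eq)
  have "(\<lambda>n. integral\<^sup>L lborel (f n)) sums (\<integral>u. psum a u * exp (- (s * of_real u)) \<partial>lborel)"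
    using sums_integral[where M = lborel and f = f, OF fin AE_I2[OF nsummable] summ] by (simp add: eq)
  moreover have "(\<lambda>n. integral\<^sup>L lborel (f n)) = (\<lambda>n. a (Suc n) / of_nat (Suc n) powr s / s)"
  proof
    fix n
    have "integral\<^sup>L lborel (f n) = a (Suc n) * (exp (- (s * of_real (ln (real (Suc n))))) / s)"
      unfolding f_def by (subst integral_mult_right_zero) (simp only: integral_exp_tail[OF s0(2)])
    also have "exp (- (s * of_real (ln (real (Suc n))))) = 1 / of_nat (Suc n) powr s"
    proof -
      have "Ln (of_nat (Suc n)) = of_real (ln (real (Suc n)))"
        by (metis Ln_of_real of_nat_0_less_iff of_real_of_nat_eq zero_less_Suc)
      then have "of_nat (Suc n) powr s = exp (s * of_real (ln (real (Suc n))))"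
        unfolding powr_def by (simp del: of_nat_Suc)
      then show ?thesis by (simp add: exp_minus field_simps del: of_nat_Suc)
    qed
    finally show "integral\<^sup>L lborel (f n) = a (Suc n) / of_nat (Suc n) powr s / s" by simp
  qed
  ultimately have "(\<lambda>n. a (Suc n) / of_nat (Suc n) powr s / s) sums (\<integral>u. psum a u * exp (- (s * of_real u)) \<partial>lborel)"
    by simp
  moreover have "(\<lambda>n. a (Suc n) / of_nat (Suc n) powr s / s) sums (S / s)"
    by (rule sums_divide[OF P])
  ultimately show "(\<integral>u. psum a u * exp (- (s * of_real u)) \<partial>lborel) = S / s"
    by (rule sums_unique2)
qed

lemma norm_psum_le:
  assumes "\<And>n. norm (a n) \<le> 1"
  shows "norm (psum a u) \<le> exp u"
proof -
  have "norm (psum a u) \<le> (\<Sum>n=1..nat \<lfloor>exp u\<rfloor>. 1)"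
    unfolding psum_def by (intro sum_norm_le) (use assms in auto)
  also have "\<dots> \<le> exp u" by simp
  finally show ?thesis .
qed

lemma norm_psum_diff_le:
  assumes a: "\<And>n. norm (a n) \<le> 1"
  shows "norm (psum a u - psum a v) \<le> \<bar>exp u - exp v\<bar> + 1"
proof -
  have *: "norm (psum a u - psum a v) \<le> exp u - exp v + 1" if "v \<le> u" for u v
  proof -
    have le: "nat \<lfloor>exp v\<rfloor> \<le> nat \<lfloor>exp u\<rfloor>" using that by (intro nat_mono floor_mono) simp
    have "psum a u - psum a v = (\<Sum>n\<in>{1..nat \<lfloor>exp u\<rfloor>} - {1..nat \<lfloor>exp v\<rfloor>}. a n)"
      unfolding psum_def using le by (subst sum_diff) auto
    also have "norm \<dots> \<le> (\<Sum>n\<in>{1..nat \<lfloor>exp u\<rfloor>} - {1..nat \<lfloor>exp v\<rfloor>}. 1)"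
      by (intro sum_norm_le) (use a in auto)
    also have "\<dots> = real (nat \<lfloor>exp u\<rfloor>) - real (nat \<lfloor>exp v\<rfloor>)"
      using le by (simp add: card_Diff_subset of_nat_diff)
    also have "\<dots> = of_int \<lfloor>exp u\<rfloor> - of_int \<lfloor>exp v\<rfloor>" by simp
    also have "\<dots> \<le> exp u - exp v + 1" by linarith
    finally show ?thesis .
  qed
  show ?thesis
    using *[of v u] *[of u v] by (cases "v \<le> u") (auto simp: norm_minus_commute)
qed

text \<open>
The normalised partial sums change little under a shift by a small \<open>h\<close>, because the coefficients are bounded. The
summand \<open>exp (- y)\<close> pays for rounding; the minimum with \<open>2\<close> keeps the bound integrable against
the Fejer kernel.
\<close>

lemma psum_slowly_varying:
  assumes a: "\<And>n. norm (a n) \<le> 1"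
  shows "norm (psum a y * exp (- of_real y) - psum a (y + h) * exp (- of_real (y + h)))
    \<le> min 2 (2 * \<bar>exp h - 1\<bar>) + exp (- y)"
proof -
  let ?\<phi> = "\<lambda>u. psum a u * exp (- of_real u)"
  have le1: "norm (?\<phi> u) \<le> 1" for u
    using norm_psum_le[of a u, OF a] by (simp add: norm_mult norm_divide exp_minus field_simps)
  have "norm (?\<phi> y - ?\<phi> (y + h)) \<le> 1 + 1"
    by (rule order_trans[OF norm_triangle_ineq4 add_mono[OF le1 le1]])
  then have A: "norm (?\<phi> y - ?\<phi> (y + h)) \<le> 2" by simp
  have e: "exp (- of_real y) = of_real (exp (- y))" for y :: real
    by (simp flip: exp_of_real)
  have "?\<phi> y - ?\<phi> (y + h) = (psum a y - psum a (y + h)) * of_real (exp (- y))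
      + psum a (y + h) * of_real (exp (- y) - exp (- (y + h)))"
    unfolding e by (simp add: algebra_simps)
  also have "norm \<dots> \<le> (\<bar>exp y - exp (y + h)\<bar> + 1) * exp (- y) + exp (y + h) * \<bar>exp (- y) - exp (- (y + h))\<bar>"
    by (rule order_trans[OF norm_triangle_ineq], unfold norm_mult norm_of_real,
        intro add_mono mult_mono norm_psum_diff_le norm_psum_le a) auto
  also have "\<dots> = 2 * \<bar>exp h - 1\<bar> + exp (- y)"
  proof -
    have "\<bar>exp y - exp (y + h)\<bar> * exp (- y) = \<bar>(exp y - exp (y + h)) * exp (- y)\<bar>"
      by (simp add: abs_mult)
    also have "(exp y - exp (y + h)) * exp (- y) = 1 - exp h"
      by (simp add: left_diff_distrib flip: exp_add)
    finally have 1: "\<bar>exp y - exp (y + h)\<bar> * exp (- y) = \<bar>exp h - 1\<bar>" by simp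
    have "exp (y + h) * \<bar>exp (- y) - exp (- (y + h))\<bar> = \<bar>exp (y + h) * (exp (- y) - exp (- (y + h)))\<bar>"
      by (simp add: abs_mult)
    also have "exp (y + h) * (exp (- y) - exp (- (y + h))) = exp h - 1"
      by (simp add: right_diff_distrib flip: exp_add)
    finally show ?thesis using 1 by (simp add: distrib_right)
  qed
  finally show ?thesis using A exp_ge_zero[of "-y"] by linarith
qed

text \<open>
Let \<open>\<phi> y\<close> be the normalised partial sum up to \<open>exp y\<close>. Its Laplace transform is \<open>P(s)/s\<close>. Smoothing \<open>\<phi>\<close>
around \<open>y\<close> with a Fejer kernel of width \<open>1/T\<close> gives an integral of \<open>P(s)/s\<close> over a segment of the line
\<open>Re s = 1\<close> against \<open>exp(i t y)\<close>, and this tends to \<open>0\<close> by the Riemann--Lebesgue lemma. As \<open>\<phi>\<close> varies slowly,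
the smoothed value is close to a fixed multiple of \<open>\<phi> y\<close> when \<open>T\<close> is large.
\<close>

theorem Tauberian_bounded:
  fixes a :: "nat \<Rightarrow> complex" and P :: "complex \<Rightarrow> complex"
  assumes a: "\<And>n. norm (a n) \<le> 1"
    and cont: "continuous_on {s. Re s \<ge> 1} P"
    and P: "\<And>s. Re s > 1 \<Longrightarrow> (\<lambda>n. a (Suc n) / of_nat (Suc n) powr s) sums P s"
  shows "(\<lambda>N. (\<Sum>n=1..N. a n) / of_nat N) \<longlonglongrightarrow> 0"
proof -
  define \<phi> where "\<phi> u = psum a u * exp (- of_real u)" for u
  have [measurable]: "\<phi> \<in> borel_measurable borel" unfolding \<phi>_def by measurable
  have le1: "norm (\<phi> u) \<le> 1" for u
    using norm_psum_le[of a u, OF a] by (simp add: \<phi>_def norm_mult norm_divide exp_minus field_simps)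
  define Q where "Q s = P s / s" for s
  have Qcont: "continuous_on {s. Re s \<ge> 1} Q"
    unfolding Q_def by (intro continuous_intros cont) auto
  define J where "J T y = (\<integral>u. \<phi> u * of_real (T * fejer (T * (y - u))) \<partial>lborel)" for T y
  have fj: "integrable lborel (\<lambda>u. T * fejer (T * (y - u)))" if T: "T > 0" for T y
  proof -
    have "integrable lborel (\<lambda>u. fejer (T * y + (- T) * u))"
      using T fejer_integrable by (subst lborel_integrable_real_affine_iff) auto
    then show ?thesis by (simp add: algebra_simps)
  qed
  \<comment> \<open>The identity holds to the right of the line by absolute convergence; letting the abscissa decrease to 1 uses continuity up to the boundary on a compact piece of the line.\<close>
  have J: "J T y = (\<integral>t. of_real (tent (t / T)) * iexp (y * t) * Q (1 + \<i> * of_real t) \<partial>lborel)"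
    if T: "T > 0" for T y
  proof -
    define \<epsilon> where "\<epsilon> k = 1 / real (Suc k)" for k
    have \<epsilon>: "\<epsilon> k > 0" "\<epsilon> k \<le> 1" for k by (auto simp: \<epsilon>_def)
    have \<epsilon>lim: "\<epsilon> \<longlonglongrightarrow> 0" unfolding \<epsilon>_def by real_asymp
    define g where "g k u = psum a u * exp (- (of_real (1 + \<epsilon> k) * of_real u))" for k u
    have [measurable]: "g k \<in> borel_measurable borel" for k unfolding g_def by measurable
    have g\<phi>: "g k u = \<phi> u * of_real (exp (- (\<epsilon> k * u)))" for k u
    proof -
      have "- (complex_of_real (1 + \<epsilon> k) * of_real u) = - of_real u + of_real (- (\<epsilon> k * u))"
        by (simp add: algebra_simps)
      then show ?thesis unfolding g_def \<phi>_def by (simp only: exp_add exp_of_real mult.assoc)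
    qed
    have gint: "integrable lborel (g k)" for k
      unfolding g_def using Laplace_psum_integrable[of a, OF a _ P, of "of_real (1 + \<epsilon> k)"] \<epsilon>[of k] by simp
    have gL: "(\<integral>u. g k u * iexp (- (t * u)) \<partial>lborel) = Q (of_real (1 + \<epsilon> k) + \<i> * of_real t)" for k t
    proof -
      have "g k u * iexp (- (t * u)) = psum a u * exp (- ((of_real (1 + \<epsilon> k) + \<i> * of_real t) * of_real u))" for u
        unfolding g_def by (simp add: algebra_simps flip: exp_add)
      then show ?thesis
        using Laplace_psum[of a, OF a _ P, of "of_real (1 + \<epsilon> k) + \<i> * of_real t"] \<epsilon>[of k] by (simp add: Q_def)
    qed
    have eq: "(\<integral>t. of_real (tent (t / T)) * iexp (y * t) * Q (of_real (1 + \<epsilon> k) + \<i> * of_real t) \<partial>lborel)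
      = (\<integral>u. g k u * of_real (T * fejer (T * (y - u))) \<partial>lborel)" for k
      using Fourier_fejer[OF gint[of k] T, of y] by (simp only: gL)
    have Qc: "continuous_on UNIV (\<lambda>t. Q (of_real (1 + e) + \<i> * of_real t))" if "e \<ge> 0" for e
      by (rule continuous_on_compose2[OF Qcont]) (use that in \<open>auto intro!: continuous_intros\<close>)
    have Qm: "(\<lambda>t. Q (of_real (1 + e) + \<i> * of_real t)) \<in> borel_measurable borel" if "e \<ge> 0" for e
      using Qc[OF that] by (rule borel_measurable_continuous_onI)
    define K where "K = (\<lambda>p. complex_of_real (1 + fst p) + \<i> * of_real (snd p)) ` ({0..1} \<times> {-T..T})"
    have "continuous_on ({0..1} \<times> {-T..T}) (\<lambda>p. complex_of_real (1 + fst p) + \<i> * of_real (snd p))"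
      by (intro continuous_intros)
    then have "compact K" unfolding K_def by (rule compact_continuous_image) (intro compact_Times compact_Icc)
    moreover have "continuous_on K Q"
      by (rule continuous_on_subset[OF Qcont]) (auto simp: K_def)
    ultimately have "bounded (Q ` K)" by (intro compact_imp_bounded compact_continuous_image)
    then obtain B where B': "\<And>z. z \<in> K \<Longrightarrow> norm (Q z) \<le> B" unfolding bounded_iff by blast
    have B: "norm (Q (of_real (1 + e) + \<i> * of_real t)) \<le> B" if "e \<in> {0..1}" "t \<in> {-T..T}" for e t
      using that by (intro B') (force simp: K_def)
    have lim1: "(\<lambda>k. \<integral>t. of_real (tent (t / T)) * iexp (y * t) * Q (of_real (1 + \<epsilon> k) + \<i> * of_real t) \<partial>lborel)
        \<longlonglongrightarrow> (\<integral>t. of_real (tent (t / T)) * iexp (y * t) * Q (1 + \<i> * of_real t) \<partial>lborel)"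
    proof (rule integral_dominated_convergence[where w = "\<lambda>t. tent (t / T) * B"])
      show "integrable lborel (\<lambda>t. tent (t / T) * B)" using tent_integrable[OF T] by simp
      show "(\<lambda>t. of_real (tent (t / T)) * iexp (y * t) * Q (1 + \<i> * of_real t)) \<in> borel_measurable lborel"
        using Qm[of 0] by simp
      show "(\<lambda>t. of_real (tent (t / T)) * iexp (y * t) * Q (of_real (1 + \<epsilon> k) + \<i> * of_real t)) \<in> borel_measurable lborel" for k
        using Qm[of "\<epsilon> k"] \<epsilon>[of k] by simp
      show "AE t in lborel. (\<lambda>k. of_real (tent (t / T)) * iexp (y * t) * Q (of_real (1 + \<epsilon> k) + \<i> * of_real t))
          \<longlonglongrightarrow> of_real (tent (t / T)) * iexp (y * t) * Q (1 + \<i> * of_real t)"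
      proof (rule AE_I2)
        fix t
        have l: "(\<lambda>k. of_real (1 + \<epsilon> k) + \<i> * of_real t) \<longlonglongrightarrow> of_real (1 + 0) + \<i> * of_real t"
          by (intro tendsto_intros \<epsilon>lim)
        have "(\<lambda>k. Q (of_real (1 + \<epsilon> k) + \<i> * of_real t)) \<longlonglongrightarrow> Q (of_real (1 + 0) + \<i> * of_real t)"
          by (rule continuous_on_tendsto_compose[OF Qcont l]) (use \<epsilon> in \<open>auto simp: less_imp_le\<close>)
        then show "(\<lambda>k. of_real (tent (t / T)) * iexp (y * t) * Q (of_real (1 + \<epsilon> k) + \<i> * of_real t))
          \<longlonglongrightarrow> of_real (tent (t / T)) * iexp (y * t) * Q (1 + \<i> * of_real t)"
          by (intro tendsto_intros) simp
      qed
      show "AE t in lborel. norm (of_real (tent (t / T)) * iexp (y * t) * Q (of_real (1 + \<epsilon> k) + \<i> * of_real t)) \<le> tent (t / T) * B" for k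
      proof (rule AE_I2)
        fix t
        show "norm (of_real (tent (t / T)) * iexp (y * t) * Q (of_real (1 + \<epsilon> k) + \<i> * of_real t)) \<le> tent (t / T) * B"
        proof (cases "\<bar>t\<bar> \<le> T")
          case True
          then show ?thesis using B[of "\<epsilon> k" t] \<epsilon>[of k] by (auto simp: norm_mult tent_nonneg abs_le_iff intro!: mult_left_mono)
        next
          case False
          then have "tent (t / T) = 0" using T by (intro tent_eq_0) (auto simp: field_simps)
          then show ?thesis by simp
        qed
      qed
    qed
    have lim2: "(\<lambda>k. \<integral>u. indicator {0..} u * (g k u * of_real (T * fejer (T * (y - u)))) \<partial>lborel)
        \<longlonglongrightarrow> (\<integral>u. indicator {0..} u * (\<phi> u * of_real (T * fejer (T * (y - u)))) \<partial>lborel)"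
    proof (rule integral_dominated_convergence[where w = "\<lambda>u. T * fejer (T * (y - u))"])
      show "AE u in lborel. (\<lambda>k. indicator {0..} u * (g k u * of_real (T * fejer (T * (y - u)))))
          \<longlonglongrightarrow> indicator {0..} u * (\<phi> u * of_real (T * fejer (T * (y - u))))"
      proof (rule AE_I2)
        fix u
        have "(\<lambda>k. g k u) \<longlonglongrightarrow> \<phi> u * of_real (exp (- (0 * u)))"
          unfolding g\<phi> by (intro tendsto_intros \<epsilon>lim)
        then show "(\<lambda>k. indicator {0..} u * (g k u * of_real (T * fejer (T * (y - u)))))
          \<longlonglongrightarrow> indicator {0..} u * (\<phi> u * of_real (T * fejer (T * (y - u))))"
          by (intro tendsto_intros) simp
      qed
      show "AE u in lborel. norm (indicator {0..} u * (g k u * of_real (T * fejer (T * (y - u))))) \<le> T * fejer (T * (y - u))" for k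
      proof (rule AE_I2)
        fix u
        have "norm (g k u) \<le> 1" if "u \<ge> 0"
        proof -
          have "exp (- (\<epsilon> k * u)) \<le> 1" using that \<epsilon>[of k] by simp
          then have "norm (\<phi> u) * exp (- (\<epsilon> k * u)) \<le> 1 * 1" by (intro mult_mono le1) auto
          then show ?thesis by (simp add: g\<phi> norm_mult)
        qed
        then show "norm (indicator {0..} u * (g k u * of_real (T * fejer (T * (y - u))))) \<le> T * fejer (T * (y - u))"
          using T fejer_nonneg by (auto simp: indicator_def norm_mult mult_left_le_one_le)
      qed
    qed (use fj[OF T] in simp_all)
    have neg: "psum a u = 0" if "u < 0" for u
    proof -
      have "\<lfloor>exp u\<rfloor> = 0" using that by (simp add: floor_eq_iff)
      then show ?thesis by (simp add: psum_def)
    qed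
    have "indicator {0..} u * (g k u * c) = g k u * c" "indicator {0..} u * (\<phi> u * c) = \<phi> u * c" for k u c
      using neg[of u] by (auto simp: indicator_def g_def \<phi>_def)
    with lim2 have "(\<lambda>k. \<integral>u. g k u * of_real (T * fejer (T * (y - u))) \<partial>lborel) \<longlonglongrightarrow> J T y"
      by (simp add: J_def)
    with lim1 show ?thesis unfolding eq by (rule LIMSEQ_unique[rotated])
  qed
  have Jlim: "((\<lambda>y. J T y) \<longlongrightarrow> 0) at_top" if T: "T > 0" for T
  proof -
    have "((\<lambda>y. \<integral>t. (of_real (tent (t / T)) * Q (1 + \<i> * of_real t)) * iexp (y * t) \<partial>lborel) \<longlongrightarrow> 0) at_top"
    proof (rule Riemann_Lebesgue_compact_support[where T = T])
      have "continuous_on UNIV (\<lambda>t. Q (1 + \<i> * of_real t))"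
        by (rule continuous_on_compose2[OF Qcont]) (auto intro!: continuous_intros)
      then show "continuous_on UNIV (\<lambda>t. of_real (tent (t / T)) * Q (1 + \<i> * of_real t))"
        unfolding tent_def using T by (intro continuous_intros) auto
      show "of_real (tent (t / T)) * Q (1 + \<i> * of_real t) = 0" if "\<bar>t\<bar> \<ge> T" for t
        using that T by (simp add: tent_eq_0)
    qed
    then show ?thesis by (simp add: J[OF T] mult_ac)
  qed
  \<comment> \<open>Rescaling puts the dependence on the width into the argument of the slowly varying function.\<close>
  have Jsub: "J T y = (\<integral>w. \<phi> (y + (- 1 / T) * w) * of_real (fejer w) \<partial>lborel)" if T: "T > 0" for T y
    unfolding J_def using T
    by (subst lborel_integral_real_affine[where c = "- 1 / T" and t = y])
       (auto simp: scaleR_conv_of_real field_simps simp flip: integral_mult_right_zero)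
  define c where "c = (\<integral>v. fejer v \<partial>lborel)"
  have c: "c > 0" unfolding c_def by (rule fejer_mass_pos)
  define D where "D T = (\<integral>w. min 2 (2 * \<bar>exp ((- 1 / T) * w) - 1\<bar>) * fejer w \<partial>lborel)" for T
  have Dint: "integrable lborel (\<lambda>w. min 2 (2 * \<bar>exp ((- 1 / T) * w) - 1\<bar>) * fejer w)" for T
  proof (rule Bochner_Integration.integrable_bound)
    show "integrable lborel (\<lambda>w. 2 * fejer w)" using fejer_integrable by simp
    show "AE w in lborel. norm (min 2 (2 * \<bar>exp ((- 1 / T) * w) - 1\<bar>) * fejer w) \<le> norm (2 * fejer w)"
      using fejer_nonneg by (intro AE_I2) (auto simp: abs_mult intro!: mult_right_mono)
  qed simp
  have Dlim: "(D \<longlongrightarrow> 0) at_top"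
  proof -
    have "((\<lambda>T. \<integral>w. min 2 (2 * \<bar>exp ((- 1 / T) * w) - 1\<bar>) * fejer w \<partial>lborel) \<longlongrightarrow> integral\<^sup>L lborel (\<lambda>w::real. 0)) at_top"
    proof (rule integral_dominated_convergence_at_top[where w = "\<lambda>w. 2 * fejer w" and M = lborel and f = "\<lambda>_. 0"
          and s = "\<lambda>T w. min 2 (2 * \<bar>exp ((- 1 / T) * w) - 1\<bar>) * fejer w"])
      show "\<forall>\<^sub>F T in at_top. AE w in lborel. norm (min 2 (2 * \<bar>exp ((- 1 / T) * w) - 1\<bar>) * fejer w) \<le> 2 * fejer w"
        using fejer_nonneg by (intro always_eventually allI AE_I2) (auto simp: abs_mult intro!: mult_right_mono)
      show "AE w in lborel. ((\<lambda>T. min 2 (2 * \<bar>exp ((- 1 / T) * w) - 1\<bar>) * fejer w) \<longlongrightarrow> 0) at_top"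
      proof (rule AE_I2)
        fix w :: real
        have "((\<lambda>T::real. (- 1 / T) * w) \<longlongrightarrow> 0) at_top" by real_asymp
        then have "((\<lambda>T. min 2 (2 * \<bar>exp ((- 1 / T) * w) - 1\<bar>) * fejer w) \<longlongrightarrow> min 2 (2 * \<bar>exp 0 - 1\<bar>) * fejer w) at_top"
          by (intro tendsto_intros)
        then show "((\<lambda>T. min 2 (2 * \<bar>exp ((- 1 / T) * w) - 1\<bar>) * fejer w) \<longlongrightarrow> 0) at_top" by simp
      qed
    qed (use fejer_integrable in simp_all)
    then show ?thesis by (simp add: D_def[abs_def])
  qed
  have main: "c * norm (\<phi> y) \<le> norm (J T y) + D T + c * exp (- y)" if T: "T > 0" for T y
  proof -
    have int1: "integrable lborel (\<lambda>w. \<phi> y * of_real (fejer w))"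
      using fejer_integrable by (intro integrable_mult_right integrable_of_real)
    have int2: "integrable lborel (\<lambda>w. \<phi> (y + (- 1 / T) * w) * of_real (fejer w))"
    proof (rule Bochner_Integration.integrable_bound[OF fejer_integrable])
      show "AE w in lborel. norm (\<phi> (y + (- 1 / T) * w) * of_real (fejer w)) \<le> norm (fejer w)"
        using le1 by (intro AE_I2) (auto simp: norm_mult intro!: mult_left_le_one_le)
    qed simp
    have "of_real c * \<phi> y - J T y = (\<integral>w. \<phi> y * of_real (fejer w) - \<phi> (y + (- 1 / T) * w) * of_real (fejer w) \<partial>lborel)"
      using int1 int2 by (simp add: Jsub[OF T] c_def mult.commute)
    also have "norm \<dots> \<le> (\<integral>w. min 2 (2 * \<bar>exp ((- 1 / T) * w) - 1\<bar>) * fejer w + exp (- y) * fejer w \<partial>lborel)"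
    proof (rule Bochner_Integration.integral_norm_bound_integral)
      show "integrable lborel (\<lambda>w. \<phi> y * of_real (fejer w) - \<phi> (y + (- 1 / T) * w) * of_real (fejer w))"
        using int1 int2 by (rule Bochner_Integration.integrable_diff)
      show "integrable lborel (\<lambda>w. min 2 (2 * \<bar>exp ((- 1 / T) * w) - 1\<bar>) * fejer w + exp (- y) * fejer w)"
        using Dint fejer_integrable by (intro Bochner_Integration.integrable_add) auto
      show "norm (\<phi> y * of_real (fejer w) - \<phi> (y + (- 1 / T) * w) * of_real (fejer w))
          \<le> min 2 (2 * \<bar>exp ((- 1 / T) * w) - 1\<bar>) * fejer w + exp (- y) * fejer w" for w
      proof -
        have "norm (\<phi> y * of_real (fejer w) - \<phi> (y + (- 1 / T) * w) * of_real (fejer w))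
            = norm (\<phi> y - \<phi> (y + (- 1 / T) * w)) * fejer w"
          using fejer_nonneg[of w] by (simp add: norm_mult flip: left_diff_distrib)
        also have "\<dots> \<le> (min 2 (2 * \<bar>exp ((- 1 / T) * w) - 1\<bar>) + exp (- y)) * fejer w"
          unfolding \<phi>_def by (intro mult_right_mono psum_slowly_varying a fejer_nonneg)
        finally show ?thesis by (simp add: distrib_right)
      qed
    qed
    also have "\<dots> = D T + c * exp (- y)"
      using Dint fejer_integrable by (simp add: D_def c_def)
    finally have "norm (of_real c * \<phi> y - J T y) \<le> D T + c * exp (- y)" .
    moreover have "norm (of_real c * \<phi> y) = c * norm (\<phi> y)" using c by (simp add: norm_mult)
    ultimately show ?thesis
      using norm_triangle_ineq2[of "of_real c * \<phi> y" "J T y"] by linarith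
  qed
  have \<phi>lim: "(\<phi> \<longlongrightarrow> 0) at_top"
  proof (rule tendstoI)
    fix e :: real assume e: "e > 0"
    then have ce: "c * e / 3 > 0" using c by simp
    have "\<forall>\<^sub>F T in at_top. T > 0 \<and> dist (D T) 0 < c * e / 3"
      by (intro eventually_conj eventually_gt_at_top tendstoD[OF Dlim ce])
    then obtain T where T: "T > 0" "\<bar>D T\<bar> < c * e / 3"
      by (auto simp: eventually_at_top_linorder)
    have "((\<lambda>y::real. c * exp (- y)) \<longlongrightarrow> 0) at_top" by real_asymp
    from tendstoD[OF this ce] tendstoD[OF Jlim[OF T(1)] ce]
    show "\<forall>\<^sub>F y in at_top. dist (\<phi> y) 0 < e"
    proof eventually_elim
      case (elim y)
      have "\<bar>c * exp (- y)\<bar> < c * e / 3" using elim(1) unfolding dist_real_def by simp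
      moreover have "norm (J T y) < c * e / 3" using elim(2) unfolding dist_norm by simp
      ultimately have "c * norm (\<phi> y) < c * e" using main[OF T(1), of y] T(2) by linarith
      then show ?case using c by simp
    qed
  qed
  have "filterlim (\<lambda>N::nat. ln (real N)) at_top sequentially" by real_asymp
  with \<phi>lim have "(\<lambda>N. \<phi> (ln (real N))) \<longlonglongrightarrow> 0" by (rule filterlim_compose)
  then show ?thesis
  proof (rule Lim_transform_eventually)
    show "\<forall>\<^sub>F N in sequentially. \<phi> (ln (real N)) = (\<Sum>n=1..N. a n) / of_nat N"
      using eventually_gt_at_top[of 0]
    proof eventually_elim
      case (elim N)
      then have "exp (- complex_of_real (ln (real N))) = inverse (of_nat N)"
        by (simp add: exp_minus exp_of_real)
      then show ?case using elim by (simp add: \<phi>_def psum_def divide_inverse)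
    qed
  qed
qed

section \<open>The Moebius function and Euler products\<close>

lemma moebius_mu_1 [simp]: "moebius_mu 1 = 1" "moebius_mu (Suc 0) = 1"
  by (simp_all add: moebius_mu_def)

lemma abs_moebius_mu_le: "\<bar>moebius_mu n\<bar> \<le> 1"
  by (simp add: moebius_mu_def power_abs)

lemma moebius_mu_mult_coprime:
  assumes "coprime m n"
  shows "moebius_mu (m * n) = moebius_mu m * moebius_mu n"
proof (cases "squarefree m \<and> squarefree n")
  case True
  then have sq: "squarefree (m * n)" and nz: "m \<noteq> 0" "n \<noteq> 0"
    using assms by (auto intro!: squarefree_mult_coprime intro: Nat.gr0I)
  have "prime_factors (m * n) = prime_factors m \<union> prime_factors n"
    using nz by (simp add: prime_factors_product)
  moreover have "prime_factors m \<inter> prime_factors n = {}"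
    using assms by (auto simp: in_prime_factors_iff dest: coprime_common_divisor_nat not_prime_unit)
  ultimately have "card (prime_factors (m * n)) = card (prime_factors m) + card (prime_factors n)"
    by (simp add: card_Un_disjoint)
  with True sq show ?thesis by (simp add: moebius_mu_def power_add)
next
  case False
  then have "\<not> squarefree (m * n)" by (meson dvd_triv_left dvd_triv_right squarefree_mono)
  with False show ?thesis by (auto simp: moebius_mu_def)
qed

lemma moebius_mu_prime: "prime p \<Longrightarrow> moebius_mu p = -1"
  by (simp add: moebius_mu_def squarefree_prime prime_prime_factors)

lemma moebius_mu_prime_mult:
  assumes "prime p"
  shows "moebius_mu (p * m) = (if p dvd m then 0 else - moebius_mu m)"
proof (cases "p dvd m")
  case True
  then have "p\<^sup>2 dvd p * m" by (simp add: power2_eq_square)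
  then have "\<not> squarefree (p * m)" using assms by (intro not_squarefreeI[of p]) auto
  then show ?thesis using True by (simp add: moebius_mu_def)
next
  case False
  then have "coprime p m" using assms by (simp add: prime_imp_coprime)
  then show ?thesis using False assms by (simp add: moebius_mu_mult_coprime moebius_mu_prime)
qed

text \<open>
Expanding the product over \<open>P\<close> produces one term for every subset of \<open>P\<close>, that is, for every squarefree number with
prime factors in \<open>P\<close>.
\<close>

lemma sum_moebius_squarefree_smooth:
  fixes g :: "nat \<Rightarrow> complex"
  assumes g1: "g 1 = 1" and gm: "\<And>m n. g (m * n) = g m * g n"
    and "finite P" "\<And>p. p \<in> P \<Longrightarrow> prime p"
  shows "finite {n. squarefree n \<and> prime_factors n \<subseteq> P}"
    and "(\<Sum>n\<in>{n. squarefree n \<and> prime_factors n \<subseteq> P}. of_int (moebius_mu n) * g n) = (\<Prod>p\<in>P. 1 - g p)"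
proof -
  define Q where "Q P = {n::nat. squarefree n \<and> prime_factors n \<subseteq> P}" for P
  have "finite (Q P) \<and> (\<Sum>n\<in>Q P. of_int (moebius_mu n) * g n) = (\<Prod>p\<in>P. 1 - g p)"
    using assms(3,4)
  proof (induction P rule: finite_induct)
    case empty
    have "Q {} = {1}"
      unfolding Q_def by (auto simp: prime_factorization_empty_iff intro: Nat.gr0I)
    then show ?case using g1 by simp
  next
    case (insert p P)
    have p: "prime p" using insert by auto
    then have p0: "p \<noteq> 0" using prime_gt_0_nat by blast
    have ndvd: "\<not> p dvd n" if "n \<in> Q P" for n
    proof
      assume "p dvd n"
      moreover have "n \<noteq> 0" using that by (auto simp: Q_def intro: Nat.gr0I)
      ultimately have "p \<in> prime_factors n" using p by (simp add: in_prime_factors_iff)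
      then show False using that insert.hyps by (auto simp: Q_def)
    qed
    have "Q (insert p P) = Q P \<union> (*) p ` Q P"
    proof (intro equalityI subsetI)
      fix n assume n: "n \<in> Q (insert p P)"
      show "n \<in> Q P \<union> (*) p ` Q P"
      proof (cases "p dvd n")
        case True
        then obtain m where m: "n = p * m" by blast
        have sq: "squarefree m" and m0: "m \<noteq> 0"
          using n m squarefree_mono[of m n] by (auto simp: Q_def intro: Nat.gr0I)
        have "\<not> p dvd m"
        proof
          assume "p dvd m"
          then have "p\<^sup>2 dvd n" using m by (simp add: power2_eq_square)
          then show False using n p by (auto simp: Q_def dest: squarefreeD)
        qed
        moreover have "prime_factors n = insert p (prime_factors m)"
          using m m0 p0 p by (simp add: prime_factors_product prime_prime_factors)
        ultimately have "prime_factors m \<subseteq> P" using n by (auto simp: Q_def in_prime_factors_iff)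
        then show ?thesis using m sq by (auto simp: Q_def)
      next
        case False
        then show ?thesis using n by (auto simp: Q_def in_prime_factors_iff)
      qed
    next
      fix n assume "n \<in> Q P \<union> (*) p ` Q P"
      then show "n \<in> Q (insert p P)"
      proof
        assume "n \<in> (*) p ` Q P"
        then obtain m where m: "n = p * m" "m \<in> Q P" by blast
        have m0: "m \<noteq> 0" using m by (auto simp: Q_def intro: Nat.gr0I)
        have "coprime p m" using ndvd[OF m(2)] p by (simp add: prime_imp_coprime)
        then have "squarefree n" using m p by (auto simp: Q_def squarefree_prime intro!: squarefree_mult_coprime)
        moreover have "prime_factors n = insert p (prime_factors m)"
          using m m0 p0 p by (simp add: prime_factors_product prime_prime_factors)
        ultimately show ?thesis using m by (auto simp: Q_def)
      qed (auto simp: Q_def)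
    qed
    moreover have fin: "finite (Q P)" and IH: "(\<Sum>n\<in>Q P. of_int (moebius_mu n) * g n) = (\<Prod>p\<in>P. 1 - g p)"
      using insert by auto
    moreover have "Q P \<inter> (*) p ` Q P = {}" using ndvd dvd_triv_left by blast
    moreover have "(\<Sum>n\<in>(*) p ` Q P. of_int (moebius_mu n) * g n) = - g p * (\<Sum>n\<in>Q P. of_int (moebius_mu n) * g n)"
    proof -
      have "(\<Sum>n\<in>(*) p ` Q P. of_int (moebius_mu n) * g n) = (\<Sum>n\<in>Q P. of_int (moebius_mu (p * n)) * g (p * n))"
        using p0 by (subst sum.reindex) (auto simp: inj_on_def)
      also have "\<dots> = (\<Sum>n\<in>Q P. - g p * (of_int (moebius_mu n) * g n))"
        by (intro sum.cong) (auto simp: moebius_mu_prime_mult[OF p] ndvd gm)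
      finally show ?thesis by (simp add: sum_distrib_left)
    qed
    ultimately show ?case
      using insert.hyps by (simp add: sum.union_disjoint algebra_simps)
  qed
  then show "finite {n. squarefree n \<and> prime_factors n \<subseteq> P}"
    and "(\<Sum>n\<in>{n. squarefree n \<and> prime_factors n \<subseteq> P}. of_int (moebius_mu n) * g n) = (\<Prod>p\<in>P. 1 - g p)"
    by (auto simp: Q_def)
qed

lemma infsum_eq_suminf:
  fixes f :: "nat \<Rightarrow> 'a :: banach"
  assumes "summable (\<lambda>n. norm (f n))"
  shows "infsum f UNIV = (\<Sum>n. f n)"
  using norm_summable_imp_has_sum[OF assms summable_sums[OF summable_norm_cancel[OF assms]]]
  by (rule infsumI)

text \<open>
Subtracting \<open>g p\<close> times the series removes the multiples of \<open>p\<close>: Euler's sieve, one prime at a time.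
\<close>

lemma infsum_sieve_primes:
  fixes g :: "nat \<Rightarrow> complex"
  assumes gm: "\<And>m n. g (m * n) = g m * g n" and summ: "summable (\<lambda>n. norm (g n))"
    and "finite P" "\<And>p. p \<in> P \<Longrightarrow> prime p"
  shows "infsum g UNIV * (\<Prod>p\<in>P. 1 - g p) = infsum g {n. \<forall>p\<in>P. \<not> p dvd n}"
  using assms(3,4)
proof (induction P rule: finite_induct)
  case (insert p P)
  define S where "S = {n. \<forall>q\<in>P. \<not> q dvd n}"
  define S' where "S' = {n. \<forall>q\<in>insert p P. \<not> q dvd n}"
  have p: "prime p" "p > 0" using insert by (auto simp: prime_gt_0_nat)
  have so: "g summable_on A" for A
    using norm_summable_imp_summable_on[OF summ] by (rule summable_on_subset_banach) simp
  have dvdp: "q dvd m" if "q \<in> P" "q dvd p * m" for q m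
  proof -
    have "prime q" "q \<noteq> p" using that insert by auto
    then have "coprime q p" using p by (simp add: primes_coprime)
    then show ?thesis using that by (simp add: coprime_dvd_mult_right_iff)
  qed
  have *: "p * m \<in> S" if "m \<in> S" for m using that dvdp unfolding S_def by blast
  have S: "S = S' \<union> (*) p ` S"
  proof (intro equalityI subsetI)
    fix n assume n: "n \<in> S"
    show "n \<in> S' \<union> (*) p ` S"
    proof (cases "p dvd n")
      case True
      then obtain m where m: "n = p * m" by blast
      then have "m \<in> S" using n dvd_mult[of _ m p] unfolding S_def by blast
      then show ?thesis using m by blast
    qed (use n in \<open>auto simp: S_def S'_def\<close>)
  next
    fix n assume "n \<in> S' \<union> (*) p ` S"
    then show "n \<in> S" using * unfolding S_def S'_def by blast
  qed
  have disj: "S' \<inter> (*) p ` S = {}" by (auto simp: S'_def)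
  have "infsum g S = infsum g S' + infsum g ((*) p ` S)"
    by (subst S) (rule infsum_Un_disjoint[OF so so disj])
  also have "infsum g ((*) p ` S) = infsum (\<lambda>m. g p * g m) S"
    using p by (subst infsum_reindex) (auto simp: inj_on_def o_def gm)
  also have "\<dots> = g p * infsum g S" by (rule infsum_cmult_right[OF so])
  finally have "infsum g S' = infsum g S - g p * infsum g S"
    unfolding eq_diff_eq by (rule sym)
  then have "infsum g S' = infsum g S * (1 - g p)"
    by (simp only: right_diff_distrib mult.commute mult_1_left)
  moreover have "infsum g UNIV * (\<Prod>p\<in>P. 1 - g p) = infsum g S"
    using insert by (simp add: S_def)
  ultimately show ?case using insert.hyps by (simp add: S'_def mult_ac)
qed simp

text \<open>
As \<open>P\<close> grows, the finite products over \<open>1 - g p\<close> tend to the series of \<open>\<mu>(n) g(n)\<close>, while the sieve shows that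
multiplied with the series of \<open>g\<close> they tend to \<open>g 1 = 1\<close>.
\<close>

lemma Euler_product_moebius:
  fixes g :: "nat \<Rightarrow> complex"
  assumes g0: "g 0 = 0" and g1: "g 1 = 1" and gm: "\<And>m n. g (m * n) = g m * g n"
    and summ: "summable (\<lambda>n. norm (g n))"
  shows "(\<lambda>x. \<Prod>p\<in>{p. prime p \<and> p \<le> x}. 1 - g p) \<longlonglongrightarrow> (\<Sum>n. of_int (moebius_mu n) * g n)"
    and "(\<Sum>n. g n) * (\<Sum>n. of_int (moebius_mu n) * g n) = 1"
proof -
  define P where "P x = {p::nat. prime p \<and> p \<le> x}" for x
  have finP: "finite (P x)" and prP: "\<And>p. p \<in> P x \<Longrightarrow> prime p" for x
    by (auto simp: P_def intro: finite_subset[of _ "{..x}"])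
  have mg: "norm (of_int (moebius_mu n) * g n) \<le> norm (g n)" for n
    using abs_moebius_mu_le[of n]
    by (auto simp: norm_mult intro!: mult_left_le_one_le simp flip: of_int_abs)
  have lim1: "(\<lambda>x. \<Prod>p\<in>P x. 1 - g p) \<longlonglongrightarrow> (\<Sum>n. of_int (moebius_mu n) * g n)"
  proof -
    define f where "f n x = (if squarefree n \<and> prime_factors n \<subseteq> P x then of_int (moebius_mu n) * g n else 0)" for n x
    have "(\<lambda>x. \<Sum>n. f n x) \<longlonglongrightarrow> (\<Sum>n. of_int (moebius_mu n) * g n)"
    proof (rule tannerys_theorem[where M = "\<lambda>n. norm (g n)", THEN conjunct2, THEN conjunct2])
      show "(f n \<longlongrightarrow> of_int (moebius_mu n) * g n) sequentially" for n
      proof (rule tendsto_eventually)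
        show "\<forall>\<^sub>F x in sequentially. f n x = of_int (moebius_mu n) * g n"
          using eventually_ge_at_top[of n]
        proof eventually_elim
          case (elim x)
          show ?case
          proof (cases "squarefree n")
            case True
            then have "n > 0" by (auto intro: Nat.gr0I)
            then have "prime_factors n \<subseteq> P x"
              using elim by (auto simp: P_def in_prime_factors_iff dest!: dvd_imp_le)
            with True show ?thesis by (simp add: f_def)
          qed (simp add: f_def moebius_mu_def)
        qed
      qed
      show "\<forall>\<^sub>F (n, x) in sequentially \<times>\<^sub>F sequentially. norm (f n x) \<le> norm (g n)"
        using mg by (intro always_eventually) (auto simp: f_def)
      show "sequentially \<noteq> bot" by simp
    qed (use summ in auto)
    moreover have "(\<Sum>n. f n x) = (\<Prod>p\<in>P x. 1 - g p)" for x
    proof -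
      have "(\<Sum>n. f n x) = (\<Sum>n\<in>{n. squarefree n \<and> prime_factors n \<subseteq> P x}. f n x)"
        by (rule suminf_finite) (use sum_moebius_squarefree_smooth(1)[of g, OF g1 gm finP prP] in \<open>auto simp: f_def\<close>)
      also have "\<dots> = (\<Sum>n\<in>{n. squarefree n \<and> prime_factors n \<subseteq> P x}. of_int (moebius_mu n) * g n)"
        by (intro sum.cong) (auto simp: f_def)
      also have "\<dots> = (\<Prod>p\<in>P x. 1 - g p)"
        by (rule sum_moebius_squarefree_smooth(2)[of g, OF g1 gm finP prP])
      finally show ?thesis .
    qed
    ultimately show ?thesis by simp
  qed
  have lim2: "(\<lambda>x. (\<Sum>n. g n) * (\<Prod>p\<in>P x. 1 - g p)) \<longlonglongrightarrow> (\<Sum>n. if n = 1 then 1 else 0)"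
  proof -
    define f where "f n x = (if \<forall>p\<in>P x. \<not> p dvd n then g n else 0)" for n x
    have "(\<lambda>x. \<Sum>n. f n x) \<longlonglongrightarrow> (\<Sum>n. if n = 1 then 1 else 0)"
    proof (rule tannerys_theorem[where M = "\<lambda>n. norm (g n)", THEN conjunct2, THEN conjunct2])
      show "(f n \<longlongrightarrow> (if n = 1 then 1 else 0)) sequentially" for n
      proof (rule tendsto_eventually)
        show "\<forall>\<^sub>F x in sequentially. f n x = (if n = 1 then 1 else 0)"
          using eventually_ge_at_top[of n]
        proof eventually_elim
          case (elim x)
          consider "n = 0" | "n = 1" | "n > 1" by linarith
          then show ?case
          proof cases
            case 2
            then show ?thesis using g1 by (auto simp: f_def P_def)
          next
            case 3
            then obtain p where p: "prime p" "p dvd n" using prime_factor_nat[of n] by auto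
            with 3 elim have "p \<in> P x" by (auto simp: P_def dest!: dvd_imp_le)
            with p 3 show ?thesis by (auto simp: f_def)
          qed (simp add: f_def g0)
        qed
      qed
      show "\<forall>\<^sub>F (n, x) in sequentially \<times>\<^sub>F sequentially. norm (f n x) \<le> norm (g n)"
        by (intro always_eventually) (auto simp: f_def)
      show "sequentially \<noteq> bot" by simp
    qed (use summ in auto)
    moreover have "(\<Sum>n. f n x) = (\<Sum>n. g n) * (\<Prod>p\<in>P x. 1 - g p)" for x
    proof -
      have "summable (\<lambda>n. norm (f n x))"
        by (rule summable_comparison_test'[OF summ]) (auto simp: f_def)
      then have "(\<Sum>n. f n x) = infsum (\<lambda>n. f n x) UNIV"
        by (rule infsum_eq_suminf[symmetric])
      also have "\<dots> = infsum g {n. \<forall>p\<in>P x. \<not> p dvd n}"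
        by (rule infsum_cong_neutral) (auto simp: f_def)
      also have "\<dots> = infsum g UNIV * (\<Prod>p\<in>P x. 1 - g p)"
        by (rule infsum_sieve_primes[of g, OF gm summ finP prP, symmetric])
      also have "infsum g UNIV = (\<Sum>n. g n)"
        by (rule infsum_eq_suminf[OF summ])
      finally show ?thesis .
    qed
    ultimately show ?thesis by simp
  qed
  show "(\<lambda>x. \<Prod>p\<in>{p. prime p \<and> p \<le> x}. 1 - g p) \<longlonglongrightarrow> (\<Sum>n. of_int (moebius_mu n) * g n)"
    using lim1 by (simp add: P_def)
  have "(\<Sum>n::nat. if n = 1 then 1 else 0 :: complex) = 1"
    by (subst suminf_finite[of "{1}"]) auto
  moreover have "(\<lambda>x. (\<Sum>n. g n) * (\<Prod>p\<in>P x. 1 - g p)) \<longlonglongrightarrow> (\<Sum>n. g n) * (\<Sum>n. of_int (moebius_mu n) * g n)"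
    by (intro tendsto_intros lim1)
  ultimately show "(\<Sum>n. g n) * (\<Sum>n. of_int (moebius_mu n) * g n) = 1"
    using lim2 LIMSEQ_unique by fastforce
qed

text \<open>
The classical inequality \<open>3 + 4 cos \<theta> + cos 2\<theta> = 2 (1 + cos \<theta>)\<^sup>2 \<ge> 0\<close>, applied to each term of the power series of
the logarithm of the three factors.
\<close>

lemma three_four_one:
  fixes z :: complex and r :: real
  assumes "norm z = 1" "0 \<le> r" "r < 1"
  shows "norm (1 - complex_of_real r) ^ 3 * norm (1 - of_real r * z) ^ 4 * norm (1 - of_real r * z\<^sup>2) \<le> 1"
proof -
  have logs: "(\<lambda>n. - Re ((of_real r * w) ^ n / of_nat n)) sums ln (norm (1 - of_real r * w))"
    and nz: "norm (1 - of_real r * w) > 0" if w: "norm w = 1" for w :: complex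
  proof -
    have lt: "norm (- (of_real r * w)) < 1" using assms w by (simp add: norm_mult)
    have n0: "1 + - (of_real r * w) \<noteq> 0"
    proof
      assume "1 + - (of_real r * w) = 0"
      then have "of_real r * w = 1" by simp
      with lt show False by simp
    qed
    then show "norm (1 - of_real r * w) > 0" by simp
    have "(\<lambda>n. Re ((-1) ^ Suc n / of_nat n * (- (of_real r * w)) ^ n)) sums Re (Ln (1 + - (of_real r * w)))"
      using Ln_series[OF lt] by (rule sums_Re)
    moreover have "(\<lambda>n. Re ((-1) ^ Suc n / of_nat n * (- (of_real r * w)) ^ n)) = (\<lambda>n. - Re ((of_real r * w) ^ n / of_nat n))"
    proof
      fix n :: nat
      have "(- (of_real r * w)) ^ n = (-1) ^ n * (of_real r * w) ^ n"
        by (subst power_minus) simp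
      moreover have "(-1) ^ n * (-1 :: complex) ^ n = 1"
        by (simp flip: power_mult_distrib)
      ultimately have "(-1) ^ Suc n / of_nat n * (- (of_real r * w)) ^ n = - ((of_real r * w) ^ n / of_nat n)"
        by (simp add: mult.assoc[symmetric])
      then show "Re ((-1) ^ Suc n / of_nat n * (- (of_real r * w)) ^ n) = - Re ((of_real r * w) ^ n / of_nat n)"
        by (simp only: uminus_complex.sel)
    qed
    ultimately have "(\<lambda>n. - Re ((of_real r * w) ^ n / of_nat n)) sums Re (Ln (1 + - (of_real r * w)))"
      by metis
    then show "(\<lambda>n. - Re ((of_real r * w) ^ n / of_nat n)) sums ln (norm (1 - of_real r * w))"
      unfolding Re_Ln[OF n0] by simp
  qed
  have n2: "norm (z\<^sup>2) = 1" using assms by (simp add: norm_power)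
  let ?t = "\<lambda>w n. - Re ((of_real r * w) ^ n / of_nat n)"
  have sm: "(\<lambda>n. 3 * ?t 1 n + 4 * ?t z n + ?t (z\<^sup>2) n) sums
      (3 * ln (norm (1 - complex_of_real r * 1)) + 4 * ln (norm (1 - of_real r * z)) + ln (norm (1 - of_real r * z\<^sup>2)))"
    by (intro sums_add sums_mult logs assms n2) simp
  have le: "3 * ?t 1 n + 4 * ?t z n + ?t (z\<^sup>2) n \<le> 0" for n
  proof -
    define c where "c = Re (z ^ n)"
    have "norm (z ^ n) = 1" using assms by (simp add: norm_power)
    then have "(Re (z ^ n))\<^sup>2 + (Im (z ^ n))\<^sup>2 = 1" by (simp add: cmod_def)
    moreover have "(z\<^sup>2) ^ n = (z ^ n)\<^sup>2" by (simp only: power_mult[symmetric] mult.commute[of 2 n])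
    ultimately have sq: "Re ((z\<^sup>2) ^ n) = 2 * c\<^sup>2 - 1"
      by (simp add: c_def Re_power2)
    have tw: "?t w n = - (r ^ n / real n * Re (w ^ n))" for w
    proof -
      have eq: "(of_real r * w) ^ n / of_nat n = of_real (r ^ n / real n) * w ^ n"
        by (simp add: power_mult_distrib)
      have R: "Re (of_real a * v) = a * Re v" for a v by simp
      show ?thesis unfolding eq R ..
    qed
    have c1: "Re (1 ^ n) = 1" by simp
    have "3 * ?t 1 n + 4 * ?t z n + ?t (z\<^sup>2) n = - (r ^ n / real n * (3 + 4 * c + (2 * c\<^sup>2 - 1)))"
    proof -
      have "3 * ?t 1 n + 4 * ?t z n + ?t (z\<^sup>2) n = 3 * - (r ^ n / real n * 1) + 4 * - (r ^ n / real n * c) + - (r ^ n / real n * (2 * c\<^sup>2 - 1))"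
        by (simp only: tw sq c1 c_def)
      also have "\<dots> = - (k * (3 + 4 * c + (2 * c\<^sup>2 - 1)))" if "k = r ^ n / real n" for k
        unfolding that[symmetric] by (simp add: algebra_simps)
      finally show ?thesis by simp
    qed
    also have "3 + 4 * c + (2 * c\<^sup>2 - 1) = 2 * (c + 1)\<^sup>2" by (simp add: power2_sum)
    finally show ?thesis using assms by simp
  qed
  define A where "A = norm (1 - complex_of_real r * 1)"
  define B where "B = norm (1 - of_real r * z)"
  define C where "C = norm (1 - of_real r * z\<^sup>2)"
  have pos: "A > 0" "B > 0" "C > 0"
    unfolding A_def B_def C_def using nz[of 1] nz[OF assms(1)] nz[OF n2] by auto
  have ln_le: "3 * ln A + 4 * ln B + ln C \<le> 0"
    unfolding A_def B_def C_def
    by (rule sums_le[where f = "\<lambda>n. 3 * ?t 1 n + 4 * ?t z n + ?t (z\<^sup>2) n" and g = "\<lambda>_. 0"])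
       (rule le, rule sm, rule sums_zero)
  have "3 * ln A + 4 * ln B + ln C = ln (A ^ 3 * B ^ 4 * C)"
  proof -
    show ?thesis using pos by (simp add: ln_mult_pos ln_realpow)
  qed
  with ln_le have "A ^ 3 * B ^ 4 * C \<le> 1"
    using ln_le_zero_iff[of "A ^ 3 * B ^ 4 * C"] pos by simp
  then show ?thesis by (simp add: A_def B_def C_def)
qed

section \<open>Continuation of Dirichlet series to the right half-plane\<close>

lemma powr_minus_nat: "a / of_nat (Suc n) powr s = a * complex_of_nat (Suc n) powr (- s)"
  by (simp add: powr_def exp_minus divide_inverse del: of_nat_Suc)

lemma
  fixes w :: complex and n :: nat
  assumes n: "n > 0"
  shows powr_nat_Taylor1: "Re w \<le> 1 \<Longrightarrow>
      norm (of_nat (Suc n) powr w - of_nat n powr w) \<le> norm w * real n powr (Re w - 1)"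
    and powr_nat_Taylor2: "Re w \<le> 2 \<Longrightarrow>
      norm (of_nat (Suc n) powr w - of_nat n powr w - w * of_nat n powr (w - 1))
        \<le> norm w * norm (w - 1) * real n powr (Re w - 2)"
proof -
  define S where "S = {z::complex. Im z = 0} \<inter> {z. real n \<le> Re z}"
  have "S = {z. 0 \<le> Im z} \<inter> {z. Im z \<le> 0} \<inter> {z. real n \<le> Re z}" by (auto simp: S_def)
  then have S: "convex S"
    by (auto intro!: convex_Int convex_halfspace_Re_ge convex_halfspace_Im_ge convex_halfspace_Im_le)
  have inS: "of_nat (Suc n) \<in> S" "of_nat n \<in> S" by (auto simp: S_def)
  have nonpos: "z \<notin> \<real>\<^sub>\<le>\<^sub>0" if "z \<in> S" for z
    using that n by (auto simp: S_def complex_nonpos_Reals_iff)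
  have bnd: "norm (z powr v) \<le> real n powr Re v" if "z \<in> S" "Re v \<le> 0" for z v
  proof -
    have "z \<in> \<real>" "Re z > 0" "real n \<le> Re z" using that n by (auto simp: S_def complex_is_Real_iff)
    then have "norm (z powr v) = Re z powr Re v" by (simp add: norm_powr_real_powr)
    also have "\<dots> \<le> real n powr Re v"
      using that n \<open>real n \<le> Re z\<close> by (intro powr_mono2') auto
    finally show ?thesis .
  qed
  have d1: "((\<lambda>z. z powr w) has_field_derivative w * z powr (w - 1)) (at z within S)" if "z \<in> S" for z w
    by (rule has_field_derivative_at_within[OF has_field_derivative_powr[OF nonpos[OF that]]])
  have d2: "((\<lambda>z. w * z powr (w - 1)) has_field_derivative w * (w - 1) * z powr (w - 2)) (at z within S)" if "z \<in> S" for z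
    using DERIV_cmult[OF d1[OF that, of "w - 1"], of w] by (simp add: mult.assoc)
  show "norm (of_nat (Suc n) powr w - of_nat n powr w) \<le> norm w * real n powr (Re w - 1)" if "Re w \<le> 1"
  proof -
    let ?f = "\<lambda>(i::nat) z. if i = 0 then z powr w else w * z powr (w - 1)"
    have "norm (?f 0 (of_nat (Suc n)) - (\<Sum>i\<le>0. ?f i (of_nat n) * (of_nat (Suc n) - of_nat n) ^ i / fact i))
        \<le> (norm w * real n powr (Re w - 1)) * norm (of_nat (Suc n) - of_nat n :: complex) ^ Suc 0 / fact 0"
    proof (rule field_Taylor[OF S _ _ inS(2,1)])
      show "norm (?f (Suc 0) z) \<le> norm w * real n powr (Re w - 1)" if "z \<in> S" for z
        using bnd[OF that, of "w - 1"] \<open>Re w \<le> 1\<close> by (auto simp: norm_mult intro!: mult_left_mono)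
    qed (use d1 in auto)
    then show ?thesis by simp
  qed
  show "norm (of_nat (Suc n) powr w - of_nat n powr w - w * of_nat n powr (w - 1))
        \<le> norm w * norm (w - 1) * real n powr (Re w - 2)" if "Re w \<le> 2"
  proof -
    let ?f = "\<lambda>(i::nat) z. if i = 0 then z powr w else if i = Suc 0 then w * z powr (w - 1) else w * (w - 1) * z powr (w - 2)"
    have "norm (?f 0 (of_nat (Suc n)) - (\<Sum>i\<le>Suc 0. ?f i (of_nat n) * (of_nat (Suc n) - of_nat n) ^ i / fact i))
        \<le> (norm w * norm (w - 1) * real n powr (Re w - 2)) * norm (of_nat (Suc n) - of_nat n :: complex) ^ Suc (Suc 0) / fact (Suc 0)"
    proof (rule field_Taylor[OF S _ _ inS(2,1)])
      show "norm (?f (Suc (Suc 0)) z) \<le> norm w * norm (w - 1) * real n powr (Re w - 2)" if "z \<in> S" for z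
        using bnd[OF that, of "w - 2"] \<open>Re w \<le> 2\<close> by (auto simp: norm_mult intro!: mult_left_mono)
      show "(?f i has_field_derivative ?f (Suc i) z) (at z within S)" if "z \<in> S" "i \<le> Suc 0" for i z
        using that d1[OF that(1), of w] d2[OF that(1)] by (cases i) auto
    qed
    then show ?thesis by (simp add: diff_diff_eq)
  qed
qed

text \<open>
The majorant is summable locally uniformly in \<open>s\<close>, since \<open>C\<close> is bounded on small discs and \<open>Re s\<close> is bounded
below there.
\<close>

lemma holomorphic_suminf_comparison:
  fixes f :: "nat \<Rightarrow> complex \<Rightarrow> complex" and C :: "complex \<Rightarrow> real"
  assumes hol: "\<And>k. f k holomorphic_on {s. Re s > 0}"
    and bnd: "\<And>k s. Re s > 0 \<Longrightarrow> norm (f k s) \<le> C s * real (Suc k) powr (- Re s - 1)"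
    and cont: "continuous_on {s. Re s > 0} C"
  obtains g where "g holomorphic_on {s. Re s > 0}" "\<And>s. Re s > 0 \<Longrightarrow> (\<lambda>k. f k s) sums g s"
proof -
  have op: "open {s. Re s > 0}" by (rule open_halfspace_Re_gt)
  obtain g where g: "\<forall>x\<in>{s. Re s > 0}. (\<lambda>n. f n x) sums g x \<and> g field_differentiable at x"
  proof (rule series_differentiable_comparison_complex[OF op, of f])
    show "f n field_differentiable at x" if "x \<in> {s. Re s > 0}" for n x
      using holomorphic_on_imp_differentiable_at[OF hol op that] .
    show "\<exists>d (h :: nat \<Rightarrow> complex). 0 < d \<and> summable h \<and> range h \<subseteq> \<real>\<^sub>\<ge>\<^sub>0 \<and>
        (\<forall>\<^sub>F n in sequentially. \<forall>y\<in>ball x d \<inter> {s. 0 < Re s}. norm (f n y) \<le> norm (h n))"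
      if "x \<in> {s. Re s > 0}" for x
    proof -
      define d where "d = Re x / 2"
      have d: "d > 0" using that by (simp add: d_def)
      have re: "Re y \<ge> d" if "y \<in> cball x d" for y
        using that abs_Re_le_cmod[of "x - y"] by (simp add: d_def dist_norm)
      have "compact (C ` cball x d)"
        by (intro compact_continuous_image continuous_on_subset[OF cont]) (use re d in force)+
      then obtain B where B: "\<And>y. y \<in> cball x d \<Longrightarrow> \<bar>C y\<bar> \<le> B"
        by (fastforce dest!: compact_imp_bounded simp: bounded_iff)
      define h where "h k = complex_of_real (B * real (Suc k) powr (- d - 1))" for k
      have B0: "B \<ge> 0" using B[of x] d by auto
      have "summable (\<lambda>k. real k powr (- d - 1))" using d by (simp add: summable_real_powr_iff)
      then have "summable (\<lambda>k. B * real (Suc k) powr (- d - 1))"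
        by (subst (asm) summable_Suc_iff[symmetric]) (rule summable_mult)
      then have "summable h" unfolding h_def by (rule summable_of_real)
      moreover have "norm (f k y) \<le> norm (h k)" if "y \<in> ball x d" for k y
      proof -
        have y: "Re y \<ge> d" "\<bar>C y\<bar> \<le> B" using that re B by auto
        have "norm (f k y) \<le> C y * real (Suc k) powr (- Re y - 1)" using y d by (intro bnd) auto
        also have "\<dots> \<le> B * real (Suc k) powr (- d - 1)"
          using y B0 by (intro mult_mono powr_mono) auto
        also have "\<dots> = norm (h k)" unfolding h_def norm_of_real using B0 by (simp add: abs_mult)
        finally show ?thesis .
      qed
      moreover have "range h \<subseteq> \<real>\<^sub>\<ge>\<^sub>0" using B0 by (auto simp: h_def)
      ultimately show ?thesis using d by (intro exI[of _ d] exI[of _ h]) auto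
    qed
  qed blast
  show ?thesis
  proof
    show "g holomorphic_on {s. Re s > 0}"
      using g op by (auto simp: holomorphic_on_def field_differentiable_at_within)
  qed (use g in auto)
qed

text \<open>
Up to the factor \<open>1 - s\<close>, each term \<open>n powr (- s)\<close> is the increment of \<open>n powr (1 - s)\<close> with an error of second order,
which is summable for \<open>Re s > 0\<close>; the increments telescope.
\<close>

lemma zeta_continuation:
  obtains E where "E holomorphic_on {s. Re s > 0}" "E 1 = 1"
    "\<And>s. Re s > 1 \<Longrightarrow> (\<lambda>n. (s - 1) * (1 / of_nat (Suc n) powr s)) sums E s"
proof -
  define e where "e k s = of_nat (Suc (Suc k)) powr (1 - s) - of_nat (Suc k) powr (1 - s)
      - (1 - s) * complex_of_nat (Suc k) powr (- s)" for k s
  obtain g where g: "g holomorphic_on {s. Re s > 0}" "\<And>s. Re s > 0 \<Longrightarrow> (\<lambda>k. e k s) sums g s"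
  proof (rule holomorphic_suminf_comparison[of e "\<lambda>s. norm (1 - s) * norm (- s)"])
    show "e k holomorphic_on {s. Re s > 0}" for k
      unfolding e_def by (intro holomorphic_intros)
    show "norm (e k s) \<le> norm (1 - s) * norm (- s) * real (Suc k) powr (- Re s - 1)" if "Re s > 0" for k s
    proof -
      have eqs: "1 - s - 1 = - s" "Re (1 - s) - 2 = - Re s - 1" and le: "Re (1 - s) \<le> 2"
        using that by simp_all
      show ?thesis using powr_nat_Taylor2[OF zero_less_Suc le, of k] unfolding e_def eqs .
    qed
    show "continuous_on {s. Re s > 0} (\<lambda>s. norm (1 - s) * norm (- s))" by (intro continuous_intros)
  qed blast
  show thesis
  proof
    show "(\<lambda>s. 1 + g s) holomorphic_on {s. Re s > 0}" by (intro holomorphic_intros g)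
    have "(\<lambda>k. e k 1) sums 0" by (simp add: e_def del: of_nat_Suc)
    then show "1 + g 1 = 1" using g(2)[of 1] sums_unique2 by fastforce
    show "(\<lambda>n. (s - 1) * (1 / of_nat (Suc n) powr s)) sums (1 + g s)" if s: "Re s > 1" for s
    proof -
      have part: "(\<Sum>k<N. (s - 1) * (1 / of_nat (Suc k) powr s)) = (\<Sum>k<N. e k s) + 1 - of_nat (Suc N) powr (1 - s)" for N
      proof (induction N)
        case (Suc N)
        have t: "(s - 1) * (1 / of_nat (Suc N) powr s) = - ((1 - s) * of_nat (Suc N) powr (- s))"
          unfolding powr_minus_nat by (simp only: mult_1 left_diff_distrib minus_diff_eq)
        show ?case unfolding sum.lessThan_Suc Suc t e_def by (simp del: of_nat_Suc)
      qed simp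
      have "(\<lambda>N. of_nat (Suc N) powr (1 - s)) \<longlonglongrightarrow> 0"
      proof (rule tendsto_norm_zero_cancel)
        have "(\<lambda>N. real (Suc N) powr (1 - Re s)) \<longlonglongrightarrow> 0" using s by real_asymp
        then show "(\<lambda>N. norm (complex_of_nat (Suc N) powr (1 - s))) \<longlonglongrightarrow> 0"
          by (subst norm_powr_real_powr) auto
      qed
      then have "(\<lambda>N. (\<Sum>k<N. e k s) + 1 - of_nat (Suc N) powr (1 - s)) \<longlonglongrightarrow> g s + 1 - 0"
        using g(2)[of s] s unfolding sums_def by (intro tendsto_intros) auto
      then show ?thesis unfolding sums_def part by (simp add: add.commute)
    qed
  qed
qed

text \<open>
Summation by parts trades each factor \<open>n powr (- s)\<close> for its increment, which is smaller by a factor of order \<open>1/n\<close>.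
\<close>

lemma Dirichlet_series_bounded_partial_sums:
  fixes b :: "nat \<Rightarrow> complex"
  assumes C: "\<And>n. norm (\<Sum>k<n. b (Suc k)) \<le> C"
  obtains H where "H holomorphic_on {s. Re s > 0}"
    "\<And>s. Re s > 0 \<Longrightarrow> (\<lambda>n. b (Suc n) / of_nat (Suc n) powr s) sums H s"
proof -
  define R where "R n = (\<Sum>k<n. b (Suc k))" for n
  define e where "e k s = R (Suc k) * (complex_of_nat (Suc k) powr (- s) - of_nat (Suc (Suc k)) powr (- s))" for k s
  obtain H where H: "H holomorphic_on {s. Re s > 0}" "\<And>s. Re s > 0 \<Longrightarrow> (\<lambda>k. e k s) sums H s"
  proof (rule holomorphic_suminf_comparison[of e "\<lambda>s. C * norm (- s)"])
    show "e k holomorphic_on {s. Re s > 0}" for k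
      unfolding e_def by (intro holomorphic_intros)
    show "norm (e k s) \<le> C * norm (- s) * real (Suc k) powr (- Re s - 1)" if "Re s > 0" for k s
    proof -
      have "norm (e k s) = norm (R (Suc k)) * norm (of_nat (Suc (Suc k)) powr (- s) - complex_of_nat (Suc k) powr (- s))"
        unfolding e_def norm_mult by (simp only: norm_minus_commute)
      also have "\<dots> \<le> C * (norm (- s) * real (Suc k) powr (Re (- s) - 1))"
        unfolding R_def using that
        by (intro mult_mono C powr_nat_Taylor1 order_trans[OF norm_ge_zero C]) auto
      finally show ?thesis by simp
    qed
  qed (auto intro!: continuous_intros)
  show thesis
  proof
    show "(\<lambda>n. b (Suc n) / of_nat (Suc n) powr s) sums H s" if s: "Re s > 0" for s
    proof -
      have part: "(\<Sum>k<N. b (Suc k) / of_nat (Suc k) powr s) = (\<Sum>k<N. e k s) + R N * of_nat (Suc N) powr (- s)" for N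
      proof (induction N)
        case (Suc N)
        have "R (Suc N) = R N + b (Suc N)" by (simp add: R_def)
        with Suc show ?case by (simp add: e_def powr_minus_nat algebra_simps del: of_nat_Suc)
      qed (simp add: R_def)
      have "(\<lambda>N. R N * of_nat (Suc N) powr (- s)) \<longlonglongrightarrow> 0"
      proof (rule Lim_null_comparison)
        show "\<forall>\<^sub>F N in sequentially. norm (R N * of_nat (Suc N) powr (- s)) \<le> C * real (Suc N) powr (- Re s)"
        proof (intro always_eventually allI)
          fix N
          have "norm (R N * of_nat (Suc N) powr (- s)) = norm (R N) * real (Suc N) powr (- Re s)"
            by (simp add: norm_mult norm_powr_real_powr del: of_nat_Suc)
          also have "\<dots> \<le> C * real (Suc N) powr (- Re s)"
            unfolding R_def by (intro mult_right_mono C) simp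
          finally show "norm (R N * of_nat (Suc N) powr (- s)) \<le> C * real (Suc N) powr (- Re s)" .
        qed
        show "(\<lambda>N. C * real (Suc N) powr (- Re s)) \<longlonglongrightarrow> 0" using s by real_asymp
      qed
      then have "(\<lambda>N. (\<Sum>k<N. e k s) + R N * of_nat (Suc N) powr (- s)) \<longlonglongrightarrow> H s + 0"
        using H(2)[of s] s unfolding sums_def by (intro tendsto_intros) auto
      then show ?thesis unfolding sums_def part by simp
    qed
  qed (rule H)
qed

section \<open>Dirichlet characters\<close>

definition dirichlet_char :: "nat \<Rightarrow> (nat \<Rightarrow> complex) \<Rightarrow> bool" where
  "dirichlet_char q \<psi> \<longleftrightarrow> \<psi> 1 = 1 \<and> (\<forall>m n. \<psi> (m * n) = \<psi> m * \<psi> n) \<and>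
     (\<forall>n. \<psi> (n + q) = \<psi> n) \<and> (\<forall>n. \<psi> n = 0 \<longleftrightarrow> \<not> coprime n q)"

definition principal_char :: "nat \<Rightarrow> nat \<Rightarrow> complex" where
  "principal_char q n = (if coprime n q then 1 else 0)"

lemma dirichlet_charD:
  assumes "dirichlet_char q \<psi>"
  shows "\<psi> 1 = 1" "\<And>m n. \<psi> (m * n) = \<psi> m * \<psi> n" "\<And>n. \<psi> (n + q) = \<psi> n"
    "\<And>n. \<psi> n = 0 \<longleftrightarrow> \<not> coprime n q"
  using assms by (auto simp: dirichlet_char_def)

lemma dirichlet_char_principal: "dirichlet_char q (principal_char q)"
proof -
  have "coprime (n + q) q \<longleftrightarrow> coprime n q" for n
    by (simp only: coprime_iff_gcd_eq_1 gcd_add1)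
  then show ?thesis by (auto simp: dirichlet_char_def principal_char_def)
qed

lemma dirichlet_char_square: "dirichlet_char q \<psi> \<Longrightarrow> dirichlet_char q (\<lambda>n. \<psi> n ^ 2)"
  by (auto simp: dirichlet_char_def power_mult_distrib)

lemma periodic_mod:
  fixes f :: "nat \<Rightarrow> 'a"
  assumes "\<And>n. f (n + q) = f n"
  shows "f (n mod q) = f n"
proof -
  have "f (r + k * q) = f r" for r k
  proof (induction k)
    case (Suc k)
    then show ?case using assms[of "r + k * q"] by (simp add: add_ac)
  qed simp
  from this[of "n mod q" "n div q"] show ?thesis by simp
qed

lemma sum_periodic_shift:
  fixes f :: "nat \<Rightarrow> 'a :: ab_group_add"
  assumes "\<And>n. f (n + q) = f n"
  shows "(\<Sum>k<q. f (n + k)) = (\<Sum>k<q. f k)"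
proof (induction n)
  case (Suc n)
  have "(\<Sum>k<q. f (Suc n + k)) + f n = (\<Sum>k<Suc q. f (n + k))"
    by (subst sum.lessThan_Suc_shift) (simp add: add.commute)
  also have "\<dots> = (\<Sum>k<q. f (n + k)) + f (n + q)" by simp
  also have "f (n + q) = f n" by (rule assms)
  finally show ?case using Suc by simp
qed simp

text \<open>
Full periods contribute nothing, so only the finitely many values of incomplete periods occur.
\<close>

lemma bounded_partial_sums_periodic:
  fixes f :: "nat \<Rightarrow> complex"
  assumes per: "\<And>n. f (n + q) = f n" and zero: "(\<Sum>k<q. f k) = 0" and q: "q > 0"
  obtains C where "\<And>n. norm (\<Sum>k<n. f (Suc k)) \<le> C"
proof -
  define F where "F n = (\<Sum>k<n. f (Suc k))" for n
  have "F (n + q) = F n" for n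
  proof -
    have "F (n + m) = F n + (\<Sum>k<m. f (Suc n + k))" for m
      by (induction m) (simp_all add: F_def add.assoc)
    then show ?thesis using sum_periodic_shift[of f q "Suc n", OF per] zero by simp
  qed
  then have F: "F n = F (n mod q)" for n using periodic_mod[of F q n] by simp
  show thesis
  proof
    fix n
    have "norm (F (n mod q)) \<le> (\<Sum>k<q. norm (F k))"
      using q by (intro member_le_sum) auto
    then show "norm (\<Sum>k<n. f (Suc k)) \<le> (\<Sum>k<q. norm (F k))" using F[of n] by (simp add: F_def)
  qed
qed

text \<open>
On numbers coprime to \<open>q\<close> the values are roots of unity, by Euler's theorem.
\<close>

lemma norm_dirichlet_char:
  assumes "dirichlet_char q \<psi>" "q > 0"
  shows "norm (\<psi> n) = (if coprime n q then 1 else 0)"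
proof (cases "coprime n q")
  case True
  note \<psi> = dirichlet_charD[OF assms(1)]
  have "[n ^ totient q = 1] (mod q)" using True by (rule euler_theorem)
  then have e: "n ^ totient q mod q = 1 mod q" unfolding cong_def .
  have "\<psi> (n ^ totient q) = \<psi> (n ^ totient q mod q)"
    by (rule periodic_mod[symmetric, of \<psi> q, OF \<psi>(3)])
  also have "\<dots> = \<psi> 1"
    unfolding e by (rule periodic_mod[of \<psi> q, OF \<psi>(3)])
  finally have "\<psi> (n ^ totient q) = \<psi> 1" .
  moreover have "\<psi> (n ^ k) = \<psi> n ^ k" for k
    by (induction k) (simp_all add: \<psi>(1)[simplified] \<psi>(2))
  ultimately have "\<psi> n ^ totient q = 1" using \<psi>(1) by simp
  then have eq: "norm (\<psi> n) ^ totient q = 1 ^ totient q"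
    unfolding norm_power[symmetric] by (simp only: norm_one power_one)
  have "norm (\<psi> n) = 1"
    by (rule power_eq_imp_eq_base[OF eq]) (use assms(2) in simp_all)
  then show ?thesis using True by (simp only: if_True)
qed (use dirichlet_charD(4)[OF assms(1)] in simp)

text \<open>
Multiplication by a number \<open>a\<close> coprime to \<open>q\<close> permutes the residues and multiplies the sum by \<open>\<psi> a\<close>; for a
non-principal character some \<open>\<psi> a\<close> differs from \<open>1\<close>.
\<close>

lemma sum_dirichlet_char_nonprincipal:
  assumes \<psi>: "dirichlet_char q \<psi>" and q: "q > 0" and np: "\<psi> \<noteq> principal_char q"
  shows "(\<Sum>k<q. \<psi> k) = 0"
proof -
  note \<psi>' = dirichlet_charD[OF \<psi>]
  obtain a where a: "\<psi> a \<noteq> principal_char q a" using np unfolding fun_eq_iff by blast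
  have ca: "coprime a q"
  proof (rule ccontr)
    assume n: "\<not> coprime a q"
    then have "\<psi> a = 0" by (rule iffD2[OF \<psi>'(4)])
    with a n show False by (simp add: principal_char_def)
  qed
  have a1: "\<psi> a \<noteq> 1" using a ca by (simp add: principal_char_def)
  have "inj_on (\<lambda>k. a * k mod q) {..<q}"
  proof (rule inj_onI)
    fix x y assume xy: "x \<in> {..<q}" "y \<in> {..<q}" "a * x mod q = a * y mod q"
    have "[x = y] (mod q)"
      using xy(3) unfolding cong_def[symmetric] by (rule iffD1[OF cong_mult_lcancel_nat[OF ca]])
    then show "x = y" using xy(1,2) unfolding cong_def by simp
  qed
  then have bij: "bij_betw (\<lambda>k. a * k mod q) {..<q} {..<q}"
    using q by (intro bij_betw_imageI endo_inj_surj) auto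
  have "(\<Sum>k<q. \<psi> k) = (\<Sum>k<q. \<psi> (a * k mod q))"
    by (rule sum.reindex_bij_betw[OF bij, symmetric])
  also have "\<dots> = (\<Sum>k<q. \<psi> a * \<psi> k)"
    by (intro sum.cong refl) (simp only: periodic_mod[of \<psi> q, OF \<psi>'(3)] \<psi>'(2))
  also have "\<dots> = \<psi> a * (\<Sum>k<q. \<psi> k)" by (rule sum_distrib_left[symmetric])
  finally have "(\<Sum>k<q. \<psi> k) - \<psi> a * (\<Sum>k<q. \<psi> k) = 0"
    by (rule iffD2[OF right_minus_eq])
  then have "(1 - \<psi> a) * (\<Sum>k<q. \<psi> k) = 0" by (simp only: left_diff_distrib mult_1)
  then show ?thesis using a1 by simp
qed

lemma L_continuation_nonprincipal:
  assumes "dirichlet_char q \<psi>" "q > 0" "\<psi> \<noteq> principal_char q"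
  obtains H C where "H holomorphic_on {s. Re s > 0}"
    "\<And>s. Re s > 0 \<Longrightarrow> (\<lambda>n. \<psi> (Suc n) / of_nat (Suc n) powr s) sums H s"
    "\<And>n. norm (\<Sum>k<n. \<psi> (Suc k)) \<le> C"
proof -
  obtain C where C: "\<And>n. norm (\<Sum>k<n. \<psi> (Suc k)) \<le> C"
    by (rule bounded_partial_sums_periodic[of \<psi> q, OF dirichlet_charD(3)[OF assms(1)]
      sum_dirichlet_char_nonprincipal[OF assms] assms(2)], rule that)
  obtain H where H: "H holomorphic_on {s. Re s > 0}"
    "\<And>s. Re s > 0 \<Longrightarrow> (\<lambda>n. \<psi> (Suc n) / of_nat (Suc n) powr s) sums H s"
    by (rule Dirichlet_series_bounded_partial_sums[of \<psi>, OF C], rule that)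
  show ?thesis by (rule that[OF H C])
qed

text \<open>
After subtracting its mean value \<open>c\<close> the principal character has bounded partial sums; the constant part contributes
\<open>c\<close> times the continuation of \<open>(s - 1) \<zeta>(s)\<close>. Hence \<open>K 1 = c \<noteq> 0\<close>.
\<close>

lemma L_continuation_principal:
  assumes q: "q > 0"
  obtains K where "K holomorphic_on {s. Re s > 0}" "K 1 \<noteq> 0"
    "\<And>s. Re s > 1 \<Longrightarrow> (\<lambda>n. (s - 1) * (principal_char q (Suc n) / of_nat (Suc n) powr s)) sums K s"
proof -
  let ?\<psi> = "principal_char q"
  define c where "c = (\<Sum>k<q. ?\<psi> k) / of_nat q"
  have per: "?\<psi> (n + q) = ?\<psi> n" for n using dirichlet_charD(3)[OF dirichlet_char_principal] .
  have c0: "c \<noteq> 0"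
  proof -
    have "(\<Sum>k<q. ?\<psi> k) = of_nat (card {k\<in>{..<q}. coprime k q})"
      by (simp add: principal_char_def sum.If_cases Int_def conj_commute)
    moreover have "1 mod q \<in> {k\<in>{..<q}. coprime k q}" using q by (cases "q = 1") auto
    then have "card {k\<in>{..<q}. coprime k q} > 0" by (subst card_gt_0_iff) auto
    ultimately obtain m where "(\<Sum>k<q. ?\<psi> k) = of_nat m" "m > 0" by blast
    then show ?thesis using q by (simp add: c_def)
  qed
  obtain C where C: "\<And>n. norm (\<Sum>k<n. ?\<psi> (Suc k) - c) \<le> C"
  proof -
    have "(\<Sum>k<q. ?\<psi> k - c) = 0" using q by (simp add: sum_subtractf c_def)
    moreover have "?\<psi> (n + q) - c = ?\<psi> n - c" for n by (simp only: per)
    ultimately show ?thesis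
      using bounded_partial_sums_periodic[of "\<lambda>n. ?\<psi> n - c" q] that q by blast
  qed
  obtain H where H: "H holomorphic_on {s. Re s > 0}"
    "\<And>s. Re s > 0 \<Longrightarrow> (\<lambda>n. (?\<psi> (Suc n) - c) / of_nat (Suc n) powr s) sums H s"
    by (rule Dirichlet_series_bounded_partial_sums[of "\<lambda>n. ?\<psi> n - c", OF C], rule that)
  obtain E where E: "E holomorphic_on {s. Re s > 0}" "E 1 = 1"
    "\<And>s. Re s > 1 \<Longrightarrow> (\<lambda>n. (s - 1) * (1 / of_nat (Suc n) powr s)) sums E s"
    by (rule zeta_continuation, rule that)
  show thesis
  proof
    show "(\<lambda>s. c * E s + (s - 1) * H s) holomorphic_on {s. Re s > 0}"
      by (intro holomorphic_intros E H)
    show "c * E 1 + (1 - 1) * H 1 \<noteq> 0" using c0 E by simp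
    show "(\<lambda>n. (s - 1) * (?\<psi> (Suc n) / of_nat (Suc n) powr s)) sums (c * E s + (s - 1) * H s)" if s: "Re s > 1" for s
    proof -
      have "(\<lambda>n. c * ((s - 1) * (1 / of_nat (Suc n) powr s)) + (s - 1) * ((?\<psi> (Suc n) - c) / of_nat (Suc n) powr s))
          sums (c * E s + (s - 1) * H s)"
        by (rule sums_add[OF sums_mult[OF E(3)[OF s]] sums_mult[OF H(2)]]) (use s in simp)
      moreover have "c * ((s - 1) * (1 / of_nat (Suc n) powr s)) + (s - 1) * ((?\<psi> (Suc n) - c) / of_nat (Suc n) powr s)
          = (s - 1) * (?\<psi> (Suc n) / of_nat (Suc n) powr s)" for n
      proof -
        have "c * ((s - 1) * (1 / p)) + (s - 1) * ((v - c) / p) = (s - 1) * (v / p)" for p v :: complex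
          unfolding diff_divide_distrib by (simp add: right_diff_distrib mult_ac)
        then show ?thesis .
      qed
      ultimately show ?thesis by (simp only:)
    qed
  qed
qed

section \<open>Non-vanishing on the line Re s = 1\<close>

lemma sums_Suc_imp_suminf:
  fixes f :: "nat \<Rightarrow> complex"
  assumes "(\<lambda>n. f (Suc n)) sums S" "f 0 = 0"
  shows "(\<Sum>n. f n) = S"
proof -
  have "f sums (S + f 0)" by (rule iffD1[OF sums_Suc_iff assms(1)])
  then show ?thesis using assms(2) by (simp add: sums_iff)
qed

lemma
  assumes \<psi>: "dirichlet_char q \<psi>" and q: "q > 0" and s: "Re s > 1"
  defines "g \<equiv> \<lambda>n. \<psi> n / complex_of_nat n powr s"
  shows char_series_0: "g 0 = 0" and char_series_1: "g 1 = 1"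
    and char_series_mult: "\<And>m n. g (m * n) = g m * g n"
    and char_series_summable: "summable (\<lambda>n. norm (g n))"
proof -
  note \<psi>' = dirichlet_charD[OF \<psi>]
  show "g 0 = 0" by (simp add: g_def)
  show "g 1 = 1" using \<psi>'(1) by (simp add: g_def)
  show "g (m * n) = g m * g n" for m n
    by (simp add: g_def \<psi>'(2) powr_times_real)
  show "summable (\<lambda>n. norm (g n))"
  proof (rule summable_comparison_test')
    show "summable (\<lambda>n. real n powr (- Re s))" using s by (simp add: summable_real_powr_iff)
    show "norm (norm (g n)) \<le> real n powr (- Re s)" for n
      using norm_dirichlet_char[OF \<psi> q, of n]
      by (simp add: g_def norm_mult norm_inverse norm_powr_real_powr powr_minus divide_inverse)
  qed
qed

text \<open>
\<open>DL \<psi>\<close> is the \<open>L\<close>-series of \<open>\<psi>\<close>, and \<open>DM \<psi>\<close> the Dirichlet series of \<open>\<mu> \<psi>\<close>. The term for \<open>n = 0\<close> vanishes because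
\<open>0 powr s = 0\<close>.
\<close>

definition DL :: "(nat \<Rightarrow> complex) \<Rightarrow> complex \<Rightarrow> complex" where
  "DL \<psi> s = (\<Sum>n. \<psi> n / of_nat n powr s)"

definition DM :: "(nat \<Rightarrow> complex) \<Rightarrow> complex \<Rightarrow> complex" where
  "DM \<psi> s = (\<Sum>n. of_int (moebius_mu n) * (\<psi> n / of_nat n powr s))"

lemma DL_eqI:
  assumes "(\<lambda>n. \<psi> (Suc n) / of_nat (Suc n) powr s) sums S"
  shows "DL \<psi> s = S"
  unfolding DL_def by (rule sums_Suc_imp_suminf) (use assms in simp_all)

lemma L_principal:
  assumes q: "q > 0"
  obtains K where "K holomorphic_on {s. Re s > 0}" "K 1 \<noteq> 0"
    "\<And>s. Re s > 1 \<Longrightarrow> DL (principal_char q) s = K s / (s - 1)"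
proof -
  obtain K where K: "K holomorphic_on {s. Re s > 0}" "K 1 \<noteq> 0"
    "\<And>s. Re s > 1 \<Longrightarrow> (\<lambda>n. (s - 1) * (principal_char q (Suc n) / of_nat (Suc n) powr s)) sums K s"
    by (rule L_continuation_principal[OF q], rule that)
  have K': "DL (principal_char q) s = K s / (s - 1)" if "Re s > 1" for s
  proof -
    have ne: "s - 1 \<noteq> 0" using that by auto
    have "(\<lambda>n. (s - 1) * (principal_char q (Suc n) / of_nat (Suc n) powr s) / (s - 1)) sums (K s / (s - 1))"
      by (rule sums_divide[OF K(3)[OF that]])
    then have "(\<lambda>n. principal_char q (Suc n) / of_nat (Suc n) powr s) sums (K s / (s - 1))"
      using ne by (simp del: of_nat_Suc)
    then show ?thesis by (rule DL_eqI)
  qed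
  show thesis by (rule that[OF K(1,2) K'])
qed

lemma DL_mult_DM:
  assumes "dirichlet_char q \<psi>" "q > 0" "Re s > 1"
  shows "DL \<psi> s * DM \<psi> s = 1"
  unfolding DL_def DM_def
  by (rule Euler_product_moebius(2)[OF char_series_0[OF assms] char_series_1[OF assms]
    char_series_mult[OF assms] char_series_summable[OF assms]])

lemma DM_sums:
  assumes "dirichlet_char q \<psi>" "q > 0" "Re s > 1"
  shows "(\<lambda>n. of_int (moebius_mu (Suc n)) * \<psi> (Suc n) / of_nat (Suc n) powr s) sums DM \<psi> s"
proof -
  let ?f = "\<lambda>n. of_int (moebius_mu n) * (\<psi> n / of_nat n powr s)"
  have "summable (\<lambda>n. norm (?f n))"
  proof (rule summable_comparison_test'[OF char_series_summable[OF assms]])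
    show "norm (norm (?f n)) \<le> norm (\<psi> n / of_nat n powr s)" for n
    proof -
      have "norm (complex_of_int (moebius_mu n)) \<le> 1"
        using abs_moebius_mu_le[of n] by (simp flip: of_int_abs)
      then have "norm (?f n) \<le> 1 * norm (\<psi> n / of_nat n powr s)"
        unfolding norm_mult by (rule mult_right_mono[OF _ norm_ge_zero])
      then show ?thesis by (simp only: real_norm_def abs_norm_cancel mult_1)
    qed
  qed
  then have "summable ?f" by (rule summable_norm_cancel)
  then have "?f sums DM \<psi> s" unfolding DM_def by (rule summable_sums)
  moreover have "?f 0 = 0" by simp
  ultimately have "(\<lambda>n. ?f (Suc n)) sums DM \<psi> s" using sums_Suc_iff[of ?f "DM \<psi> s"] by simp
  then show ?thesis by (simp only: times_divide_eq_right)
qed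

text \<open>
The inequality for a single Euler factor, multiplied over all primes and inverted.
\<close>

lemma three_four_one_L:
  assumes \<psi>: "dirichlet_char q \<psi>" and q: "q > 0" and \<sigma>: "\<sigma> > 1"
  shows "norm (DL (principal_char q) (of_real \<sigma>)) ^ 3 * norm (DL \<psi> (of_real \<sigma> + \<i> * of_real t)) ^ 4
    * norm (DL (\<lambda>n. \<psi> n ^ 2) (of_real \<sigma> + \<i> * of_real (2 * t))) \<ge> 1"
proof -
  define \<psi>0 where "\<psi>0 = principal_char q"
  define \<psi>2 where "\<psi>2 = (\<lambda>n. \<psi> n ^ 2)"
  define s0 where "s0 = complex_of_real \<sigma>"
  define s1 where "s1 = of_real \<sigma> + \<i> * complex_of_real t"
  define s2 where "s2 = of_real \<sigma> + \<i> * complex_of_real (2 * t)"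
  have chars: "dirichlet_char q \<psi>0" "dirichlet_char q \<psi>2"
    unfolding \<psi>0_def \<psi>2_def using dirichlet_char_principal dirichlet_char_square[OF \<psi>] by auto
  have res: "Re s0 > 1" "Re s1 > 1" "Re s2 > 1" using \<sigma> by (auto simp: s0_def s1_def s2_def)
  define P where "P x = {p::nat. prime p \<and> p \<le> x}" for x
  define F where "F \<psi> s x = (\<Prod>p\<in>P x. 1 - \<psi> p / complex_of_nat p powr s)" for \<psi> s x
  have lim: "F \<psi> s \<longlonglongrightarrow> DM \<psi> s" if "dirichlet_char q \<psi>" "Re s > 1" for \<psi> s
    unfolding F_def P_def DM_def
    by (rule Euler_product_moebius(1)[OF char_series_0[OF that(1) q that(2)] char_series_1[OF that(1) q that(2)]
      char_series_mult[OF that(1) q that(2)] char_series_summable[OF that(1) q that(2)]])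
  have factor: "norm (1 - \<psi>0 p / of_nat p powr s0) ^ 3 * norm (1 - \<psi> p / of_nat p powr s1) ^ 4
      * norm (1 - \<psi>2 p / of_nat p powr s2) \<le> 1" if p: "prime p" for p
  proof (cases "coprime p q")
    case True
    have p1: "p > 1" using p prime_gt_1_nat by blast
    define r where "r = real p powr (- \<sigma>)"
    define z where "z = \<psi> p * complex_of_nat p powr (- (\<i> * of_real t))"
    have r: "0 \<le> r" "r < 1" using p1 \<sigma> by (auto simp: r_def powr_less_one)
    have nz: "norm z = 1"
      using p1 norm_dirichlet_char[OF \<psi> q, of p] True
      by (simp add: z_def norm_mult norm_powr_real_powr)
    have n0: "complex_of_nat p \<noteq> 0" using p1 by simp
    have pr: "complex_of_nat p powr (- of_real \<sigma>) = of_real r"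
    proof -
      have "complex_of_real (real p) powr (complex_of_real (- \<sigma>)) = of_real (real p powr (- \<sigma>))"
        by (rule powr_of_real) simp
      then show ?thesis by (simp add: r_def)
    qed
    have inv: "a / complex_of_nat p powr s = a * complex_of_nat p powr (- s)" for a s
      using p1 by (simp add: powr_def exp_minus divide_inverse)
    have add: "complex_of_nat p powr (a + b) = complex_of_nat p powr a * complex_of_nat p powr b" for a b
      by (rule powr_add)
    have e0: "\<psi>0 p / of_nat p powr s0 = of_real r"
      using True by (simp add: inv s0_def \<psi>0_def principal_char_def pr)
    have "- s1 = - of_real \<sigma> + - (\<i> * of_real t)" by (simp add: s1_def)
    then have e1: "\<psi> p / of_nat p powr s1 = of_real r * z"
      by (simp only: inv add pr z_def mult_ac)
    have "- s2 = - of_real \<sigma> + (- (\<i> * of_real t) + - (\<i> * of_real t))" by (simp add: s2_def)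
    then have e2: "\<psi>2 p / of_nat p powr s2 = of_real r * z\<^sup>2"
      by (simp only: inv add pr z_def mult_ac \<psi>2_def power2_eq_square)
    show ?thesis unfolding e0 e1 e2 by (rule three_four_one[OF nz r])
  next
    case False
    then show ?thesis
      using dirichlet_charD(4)[OF \<psi>, of p] by (simp add: \<psi>0_def \<psi>2_def principal_char_def)
  qed
  have "norm (F \<psi>0 s0 x) ^ 3 * norm (F \<psi> s1 x) ^ 4 * norm (F \<psi>2 s2 x) \<le> 1" for x
  proof -
    have "norm (F \<psi>0 s0 x) ^ 3 * norm (F \<psi> s1 x) ^ 4 * norm (F \<psi>2 s2 x)
      = (\<Prod>p\<in>P x. norm (1 - \<psi>0 p / of_nat p powr s0) ^ 3 * norm (1 - \<psi> p / of_nat p powr s1) ^ 4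
      * norm (1 - \<psi>2 p / of_nat p powr s2))"
      by (simp only: F_def prod_norm[symmetric] prod_power_distrib prod.distrib)
    also have "\<dots> \<le> 1"
      by (rule prod_le_1) (use factor in \<open>auto simp: P_def\<close>)
    finally show ?thesis .
  qed
  moreover have "(\<lambda>x. norm (F \<psi>0 s0 x) ^ 3 * norm (F \<psi> s1 x) ^ 4 * norm (F \<psi>2 s2 x)) \<longlonglongrightarrow>
      norm (DM \<psi>0 s0) ^ 3 * norm (DM \<psi> s1) ^ 4 * norm (DM \<psi>2 s2)"
    by (intro tendsto_intros lim chars \<psi> res)
  ultimately have le: "norm (DM \<psi>0 s0) ^ 3 * norm (DM \<psi> s1) ^ 4 * norm (DM \<psi>2 s2) \<le> 1"
    by (intro LIMSEQ_le_const2) auto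
  have nn: "norm (DL \<psi> s) * norm (DM \<psi> s) = 1" if "dirichlet_char q \<psi>" "Re s > 1" for \<psi> s
    using DL_mult_DM[OF that(1) q that(2)] by (metis norm_mult norm_one)
  have "norm (DL \<psi>0 s0) ^ 3 * norm (DL \<psi> s1) ^ 4 * norm (DL \<psi>2 s2) *
      (norm (DM \<psi>0 s0) ^ 3 * norm (DM \<psi> s1) ^ 4 * norm (DM \<psi>2 s2))
      = (norm (DL \<psi>0 s0) * norm (DM \<psi>0 s0)) ^ 3 * (norm (DL \<psi> s1) * norm (DM \<psi> s1)) ^ 4
        * (norm (DL \<psi>2 s2) * norm (DM \<psi>2 s2))"
    by (simp only: power_mult_distrib mult_ac)
  also have "\<dots> = 1"
    by (simp only: nn chars \<psi> res power_one mult_1)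
  finally have one: "norm (DL \<psi>0 s0) ^ 3 * norm (DL \<psi> s1) ^ 4 * norm (DL \<psi>2 s2) *
      (norm (DM \<psi>0 s0) ^ 3 * norm (DM \<psi> s1) ^ 4 * norm (DM \<psi>2 s2)) = 1" .
  have "1 \<le> norm (DL \<psi>0 s0) ^ 3 * norm (DL \<psi> s1) ^ 4 * norm (DL \<psi>2 s2)"
    unfolding one[symmetric] by (rule mult_left_le[OF le]) (intro mult_nonneg_nonneg zero_le_power norm_ge_zero)
  then show ?thesis by (simp only: \<psi>0_def \<psi>2_def s0_def s1_def s2_def)
qed

text \<open>
If \<open>L\<close> vanished at \<open>1 + i t\<close>, then approaching the line the product of the 3-4-1 inequality would have a zero of order at
least \<open>4\<close> against a pole of order \<open>3\<close>, provided the third factor, at \<open>1 + 2 i t\<close>, stays finite. The functions \<open>N\<close> and \<open>N2\<close> stand for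
continuations of the two \<open>L\<close>-series near these points.
\<close>

lemma L_nonzero_by_341:
  assumes \<psi>: "dirichlet_char q \<psi>" and q: "q > 0"
    and N: "N field_differentiable (at (1 + \<i> * of_real t))"
      "\<And>s. Re s > 1 \<Longrightarrow> DL \<psi> s = N s"
    and N2: "isCont N2 (1 + \<i> * of_real (2 * t))" "\<And>s. Re s > 1 \<Longrightarrow> DL (\<lambda>n. \<psi> n ^ 2) s = N2 s"
  shows "N (1 + \<i> * of_real t) \<noteq> 0"
proof
  assume zero: "N (1 + \<i> * of_real t) = 0"
  obtain K where K: "K holomorphic_on {s. Re s > 0}" "K 1 \<noteq> 0"
    "\<And>s. Re s > 1 \<Longrightarrow> DL (principal_char q) s = K s / (s - 1)"
    by (rule L_principal[OF q], rule that)
  have K': "(s - 1) * DL (principal_char q) s = K s" if "Re s > 1" for s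
    using that K(3)[OF that] by auto
  define e where "e k = 1 / real (Suc k)" for k
  have e: "e k > 0" for k by (simp add: e_def)
  have elim: "e \<longlonglongrightarrow> 0" unfolding e_def by real_asymp
  have elim': "(\<lambda>k. complex_of_real (e k)) \<longlonglongrightarrow> 0" using tendsto_of_real[OF elim] by simp
  obtain d where d: "(N has_field_derivative d) (at (1 + \<i> * of_real t))"
    using N(1) by (auto simp: field_differentiable_def)
  have l1: "(\<lambda>k. K (1 + of_real (e k))) \<longlonglongrightarrow> K 1"
  proof -
    have "isCont K 1"
      using holomorphic_on_imp_differentiable_at[OF K(1) open_halfspace_Re_gt]
      by (intro field_differentiable_imp_continuous_at) simp
    moreover have "(\<lambda>k. 1 + complex_of_real (e k)) \<longlonglongrightarrow> 1 + 0" by (intro tendsto_intros elim')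
    ultimately show ?thesis using isCont_tendsto_compose[of 1 K] by simp
  qed
  have l2: "(\<lambda>k. N (1 + \<i> * of_real t + of_real (e k)) / of_real (e k)) \<longlonglongrightarrow> d"
  proof -
    have "((\<lambda>h. (N (1 + \<i> * of_real t + h) - N (1 + \<i> * of_real t)) / h) \<longlongrightarrow> d) (at 0)"
      using d by (simp add: DERIV_def)
    moreover have "filterlim (\<lambda>k. complex_of_real (e k)) (at 0) sequentially"
      using e elim' by (auto simp: filterlim_at less_imp_neq[symmetric] intro!: always_eventually)
    ultimately have "(\<lambda>k. (N (1 + \<i> * of_real t + of_real (e k)) - N (1 + \<i> * of_real t)) / of_real (e k)) \<longlonglongrightarrow> d"
      by (rule filterlim_compose)
    then show ?thesis by (simp add: zero)
  qed
  have l3: "(\<lambda>k. N2 (1 + \<i> * of_real (2 * t) + of_real (e k))) \<longlonglongrightarrow> N2 (1 + \<i> * of_real (2 * t))"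
  proof -
    have "(\<lambda>k. 1 + \<i> * of_real (2 * t) + of_real (e k)) \<longlonglongrightarrow> 1 + \<i> * of_real (2 * t) + 0"
      by (intro tendsto_intros elim')
    then show ?thesis using isCont_tendsto_compose[OF N2(1)] by simp
  qed
  \<comment> \<open>The 3-4-1 product at 1 + e k, with the powers of e k distributed so that each factor has a limit; one factor e k is left over.\<close>
  define X where "X k = norm (K (1 + of_real (e k))) ^ 3 * norm (N (1 + \<i> * of_real t + of_real (e k)) / of_real (e k)) ^ 4
      * (e k * norm (N2 (1 + \<i> * of_real (2 * t) + of_real (e k))))" for k
  have "X \<longlonglongrightarrow> norm (K 1) ^ 3 * norm d ^ 4 * (0 * norm (N2 (1 + \<i> * of_real (2 * t))))"
    unfolding X_def by (intro tendsto_intros l1 l2 l3 elim)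
  then have X0: "X \<longlonglongrightarrow> 0" by simp
  have "1 \<le> X k" for k
  proof -
    define \<sigma> where "\<sigma> = 1 + e k"
    have \<sigma>: "\<sigma> > 1" using e by (simp add: \<sigma>_def)
    define A where "A = norm (DL (principal_char q) (of_real \<sigma>))"
    define B where "B = norm (DL \<psi> (of_real \<sigma> + \<i> * of_real t))"
    define C where "C = norm (DL (\<lambda>n. \<psi> n ^ 2) (of_real \<sigma> + \<i> * of_real (2 * t)))"
    have "norm (K (1 + of_real (e k))) = e k * A"
    proof -
      have "K (1 + of_real (e k)) = of_real (e k) * DL (principal_char q) (of_real \<sigma>)"
        using K'[of "of_real \<sigma>"] \<sigma> by (simp add: \<sigma>_def)
      then show ?thesis using e[of k] by (simp add: A_def norm_mult)
    qed
    moreover have "norm (N (1 + \<i> * of_real t + of_real (e k)) / of_real (e k)) = B / e k"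
      using N(2)[of "of_real \<sigma> + \<i> * of_real t"] \<sigma> e[of k] by (simp add: B_def \<sigma>_def norm_divide add_ac)
    moreover have "norm (N2 (1 + \<i> * of_real (2 * t) + of_real (e k))) = C"
      using N2(2)[of "of_real \<sigma> + \<i> * of_real (2 * t)"] \<sigma> e[of k] by (simp add: C_def \<sigma>_def add_ac)
    ultimately have "X k = (e k * A) ^ 3 * (B / e k) ^ 4 * (e k * C)" by (simp only: X_def)
    also have "\<dots> = A ^ 3 * B ^ 4 * C"
    proof -
      have "(e k * A) ^ 3 * (B / e k) ^ 4 * (e k * C) = A ^ 3 * B ^ 4 * C * (e k ^ 3 * e k / e k ^ 4)"
        by (simp only: power_mult_distrib power_divide times_divide_eq_left times_divide_eq_right mult_ac)
      also have "e k ^ 3 * e k = e k ^ 4" by (simp only: power_Suc2[symmetric]) simp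
      finally show ?thesis using e[of k] by simp
    qed
    also have "\<dots> \<ge> 1" unfolding A_def B_def C_def by (rule three_four_one_L[OF \<psi> q \<sigma>])
    finally show ?thesis .
  qed
  then have "1 \<le> (0::real)" by (intro LIMSEQ_le_const[OF X0]) auto
  then show False by simp
qed

section \<open>Real characters at s = 1\<close>

text \<open>
The divisor sum is multiplicative. At a prime power \<open>p\<^sup>k\<close> it equals \<open>1 + f p + \<dots> + (f p)\<^sup>k\<close>, which is nonnegative for
\<open>f p\<close> in \<open>{-1, 0, 1}\<close>, and at least \<open>1\<close> for even \<open>k\<close>.
\<close>

lemma divisor_sum_nonneg:
  fixes f :: "nat \<Rightarrow> real"
  assumes f1: "f 1 = 1" and fm: "\<And>m n. f (m * n) = f m * f n"
    and fv: "\<And>n. f n \<in> {-1, 0, 1}" and n: "n > 0"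
  shows "(\<Sum>d | d dvd n. f d) \<ge> 0" and "(\<Sum>d | d dvd n\<^sup>2. f d) \<ge> 1"
proof -
  define r where "r n = (\<Sum>d | d dvd n. f d)" for n
  have fp: "f (p ^ i) = f p ^ i" for p i
    by (induction i) (use f1 fm in simp_all)
  have step: "r (p ^ a * m) = (\<Sum>i\<le>a. f p ^ i) * r m" if p: "prime p" "\<not> p dvd m" "m > 0" for p a m
  proof -
    have cop: "coprime (p ^ i) e" if "e dvd m" for i e
      using p that by (metis coprime_power_left_iff dvd_trans prime_imp_coprime)
    have "{d. d dvd p ^ a * m} = (\<lambda>(i, e). p ^ i * e) ` ({..a} \<times> {e. e dvd m})"
    proof (intro equalityI subsetI)
      fix d assume "d \<in> {d. d dvd p ^ a * m}"
      then obtain b c where "d = b * c" "b dvd p ^ a" "c dvd m" using division_decomp[of d "p ^ a" m] by blast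
      then show "d \<in> (\<lambda>(i, e). p ^ i * e) ` ({..a} \<times> {e. e dvd m})"
        using divides_primepow_nat[OF p(1), of b a] by auto
    qed (auto intro!: mult_dvd_mono le_imp_power_dvd)
    moreover have "inj_on (\<lambda>(i, e). p ^ i * e) ({..a} \<times> {e. e dvd m})"
    proof (rule inj_onI, clarify)
      fix i e j e' assume *: "e dvd m" "e' dvd m" "p ^ i * e = p ^ j * e'"
      have nd: "\<not> p dvd e" "\<not> p dvd e'" using * p dvd_trans by blast+
      have e0: "e \<noteq> 0" "e' \<noteq> 0" by (rule notI, use nd in simp)+
      have mult: "multiplicity p (p ^ i * e) = i" if "\<not> p dvd e" "e \<noteq> 0" for i e
        using p(1) that by (simp add: prime_elem_multiplicity_mult_distrib not_dvd_imp_multiplicity_0)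
      have "i = j" using mult[OF nd(1) e0(1), of i] mult[OF nd(2) e0(2), of j] *(3) by simp
      then show "i = j \<and> e = e'" using *(3) p(1) prime_gt_0_nat by simp
    qed
    ultimately have "r (p ^ a * m) = (\<Sum>(i, e)\<in>{..a} \<times> {e. e dvd m}. f (p ^ i * e))"
      unfolding r_def by (simp add: sum.reindex case_prod_unfold)
    also have "\<dots> = (\<Sum>i\<le>a. f p ^ i) * r m"
      by (simp add: sum.cartesian_product[symmetric] fm fp r_def sum_product)
    finally show ?thesis .
  qed
  have geo: "(\<Sum>i\<le>a. f p ^ i) \<ge> 0" "even a \<Longrightarrow> (\<Sum>i\<le>a. f p ^ i) \<ge> 1" for a p
  proof -
    consider "f p = 0" | "f p = 1" | "f p = -1" using fv by blast
    then have "(\<Sum>i\<le>a. f p ^ i) \<ge> 0 \<and> (even a \<longrightarrow> (\<Sum>i\<le>a. f p ^ i) \<ge> 1)"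
    proof cases
      case 3
      have "(\<Sum>i\<le>a. (-1::real) ^ i) = (if even a then 1 else 0)" by (induction a) auto
      then show ?thesis using 3 by auto
    qed (auto simp: power_0_left)
    then show "(\<Sum>i\<le>a. f p ^ i) \<ge> 0" "even a \<Longrightarrow> (\<Sum>i\<le>a. f p ^ i) \<ge> 1" by auto
  qed
  have "r n \<ge> 0 \<and> r (n\<^sup>2) \<ge> 1" using n
  proof (induction n rule: less_induct)
    case (less n)
    show ?case
    proof (cases "n = 1")
      case True
      then show ?thesis using f1 by (simp add: r_def)
    next
      case False
      then obtain p where p: "prime p" "p dvd n" using prime_factor_nat by blast
      define a where "a = multiplicity p n"
      obtain m where m: "n = p ^ a * m" "\<not> p dvd m"
        using multiplicity_decompose'[of n p] less.prems p(1) unfolding a_def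
        by (metis not_gr0 not_prime_unit)
      have m0: "m > 0" using m less.prems by (cases m) auto
      have a0: "a > 0" using p less.prems unfolding a_def by (simp add: prime_multiplicity_gt_zero_iff)
      have "p ^ a > 1" by (rule one_less_power[OF prime_gt_1_nat[OF p(1)] a0])
      then have mn: "m < n" using m(1) m0 by simp
      have IH: "r m \<ge> 0" "r (m\<^sup>2) \<ge> 1" using less.IH[OF mn m0] by auto
      have "r n \<ge> 0" unfolding m(1) step[OF p(1) m(2) m0] using geo(1) IH by simp
      moreover have "n\<^sup>2 = p ^ (2 * a) * m\<^sup>2" unfolding m(1) by (simp add: power_mult_distrib power_mult[symmetric] mult.commute)
      moreover have "\<not> p dvd m\<^sup>2" using p(1) m(2) by (simp add: prime_dvd_power_iff)
      ultimately show ?thesis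
        using step[of p "m\<^sup>2" "2 * a"] p(1) m0 geo(2)[of "2 * a" p] IH(2)
          mult_mono[of 1 "(\<Sum>i\<le>2 * a. f p ^ i)" 1 "r (m\<^sup>2)"] by simp
    qed
  qed
  then show "(\<Sum>d | d dvd n. f d) \<ge> 0" "(\<Sum>d | d dvd n\<^sup>2. f d) \<ge> 1" by (auto simp: r_def)
qed

lemma abel_decreasing_bound:
  fixes a b :: "nat \<Rightarrow> real"
  assumes C: "\<And>n. \<bar>\<Sum>k<n. a k\<bar> \<le> C" and dec: "\<And>k. b (Suc k) \<le> b k" and nn: "\<And>k. b k \<ge> 0"
  shows "\<bar>\<Sum>k<n. a k * b k\<bar> \<le> C * b 0"
proof -
  define R where "R n = (\<Sum>k<n. a k)" for n
  have id: "(\<Sum>k<n. a k * b k) = (\<Sum>k<n. R (Suc k) * (b k - b (Suc k))) + R n * b n" for n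
    by (induction n) (simp_all add: R_def algebra_simps)
  have RC: "\<bar>R m\<bar> \<le> C" for m unfolding R_def by (rule C)
  have "\<bar>\<Sum>k<n. a k * b k\<bar> \<le> (\<Sum>k<n. \<bar>R (Suc k) * (b k - b (Suc k))\<bar>) + \<bar>R n * b n\<bar>"
    unfolding id using sum_abs[of "\<lambda>k. R (Suc k) * (b k - b (Suc k))" "{..<n}"] by linarith
  also have "\<dots> \<le> (\<Sum>k<n. C * (b k - b (Suc k))) + C * b n"
    using RC dec nn by (intro add_mono sum_mono) (auto simp: abs_mult intro!: mult_right_mono)
  also have "\<dots> = C * b 0"
    unfolding sum_distrib_left[symmetric] sum_lessThan_telescope' by (simp add: right_diff_distrib)
  finally show ?thesis .
qed

text \<open>
The difference between the weights of the series for \<open>L(1)\<close> and \<open>(1 - x)\<close> times those of the Lambert series is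
nonnegative and decreasing, so that Abel summation applies to it uniformly in \<open>x\<close>. With \<open>G n = 1 + x + \<dots> + x\<^sup>n\<^sup>-\<^sup>1\<close>
monotonicity amounts to \<open>n (n + 1) x\<^sup>n \<le> G n * G (n + 1)\<close>, an instance of the inequality between arithmetic and
geometric means.
\<close>

lemma monsky_weights:
  fixes x :: real and k :: nat
  assumes x: "0 < x" "x < 1"
  defines "b \<equiv> \<lambda>k. 1 / real (Suc k) - (1 - x) * (x ^ Suc k / (1 - x ^ Suc k))"
  shows "b (Suc k) \<le> b k" and "b k \<ge> 0"
proof -
  define G where "G n = (\<Sum>j<n. x ^ j)" for n
  have G: "1 - x ^ n = (1 - x) * G n" for n
    unfolding G_def by (rule one_diff_power_eq)
  have Gpos: "G (Suc n) > 0" for n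
    unfolding G_def using x by (intro sum_pos) auto
  have b: "b k = 1 / real (Suc k) - x ^ Suc k / G (Suc k)" for k
    using x unfolding b_def G by (simp del: power_Suc of_nat_Suc)
  have Glow: "real n * x ^ n \<le> G n" for n
  proof -
    have "(\<Sum>j<n. x ^ n) \<le> G n" unfolding G_def using x by (intro sum_mono power_decreasing) auto
    then show ?thesis by simp
  qed
  show "b k \<ge> 0"
  proof -
    have "x ^ Suc k / G (Suc k) \<le> 1 / real (Suc k)"
      using Glow[of "Suc k"] Gpos[of k] by (simp add: field_simps del: power_Suc)
    then show ?thesis by (simp add: b)
  qed
  have amgm: "(real n)\<^sup>2 * x ^ n \<le> (G n)\<^sup>2 * x" for n
  proof -
    have sq: "real n * sqrt (x ^ n) \<le> G n * sqrt x"
    proof -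
      \<comment> \<open>Pair the j-th term of G n with the j-th from the end.\<close>
      have p: "2 * sqrt (x ^ n) \<le> sqrt x * (x ^ j + x ^ (n - Suc j))" if "j < n" for j
      proof -
        have "x ^ n = x * (x ^ j * x ^ (n - Suc j))"
          using that by (simp add: power_add[symmetric] flip: power_Suc)
        then have "sqrt (x ^ n) = sqrt x * sqrt (x ^ j * x ^ (n - Suc j))" by (simp add: real_sqrt_mult)
        moreover have "sqrt (x ^ j * x ^ (n - Suc j)) \<le> (x ^ j + x ^ (n - Suc j)) / 2"
          using x by (intro arith_geo_mean_sqrt) auto
        ultimately show ?thesis using x
          mult_left_mono[of "sqrt (x ^ j * x ^ (n - Suc j))" "(x ^ j + x ^ (n - Suc j)) / 2" "sqrt x"] by simp
      qed
      have "(\<Sum>j<n. 2 * sqrt (x ^ n)) \<le> (\<Sum>j<n. sqrt x * (x ^ j + x ^ (n - Suc j)))"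
        by (intro sum_mono p) simp
      also have "\<dots> = sqrt x * (G n + (\<Sum>j<n. x ^ (n - Suc j)))"
        by (simp add: G_def sum_distrib_left[symmetric] sum.distrib)
      also have "(\<Sum>j<n. x ^ (n - Suc j)) = G n"
        unfolding G_def by (rule sum.nat_diff_reindex)
      finally show ?thesis by (simp add: mult.commute)
    qed
    have "(real n * sqrt (x ^ n))\<^sup>2 \<le> (G n * sqrt x)\<^sup>2"
      using sq x by (intro power_mono) auto
    then show ?thesis using x by (simp add: power_mult_distrib)
  qed
  show "b (Suc k) \<le> b k"
  proof -
    define n where "n = Suc k"
    have n: "n > 0" by (simp add: n_def)
    have G0: "G n > 0" "G (Suc n) > 0" using Gpos[of k] Gpos[of n] by (simp_all add: n_def)
    have GS: "G (Suc n) = G n + x ^ n" by (simp add: G_def)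
    have GS': "G (Suc n) = 1 + x * G n"
      unfolding G_def by (subst sum.lessThan_Suc_shift) (simp add: sum_distrib_left)
    have key: "real n * real (Suc n) * x ^ n \<le> G n * G (Suc n)"
    proof -
      have "(real n)\<^sup>2 * x ^ n \<le> (G n)\<^sup>2 * x" by (rule amgm)
      moreover have "real n * x ^ n \<le> G n" by (rule Glow)
      ultimately have "(real n)\<^sup>2 * x ^ n + real n * x ^ n \<le> G n * (1 + x * G n)"
        by (simp add: power2_eq_square algebra_simps)
      then show ?thesis by (simp add: GS' power2_eq_square algebra_simps)
    qed
    have "x ^ n / G n - x ^ Suc n / G (Suc n) = x ^ n / (G n * G (Suc n))"
    proof -
      have "x ^ n / G n - x ^ Suc n / G (Suc n) = (x ^ n * (G (Suc n) - x * G n)) / (G n * G (Suc n))"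
        using G0 by (simp add: field_simps)
      also have "G (Suc n) - x * G n = 1" using GS' by simp
      finally show ?thesis by simp
    qed
    also have "\<dots> \<le> 1 / (real n * real (Suc n))"
    proof -
      have "x ^ n \<le> (G n * G (Suc n)) / (real n * real (Suc n))"
        using key n by (simp add: pos_le_divide_eq mult_ac del: of_nat_Suc)
      then have "x ^ n / (G n * G (Suc n)) \<le> (G n * G (Suc n)) / (real n * real (Suc n)) / (G n * G (Suc n))"
        using G0 by (intro divide_right_mono) auto
      then show ?thesis using G0 by simp
    qed
    also have "\<dots> = 1 / real n - 1 / real (Suc n)" using n by (simp add: field_simps)
    finally show ?thesis unfolding b n_def by simp
  qed
qed

text \<open>
Expanding each \<open>x\<^sup>n / (1 - x\<^sup>n)\<close> as a geometric series and collecting powers of \<open>x\<close> turns the coefficients into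
divisor sums.
\<close>

lemma lambert_series:
  fixes f :: "nat \<Rightarrow> real" and x :: real
  assumes f: "\<And>n. \<bar>f n\<bar> \<le> 1" and x: "0 < x" "x < 1"
  shows "summable (\<lambda>n. norm (f (Suc n) * (x ^ Suc n / (1 - x ^ Suc n))))"
    and "\<And>B. finite B \<Longrightarrow> 0 \<notin> B \<Longrightarrow> (\<And>m. m > 0 \<Longrightarrow> (\<Sum>d | d dvd m. f d) \<ge> 0) \<Longrightarrow>
      (\<Sum>m\<in>B. (\<Sum>d | d dvd m. f d) * x ^ m) \<le> (\<Sum>n. f (Suc n) * (x ^ Suc n / (1 - x ^ Suc n)))"
proof -
  define w where "w = (\<lambda>(n, j). f (Suc n) * x ^ (Suc n * Suc j))"
  have xp: "0 \<le> x ^ Suc n" "x ^ Suc n < 1" for n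
    using x by (auto simp: power_less_one_iff simp del: power_Suc)
  have geo: "(\<lambda>j. c * x ^ (Suc n * Suc j)) sums (c * (x ^ Suc n / (1 - x ^ Suc n)))" for n and c :: real
  proof -
    have "(\<lambda>j. (x ^ Suc n) ^ j) sums (1 / (1 - x ^ Suc n))"
      using xp[of n] by (intro geometric_sums) (simp del: power_Suc)
    then have "(\<lambda>j. (c * x ^ Suc n) * (x ^ Suc n) ^ j) sums ((c * x ^ Suc n) * (1 / (1 - x ^ Suc n)))"
      by (rule sums_mult)
    moreover have "(c * x ^ Suc n) * (x ^ Suc n) ^ j = c * x ^ (Suc n * Suc j)" for j
      unfolding power_mult power_Suc[of "x ^ Suc n" j] by (rule mult.assoc)
    ultimately show ?thesis by (simp del: power_Suc mult_Suc mult_Suc_right)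
  qed
  have geo_nn: "((\<lambda>j. \<bar>f (Suc n)\<bar> * x ^ (Suc n * Suc j)) has_sum (\<bar>f (Suc n)\<bar> * (x ^ Suc n / (1 - x ^ Suc n)))) UNIV" for n
    using geo[of "\<bar>f (Suc n)\<bar>" n] x by (intro norm_summable_imp_has_sum) (auto simp: sums_iff abs_mult simp del: power_Suc)
  have nw: "norm (w (n, j)) = \<bar>f (Suc n)\<bar> * x ^ (Suc n * Suc j)" for n j
    using x by (simp add: w_def abs_mult del: power_Suc mult_Suc mult_Suc_right)
  have bnd: "norm (f (Suc n) * (x ^ Suc n / (1 - x ^ Suc n))) \<le> x ^ n * (x / (1 - x))" for n
  proof -
    have "x ^ Suc n \<le> x" using x power_decreasing[of 1 "Suc n" x] by simp
    then have "x ^ Suc n / (1 - x ^ Suc n) \<le> x ^ Suc n / (1 - x)"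
      using x xp[of n] by (intro divide_left_mono mult_pos_pos) auto
    moreover have "x ^ Suc n / (1 - x) = x ^ n * (x / (1 - x))" by (simp add: mult.commute)
    ultimately have "x ^ Suc n / (1 - x ^ Suc n) \<le> x ^ n * (x / (1 - x))" by (simp only:)
    moreover have "norm (f (Suc n) * (x ^ Suc n / (1 - x ^ Suc n))) \<le> 1 * (x ^ Suc n / (1 - x ^ Suc n))"
      unfolding norm_mult using f[of "Suc n"] xp[of n] by (intro mult_mono) (auto simp del: power_Suc)
    ultimately show ?thesis by linarith
  qed
  show summ: "summable (\<lambda>n. norm (f (Suc n) * (x ^ Suc n / (1 - x ^ Suc n))))"
  proof (rule summable_comparison_test')
    show "summable (\<lambda>n. x ^ n * (x / (1 - x)))" using x by (intro summable_mult2 summable_geometric) auto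
    show "norm (norm (f (Suc n) * (x ^ Suc n / (1 - x ^ Suc n)))) \<le> x ^ n * (x / (1 - x))" for n
      using bnd[of n] by simp
  qed
  have abs: "(\<lambda>a. norm (w a)) summable_on UNIV \<times> UNIV"
  proof (subst Infinite_Sum.abs_summable_on_Sigma_iff, intro conjI ballI)
    show "(\<lambda>j. norm (w (n, j))) summable_on UNIV" for n
      unfolding nw by (rule has_sum_imp_summable[OF geo_nn])
    have "infsum (\<lambda>j. norm (w (n, j))) UNIV = \<bar>f (Suc n)\<bar> * (x ^ Suc n / (1 - x ^ Suc n))" for n
      unfolding nw by (rule infsumI[OF geo_nn])
    then have eq: "norm (infsum (\<lambda>j. norm (w (n, j))) UNIV) = norm (f (Suc n) * (x ^ Suc n / (1 - x ^ Suc n)))" for n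
      by (simp only: real_norm_def abs_mult abs_abs)
    show "(\<lambda>n. norm (infsum (\<lambda>j. norm (w (n, j))) UNIV)) summable_on UNIV"
      unfolding eq by (rule norm_summable_imp_summable_on) (use summ in \<open>simp only: real_norm_def abs_abs\<close>)
  qed
  have wsum: "w summable_on UNIV \<times> UNIV" by (rule abs_summable_summable[OF abs])
  have S: "(\<Sum>n. f (Suc n) * (x ^ Suc n / (1 - x ^ Suc n))) = infsum w (UNIV \<times> UNIV)"
  proof -
    have "infsum (\<lambda>j. w (n, j)) UNIV = f (Suc n) * (x ^ Suc n / (1 - x ^ Suc n))" for n
    proof -
      have "summable (\<lambda>j. norm (w (n, j)))"
        unfolding nw using geo[of "\<bar>f (Suc n)\<bar>" n] by (rule sums_summable)
      then have "infsum (\<lambda>j. w (n, j)) UNIV = (\<Sum>j. w (n, j))" by (rule infsum_eq_suminf)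
      also have "\<dots> = f (Suc n) * (x ^ Suc n / (1 - x ^ Suc n))"
        using sums_unique[OF geo[of "f (Suc n)" n]] by (simp add: w_def del: power_Suc mult_Suc mult_Suc_right)
      finally show ?thesis .
    qed
    then have "infsum w (UNIV \<times> UNIV) = infsum (\<lambda>n. f (Suc n) * (x ^ Suc n / (1 - x ^ Suc n))) UNIV"
      using infsum_Sigma_banach[OF wsum] by (simp del: power_Suc)
    also have "\<dots> = (\<Sum>n. f (Suc n) * (x ^ Suc n / (1 - x ^ Suc n)))"
      by (rule infsum_eq_suminf[OF summ])
    finally show ?thesis by simp
  qed
  fix B :: "nat set"
  assume B: "finite B" "0 \<notin> B" and r: "\<And>m. m > 0 \<Longrightarrow> (\<Sum>d | d dvd m. f d) \<ge> 0"
  define V where "V = (\<lambda>(m::nat, d). f d * x ^ m)"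
  define h where "h = (\<lambda>(n, j). (Suc n * Suc j, Suc n))"
  define T where "T = Sigma {0<..} (\<lambda>m::nat. {d. d dvd m})"
  have bij: "bij_betw h (UNIV \<times> UNIV) T"
  proof (rule bij_betw_byWitness[where f' = "\<lambda>(m, d). (d - 1, m div d - 1)"])
    show "\<forall>a\<in>UNIV \<times> UNIV. (case h a of (m, d) \<Rightarrow> (d - 1, m div d - 1)) = a"
      by (auto simp: h_def simp del: mult_Suc mult_Suc_right)
    show "\<forall>a'\<in>T. h (case a' of (m, d) \<Rightarrow> (d - 1, m div d - 1)) = a'"
      by (auto simp: h_def T_def elim!: dvdE simp del: mult_Suc mult_Suc_right)
    show "h ` (UNIV \<times> UNIV) \<subseteq> T" by (auto simp: h_def T_def simp del: mult_Suc mult_Suc_right)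
    show "(\<lambda>(m, d). (d - 1, m div d - 1)) ` T \<subseteq> UNIV \<times> UNIV" by auto
  qed
  have Vh: "V (h a) = w a" for a by (cases a) (simp add: V_def h_def w_def)
  have Vsum: "V summable_on T"
    using summable_on_reindex_bij_betw[OF bij, of V] wsum by (simp add: Vh)
  have "infsum w (UNIV \<times> UNIV) = infsum V T"
    using infsum_reindex_bij_betw[OF bij, of V] by (simp add: Vh)
  also have "\<dots> = infsum (\<lambda>m. infsum (\<lambda>d. V (m, d)) {d. d dvd m}) {0<..}"
    using infsum_Sigma_banach[OF Vsum[unfolded T_def]] by (simp add: T_def)
  also have "\<dots> = infsum (\<lambda>m. (\<Sum>d | d dvd m. f d) * x ^ m) {0<..}"
    by (intro infsum_cong) (simp add: V_def sum_distrib_right)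
  also have "\<dots> \<ge> (\<Sum>m\<in>B. (\<Sum>d | d dvd m. f d) * x ^ m)"
  proof (rule finite_sum_le_infsum)
    have A: "(\<lambda>m. infsum (\<lambda>d. f d * x ^ m) {d. d dvd m}) summable_on {0<..}"
      by (rule summable_on_Sigma_banach[OF Vsum[unfolded T_def V_def]])
    have A': "infsum (\<lambda>d. f d * x ^ m) {d. d dvd m} = (\<Sum>d | d dvd m. f d) * x ^ m" if "m \<in> {0<..}" for m
      using that by (simp add: sum_distrib_right)
    show "(\<lambda>m. (\<Sum>d | d dvd m. f d) * x ^ m) summable_on {0<..}"
      by (rule iffD1[OF summable_on_cong[OF A'] A])
    show "B \<subseteq> {0<..}" using B by (auto intro: Nat.gr0I)
    show "0 \<le> (\<Sum>d | d dvd m. f d) * x ^ m" if "m \<in> {0<..} - B" for m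
      using r[of m] that x by simp
  qed (rule B)
  finally show "(\<Sum>m\<in>B. (\<Sum>d | d dvd m. f d) * x ^ m) \<le> (\<Sum>n. f (Suc n) * (x ^ Suc n / (1 - x ^ Suc n)))"
    using S by simp
qed

text \<open>
Monsky's argument. If the series summed to \<open>0\<close>, Abel summation would bound the Lambert series of \<open>f\<close> by \<open>C\<close> for all
\<open>x < 1\<close>. But its coefficients are the divisor sums of \<open>f\<close>, which are nonnegative and at least \<open>1\<close> at
squares, so that it is unbounded as \<open>x\<close> tends to \<open>1\<close>.
\<close>

lemma L_one_real_nonzero:
  fixes f :: "nat \<Rightarrow> real"
  assumes f1: "f 1 = 1" and fm: "\<And>m n. f (m * n) = f m * f n"
    and fv: "\<And>n. f n \<in> {-1, 0, 1}" and C: "\<And>n. \<bar>\<Sum>k<n. f (Suc k)\<bar> \<le> C"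
    and L: "(\<lambda>n. f (Suc n) / real (Suc n)) sums S"
  shows "S \<noteq> 0"
proof
  assume S0: "S = 0"
  have fle: "\<bar>f n\<bar> \<le> 1" for n using fv[of n] by auto
  have upper: "(\<Sum>n. f (Suc n) * (x ^ Suc n / (1 - x ^ Suc n))) \<le> C" if x: "0 < x" "x < 1" for x
  proof -
    define b where "b k = 1 / real (Suc k) - (1 - x) * (x ^ Suc k / (1 - x ^ Suc k))" for k
    have "\<bar>\<Sum>k<n. f (Suc k) * b k\<bar> \<le> C * b 0" for n
      unfolding b_def using monsky_weights[OF x] by (intro abel_decreasing_bound C) auto
    also have "b 0 = 1 - x" using x by (simp add: b_def)
    finally have bd: "\<bar>\<Sum>k<n. f (Suc k) * b k\<bar> \<le> C * (1 - x)" for n .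
    define Z where "Z = (\<Sum>n. f (Suc n) * (x ^ Suc n / (1 - x ^ Suc n)))"
    have Z: "(\<lambda>n. f (Suc n) * (x ^ Suc n / (1 - x ^ Suc n))) sums Z"
      unfolding Z_def by (rule summable_sums[OF summable_norm_cancel[OF lambert_series(1)[of f, OF fle x]]])
    have "(\<lambda>n. f (Suc n) / real (Suc n) - (1 - x) * (f (Suc n) * (x ^ Suc n / (1 - x ^ Suc n)))) sums (0 - (1 - x) * Z)"
      by (rule sums_diff[OF L[unfolded S0] sums_mult[OF Z]])
    moreover have "f (Suc n) / real (Suc n) - (1 - x) * (f (Suc n) * (x ^ Suc n / (1 - x ^ Suc n))) = f (Suc n) * b n" for n
      by (simp add: b_def right_diff_distrib mult_ac del: of_nat_Suc power_Suc)
    ultimately have "(\<lambda>n. \<Sum>k<n. f (Suc k) * b k) \<longlonglongrightarrow> - ((1 - x) * Z)" by (simp add: sums_def)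
    then have "(\<lambda>n. \<bar>\<Sum>k<n. f (Suc k) * b k\<bar>) \<longlonglongrightarrow> \<bar>- ((1 - x) * Z)\<bar>" by (rule tendsto_rabs)
    then have "\<bar>- ((1 - x) * Z)\<bar> \<le> C * (1 - x)" by (rule LIMSEQ_le_const2) (use bd in auto)
    then have "(1 - x) * Z \<le> (1 - x) * C" by (simp add: mult.commute)
    then show ?thesis using x by (simp add: Z_def)
  qed
  have r: "(\<Sum>d | d dvd n. f d) \<ge> 0" "(\<Sum>d | d dvd n\<^sup>2. f d) \<ge> 1" if "n > 0" for n
    using divisor_sum_nonneg[of f n, OF f1 fm fv that] by auto
  have "real K \<le> C" for K
  proof -
    have inj: "inj_on (\<lambda>k::nat. k\<^sup>2) {1..K}" by (auto simp: inj_on_def)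
    have "(\<Sum>k=1..K. x ^ (k\<^sup>2)) \<le> C" if x: "0 < x" "x < 1" for x
    proof -
      have "(\<Sum>k=1..K. x ^ (k\<^sup>2)) \<le> (\<Sum>k=1..K. (\<Sum>d | d dvd k\<^sup>2. f d) * x ^ (k\<^sup>2))"
        using x r(2) by (intro sum_mono) (simp add: mult_right_mono[of 1, simplified])
      also have "\<dots> = (\<Sum>m\<in>(\<lambda>k. k\<^sup>2) ` {1..K}. (\<Sum>d | d dvd m. f d) * x ^ m)"
        by (subst sum.reindex[OF inj]) (simp add: o_def)
      also have "\<dots> \<le> (\<Sum>n. f (Suc n) * (x ^ Suc n / (1 - x ^ Suc n)))"
        by (rule lambert_series(2)[OF fle x]) (use r(1) in auto)
      also have "\<dots> \<le> C" by (rule upper[OF x])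
      finally show ?thesis .
    qed
    then have "\<forall>\<^sub>F x in at_left 1. (\<Sum>k=1..K. x ^ (k\<^sup>2)) \<le> C"
      using eventually_at_left[of 0 1] by (auto simp: eventually_at_left_field intro!: exI[of _ 0])
    moreover have "((\<lambda>x::real. \<Sum>k=1..K. x ^ (k\<^sup>2)) \<longlongrightarrow> (\<Sum>k=1..K. 1 ^ (k\<^sup>2))) (at_left 1)"
      by (intro tendsto_intros)
    ultimately have "(\<Sum>k=1..K. (1::real) ^ (k\<^sup>2)) \<le> C"
      by (intro tendsto_upperbound[of _ _ "at_left (1::real)"]) auto
    then show ?thesis by simp
  qed
  moreover obtain K where "real K > C" using reals_Archimedean2 by blast
  ultimately show False by (meson not_le)
qed

section \<open>Prime divisors from a finite set of primes\<close>

lemma sum_multiples: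
  fixes f :: "nat \<Rightarrow> 'a :: comm_monoid_add"
  assumes d: "d > 0"
  shows "(\<Sum>n\<in>{n\<in>{1..N}. d dvd n}. f n) = (\<Sum>m=1..N div d. f (d * m))"
proof -
  have "{n\<in>{1..N}. d dvd n} = (*) d ` {1..N div d}"
  proof (intro equalityI subsetI)
    fix n assume "n \<in> {n\<in>{1..N}. d dvd n}"
    then obtain m where m: "n = d * m" "1 \<le> n" "n \<le> N" by auto
    then have "m \<le> N div d" using d by (simp add: less_eq_div_iff_mult_less_eq mult.commute)
    moreover have "m \<ge> 1" using m by (cases m) auto
    ultimately show "n \<in> (*) d ` {1..N div d}" using m by auto
  next
    fix n assume "n \<in> (*) d ` {1..N div d}"
    then obtain m where "n = d * m" "m \<in> {1..N div d}" by blast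
    then have m: "n = d * m" "1 \<le> m" "m \<le> N div d" by simp_all
    then show "n \<in> {n\<in>{1..N}. d dvd n}"
      using d by (auto simp: less_eq_div_iff_mult_less_eq mult.commute Suc_le_eq)
  qed
  moreover have "inj_on ((*) d) {1..N div d}" using d by (auto simp: inj_on_def)
  ultimately show ?thesis by (simp add: sum.reindex)
qed

lemma card_multiples: "d > 0 \<Longrightarrow> card {n\<in>{1..N}. d dvd n} = N div d"
  using sum_multiples[of d "\<lambda>_. 1::nat" N] by simp

text \<open>
The variance of the number of prime divisors in \<open>P\<close>: divisibility by different primes is
independent up to rounding errors, and the mean is \<open>H\<close>.
\<close>

lemma Turan_Kubilius:
  fixes P :: "nat set"
  assumes fin: "finite P" and pr: "\<And>p. p \<in> P \<Longrightarrow> prime p"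
  defines "H \<equiv> (\<Sum>p\<in>P. 1 / real p)"
  shows "(\<Sum>n=1..N. (real (card {p\<in>P. p dvd n}) - H)\<^sup>2) \<le> real N * H + 2 * H * real (card P)"
proof -
  define w where "w n = (\<Sum>p\<in>P. of_bool (p dvd n) :: real)" for n
  have w: "real (card {p\<in>P. p dvd n}) = w n" for n
    using fin by (simp add: w_def sum.If_cases of_bool_def Int_def)
  have cnt: "(\<Sum>n=1..N. of_bool (d dvd n) :: real) = real (N div d)" if "d > 0" for d
    using card_multiples[OF that, of N] by (simp add: sum.If_cases of_bool_def Int_def)
  have pos: "p > 0" if "p \<in> P" for p using pr[OF that] prime_gt_0_nat by blast
  have H0: "H \<ge> 0" unfolding H_def by (intro sum_nonneg) simp
  have s1: "(\<Sum>n=1..N. w n) = (\<Sum>p\<in>P. real (N div p))"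
    unfolding w_def by (subst sum.swap) (intro sum.cong refl cnt pos)
  have "real N / real p - 1 \<le> real (N div p)" for p
    using floor_divide_of_nat_eq[of N p, where ?'a = real] by linarith
  then have "(\<Sum>p\<in>P. real N / real p - 1) \<le> (\<Sum>p\<in>P. real (N div p))" by (intro sum_mono)
  moreover have "(\<Sum>p\<in>P. real N / real p - 1) = real N * H - real (card P)"
    by (simp add: H_def sum_distrib_left sum_subtractf)
  ultimately have s1': "real N * H - real (card P) \<le> (\<Sum>n=1..N. w n)"
    unfolding s1 by (simp only:)
  have pq: "(\<Sum>n=1..N. of_bool (p dvd n) * of_bool (q dvd n)) \<le> (if p = q then real N / real p else 0) + real N * (1 / real p * (1 / real q))"
    if "p \<in> P" "q \<in> P" for p q
  proof (cases "p = q")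
    case True
    have "(\<Sum>n=1..N. of_bool (p dvd n) * of_bool (q dvd n) :: real) = real (N div p)"
      using cnt[OF pos[OF that(1)]] True by (simp add: of_bool_conj[symmetric])
    also have "\<dots> \<le> real N / real p" by (rule of_nat_div_le_of_nat)
    finally show ?thesis using True by (simp add: add_increasing2)
  next
    case False
    have "coprime p q" using pr that False by (simp add: primes_coprime)
    then have "p dvd n \<and> q dvd n \<longleftrightarrow> p * q dvd n" for n
      by (auto intro: divides_mult dvd_mult_left dvd_mult_right)
    then have "(\<Sum>n=1..N. of_bool (p dvd n) * of_bool (q dvd n) :: real) = (\<Sum>n=1..N. of_bool (p * q dvd n))"
      by (intro sum.cong refl) (simp only: of_bool_conj[symmetric])
    also have "\<dots> = real (N div (p * q))" using pos that by (intro cnt) simp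
    also have "\<dots> \<le> real N / real (p * q)" by (rule of_nat_div_le_of_nat)
    finally show ?thesis using False by simp
  qed
  have "(\<Sum>n=1..N. (w n)\<^sup>2) = (\<Sum>p\<in>P. \<Sum>q\<in>P. \<Sum>n=1..N. of_bool (p dvd n) * of_bool (q dvd n))"
  proof -
    have "(\<Sum>n=1..N. (w n)\<^sup>2) = (\<Sum>n=1..N. \<Sum>p\<in>P. \<Sum>q\<in>P. of_bool (p dvd n) * of_bool (q dvd n))"
      by (simp only: w_def power2_eq_square sum_product)
    also have "\<dots> = (\<Sum>p\<in>P. \<Sum>n=1..N. \<Sum>q\<in>P. of_bool (p dvd n) * of_bool (q dvd n))" by (rule sum.swap)
    also have "\<dots> = (\<Sum>p\<in>P. \<Sum>q\<in>P. \<Sum>n=1..N. of_bool (p dvd n) * of_bool (q dvd n))"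
      by (intro sum.cong refl sum.swap)
    finally show ?thesis .
  qed
  also have "\<dots> \<le> (\<Sum>p\<in>P. \<Sum>q\<in>P. (if p = q then real N / real p else 0) + real N * (1 / real p * (1 / real q)))"
    by (intro sum_mono pq)
  also have "\<dots> = (\<Sum>p\<in>P. real N / real p) + real N * (\<Sum>p\<in>P. \<Sum>q\<in>P. 1 / real p * (1 / real q))"
    using fin by (simp only: sum.distrib sum.delta' sum_distrib_left) (simp cong: sum.cong)
  also have "(\<Sum>p\<in>P. \<Sum>q\<in>P. 1 / real p * (1 / real q)) = H\<^sup>2"
    by (simp only: H_def power2_eq_square sum_product)
  also have "(\<Sum>p\<in>P. real N / real p) = real N * H" by (simp add: H_def sum_distrib_left)
  finally have s2: "(\<Sum>n=1..N. (w n)\<^sup>2) \<le> real N * H + real N * H\<^sup>2" .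
  have "(\<Sum>n=1..N. (w n - H)\<^sup>2) = (\<Sum>n=1..N. (w n)\<^sup>2) - 2 * H * (\<Sum>n=1..N. w n) + real N * H\<^sup>2"
    by (simp add: power2_diff sum.distrib sum_subtractf sum_distrib_left mult_ac)
  also have "\<dots> \<le> (real N * H + real N * H\<^sup>2) - 2 * H * (real N * H - real (card P)) + real N * H\<^sup>2"
    using s2 s1' H0 by (intro add_mono diff_mono mult_left_mono) auto
  also have "\<dots> = real N * H + 2 * H * real (card P)" by (simp add: power2_eq_square algebra_simps)
  finally show ?thesis by (simp add: w)
qed

text \<open>
A bound \<open>R\<close> for these sums would keep the Euler products of \<open>1 - p powr (- \<sigma>)\<close> above \<open>exp (- 2 R)\<close> for all \<open>\<sigma> > 1\<close>,
but they tend to \<open>1 / \<zeta>(\<sigma>)\<close>, which vanishes as \<open>\<sigma>\<close> tends to \<open>1\<close>.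
\<close>

lemma prime_reciprocals_unbounded: "\<exists>P. finite P \<and> (\<forall>p\<in>P. prime p) \<and> (\<Sum>p\<in>P. 1 / real p) \<ge> R"
proof (rule ccontr)
  assume contr: "\<not> ?thesis"
  have R: "(\<Sum>p\<in>P. 1 / real p) < R" if "finite P" "\<forall>p\<in>P. prime p" for P
  proof (rule ccontr)
    assume "\<not> (\<Sum>p\<in>P. 1 / real p) < R"
    then have "R \<le> (\<Sum>p\<in>P. 1 / real p)" by (rule leI)
    with that contr show False by blast
  qed
  define c where "c = exp (- 2 * R)"
  have key: "exp (- 2 * t) \<le> 1 - t" if "0 \<le> t" "t \<le> 1/2" for t :: real
  proof -
    have "1 \<le> (1 - t) * (1 + 2 * t)" using that mult_nonneg_nonneg[of t "1 - 2 * t"] by (simp add: algebra_simps)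
    also have "\<dots> \<le> (1 - t) * exp (2 * t)" using that exp_ge_add_one_self[of "2 * t"] by (intro mult_left_mono) auto
    finally show ?thesis by (simp add: exp_minus field_simps)
  qed
  define E where "E \<sigma> x = (\<Prod>p\<in>{p. prime p \<and> p \<le> x}. 1 - 1 / complex_of_nat p powr of_real \<sigma>)" for \<sigma> and x :: nat
  have low: "norm (E \<sigma> x) \<ge> c" if \<sigma>: "\<sigma> > 1" for \<sigma> x
  proof -
    have fin: "finite {p. prime p \<and> p \<le> x}" by (auto intro: finite_subset[of _ "{..x}"])
    have "c \<le> exp (\<Sum>p\<in>{p. prime p \<and> p \<le> x}. - 2 * (1 / real p))"
    proof -
      have "(\<Sum>p\<in>{p. prime p \<and> p \<le> x}. - 2 * (1 / real p)) = - 2 * (\<Sum>p\<in>{p. prime p \<and> p \<le> x}. 1 / real p)"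
        by (rule sum_distrib_left[symmetric])
      moreover have "(\<Sum>p\<in>{p. prime p \<and> p \<le> x}. 1 / real p) < R" by (rule R[OF fin]) simp
      ultimately show ?thesis unfolding c_def exp_le_cancel_iff by linarith
    qed
    also have "\<dots> = (\<Prod>p\<in>{p. prime p \<and> p \<le> x}. exp (- 2 * (1 / real p)))" by (rule exp_sum[OF fin])
    also have "\<dots> \<le> (\<Prod>p\<in>{p. prime p \<and> p \<le> x}. norm (1 - 1 / complex_of_nat p powr of_real \<sigma>))"
    proof (intro prod_mono conjI)
      fix p assume "p \<in> {p. prime p \<and> p \<le> x}"
      then have p: "p \<ge> 2" using prime_ge_2_nat by blast
      have pw: "complex_of_nat p powr of_real \<sigma> = of_real (real p powr \<sigma>)"
        using powr_of_real[of "real p" \<sigma>] by simp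
      have "real p powr 1 \<le> real p powr \<sigma>" using p \<sigma> by (intro powr_mono) auto
      then have le: "1 / real p powr \<sigma> \<le> 1 / real p" using p by (intro divide_left_mono) auto
      have "exp (- 2 * (1 / real p)) \<le> 1 - 1 / real p" using p by (intro key) (auto simp: field_simps)
      also have "\<dots> \<le> 1 - 1 / real p powr \<sigma>" using le by simp
      also have "\<dots> \<le> norm (1 - 1 / complex_of_nat p powr of_real \<sigma>)"
      proof -
        have "1 - 1 / complex_of_nat p powr of_real \<sigma> = of_real (1 - 1 / real p powr \<sigma>)" by (simp add: pw)
        then show ?thesis by (metis abs_ge_self norm_of_real)
      qed
      finally show "exp (- 2 * (1 / real p)) \<le> norm (1 - 1 / complex_of_nat p powr of_real \<sigma>)" .
    qed simp
    also have "\<dots> = norm (E \<sigma> x)" by (simp add: E_def prod_norm)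
    finally show ?thesis .
  qed
  obtain Z where Z: "Z holomorphic_on {s. Re s > 0}" "Z 1 = 1"
    "\<And>s. Re s > 1 \<Longrightarrow> (\<lambda>n. (s - 1) * (1 / of_nat (Suc n) powr s)) sums Z s"
    by (rule zeta_continuation, rule that)
  have bound: "norm (Z (of_real \<sigma>)) * c \<le> \<sigma> - 1" if \<sigma>: "\<sigma> > 1" for \<sigma>
  proof -
    define s where "s = complex_of_real \<sigma>"
    define g where "g n = 1 / complex_of_nat n powr s" for n
    have s: "Re s > 1" "s - 1 \<noteq> 0" using \<sigma> by (auto simp: s_def)
    have g0: "g 0 = 0" and g1: "g 1 = 1" by (simp_all add: g_def)
    have gm: "g (m * n) = g m * g n" for m n by (simp add: g_def powr_times_real)
    have summ: "summable (\<lambda>n. norm (g n))"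
    proof (rule summable_comparison_test')
      show "summable (\<lambda>n. real n powr (- Re s))" using s by (simp add: summable_real_powr_iff)
      show "norm (norm (g n)) \<le> real n powr (- Re s)" for n
        by (simp add: g_def norm_inverse norm_powr_real_powr powr_minus divide_inverse)
    qed
    note EP = Euler_product_moebius[of g, OF g0 g1 gm summ]
    have "(\<lambda>n. (s - 1) * g (Suc n)) sums Z s" using Z(3)[OF s(1)] by (simp add: g_def)
    then have "(\<lambda>n. (s - 1) * g (Suc n) / (s - 1)) sums (Z s / (s - 1))" by (rule sums_divide)
    then have "(\<lambda>n. g (Suc n)) sums (Z s / (s - 1))" using s by simp
    then have "g sums (Z s / (s - 1))" using g0 sums_Suc_iff[of g] by simp
    then have L: "(\<Sum>n. g n) = Z s / (s - 1)" by (rule sums_unique[symmetric])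
    have "(\<lambda>x. norm (E \<sigma> x)) \<longlonglongrightarrow> norm (\<Sum>n. of_int (moebius_mu n) * g n)"
      unfolding E_def using EP(1) by (intro tendsto_norm) (simp add: g_def s_def)
    then have "c \<le> norm (\<Sum>n. of_int (moebius_mu n) * g n)"
      by (rule LIMSEQ_le_const) (use low[OF \<sigma>] in auto)
    then have "norm (\<Sum>n. g n) * c \<le> norm (\<Sum>n. g n) * norm (\<Sum>n. of_int (moebius_mu n) * g n)"
      by (intro mult_left_mono) auto
    also have "\<dots> = 1" using EP(2) by (simp add: norm_mult[symmetric])
    finally have "norm (Z s) / norm (s - 1) * c \<le> 1" by (simp add: L norm_divide)
    moreover have "norm (s - 1) = \<sigma> - 1"
    proof -
      have "s - 1 = of_real (\<sigma> - 1)" by (simp add: s_def)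
      then show ?thesis using \<sigma> by (simp only: norm_of_real)
    qed
    ultimately show ?thesis using \<sigma> by (simp add: s_def field_simps)
  qed
  have contZ: "isCont Z 1"
    using holomorphic_on_imp_differentiable_at[OF Z(1) open_halfspace_Re_gt]
    by (intro field_differentiable_imp_continuous_at) simp
  define e where "e k = 1 / real (Suc k)" for k
  have elim: "e \<longlonglongrightarrow> 0" unfolding e_def by real_asymp
  have "(\<lambda>k. complex_of_real (1 + e k)) \<longlonglongrightarrow> of_real (1 + 0)" by (intro tendsto_intros elim)
  then have "(\<lambda>k. Z (of_real (1 + e k))) \<longlonglongrightarrow> Z 1" using isCont_tendsto_compose[OF contZ] by simp
  then have "(\<lambda>k. norm (Z (of_real (1 + e k))) * c) \<longlonglongrightarrow> norm (Z 1) * c" by (intro tendsto_intros)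
  then have "norm (Z 1) * c \<le> 0"
    by (rule LIMSEQ_le[OF _ elim]) (use bound[of "1 + e _"] in \<open>auto simp: e_def\<close>)
  then show False using Z(2) by (simp add: c_def)
qed

section \<open>The Moebius function against periodic sequences\<close>

lemma L_one_quadratic_nonzero:
  assumes \<psi>: "dirichlet_char q \<psi>" and q: "q > 0" and sq: "(\<lambda>n. \<psi> n ^ 2) = principal_char q"
    and C: "\<And>n. norm (\<Sum>k<n. \<psi> (Suc k)) \<le> C"
    and H: "(\<lambda>n. \<psi> (Suc n) / of_nat (Suc n) powr 1) sums S"
  shows "S \<noteq> 0"
proof -
  note \<psi>' = dirichlet_charD[OF \<psi>]
  define f where "f n = Re (\<psi> n)" for n
  have vals: "\<psi> n \<in> {-1, 0, 1}" for n
  proof -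
    have "\<psi> n ^ 2 = principal_char q n" by (rule fun_cong[OF sq])
    then have "\<psi> n ^ 2 = 0 \<or> \<psi> n ^ 2 = 1" by (auto simp: principal_char_def split: if_splits)
    then show ?thesis by (auto simp: power2_eq_1_iff)
  qed
  have f: "\<psi> n = of_real (f n)" for n using vals[of n] by (auto simp: f_def)
  have fv: "f n \<in> {-1, 0, 1}" for n using vals[of n] by (auto simp: f_def)
  have "f 1 = 1" using \<psi>'(1) by (simp add: f_def)
  moreover have "f (m * n) = f m * f n" for m n
    using \<psi>'(2)[of m n] unfolding f of_real_mult[symmetric] of_real_eq_iff .
  moreover have "\<bar>\<Sum>k<n. f (Suc k)\<bar> \<le> C" for n
    using C[of n] unfolding f of_real_sum[symmetric] norm_of_real .
  moreover have "(\<lambda>n. f (Suc n) / real (Suc n)) sums Re S"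
  proof -
    have "(\<lambda>n. Re (\<psi> (Suc n) / of_nat (Suc n) powr 1)) sums Re S" by (rule sums_Re[OF H])
    moreover have "Re (\<psi> (Suc n) / of_nat (Suc n) powr 1) = f (Suc n) / real (Suc n)" for n
    proof -
      have "\<psi> (Suc n) / of_nat (Suc n) powr 1 = of_real (f (Suc n) / real (Suc n))"
        by (simp add: f del: of_nat_Suc)
      then show ?thesis by (simp only: Re_complex_of_real)
    qed
    ultimately show ?thesis by (simp only:)
  qed
  ultimately have "Re S \<noteq> 0"
    using L_one_real_nonzero[of f C "Re S"] fv by blast
  then show ?thesis by auto
qed

text \<open>
For \<open>Re s > 1\<close> the series is \<open>1/L\<close>, so the extension exists once \<open>L\<close> has no zeros on \<open>Re s = 1\<close>. The 3-4-1 argument gives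
this except where the \<open>L\<close>-series of \<open>\<psi>\<^sup>2\<close> has a pole, that is, at \<open>s = 1\<close> when \<open>\<psi>\<^sup>2\<close> is principal. There either \<open>\<psi>\<close> is
real and \<open>L(1) \<noteq> 0\<close>, or \<open>\<psi>\<close> is principal and the pole of \<open>L\<close> becomes a zero of \<open>1/L\<close>.
\<close>

lemma inverse_L_extension:
  assumes \<psi>: "dirichlet_char q \<psi>" and q: "q > 0"
  obtains P where "continuous_on {s. Re s \<ge> 1} P" "\<And>s. Re s > 1 \<Longrightarrow> DM \<psi> s = P s"
proof (cases "\<psi> = principal_char q")
  case False
  obtain H C where H: "H holomorphic_on {s. Re s > 0}"
    "\<And>s. Re s > 0 \<Longrightarrow> (\<lambda>n. \<psi> (Suc n) / of_nat (Suc n) powr s) sums H s"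
    and C: "\<And>n. norm (\<Sum>k<n. \<psi> (Suc k)) \<le> C"
    by (rule L_continuation_nonprincipal[OF \<psi> q False], rule that)
  have DLH: "DL \<psi> s = H s" if "Re s > 1" for s
    by (rule DL_eqI, rule H(2)) (use that in simp)
  have diff: "F field_differentiable (at (1 + \<i> * of_real t))" if "F holomorphic_on {s. Re s > 0}" for F t
    by (rule holomorphic_on_imp_differentiable_at[OF that open_halfspace_Re_gt]) simp
  have line: "H (1 + \<i> * of_real t) \<noteq> 0" for t
  proof (cases "(\<lambda>n. \<psi> n ^ 2) = principal_char q")
    case sq: False
    obtain H2 C2 where H2: "H2 holomorphic_on {s. Re s > 0}"
      "\<And>s. Re s > 0 \<Longrightarrow> (\<lambda>n. \<psi> (Suc n) ^ 2 / of_nat (Suc n) powr s) sums H2 s"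
      and C2: "\<And>n. norm (\<Sum>k<n. \<psi> (Suc k) ^ 2) \<le> C2"
      by (rule L_continuation_nonprincipal[OF dirichlet_char_square[OF \<psi>] q sq], rule that)
    show ?thesis
    proof (rule L_nonzero_by_341[OF \<psi> q diff[OF H(1)] DLH field_differentiable_imp_continuous_at[OF diff[OF H2(1)]]])
      show "DL (\<lambda>n. \<psi> n ^ 2) s = H2 s" if "Re s > 1" for s
        by (rule DL_eqI, rule H2(2)) (use that in simp)
    qed
  next
    case sq: True
    show ?thesis
    proof (cases "t = 0")
      case True
      have "(\<lambda>n. \<psi> (Suc n) / of_nat (Suc n) powr 1) sums H 1" by (rule H(2)) simp
      then have "H 1 \<noteq> 0" by (rule L_one_quadratic_nonzero[OF \<psi> q sq C])
      then show ?thesis using True by simp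
    next
      case False
      obtain K where K: "K holomorphic_on {s. Re s > 0}" "K 1 \<noteq> 0"
        "\<And>s. Re s > 1 \<Longrightarrow> DL (principal_char q) s = K s / (s - 1)"
        by (rule L_principal[OF q], rule that)
      show ?thesis
      proof (rule L_nonzero_by_341[OF \<psi> q diff[OF H(1)] DLH])
        have "isCont K (1 + \<i> * of_real (2 * t))"
          by (rule field_differentiable_imp_continuous_at[OF diff[OF K(1)]])
        then show "isCont (\<lambda>s. K s / (s - 1)) (1 + \<i> * of_real (2 * t))"
          using False by (intro continuous_intros) auto
        show "DL (\<lambda>n. \<psi> n ^ 2) s = K s / (s - 1)" if "Re s > 1" for s
          unfolding sq by (rule K(3)[OF that])
      qed
    qed
  qed
  have nz: "H s \<noteq> 0" if "Re s \<ge> 1" for s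
  proof (cases "Re s = 1")
    case True
    then have "s = 1 + \<i> * of_real (Im s)" by (simp add: complex_eq_iff)
    then show ?thesis using line[of "Im s"] by simp
  next
    case False
    then have "Re s > 1" using that by simp
    then show ?thesis using DL_mult_DM[OF \<psi> q, of s] DLH[of s] by auto
  qed
  show thesis
  proof (rule that)
    show "continuous_on {s. Re s \<ge> 1} (\<lambda>s. 1 / H s)"
      using nz by (intro continuous_intros continuous_on_subset[OF holomorphic_on_imp_continuous_on[OF H(1)]]) auto
    show "DM \<psi> s = 1 / H s" if "Re s > 1" for s
      using DL_mult_DM[OF \<psi> q that] DLH[OF that] nz[of s] that by (simp add: field_simps)
  qed
next
  case True
  obtain K where K: "K holomorphic_on {s. Re s > 0}" "K 1 \<noteq> 0"
    "\<And>s. Re s > 1 \<Longrightarrow> DL (principal_char q) s = K s / (s - 1)"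
    by (rule L_principal[OF q], rule that)
  have sq: "(\<lambda>n. \<psi> n ^ 2) = \<psi>" unfolding True by (auto simp: principal_char_def fun_eq_iff)
  have Kd: "K field_differentiable (at (1 + \<i> * of_real t))" for t
    by (rule holomorphic_on_imp_differentiable_at[OF K(1) open_halfspace_Re_gt]) simp
  have Nd: "(\<lambda>s. K s / (s - 1)) field_differentiable (at (1 + \<i> * of_real t))" if "t \<noteq> 0" for t
    using that by (intro derivative_intros Kd) auto
  have line: "K (1 + \<i> * of_real t) \<noteq> 0" if t: "t \<noteq> 0" for t
  proof -
    have "(\<lambda>s. K s / (s - 1)) (1 + \<i> * of_real t) \<noteq> 0"
    proof (rule L_nonzero_by_341[OF \<psi> q Nd[OF t]])
      show "isCont (\<lambda>s. K s / (s - 1)) (1 + \<i> * of_real (2 * t))"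
        by (rule field_differentiable_imp_continuous_at[OF Nd]) (use t in simp)
    qed (simp_all only: sq, simp_all only: True K(3))
    then show ?thesis by auto
  qed
  have nz: "K s \<noteq> 0" if "Re s \<ge> 1" for s
  proof (cases "Re s = 1")
    case re: True
    then have s: "s = 1 + \<i> * of_real (Im s)" by (simp add: complex_eq_iff)
    show ?thesis
    proof (cases "Im s = 0")
      case True
      then have "s = 1" using s by simp
      then show ?thesis using K(2) by simp
    next
      case False
      then show ?thesis using line[of "Im s"] s by simp
    qed
  next
    case False
    then have "Re s > 1" using that by simp
    then show ?thesis using DL_mult_DM[OF \<psi> q, of s] K(3)[of s] True by auto
  qed
  show thesis
  proof (rule that)
    show "continuous_on {s. Re s \<ge> 1} (\<lambda>s. (s - 1) / K s)"
      using nz by (intro continuous_intros continuous_on_subset[OF holomorphic_on_imp_continuous_on[OF K(1)]]) auto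
    show "DM \<psi> s = (s - 1) / K s" if "Re s > 1" for s
    proof -
      have "s - 1 \<noteq> 0" using that by auto
      moreover have "K s / (s - 1) * DM \<psi> s = 1"
        using DL_mult_DM[OF \<psi> q that] K(3)[OF that] True by simp
      ultimately show ?thesis using nz[of s] that by (simp add: field_simps)
    qed
  qed
qed

definition moebius_orthogonal :: "(nat \<Rightarrow> complex) \<Rightarrow> bool" where
  "moebius_orthogonal f \<longleftrightarrow> (\<lambda>N. (\<Sum>n=1..N. of_int (moebius_mu n) * f n) / of_nat N) \<longlonglongrightarrow> 0"

lemma moebius_orthogonal_char:
  assumes \<psi>: "dirichlet_char q \<psi>" and q: "q > 0"
  shows "moebius_orthogonal \<psi>"
proof -
  obtain P where P: "continuous_on {s. Re s \<ge> 1} P" "\<And>s. Re s > 1 \<Longrightarrow> DM \<psi> s = P s"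
    by (rule inverse_L_extension[OF \<psi> q], rule that)
  show ?thesis unfolding moebius_orthogonal_def
  proof (rule Tauberian_bounded[where a = "\<lambda>n. of_int (moebius_mu n) * \<psi> n", OF _ P(1)])
    show "norm (of_int (moebius_mu n) * \<psi> n) \<le> 1" for n
    proof -
      have "norm (complex_of_int (moebius_mu n)) \<le> 1"
        using abs_moebius_mu_le[of n] by (simp flip: of_int_abs)
      moreover have "norm (\<psi> n) \<le> 1" using norm_dirichlet_char[OF \<psi> q, of n] by simp
      ultimately have "norm (complex_of_int (moebius_mu n)) * norm (\<psi> n) \<le> 1 * 1"
        by (rule mult_mono) simp_all
      then show ?thesis by (simp only: norm_mult mult_1)
    qed
    show "(\<lambda>n. of_int (moebius_mu (Suc n)) * \<psi> (Suc n) / of_nat (Suc n) powr s) sums P s" if "Re s > 1" for s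
      unfolding P(2)[OF that, symmetric] by (rule DM_sums[OF \<psi> q that])
  qed
qed

lemma moebius_orthogonal_sum:
  assumes "finite I" "\<And>i. i \<in> I \<Longrightarrow> moebius_orthogonal (f i)"
  shows "moebius_orthogonal (\<lambda>n. \<Sum>i\<in>I. f i n)"
proof -
  have "(\<lambda>N. \<Sum>i\<in>I. (\<Sum>n=1..N. of_int (moebius_mu n) * f i n) / of_nat N) \<longlonglongrightarrow> (\<Sum>i\<in>I. 0)"
    using assms(2) unfolding moebius_orthogonal_def by (rule tendsto_sum)
  moreover have "(\<Sum>i\<in>I. (\<Sum>n=1..N. of_int (moebius_mu n) * f i n) / of_nat N)
      = (\<Sum>n=1..N. of_int (moebius_mu n) * (\<Sum>i\<in>I. f i n)) / of_nat N" for N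
    unfolding sum_divide_distrib[symmetric] sum_distrib_left by (subst sum.swap) (rule refl)
  ultimately show ?thesis unfolding moebius_orthogonal_def by simp
qed

lemma moebius_orthogonal_scale:
  assumes "moebius_orthogonal f"
  shows "moebius_orthogonal (\<lambda>n. c * f n)"
proof -
  have "(\<lambda>N. c * ((\<Sum>n=1..N. of_int (moebius_mu n) * f n) / of_nat N)) \<longlonglongrightarrow> c * 0"
    using assms unfolding moebius_orthogonal_def by (intro tendsto_intros)
  moreover have "c * ((\<Sum>n=1..N. of_int (moebius_mu n) * f n) / of_nat N)
      = (\<Sum>n=1..N. of_int (moebius_mu n) * (c * f n)) / of_nat N" for N
    by (simp add: sum_distrib_left mult_ac)
  ultimately show ?thesis unfolding moebius_orthogonal_def by (simp only: mult_zero_right)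
qed

text \<open>
Functions on the units mod \<open>q\<close>, extended by \<open>0\<close>, and simultaneous eigenvectors of the operators "multiply the argument by
\<open>a\<close>" on them. These operators commute and have finite order, so the Dirichlet characters arise as joint
eigenvectors, one operator at a time.
\<close>

definition unit_periodic :: "nat \<Rightarrow> (nat \<Rightarrow> complex) \<Rightarrow> bool" where
  "unit_periodic q h \<longleftrightarrow> (\<forall>n. h (n + q) = h n) \<and> (\<forall>n. \<not> coprime n q \<longrightarrow> h n = 0)"

definition eigen :: "nat \<Rightarrow> (nat \<Rightarrow> complex) \<Rightarrow> bool" where
  "eigen a h \<longleftrightarrow> (\<exists>\<omega>. \<forall>n. h (a * n) = \<omega> * h n)"

lemma unit_periodic_cong:
  assumes "unit_periodic q h" "[m = n] (mod q)"
  shows "h m = h n"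
proof -
  have per: "h (n mod q) = h n" for n
    using assms(1) by (intro periodic_mod) (simp add: unit_periodic_def)
  have "h (m mod q) = h (n mod q)" using assms(2) unfolding cong_def by (rule arg_cong)
  then show ?thesis unfolding per .
qed

text \<open>
Multiplication by \<open>a\<close> has order dividing \<open>totient q\<close>; \<open>g k\<close> is the discrete Fourier projection of \<open>h\<close> to the eigenspace
of the eigenvalue \<open>W\<^sup>-\<^sup>k\<close>. Being a combination of translates of \<open>h\<close> it remains an eigenvector of every other operator of which
\<open>h\<close> was one.
\<close>

lemma eigen_decomposition:
  assumes h: "unit_periodic q h" and a: "coprime a q" and q: "q > 0"
  obtains m :: nat and g where "\<And>n. h n = (\<Sum>k<m. g k n)" "\<And>k. unit_periodic q (g k)"
    "\<And>k. eigen a (g k)" "\<And>k b. eigen b h \<Longrightarrow> eigen b (g k)"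
proof -
  define m where "m = totient q"
  have m: "m > 0" using q by (simp add: m_def)
  define W where "W = exp (2 * of_real pi * \<i> / of_nat m)"
  have Wj: "W ^ j = exp (2 * of_real pi * \<i> * of_nat j / of_nat m)" for j
    unfolding W_def exp_of_nat_mult[symmetric] by (simp add: mult_ac)
  have Wm: "W ^ m = 1" unfolding Wj using complex_root_unity_eq_1[of m m] m by simp
  have W0: "W \<noteq> 0" by (simp add: W_def)
  define g where "g k n = (\<Sum>j<m. W ^ (k * j) * h (a ^ j * n)) / of_nat m" for k n
  have am: "h (a ^ m * n) = h n" for n
  proof (rule unit_periodic_cong[OF h])
    have "[a ^ m = 1] (mod q)" unfolding m_def by (rule euler_theorem[OF a])
    then have "[a ^ m * n = 1 * n] (mod q)" by (rule cong_scalar_right)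
    then show "[a ^ m * n = n] (mod q)" by simp
  qed
  have orth: "(\<Sum>k<m. W ^ (k * j)) = (if j = 0 then of_nat m else 0)" if "j < m" for j
  proof (cases "j = 0")
    case False
    have ne: "W ^ j \<noteq> 1" unfolding Wj using complex_root_unity_eq_1[of m j] m False that
      by (auto dest: dvd_imp_le)
    have "(\<Sum>k<m. W ^ (k * j)) = (\<Sum>k<m. (W ^ j) ^ k)" by (simp add: power_mult[symmetric] mult.commute)
    also have "\<dots> = ((W ^ j) ^ m - 1) / (W ^ j - 1)" by (rule geometric_sum[OF ne])
    also have "(W ^ j) ^ m = (W ^ m) ^ j" by (simp add: power_mult[symmetric] mult.commute)
    finally show ?thesis using False by (simp add: Wm)
  qed simp
  show thesis
  proof (rule that[where m = m and g = g])
    show "h n = (\<Sum>k<m. g k n)" for n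
    proof -
      have "(\<Sum>k<m. g k n) = (\<Sum>k<m. \<Sum>j<m. W ^ (k * j) * h (a ^ j * n)) / of_nat m"
        unfolding g_def by (rule sum_divide_distrib[symmetric])
      also have "(\<Sum>k<m. \<Sum>j<m. W ^ (k * j) * h (a ^ j * n)) = (\<Sum>j<m. \<Sum>k<m. W ^ (k * j) * h (a ^ j * n))"
        by (rule sum.swap)
      also have "\<dots> = (\<Sum>j<m. (if j = 0 then of_nat m else 0) * h (a ^ j * n))"
        by (intro sum.cong refl) (simp only: sum_distrib_right[symmetric] orth lessThan_iff)
      also have "\<dots> = (\<Sum>j<m. if j = 0 then of_nat m * h (a ^ j * n) else 0)"
        by (intro sum.cong refl) simp
      also have "\<dots> = of_nat m * h n" using m by (simp add: sum.delta)
      finally show ?thesis using m by simp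
    qed
    show "unit_periodic q (g k)" for k
    proof -
      have "h (a ^ j * (n + q)) = h (a ^ j * n)" for j n
        by (rule unit_periodic_cong[OF h]) (simp add: cong_def distrib_left)
      moreover have "h (a ^ j * n) = 0" if "\<not> coprime n q" for j n
        using h that by (simp add: unit_periodic_def coprime_mult_left_iff)
      ultimately show ?thesis by (simp add: unit_periodic_def g_def)
    qed
    show "eigen a (g k)" for k
    proof -
      have "g k (a * n) = inverse (W ^ k) * g k n" for n
      proof -
        define v where "v j = W ^ (k * j) * h (a ^ j * n)" for j
        have "v m = v 0"
        proof -
          have "W ^ (k * m) = (W ^ m) ^ k" by (simp add: power_mult[symmetric] mult.commute)
          then show ?thesis by (simp add: v_def Wm am)
        qed
        then have shift: "(\<Sum>j<m. v (Suc j)) = (\<Sum>j<m. v j)"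
          using sum.lessThan_Suc_shift[of v m] sum.lessThan_Suc[of v m] by simp
        have "W ^ (k * j) * h (a ^ j * (a * n)) = inverse (W ^ k) * v (Suc j)" for j
          using W0 by (simp add: v_def power_add mult_ac)
        then have "(\<Sum>j<m. W ^ (k * j) * h (a ^ j * (a * n))) = inverse (W ^ k) * (\<Sum>j<m. v (Suc j))"
          by (simp add: sum_distrib_left)
        then show ?thesis unfolding g_def shift by (simp add: v_def)
      qed
      then show ?thesis unfolding eigen_def by blast
    qed
    show "eigen b (g k)" if "eigen b h" for k b
    proof -
      from that obtain \<omega> where \<omega>: "\<And>n. h (b * n) = \<omega> * h n" unfolding eigen_def by blast
      have "h (a ^ j * (b * n)) = \<omega> * h (a ^ j * n)" for j n
        using \<omega>[of "a ^ j * n"] by (simp add: mult_ac)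
      then have "(\<Sum>j<m. W ^ (k * j) * h (a ^ j * (b * n))) = \<omega> * (\<Sum>j<m. W ^ (k * j) * h (a ^ j * n))" for n
        unfolding sum_distrib_left by (intro sum.cong refl) (simp only: mult.left_commute)
      then have "g k (b * n) = \<omega> * g k n" for n
        unfolding g_def by (simp only: times_divide_eq_right)
      then show ?thesis unfolding eigen_def by blast
    qed
  qed
qed

text \<open>
A joint eigenvector that does not vanish at \<open>1\<close> is a multiple of a Dirichlet character; one that vanishes at \<open>1\<close> is
\<open>0\<close>, since its value at \<open>a\<close> is a multiple of its value at \<open>1\<close>.
\<close>

lemma moebius_orthogonal_simultaneous_eigen:
  assumes h: "unit_periodic q h" and q: "q > 0" and eig: "\<And>a. coprime a q \<Longrightarrow> a < q \<Longrightarrow> eigen a h"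
  shows "moebius_orthogonal h"
proof -
  have eig': "eigen a h" if a: "coprime a q" for a
  proof -
    have "eigen (a mod q) h" using a q by (intro eig) simp_all
    moreover have "h (a * n) = h (a mod q * n)" for n
      by (rule unit_periodic_cong[OF h]) (simp add: cong_def mod_mult_left_eq)
    ultimately show ?thesis by (simp add: eigen_def)
  qed
  show ?thesis
  proof (cases "h 1 = 0")
    case True
    have "h n = 0" for n
    proof (cases "coprime n q")
      case c: True
      obtain \<omega> where "\<And>k. h (n * k) = \<omega> * h k" using eig'[OF c] unfolding eigen_def by blast
      from this[of 1] True show ?thesis by simp
    qed (use h in \<open>simp add: unit_periodic_def\<close>)
    then show ?thesis by (simp add: moebius_orthogonal_def)
  next
    case False
    define \<psi> where "\<psi> n = h n / h 1" for n
    have mult: "h (m * n) * h 1 = h m * h n" for m n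
    proof (cases "coprime m q")
      case True
      obtain \<omega> where "\<And>k. h (m * k) = \<omega> * h k" using eig'[OF True] unfolding eigen_def by blast
      from this[of 1] this[of n] show ?thesis by simp
    next
      case False
      then have "\<not> coprime (m * n) q" by (simp add: coprime_mult_left_iff)
      then have "h (m * n) = 0" using h by (simp add: unit_periodic_def)
      moreover have "h m = 0" using False h by (simp add: unit_periodic_def)
      ultimately show ?thesis by simp
    qed
    have nz: "h n \<noteq> 0" if c: "coprime n q" for n
    proof
      assume z: "h n = 0"
      have "[n ^ totient q = 1] (mod q)" by (rule euler_theorem[OF c])
      then have "h (n ^ totient q) = h 1" by (rule unit_periodic_cong[OF h])
      moreover obtain k where "totient q = Suc k" using q gr0_implies_Suc[of "totient q"] by auto
      ultimately have "h (n * n ^ k) = h 1" by simp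
      then show False using mult[of n "n ^ k"] z \<open>h 1 \<noteq> 0\<close> by simp
    qed
    have "dirichlet_char q \<psi>"
      unfolding dirichlet_char_def
    proof (intro conjI allI)
      show "\<psi> 1 = 1" using False by (simp add: \<psi>_def)
      show "\<psi> (m * n) = \<psi> m * \<psi> n" for m n
        using mult[of m n] False by (simp add: \<psi>_def field_simps)
      show "\<psi> (n + q) = \<psi> n" for n using h by (simp add: \<psi>_def unit_periodic_def)
      show "\<psi> n = 0 \<longleftrightarrow> \<not> coprime n q" for n
        using nz[of n] h False by (auto simp: \<psi>_def unit_periodic_def)
    qed
    then have "moebius_orthogonal (\<lambda>n. h 1 * \<psi> n)"
      using q by (intro moebius_orthogonal_scale moebius_orthogonal_char)
    moreover have "(\<lambda>n. h 1 * \<psi> n) = h" using False by (simp add: \<psi>_def fun_eq_iff)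
    ultimately show ?thesis by simp
  qed
qed

lemma moebius_orthogonal_unit_periodic:
  assumes h: "unit_periodic q h" and q: "q > 0"
  shows "moebius_orthogonal h"
proof -
  have main: "moebius_orthogonal h"
    if "finite S" "\<And>a. a \<in> S \<Longrightarrow> coprime a q" "unit_periodic q h" "\<And>a. a \<in> T \<Longrightarrow> eigen a h"
      "\<And>h'. unit_periodic q h' \<Longrightarrow> (\<And>a. a \<in> T \<union> S \<Longrightarrow> eigen a h') \<Longrightarrow> moebius_orthogonal h'" for S T h
    using that
  proof (induction S arbitrary: T h rule: finite_induct)
    case empty
    show ?case by (rule empty.prems(4)[OF empty.prems(2)]) (use empty.prems(3) in blast)
  next
    case (insert a S)
    have ca: "coprime a q" by (rule insert.prems(1)) simp
    obtain m :: nat and g where g: "\<And>n. h n = (\<Sum>k<m. g k n)" "\<And>k. unit_periodic q (g k)"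
      "\<And>k. eigen a (g k)" "\<And>k b. eigen b h \<Longrightarrow> eigen b (g k)"
      by (rule eigen_decomposition[OF insert.prems(2) ca q], rule that)
    have "moebius_orthogonal (g k)" for k
    proof (rule insert.IH[of "g k" "insert a T"])
      show "eigen b (g k)" if "b \<in> insert a T" for b
        using that g(3,4) insert.prems(3) by blast
      show "moebius_orthogonal h'"
        if "unit_periodic q h'" "\<And>b. b \<in> insert a T \<union> S \<Longrightarrow> eigen b h'" for h'
        using that(1) by (rule insert.prems(4)) (use that(2) in blast)
    qed (use insert.prems(1) g(2) in blast)+
    then have "moebius_orthogonal (\<lambda>n. \<Sum>k<m. g k n)" by (intro moebius_orthogonal_sum) auto
    moreover have "(\<lambda>n. \<Sum>k<m. g k n) = h" by (rule ext) (simp only: g(1))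
    ultimately show ?case by simp
  qed
  show ?thesis
  proof (rule main[of "{a. a < q \<and> coprime a q}" h "{}"])
    show "moebius_orthogonal h'"
      if "unit_periodic q h'" "\<And>a. a \<in> {} \<union> {a. a < q \<and> coprime a q} \<Longrightarrow> eigen a h'" for h'
      by (rule moebius_orthogonal_simultaneous_eigen[OF that(1) q]) (use that(2) in blast)
  qed (use h in auto)
qed

lemma moebius_mu_mult_not_coprime:
  assumes "\<not> coprime m n"
  shows "moebius_mu (m * n) = 0"
proof -
  obtain d where d: "d dvd m" "d dvd n" "\<not> is_unit d" using assms not_coprimeE by blast
  then have "d\<^sup>2 dvd m * n" by (simp add: power2_eq_square mult_dvd_mono)
  then have "\<not> squarefree (m * n)" using d(3) by (rule not_squarefreeI)
  then show ?thesis by (simp add: moebius_mu_def)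
qed

text \<open>
Split according to \<open>g = gcd n q\<close> and write \<open>n = g m\<close>. Only \<open>m\<close> coprime to \<open>g\<close> contribute, with \<open>\<mu>(n) = \<mu>(g) \<mu>(m)\<close>, and on
these \<open>m\<close> the sequence is a function on the units mod \<open>q\<close>.
\<close>

theorem moebius_orthogonal_periodic:
  assumes per: "\<And>n. f (n + q) = f n" and q: "q > 0"
  shows "moebius_orthogonal f"
proof -
  define F where "F g n = (if gcd n q = g then f n else 0)" for g n
  have orth: "moebius_orthogonal (F g)" if g: "g \<in> {g. g dvd q}" for g
  proof -
    have g0: "g > 0" using g q by (auto intro: Nat.gr0I)
    define h where "h m = (if coprime g m then F g (g * m) else 0)" for m
    have "unit_periodic q h"
      unfolding unit_periodic_def
    proof (intro conjI allI impI)
      fix m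
      have c: "coprime g (m + q) \<longleftrightarrow> coprime g m"
      proof -
        obtain k where k: "q = g * k" using g by auto
        have "gcd (m + g * k) g = gcd m g" by (metis gcd_add_mult add.commute gcd.commute mult.commute)
        then show ?thesis unfolding k by (simp only: coprime_iff_gcd_eq_1 gcd.commute[of g])
      qed
      have fp: "f (g * m + k * q) = f (g * m)" for k
        by (induction k) (use per in \<open>simp_all add: add.assoc[symmetric] add.commute[of q]\<close>)
      have "g * (m + q) = g * m + g * q" by (simp add: distrib_left)
      moreover have "gcd (g * m + g * q) q = gcd (g * m) q"
        by (metis gcd_add_mult add.commute gcd.commute)
      ultimately show "h (m + q) = h m" using fp[of g] c by (simp add: h_def F_def)
    next
      fix m assume nc: "\<not> coprime m q"
      show "h m = 0"
      proof (rule ccontr)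
        assume "h m \<noteq> 0"
        then have cg: "coprime g m" and gg: "gcd (g * m) q = g"
          by (auto simp: h_def F_def split: if_splits)
        obtain p where p: "prime p" "p dvd m" "p dvd q"
        proof -
          have "gcd m q \<noteq> 1" using nc by (simp only: coprime_iff_gcd_eq_1 not_False_eq_True)
          then obtain p where "prime p" "p dvd gcd m q" using prime_factor_nat by blast
          then show ?thesis using that[of p] by simp
        qed
        obtain k where k: "q = g * k" using g by auto
        have "\<not> p dvd g" using cg p by (meson coprime_common_divisor not_prime_unit)
        then have "p dvd k" using p k by (simp add: prime_dvd_mult_iff)
        then have "g * p dvd gcd (g * m) q" using p k by (simp add: mult_dvd_mono)
        then have "g * p dvd g" unfolding gg .
        then show False using g0 p(1) by (simp add: dvd_mult_cancel1 prime_nat_iff)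
      qed
    qed
    then have oh: "moebius_orthogonal h" using q by (rule moebius_orthogonal_unit_periodic)
    define M where "M N = (\<Sum>m=1..N. of_int (moebius_mu m) * h m)" for N
    have eq: "(\<Sum>n=1..N. of_int (moebius_mu n) * F g n) = of_int (moebius_mu g) * M (N div g)" for N
    proof -
      have "(\<Sum>n=1..N. of_int (moebius_mu n) * F g n) = (\<Sum>n\<in>{n\<in>{1..N}. g dvd n}. of_int (moebius_mu n) * F g n)"
        by (rule sum.mono_neutral_right) (auto simp: F_def)
      also have "\<dots> = (\<Sum>m=1..N div g. of_int (moebius_mu (g * m)) * F g (g * m))"
        by (rule sum_multiples[OF g0])
      also have "\<dots> = (\<Sum>m=1..N div g. of_int (moebius_mu g) * (of_int (moebius_mu m) * h m))"
        by (intro sum.cong refl) (auto simp: h_def moebius_mu_mult_coprime moebius_mu_mult_not_coprime)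
      finally show ?thesis by (simp add: M_def sum_distrib_left)
    qed
    have lim: "filterlim (\<lambda>N. N div g) at_top sequentially"
    proof (rule filterlim_at_top[THEN iffD2], rule allI)
      fix Z show "\<forall>\<^sub>F N in sequentially. Z \<le> N div g"
        using eventually_ge_at_top[of "g * Z"] by eventually_elim (use g0 in \<open>simp add: less_eq_div_iff_mult_less_eq mult.commute\<close>)
    qed
    have "(\<lambda>N. M (N div g) / of_nat (N div g)) \<longlonglongrightarrow> 0"
      using filterlim_compose[OF oh[unfolded moebius_orthogonal_def] lim] by (simp add: M_def)
    then have "(\<lambda>N. norm (M (N div g) / of_nat (N div g))) \<longlonglongrightarrow> 0" by (rule tendsto_norm_zero)
    then have "(\<lambda>N. of_int (moebius_mu g) * M (N div g) / of_nat N) \<longlonglongrightarrow> 0"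
    proof (rule Lim_null_comparison[rotated])
      show "\<forall>\<^sub>F N in sequentially. norm (of_int (moebius_mu g) * M (N div g) / of_nat N) \<le> norm (M (N div g) / of_nat (N div g))"
      proof (rule eventually_mono[OF eventually_ge_at_top[of g]])
        fix N assume "g \<le> N"
        then have d0: "N div g > 0" using g0 by (simp add: div_greater_zero_iff)
        have "norm (complex_of_int (moebius_mu g)) \<le> 1"
          using abs_moebius_mu_le[of g] by (simp flip: of_int_abs)
        then have "norm (of_int (moebius_mu g) * M (N div g)) \<le> 1 * norm (M (N div g))"
          unfolding norm_mult by (rule mult_right_mono[OF _ norm_ge_zero])
        then have "norm (of_int (moebius_mu g) * M (N div g)) / real N \<le> norm (M (N div g)) / real (N div g)"
          using d0 div_le_dividend[of N g] by (intro frac_le) auto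
        then show "norm (of_int (moebius_mu g) * M (N div g) / of_nat N) \<le> norm (M (N div g) / of_nat (N div g))"
          by (simp only: norm_divide norm_of_nat)
      qed
    qed
    then show ?thesis unfolding moebius_orthogonal_def eq .
  qed
  have fin: "finite {g. g dvd q}" using q by simp
  have "moebius_orthogonal (\<lambda>n. \<Sum>g\<in>{g. g dvd q}. F g n)"
    by (rule moebius_orthogonal_sum[OF fin orth])
  moreover have "(\<Sum>g\<in>{g. g dvd q}. F g n) = f n" for n
    unfolding F_def using fin by (subst sum.delta') auto
  ultimately show ?thesis by simp
qed

section \<open>Katai's criterion in a semi-inner product space\<close>

text \<open>
The form is only required to be defined sensibly on a subspace \<open>V\<close> of the ambient type, and it may be degenerate: the
intended example is a von Neumann algebra with the form induced by a state.
\<close>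

locale semi_inner =
  fixes V :: "'v::real_vector set" and ip :: "'v \<Rightarrow> 'v \<Rightarrow> real"
  assumes subspace: "subspace V"
    and ip_add_left: "x \<in> V \<Longrightarrow> y \<in> V \<Longrightarrow> z \<in> V \<Longrightarrow> ip (x + y) z = ip x z + ip y z"
    and ip_scale_left: "x \<in> V \<Longrightarrow> z \<in> V \<Longrightarrow> ip (r *\<^sub>R x) z = r * ip x z"
    and ip_commute: "x \<in> V \<Longrightarrow> y \<in> V \<Longrightarrow> ip x y = ip y x"
    and ip_nonneg: "x \<in> V \<Longrightarrow> ip x x \<ge> 0"
begin

lemmas V_rules = subspace_0[OF subspace] subspace_add[OF subspace] subspace_diff[OF subspace]
  subspace_scale[OF subspace] subspace_sum[OF subspace]

definition nm :: "'v \<Rightarrow> real" where "nm x = sqrt (ip x x)"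

lemma nm_nonneg: "x \<in> V \<Longrightarrow> nm x \<ge> 0"
  by (simp add: nm_def ip_nonneg)

lemma nm_sq: "x \<in> V \<Longrightarrow> (nm x)\<^sup>2 = ip x x"
  by (simp add: nm_def ip_nonneg)

lemma ip_add_right: "x \<in> V \<Longrightarrow> y \<in> V \<Longrightarrow> z \<in> V \<Longrightarrow> ip z (x + y) = ip z x + ip z y"
  using ip_add_left[of x y z] ip_commute[of z x] ip_commute[of z y] ip_commute[of z "x + y"] V_rules(2)[of x y]
  by simp

lemma ip_scale_right: "x \<in> V \<Longrightarrow> z \<in> V \<Longrightarrow> ip z (r *\<^sub>R x) = r * ip z x"
  using ip_scale_left[of x z r] ip_commute[of z x] ip_commute[of z "r *\<^sub>R x"] V_rules(4)[of x r] by simp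

lemma ip_zero_left: "z \<in> V \<Longrightarrow> ip 0 z = 0"
  using ip_scale_left[of 0 z 0] V_rules(1) by simp

lemma ip_sum_left: "(\<And>i. i \<in> I \<Longrightarrow> f i \<in> V) \<Longrightarrow> z \<in> V \<Longrightarrow> ip (sum f I) z = (\<Sum>i\<in>I. ip (f i) z)"
proof (induction I rule: infinite_finite_induct)
  case (insert i I)
  then have "f i \<in> V" "sum f I \<in> V" by (auto intro!: V_rules)
  with insert show ?case by (simp add: ip_add_left)
qed (simp_all add: ip_zero_left)

lemma ip_sum_right:
  assumes "\<And>i. i \<in> I \<Longrightarrow> f i \<in> V" "z \<in> V"
  shows "ip z (sum f I) = (\<Sum>i\<in>I. ip z (f i))"
proof -
  have "ip z (sum f I) = ip (sum f I) z" using assms by (intro ip_commute V_rules)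
  also have "\<dots> = (\<Sum>i\<in>I. ip (f i) z)" using assms by (rule ip_sum_left)
  also have "\<dots> = (\<Sum>i\<in>I. ip z (f i))" using assms by (intro sum.cong refl ip_commute)
  finally show ?thesis .
qed

lemma nm_scale: "x \<in> V \<Longrightarrow> nm (r *\<^sub>R x) = \<bar>r\<bar> * nm x"
  by (simp add: nm_def ip_scale_left ip_scale_right V_rules real_sqrt_mult mult.assoc[symmetric])

lemma ip_square_add:
  assumes "x \<in> V" "y \<in> V"
  shows "ip (x + r *\<^sub>R y) (x + r *\<^sub>R y) = ip x x + 2 * r * ip x y + r\<^sup>2 * ip y y"
  using assms ip_commute[of y x]
  by (simp add: ip_add_left ip_add_right ip_scale_left ip_scale_right V_rules power2_eq_square algebra_simps)

lemma Cauchy_Schwarz: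
  assumes xy: "x \<in> V" "y \<in> V"
  shows "\<bar>ip x y\<bar> \<le> nm x * nm y"
proof -
  have pos: "0 \<le> ip x x + 2 * r * ip x y + r\<^sup>2 * ip y y" for r
    unfolding ip_square_add[OF xy, symmetric] using xy by (intro ip_nonneg V_rules)
  have "(ip x y)\<^sup>2 \<le> ip x x * ip y y"
  proof (cases "ip y y = 0")
    case True
    have "ip x y = 0"
    proof (rule ccontr)
      assume ne: "ip x y \<noteq> 0"
      have "0 \<le> ip x x + 2 * (- (ip x x + 1) / (2 * ip x y)) * ip x y"
        using pos[of "- (ip x x + 1) / (2 * ip x y)"] True by simp
      also have "\<dots> = -1" using ne by (simp add: field_simps)
      finally show False by simp
    qed
    then show ?thesis using True by simp
  next
    case False
    then have p: "ip y y > 0" using ip_nonneg[OF xy(2)] by simp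
    have "0 \<le> ip x x + 2 * (- ip x y / ip y y) * ip x y + (- ip x y / ip y y)\<^sup>2 * ip y y"
      by (rule pos)
    also have "\<dots> = ip x x - (ip x y)\<^sup>2 / ip y y"
      using p by (simp add: power2_eq_square field_simps)
    finally show ?thesis using p by (simp add: field_simps)
  qed
  then have "sqrt ((ip x y)\<^sup>2) \<le> sqrt (ip x x * ip y y)" by (rule real_sqrt_le_mono)
  then show ?thesis by (simp add: nm_def real_sqrt_mult)
qed

lemma nm_triangle:
  assumes xy: "x \<in> V" "y \<in> V"
  shows "nm (x + y) \<le> nm x + nm y"
proof (rule power2_le_imp_le)
  have "(nm (x + y))\<^sup>2 = ip x x + 2 * ip x y + ip y y"
    using ip_square_add[OF xy, of 1] V_rules(2)[OF xy] by (simp add: nm_sq)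
  also have "\<dots> \<le> (nm x)\<^sup>2 + 2 * (nm x * nm y) + (nm y)\<^sup>2"
    using Cauchy_Schwarz[OF xy] xy by (simp add: nm_sq)
  finally show "(nm (x + y))\<^sup>2 \<le> (nm x + nm y)\<^sup>2" by (simp add: power2_sum)
qed (use xy nm_nonneg in simp)

lemma nm_zero: "nm 0 = 0" using ip_zero_left[OF V_rules(1)] by (simp add: nm_def)

lemma nm_sum: "(\<And>i. i \<in> I \<Longrightarrow> f i \<in> V) \<Longrightarrow> nm (sum f I) \<le> (\<Sum>i\<in>I. nm (f i))"
proof (induction I rule: infinite_finite_induct)
  case (insert i I)
  then have "f i \<in> V" "sum f I \<in> V" by (auto intro!: V_rules)
  then have "nm (f i + sum f I) \<le> nm (f i) + nm (sum f I)" by (rule nm_triangle)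
  then show ?case using insert by force
qed (simp_all add: nm_zero)

lemma nm_diff_triangle:
  assumes "x \<in> V" "y \<in> V" "z \<in> V"
  shows "nm (x - z) \<le> nm (x - y) + nm (y - z)"
  using nm_triangle[of "x - y" "y - z"] assms by (simp add: V_rules)

lemma nm_minus_commute:
  assumes "x \<in> V" "y \<in> V" shows "nm (x - y) = nm (y - x)"
  using nm_scale[of "x - y" "-1"] assms by (simp add: V_rules)

lemma parallelogram:
  assumes "x \<in> V" "y \<in> V"
  shows "(nm (x - y))\<^sup>2 = 2 * (nm x)\<^sup>2 + 2 * (nm y)\<^sup>2 - 4 * (nm ((1/2) *\<^sub>R (x + y)))\<^sup>2"
proof -
  have "(nm (x - y))\<^sup>2 = ip x x - 2 * ip x y + ip y y"
    using ip_square_add[OF assms, of "-1"] assms by (simp add: nm_sq V_rules)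
  moreover have "(nm (x + y))\<^sup>2 = ip x x + 2 * ip x y + ip y y"
    using ip_square_add[OF assms, of 1] assms by (simp add: nm_sq V_rules)
  moreover have "(nm ((1/2) *\<^sub>R (x + y)))\<^sup>2 = (nm (x + y))\<^sup>2 / 4"
    using assms by (simp add: nm_scale V_rules power_divide)
  ultimately show ?thesis using assms by (simp add: nm_sq)
qed

definition mavg :: "(nat \<Rightarrow> 'v) \<Rightarrow> nat \<Rightarrow> 'v" where
  "mavg x N = (1 / real N) *\<^sub>R (\<Sum>n=1..N. of_int (moebius_mu n) *\<^sub>R x n)"

lemma nm_moebius_scale:
  assumes "x \<in> V" shows "nm (of_int (moebius_mu n) *\<^sub>R x) \<le> nm x"
proof -
  have "\<bar>real_of_int (moebius_mu n)\<bar> \<le> 1" using abs_moebius_mu_le[of n] by linarith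
  then show ?thesis using mult_right_mono[of "\<bar>real_of_int (moebius_mu n)\<bar>" 1 "nm x"] nm_nonneg[OF assms]
    by (simp add: nm_scale[OF assms])
qed

text \<open>
Let \<open>w n\<close> count the prime divisors of \<open>n\<close> in \<open>P\<close>, a function with mean \<open>H\<close>. Replacing the constant \<open>H\<close> by \<open>w n\<close> costs the
first term, by the Turan--Kubilius inequality. The sum weighted with \<open>w\<close> is a double sum over \<open>n = p m\<close>, where
\<open>\<mu>(p m) = - \<mu>(m)\<close> unless \<open>p\<close> divides \<open>m\<close>; the exceptional \<open>m\<close> give the second term. What remains is bounded by the
Cauchy--Schwarz inequality in \<open>m\<close>, which removes \<open>\<mu>\<close> and leaves the correlations of \<open>x (p m)\<close> and \<open>x (q m)\<close>: the diagonal gives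
\<open>N H B\<^sup>2\<close> and the pairs \<open>p \<noteq> q\<close> are covered by the hypothesis.
\<close>

lemma Katai_inequality:
  assumes fin: "finite P" and pr: "\<And>p. p \<in> P \<Longrightarrow> prime p"
    and x: "\<And>n. x n \<in> V" and B: "\<And>n. nm (x n) \<le> B"
    and corr: "\<And>p q M. p \<in> P \<Longrightarrow> q \<in> P \<Longrightarrow> p \<noteq> q \<Longrightarrow>
        \<bar>\<Sum>m=1..M. ip (x (p * m)) (x (q * m))\<bar> \<le> \<epsilon> * real M + D"
    and \<epsilon>: "\<epsilon> \<ge> 0" "D \<ge> 0"
  defines "H \<equiv> (\<Sum>p\<in>P. 1 / real p)" and "c \<equiv> real (card P)"
  shows "H * nm (\<Sum>n=1..N. of_int (moebius_mu n) *\<^sub>R x n)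
    \<le> B * sqrt (real N * (real N * H + 2 * H * c)) + B * real N * (\<Sum>n. 1 / real (Suc n) ^ 2)
      + sqrt (real N * (real N * H * B\<^sup>2 + c\<^sup>2 * (\<epsilon> * real N + D)))"
proof -
  have B0: "B \<ge> 0" using nm_nonneg[OF x] B order_trans by blast
  have H0: "H \<ge> 0" unfolding H_def by (intro sum_nonneg) simp
  have pos: "p > 0" if "p \<in> P" for p using pr[OF that] prime_gt_0_nat by blast
  define w where "w n = real (card {p\<in>P. p dvd n})" for n
  let ?\<mu> = "\<lambda>n. real_of_int (moebius_mu n)"
  define S where "S = (\<Sum>n=1..N. ?\<mu> n *\<^sub>R x n)"
  define S1 where "S1 = (\<Sum>n=1..N. (?\<mu> n * (H - w n)) *\<^sub>R x n)"
  define S2 where "S2 = (\<Sum>p\<in>P. \<Sum>m\<in>{m\<in>{1..N div p}. p dvd m}. ?\<mu> m *\<^sub>R x (p * m))"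
  define y where "y m = (\<Sum>p\<in>{p\<in>P. p * m \<le> N}. x (p * m))" for m
  define S3 where "S3 = (\<Sum>m=1..N. ?\<mu> m *\<^sub>R y m)"
  have yV: "y m \<in> V" for m unfolding y_def by (intro V_rules x)
  have SV: "S1 \<in> V" "S2 \<in> V" "S3 \<in> V" "S \<in> V"
    unfolding S1_def S2_def S3_def S_def by (intro V_rules x yV)+
  have decomp: "H *\<^sub>R S = S1 + (S2 - S3)"
  proof -
    have "(\<Sum>n=1..N. (?\<mu> n * w n) *\<^sub>R x n) = (\<Sum>n=1..N. \<Sum>p\<in>P. if p dvd n then ?\<mu> n *\<^sub>R x n else 0)"
    proof (intro sum.cong refl)
      fix n
      have "(\<Sum>p\<in>P. if p dvd n then ?\<mu> n *\<^sub>R x n else 0) = (\<Sum>p\<in>{p\<in>P. p dvd n}. ?\<mu> n *\<^sub>R x n)"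
        using fin by (rule sum.inter_filter[symmetric])
      also have "\<dots> = w n *\<^sub>R (?\<mu> n *\<^sub>R x n)" by (simp only: sum_constant_scaleR w_def)
      finally show "(?\<mu> n * w n) *\<^sub>R x n = (\<Sum>p\<in>P. if p dvd n then ?\<mu> n *\<^sub>R x n else 0)"
        by (simp add: mult.commute)
    qed
    also have "\<dots> = (\<Sum>p\<in>P. \<Sum>n=1..N. if p dvd n then ?\<mu> n *\<^sub>R x n else 0)" by (rule sum.swap)
    also have "\<dots> = (\<Sum>p\<in>P. \<Sum>n\<in>{n\<in>{1..N}. p dvd n}. ?\<mu> n *\<^sub>R x n)"
      by (intro sum.cong refl sum.inter_filter[symmetric]) simp
    also have "\<dots> = (\<Sum>p\<in>P. \<Sum>m=1..N div p. ?\<mu> (p * m) *\<^sub>R x (p * m))"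
      by (intro sum.cong refl sum_multiples pos)
    also have "\<dots> = (\<Sum>p\<in>P. (\<Sum>m\<in>{m\<in>{1..N div p}. p dvd m}. ?\<mu> m *\<^sub>R x (p * m)) - (\<Sum>m=1..N div p. ?\<mu> m *\<^sub>R x (p * m)))"
    proof (intro sum.cong refl)
      fix p assume p: "p \<in> P"
      have "(\<Sum>m=1..N div p. ?\<mu> (p * m) *\<^sub>R x (p * m))
          = (\<Sum>m=1..N div p. (if p dvd m then ?\<mu> m *\<^sub>R x (p * m) else 0) - ?\<mu> m *\<^sub>R x (p * m))"
        by (intro sum.cong refl) (simp add: moebius_mu_prime_mult[OF pr[OF p]])
      then show "(\<Sum>m=1..N div p. ?\<mu> (p * m) *\<^sub>R x (p * m))
          = (\<Sum>m\<in>{m\<in>{1..N div p}. p dvd m}. ?\<mu> m *\<^sub>R x (p * m)) - (\<Sum>m=1..N div p. ?\<mu> m *\<^sub>R x (p * m))"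
        by (simp only: sum_subtractf sum.inter_filter[OF finite_atLeastAtMost])
    qed
    also have "\<dots> = S2 - (\<Sum>p\<in>P. \<Sum>m=1..N div p. ?\<mu> m *\<^sub>R x (p * m))"
      by (simp only: sum_subtractf S2_def)
    also have "(\<Sum>p\<in>P. \<Sum>m=1..N div p. ?\<mu> m *\<^sub>R x (p * m)) = S3"
    proof -
      have "S3 = (\<Sum>m=1..N. \<Sum>p\<in>P. if p * m \<le> N then ?\<mu> m *\<^sub>R x (p * m) else 0)"
        unfolding S3_def y_def scaleR_sum_right
        by (intro sum.cong refl sum.inter_filter fin)
      also have "\<dots> = (\<Sum>p\<in>P. \<Sum>m=1..N. if p * m \<le> N then ?\<mu> m *\<^sub>R x (p * m) else 0)" by (rule sum.swap)
      also have "\<dots> = (\<Sum>p\<in>P. \<Sum>m=1..N div p. ?\<mu> m *\<^sub>R x (p * m))"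
      proof (rule sum.cong[OF refl])
        fix p assume "p \<in> P"
        then have p: "p > 0" by (rule pos)
        have "{m\<in>{1..N}. p * m \<le> N} = {1..N div p}"
        proof -
          have "m \<le> N" if "p * m \<le> N" for m
          proof -
            have "1 * m \<le> p * m" using p by (intro mult_le_mono1) simp
            then have "m \<le> p * m" by (simp only: mult_1)
            then show ?thesis using that by (rule order_trans)
          qed
          then show ?thesis using p by (auto simp: less_eq_div_iff_mult_less_eq mult.commute)
        qed
        then show "(\<Sum>m=1..N. if p * m \<le> N then ?\<mu> m *\<^sub>R x (p * m) else 0) = (\<Sum>m=1..N div p. ?\<mu> m *\<^sub>R x (p * m))"
          by (simp only: sum.inter_filter[OF finite_atLeastAtMost, symmetric])
      qed
      finally show ?thesis by simp
    qed
    finally have *: "(\<Sum>n=1..N. (?\<mu> n * w n) *\<^sub>R x n) = S2 - S3" .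
    have "H *\<^sub>R S = S1 + (\<Sum>n=1..N. (?\<mu> n * w n) *\<^sub>R x n)"
      unfolding S_def S1_def scaleR_sum_right sum.distrib[symmetric]
      by (intro sum.cong refl) (simp add: scaleR_left_distrib[symmetric] right_diff_distrib mult.commute)
    then show ?thesis unfolding * .
  qed
  have b1: "nm S1 \<le> B * sqrt (real N * (real N * H + 2 * H * c))"
  proof -
    have "nm S1 \<le> (\<Sum>n=1..N. nm ((?\<mu> n * (H - w n)) *\<^sub>R x n))"
      unfolding S1_def by (intro nm_sum V_rules x)
    also have "\<dots> \<le> (\<Sum>n=1..N. \<bar>w n - H\<bar> * B)"
    proof (rule sum_mono)
      fix n
      have "\<bar>?\<mu> n\<bar> \<le> 1" using abs_moebius_mu_le[of n] by linarith
      then have "\<bar>?\<mu> n\<bar> * \<bar>w n - H\<bar> * nm (x n) \<le> 1 * \<bar>w n - H\<bar> * B"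
        by (intro mult_mono B mult_right_mono nm_nonneg x) auto
      then show "nm ((?\<mu> n * (H - w n)) *\<^sub>R x n) \<le> \<bar>w n - H\<bar> * B"
        by (simp add: nm_scale x abs_mult abs_minus_commute)
    qed
    also have "\<dots> = B * (\<Sum>n=1..N. \<bar>w n - H\<bar>)" 
      unfolding sum_distrib_right[symmetric] by (rule mult.commute)
    also have "(\<Sum>n=1..N. \<bar>w n - H\<bar>) \<le> sqrt (real N * (real N * H + 2 * H * c))"
    proof (rule real_le_rsqrt)
      have "(\<Sum>n=1..N. \<bar>w n - H\<bar>)\<^sup>2 \<le> real (card {1..N}) * (\<Sum>n=1..N. \<bar>w n - H\<bar>\<^sup>2)"
        using sum_squared_le_sum_of_squares[of "\<lambda>n. \<bar>w n - H\<bar>" "{1..N}"] by (simp add: mult.commute)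
      also have "\<dots> \<le> real N * (real N * H + 2 * H * c)"
      proof -
        have "(\<Sum>n=1..N. (w n - H)\<^sup>2) \<le> real N * H + 2 * H * c"
          using Turan_Kubilius[OF fin pr, of N] unfolding w_def H_def c_def .
        then have "real N * (\<Sum>n=1..N. (w n - H)\<^sup>2) \<le> real N * (real N * H + 2 * H * c)"
          by (rule mult_left_mono) simp
        then show ?thesis by simp
      qed
      finally show "(\<Sum>n=1..N. \<bar>w n - H\<bar>)\<^sup>2 \<le> real N * (real N * H + 2 * H * c)" .
    qed
    finally show ?thesis using B0 by (simp add: mult_left_mono)
  qed
  have b2: "nm S2 \<le> B * real N * (\<Sum>n. 1 / real (Suc n) ^ 2)"
  proof -
    have summ: "summable (\<lambda>n. 1 / real (Suc n) ^ 2)"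
      using inverse_squares_sums by (auto simp: sums_iff add.commute)
    have "nm S2 \<le> (\<Sum>p\<in>P. nm (\<Sum>m\<in>{m\<in>{1..N div p}. p dvd m}. ?\<mu> m *\<^sub>R x (p * m)))"
      unfolding S2_def by (intro nm_sum V_rules x)
    also have "\<dots> \<le> (\<Sum>p\<in>P. B * real N * (1 / real p ^ 2))"
    proof (rule sum_mono)
      fix p assume p: "p \<in> P"
      have "nm (\<Sum>m\<in>{m\<in>{1..N div p}. p dvd m}. ?\<mu> m *\<^sub>R x (p * m))
          \<le> (\<Sum>m\<in>{m\<in>{1..N div p}. p dvd m}. nm (?\<mu> m *\<^sub>R x (p * m)))"
        by (intro nm_sum V_rules x)
      also have "\<dots> \<le> (\<Sum>m\<in>{m\<in>{1..N div p}. p dvd m}. B)"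
        by (intro sum_mono order_trans[OF nm_moebius_scale B] x)
      also have "\<dots> = real (N div p div p) * B"
        using card_multiples[OF pos[OF p], of "N div p"] by simp
      also have "\<dots> \<le> (real N / real p / real p) * B"
      proof (rule mult_right_mono[OF _ B0])
        have "real (N div p div p) \<le> real (N div p) / real p" by (rule of_nat_div_le_of_nat)
        also have "\<dots> \<le> real N / real p / real p" by (intro divide_right_mono of_nat_div_le_of_nat) simp
        finally show "real (N div p div p) \<le> real N / real p / real p" .
      qed
      also have "\<dots> = B * real N * (1 / real p ^ 2)" by (simp add: power2_eq_square)
      finally show "nm (\<Sum>m\<in>{m\<in>{1..N div p}. p dvd m}. ?\<mu> m *\<^sub>R x (p * m)) \<le> B * real N * (1 / real p ^ 2)" .
    qed
    also have "\<dots> = B * real N * (\<Sum>p\<in>P. 1 / real p ^ 2)" by (rule sum_distrib_left[symmetric])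
    also have "(\<Sum>p\<in>P. 1 / real p ^ 2) \<le> (\<Sum>n. 1 / real (Suc n) ^ 2)"
    proof -
      have inj: "inj_on (\<lambda>p. p - 1) P"
      proof (rule inj_onI)
        fix p q assume "p \<in> P" "q \<in> P" "p - 1 = q - 1"
        then show "p = q" using pos[of p] pos[of q] by linarith
      qed
      have Sp: "Suc (p - 1) = p" if "p \<in> P" for p using pos[OF that] by simp
      have "(\<Sum>n\<in>(\<lambda>p. p - 1) ` P. 1 / real (Suc n) ^ 2) = (\<Sum>p\<in>P. 1 / real p ^ 2)"
        unfolding sum.reindex[OF inj] o_def by (intro sum.cong refl) (simp only: Sp)
      moreover have "(\<Sum>n\<in>(\<lambda>p. p - 1) ` P. 1 / real (Suc n) ^ 2) \<le> (\<Sum>n. 1 / real (Suc n) ^ 2)"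
        using fin by (intro sum_le_suminf[OF summ]) auto
      ultimately show ?thesis by simp
    qed
    finally show ?thesis using B0 by (simp add: mult_left_mono)
  qed
  have b3: "nm S3 \<le> sqrt (real N * (real N * H * B\<^sup>2 + c\<^sup>2 * (\<epsilon> * real N + D)))"
  proof (rule real_le_rsqrt)
    have "nm S3 \<le> (\<Sum>m=1..N. nm (?\<mu> m *\<^sub>R y m))" unfolding S3_def by (intro nm_sum V_rules yV)
    also have "\<dots> \<le> (\<Sum>m=1..N. nm (y m))" by (intro sum_mono nm_moebius_scale yV)
    finally have "(nm S3)\<^sup>2 \<le> (\<Sum>m=1..N. nm (y m))\<^sup>2"
      using nm_nonneg[OF SV(3)] by (rule power_mono)
    also have "\<dots> \<le> real N * (\<Sum>m=1..N. (nm (y m))\<^sup>2)"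
      using sum_squared_le_sum_of_squares[of "\<lambda>m. nm (y m)" "{1..N}"] by (simp add: mult.commute)
    also have "\<dots> \<le> real N * (real N * H * B\<^sup>2 + c\<^sup>2 * (\<epsilon> * real N + D))"
    proof (rule mult_left_mono)
      have ex: "(nm (y m))\<^sup>2 = (\<Sum>p\<in>P. \<Sum>q\<in>P. if p * m \<le> N \<and> q * m \<le> N then ip (x (p * m)) (x (q * m)) else 0)" for m
      proof -
        have "(nm (y m))\<^sup>2 = ip (y m) (y m)" by (rule nm_sq[OF yV])
        also have "\<dots> = (\<Sum>p\<in>{p\<in>P. p * m \<le> N}. ip (x (p * m)) (y m))"
          by (subst (1) y_def) (intro ip_sum_left x yV)
        also have "\<dots> = (\<Sum>p\<in>{p\<in>P. p * m \<le> N}. \<Sum>q\<in>{q\<in>P. q * m \<le> N}. ip (x (p * m)) (x (q * m)))"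
          unfolding y_def by (intro sum.cong refl ip_sum_right x)
        also have "\<dots> = (\<Sum>p\<in>P. if p * m \<le> N then (\<Sum>q\<in>P. if q * m \<le> N then ip (x (p * m)) (x (q * m)) else 0) else 0)"
          by (simp only: sum.inter_filter[OF fin])
        also have "\<dots> = (\<Sum>p\<in>P. \<Sum>q\<in>P. if p * m \<le> N \<and> q * m \<le> N then ip (x (p * m)) (x (q * m)) else 0)"
          by (intro sum.cong refl) simp
        finally show ?thesis .
      qed
      have "(\<Sum>m=1..N. (nm (y m))\<^sup>2) = (\<Sum>p\<in>P. \<Sum>q\<in>P. \<Sum>m=1..N. if p * m \<le> N \<and> q * m \<le> N then ip (x (p * m)) (x (q * m)) else 0)"
        unfolding ex by (rule trans[OF sum.swap sum.cong[OF refl sum.swap]])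
      also have "\<dots> \<le> (\<Sum>p\<in>P. \<Sum>q\<in>P. (if p = q then real N / real p * B\<^sup>2 else 0) + (\<epsilon> * real N + D))"
      proof (intro sum_mono)
        fix p q assume pq: "p \<in> P" "q \<in> P"
        define M where "M = N div (max p q)"
        have mx: "max p q > 0" using pos[OF pq(1)] by (simp add: less_max_iff_disj)
        have set: "{m\<in>{1..N}. p * m \<le> N \<and> q * m \<le> N} = {1..M}"
        proof -
          have "p * m \<le> N \<and> q * m \<le> N \<longleftrightarrow> max p q * m \<le> N" for m
          proof (cases "p \<le> q")
            case True
            then show ?thesis using order_trans[OF mult_le_mono1[OF True, of m], of N] by (simp only: max_absorb2[OF True]) blast
          next
            case False
            then have le: "q \<le> p" by simp
            show ?thesis using order_trans[OF mult_le_mono1[OF le, of m], of N] by (simp only: max_absorb1[OF le]) blast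
          qed
          moreover have "max p q * m \<le> N \<longleftrightarrow> m \<le> M" for m
            using mx by (simp add: M_def less_eq_div_iff_mult_less_eq mult.commute)
          moreover have "M \<le> N" by (simp add: M_def)
          ultimately show ?thesis by auto
        qed
        have MN: "real M \<le> real N" by (simp add: M_def)
        have eq: "(\<Sum>m=1..N. if p * m \<le> N \<and> q * m \<le> N then ip (x (p * m)) (x (q * m)) else 0) = (\<Sum>m=1..M. ip (x (p * m)) (x (q * m)))"
          by (simp only: sum.inter_filter[OF finite_atLeastAtMost, symmetric] set)
        show "(\<Sum>m=1..N. if p * m \<le> N \<and> q * m \<le> N then ip (x (p * m)) (x (q * m)) else 0)
            \<le> (if p = q then real N / real p * B\<^sup>2 else 0) + (\<epsilon> * real N + D)"
        proof (cases "p = q")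
          case True
          have "(\<Sum>m=1..M. ip (x (p * m)) (x (q * m))) \<le> (\<Sum>m=1..M. B\<^sup>2)"
          proof (rule sum_mono)
            fix m
            have "(nm (x (p * m)))\<^sup>2 \<le> B\<^sup>2" by (intro power_mono B nm_nonneg x)
            then show "ip (x (p * m)) (x (q * m)) \<le> B\<^sup>2" using True nm_sq[OF x] by simp
          qed
          also have "\<dots> = real (N div p) * B\<^sup>2" using True by (simp add: M_def)
          also have "\<dots> \<le> real N / real p * B\<^sup>2" by (intro mult_right_mono of_nat_div_le_of_nat) simp
          finally show ?thesis using True eq \<epsilon> by (simp add: add_increasing2)
        next
          case False
          have "(\<Sum>m=1..M. ip (x (p * m)) (x (q * m))) \<le> \<epsilon> * real M + D"
            using corr[OF pq False, of M] by linarith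
          also have "\<dots> \<le> \<epsilon> * real N + D" using \<epsilon> MN by (simp add: mult_left_mono)
          finally show ?thesis using False eq by simp
        qed
      qed
      also have "\<dots> = (\<Sum>p\<in>P. real N / real p * B\<^sup>2) + c\<^sup>2 * (\<epsilon> * real N + D)"
        using fin by (simp add: sum.distrib c_def power2_eq_square)
      also have "(\<Sum>p\<in>P. real N / real p * B\<^sup>2) = real N * H * B\<^sup>2"
        by (simp add: H_def sum_distrib_left sum_distrib_right)
      finally show "(\<Sum>m=1..N. (nm (y m))\<^sup>2) \<le> real N * H * B\<^sup>2 + c\<^sup>2 * (\<epsilon> * real N + D)" .
    qed simp
    finally show "(nm S3)\<^sup>2 \<le> real N * (real N * H * B\<^sup>2 + c\<^sup>2 * (\<epsilon> * real N + D))" .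
  qed
  have "H * nm S = nm (S1 + (S2 - S3))" using H0 SV by (simp add: decomp[symmetric] nm_scale)
  also have "\<dots> \<le> nm S1 + nm (S2 - S3)" using SV by (intro nm_triangle V_rules)
  also have "nm (S2 - S3) \<le> nm (S2 - 0) + nm (0 - S3)" using SV by (intro nm_diff_triangle V_rules)
  also have "nm (0 - S3) = nm S3" using nm_minus_commute[OF V_rules(1) SV(3)] by simp
  finally show ?thesis using b1 b2 b3 by (simp add: S_def)
qed

text \<open>
Divided by \<open>H N\<close>, all three terms of the inequality become small when \<open>H\<close> is large; then \<open>\<epsilon>\<close> is chosen in terms of
\<open>P\<close>. The point of this form is that \<open>P\<close> and \<open>\<epsilon>\<close> depend only on \<open>\<delta>\<close> and the bound \<open>B\<close>, and not on the sequence.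
\<close>

lemma Katai_criterion:
  assumes \<delta>: "\<delta> > 0"
  obtains P \<epsilon> where "finite P" "\<And>p. p \<in> P \<Longrightarrow> prime p" "\<epsilon> > 0"
    "\<And>x D. (\<And>n. x n \<in> V) \<Longrightarrow> (\<And>n. nm (x n) \<le> B) \<Longrightarrow> D \<ge> 0 \<Longrightarrow>
      (\<And>p q M. p \<in> P \<Longrightarrow> q \<in> P \<Longrightarrow> p \<noteq> q \<Longrightarrow>
        \<bar>\<Sum>m=1..M. ip (x (p * m)) (x (q * m))\<bar> \<le> \<epsilon> * real M + D) \<Longrightarrow>
      \<forall>\<^sub>F N in sequentially. nm (mavg x N) < \<delta>"
proof -
  define G where "G = (\<Sum>n. 1 / real (Suc n) ^ 2)"
  have l: "((\<lambda>H::real. 1 / H) \<longlongrightarrow> 0) at_top" by real_asymp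
  have "((\<lambda>H. B * sqrt (1 / H) + B * G * (1 / H) + sqrt (B\<^sup>2 * (1 / H) + (1 / H)\<^sup>2)) \<longlongrightarrow>
      B * sqrt 0 + B * G * 0 + sqrt (B\<^sup>2 * 0 + 0\<^sup>2)) at_top"
    by (intro tendsto_intros l)
  then have "((\<lambda>H. B * sqrt (1 / H) + B * G / H + sqrt (H * B\<^sup>2 + 1) / H) \<longlongrightarrow>
      B * sqrt 0 + B * G * 0 + sqrt (B\<^sup>2 * 0 + 0\<^sup>2)) at_top"
  proof (rule Lim_transform_eventually)
    show "\<forall>\<^sub>F H in at_top. B * sqrt (1 / H) + B * G * (1 / H) + sqrt (B\<^sup>2 * (1 / H) + (1 / H)\<^sup>2) =
        B * sqrt (1 / H) + B * G / H + sqrt (H * B\<^sup>2 + 1) / H"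
      using eventually_gt_at_top[of 0]
    proof eventually_elim
      case (elim H)
      have "B\<^sup>2 * (1 / H) + (1 / H)\<^sup>2 = (H * B\<^sup>2 + 1) / H\<^sup>2"
        using elim by (simp add: power2_eq_square field_simps)
      then show ?case using elim by (simp add: real_sqrt_divide)
    qed
  qed
  then have "((\<lambda>H. B * sqrt (1 / H) + B * G / H + sqrt (H * B\<^sup>2 + 1) / H) \<longlongrightarrow> 0) at_top"
    by simp
  then have "\<forall>\<^sub>F H in at_top. B * sqrt (1 / H) + B * G / H + sqrt (H * B\<^sup>2 + 1) / H < \<delta>"
    using \<delta> by (rule order_tendstoD(2))
  then obtain R where R: "\<And>H. H \<ge> R \<Longrightarrow> B * sqrt (1 / H) + B * G / H + sqrt (H * B\<^sup>2 + 1) / H < \<delta>"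
    by (auto simp: eventually_at_top_linorder)
  obtain P where P: "finite P" "\<And>p. p \<in> P \<Longrightarrow> prime p" "(\<Sum>p\<in>P. 1 / real p) \<ge> max R 1"
    using prime_reciprocals_unbounded[of "max R 1"] by blast
  define H where "H = (\<Sum>p\<in>P. 1 / real p)"
  define c where "c = real (card P)"
  have H: "H \<ge> 1" "H \<ge> R" using P(3) by (auto simp: H_def)
  have c: "c > 0"
  proof -
    have "P \<noteq> {}" using H(1) by (auto simp: H_def)
    then show ?thesis using P(1) by (simp add: c_def card_gt_0_iff)
  qed
  show thesis
  proof (rule that[of P "1 / c\<^sup>2"])
    fix x D
    assume x: "\<And>n. x n \<in> V" "\<And>n. nm (x n) \<le> B" and D: "D \<ge> 0"
      and corr: "\<And>p q M. p \<in> P \<Longrightarrow> q \<in> P \<Longrightarrow> p \<noteq> q \<Longrightarrow>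
        \<bar>\<Sum>m=1..M. ip (x (p * m)) (x (q * m))\<bar> \<le> 1 / c\<^sup>2 * real M + D"
    define g where "g N = B * sqrt (1 / H + 2 * c / (H * real N)) + B * G / H
      + sqrt (H * B\<^sup>2 + 1 + c\<^sup>2 * D / real N) / H" for N :: nat
    have "g \<longlonglongrightarrow> B * sqrt (1 / H + 0) + B * G / H + sqrt (H * B\<^sup>2 + 1 + 0) / H"
    proof -
      have 1: "(\<lambda>N. 2 * c / (H * real N)) \<longlonglongrightarrow> 0" using H by real_asymp
      have 2: "(\<lambda>N. c\<^sup>2 * D / real N) \<longlonglongrightarrow> 0" by real_asymp
      show ?thesis unfolding g_def using H by (intro tendsto_intros 1 2) auto
    qed
    then have "\<forall>\<^sub>F N in sequentially. g N < \<delta>"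
      using R[OF H(2)] by (intro order_tendstoD(2)) auto
    then show "\<forall>\<^sub>F N in sequentially. nm (mavg x N) < \<delta>"
      using eventually_gt_at_top[of 0]
    proof eventually_elim
      case (elim N)
      then have N: "real N > 0" by simp
      define S where "S = (\<Sum>n=1..N. of_int (moebius_mu n) *\<^sub>R x n)"
      have SV: "S \<in> V" unfolding S_def by (intro V_rules x)
      have "H * nm S \<le> B * sqrt (real N * (real N * H + 2 * H * c)) + B * real N * G
        + sqrt (real N * (real N * H * B\<^sup>2 + c\<^sup>2 * (1 / c\<^sup>2 * real N + D)))"
        unfolding S_def H_def c_def G_def
        by (rule Katai_inequality[OF P(1,2) x]) (use corr D in \<open>simp_all add: c_def\<close>)
      also have "real N * (real N * H + 2 * H * c) = (real N * H)\<^sup>2 * (1 / H + 2 * c / (H * real N))"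
        using N H by (simp add: power2_eq_square field_simps)
      also have "sqrt \<dots> = real N * H * sqrt (1 / H + 2 * c / (H * real N))"
        using N H by (simp add: real_sqrt_mult)
      also have "real N * (real N * H * B\<^sup>2 + c\<^sup>2 * (1 / c\<^sup>2 * real N + D)) = (real N)\<^sup>2 * (H * B\<^sup>2 + 1 + c\<^sup>2 * D / real N)"
        using N c by (simp add: power2_eq_square field_simps)
      also have "sqrt \<dots> = real N * sqrt (H * B\<^sup>2 + 1 + c\<^sup>2 * D / real N)"
        using N by (simp add: real_sqrt_mult)
      also have "B * (real N * H * sqrt (1 / H + 2 * c / (H * real N))) + B * real N * G
          + real N * sqrt (H * B\<^sup>2 + 1 + c\<^sup>2 * D / real N) = H * (real N * g N)"
        using H by (simp add: g_def distrib_left mult_ac)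
      finally have "nm S \<le> real N * g N" using H by simp
      moreover have "nm (mavg x N) = nm S / real N"
        unfolding mavg_def S_def[symmetric] using N SV by (simp add: nm_scale)
      ultimately have "nm (mavg x N) \<le> g N" using N by (simp add: pos_divide_le_eq mult.commute)
      then show ?case using elim(1) by simp
    qed
  qed (use P c in auto)
qed

end

section \<open>Orbits of isometries\<close>

locale semi_inner_isometry = semi_inner V ip for V :: "'v::real_vector set" and ip +
  fixes U :: "'v \<Rightarrow> 'v"
  assumes U_in: "x \<in> V \<Longrightarrow> U x \<in> V"
    and U_add: "x \<in> V \<Longrightarrow> y \<in> V \<Longrightarrow> U (x + y) = U x + U y"
    and U_scale: "x \<in> V \<Longrightarrow> U (r *\<^sub>R x) = r *\<^sub>R U x"
    and U_ip: "x \<in> V \<Longrightarrow> y \<in> V \<Longrightarrow> ip (U x) (U y) = ip x y"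
begin

lemma Un_in: "x \<in> V \<Longrightarrow> (U ^^ n) x \<in> V"
  by (induction n) (simp_all add: U_in)

lemma Un_add: "x \<in> V \<Longrightarrow> y \<in> V \<Longrightarrow> (U ^^ n) (x + y) = (U ^^ n) x + (U ^^ n) y"
  by (induction n) (simp_all add: U_add Un_in)

lemma Un_scale: "x \<in> V \<Longrightarrow> (U ^^ n) (r *\<^sub>R x) = r *\<^sub>R (U ^^ n) x"
  by (induction n) (simp_all add: U_scale Un_in)

lemma Un_diff: "x \<in> V \<Longrightarrow> y \<in> V \<Longrightarrow> (U ^^ n) (x - y) = (U ^^ n) x - (U ^^ n) y"
  using Un_add[of x "(-1) *\<^sub>R y" n] Un_scale[of y n "-1"] V_rules(4)[of y "-1"] by simp

lemma Un_ip: "x \<in> V \<Longrightarrow> y \<in> V \<Longrightarrow> ip ((U ^^ n) x) ((U ^^ n) y) = ip x y"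
  by (induction n) (simp_all add: U_ip Un_in)

lemma Un_nm: "x \<in> V \<Longrightarrow> nm ((U ^^ n) x) = nm x"
  by (simp add: nm_def Un_ip)

lemma Un_Un: "(U ^^ m) ((U ^^ n) x) = (U ^^ (m + n)) x"
  by (simp add: funpow_add)

text \<open>
The convex hulls for \<open>K\<close> shrink as \<open>K\<close> passes to multiples. Averaging \<open>U\<^sup>K\<close> over the orbit of \<open>x\<close> would lead to the vector of
least norm in the completion; near-minimisers inside the hull replace it.
\<close>

definition orbit_hull :: "nat \<Rightarrow> 'v \<Rightarrow> 'v set" where
  "orbit_hull K x = convex hull (range (\<lambda>j. (U ^^ (K * j)) x))"

lemma orbit_hull_subset: "x \<in> V \<Longrightarrow> orbit_hull K x \<subseteq> V"
  unfolding orbit_hull_def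
  by (rule hull_minimal) (auto simp: Un_in subspace_imp_convex[OF subspace])

lemma orbit_hull_self: "x \<in> orbit_hull K x"
  unfolding orbit_hull_def by (rule hull_inc) (auto intro!: range_eqI[of _ _ 0])

lemma orbit_hull_mono: "K dvd L \<Longrightarrow> orbit_hull L x \<subseteq> orbit_hull K x"
  unfolding orbit_hull_def by (rule hull_mono) (auto simp: mult.assoc)

lemma orbit_hull_invariant:
  assumes x: "x \<in> V" and y: "y \<in> orbit_hull K x"
  shows "(U ^^ (K * j)) y \<in> orbit_hull K x"
proof -
  let ?S = "range (\<lambda>j. (U ^^ (K * j)) x)"
  have sub: "?S \<subseteq> V" using x by (auto simp: Un_in)
  let ?T = "{z \<in> V. (U ^^ (K * j)) z \<in> orbit_hull K x}"
  have "convex ?T"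
  proof (rule convexI)
    fix z z' and u v :: real
    assume z: "z \<in> ?T" "z' \<in> ?T" and uv: "0 \<le> u" "0 \<le> v" "u + v = 1"
    have "(U ^^ (K * j)) (u *\<^sub>R z + v *\<^sub>R z') = u *\<^sub>R (U ^^ (K * j)) z + v *\<^sub>R (U ^^ (K * j)) z'"
      using z by (simp add: Un_add Un_scale V_rules)
    also have "\<dots> \<in> orbit_hull K x"
      using z uv unfolding orbit_hull_def by (intro convexD convex_convex_hull) auto
    finally show "u *\<^sub>R z + v *\<^sub>R z' \<in> ?T" using z by (simp add: V_rules)
  qed
  moreover have "?S \<subseteq> ?T"
  proof
    fix z assume "z \<in> ?S"
    then obtain i where i: "z = (U ^^ (K * i)) x" by blast
    have "(U ^^ (K * j)) z = (U ^^ (K * (j + i))) x" by (simp add: i Un_Un distrib_left)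
    then have "(U ^^ (K * j)) z \<in> orbit_hull K x" unfolding orbit_hull_def by (intro hull_inc) auto
    then show "z \<in> ?T" using i x by (simp add: Un_in)
  qed
  ultimately have "orbit_hull K x \<subseteq> ?T" unfolding orbit_hull_def by (intro hull_minimal)
  then show ?thesis using y by blast
qed

definition dist_hull :: "nat \<Rightarrow> 'v \<Rightarrow> real" where
  "dist_hull K x = Inf (nm ` orbit_hull K x)"

lemma dist_hull_le: "x \<in> V \<Longrightarrow> y \<in> orbit_hull K x \<Longrightarrow> dist_hull K x \<le> nm y"
  unfolding dist_hull_def using orbit_hull_subset[of x K] nm_nonneg
  by (intro cINF_lower bdd_belowI2[of _ 0]) auto

lemma dist_hull_nonneg: "x \<in> V \<Longrightarrow> 0 \<le> dist_hull K x"
  unfolding dist_hull_def using orbit_hull_subset[of x K] nm_nonneg orbit_hull_self[of x K]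
  by (intro cINF_greatest) auto

lemma dist_hull_near:
  assumes "x \<in> V" "e > 0"
  obtains y where "y \<in> orbit_hull K x" "nm y < dist_hull K x + e"
proof -
  have "Inf (nm ` orbit_hull K x) < dist_hull K x + e" using assms by (simp add: dist_hull_def)
  then obtain y where "y \<in> orbit_hull K x" "nm y < dist_hull K x + e"
    using orbit_hull_self[of x K] by (auto dest!: cInf_lessD[rotated])
  then show thesis by (rule that)
qed

text \<open>
The midpoint lies in the hull again, so its norm is at least \<open>dist_hull K x\<close>; now apply the parallelogram law.
\<close>

lemma near_minimisers_close:
  assumes x: "x \<in> V" and y: "y \<in> orbit_hull K x" "y' \<in> orbit_hull K x"
    and r: "nm y \<le> r" "nm y' \<le> r"
  shows "(nm (y - y'))\<^sup>2 \<le> 4 * r\<^sup>2 - 4 * (dist_hull K x)\<^sup>2"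
proof -
  have V: "y \<in> V" "y' \<in> V" using orbit_hull_subset[OF x] y by auto
  have "(1/2) *\<^sub>R y + (1/2) *\<^sub>R y' \<in> orbit_hull K x"
    using y unfolding orbit_hull_def by (intro convexD convex_convex_hull) auto
  then have "dist_hull K x \<le> nm ((1/2) *\<^sub>R (y + y'))"
    using dist_hull_le[OF x] by (simp add: scaleR_add_right)
  then have "(dist_hull K x)\<^sup>2 \<le> (nm ((1/2) *\<^sub>R (y + y')))\<^sup>2"
    using dist_hull_nonneg[OF x] by (rule power_mono)
  moreover have "(nm y)\<^sup>2 \<le> r\<^sup>2" "(nm y')\<^sup>2 \<le> r\<^sup>2" using r V by (auto intro!: power_mono nm_nonneg)
  ultimately show ?thesis unfolding parallelogram[OF V] by linarith
qed

text \<open>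
For \<open>y = (U ^^ (k * i)) x\<close> the sum telescopes to at most \<open>2 i\<close> vectors of the norm of \<open>x\<close>, and the set of \<open>y\<close> for which the
sums stay bounded is convex.
\<close>

lemma ergodic_average_hull:
  assumes x: "x \<in> V" and kL: "k dvd L" and y: "y \<in> orbit_hull L x"
  shows "\<exists>D. \<forall>M. nm (\<Sum>m=1..M. (U ^^ (k * m)) (x - y)) \<le> D"
proof -
  let ?S = "range (\<lambda>j. (U ^^ (L * j)) x)"
  let ?T = "{z \<in> V. \<exists>D. \<forall>M. nm (\<Sum>m=1..M. (U ^^ (k * m)) (x - z)) \<le> D}"
  have "convex ?T"
  proof (rule convexI)
    fix z z' and u v :: real
    assume z: "z \<in> ?T" "z' \<in> ?T" and uv: "0 \<le> u" "0 \<le> v" "u + v = 1"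
    from z obtain D D' where D: "\<And>M. nm (\<Sum>m=1..M. (U ^^ (k * m)) (x - z)) \<le> D"
      "\<And>M. nm (\<Sum>m=1..M. (U ^^ (k * m)) (x - z')) \<le> D'" by blast
    have zV: "z \<in> V" "z' \<in> V" using z by auto
    have "nm (\<Sum>m=1..M. (U ^^ (k * m)) (x - (u *\<^sub>R z + v *\<^sub>R z'))) \<le> u * D + v * D'" for M
    proof -
      define A where "A = (\<Sum>m=1..M. (U ^^ (k * m)) (x - z))"
      define A' where "A' = (\<Sum>m=1..M. (U ^^ (k * m)) (x - z'))"
      have AV: "A \<in> V" unfolding A_def using x zV by (intro V_rules Un_in)
      have AV': "A' \<in> V" unfolding A'_def using x zV by (intro V_rules Un_in)
      have "x = (u + v) *\<^sub>R x" using uv by simp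
      then have "x - (u *\<^sub>R z + v *\<^sub>R z') = u *\<^sub>R (x - z) + v *\<^sub>R (x - z')"
        by (simp add: scaleR_left_distrib scaleR_right_diff_distrib)
      then have "(\<Sum>m=1..M. (U ^^ (k * m)) (x - (u *\<^sub>R z + v *\<^sub>R z'))) = u *\<^sub>R A + v *\<^sub>R A'"
        using x zV by (simp add: A_def A'_def Un_add Un_scale V_rules sum.distrib scaleR_sum_right)
      also have "nm \<dots> \<le> nm (u *\<^sub>R A) + nm (v *\<^sub>R A')" using AV AV' by (intro nm_triangle V_rules)
      also have "\<dots> \<le> u * D + v * D'"
      proof -
        have "nm A \<le> D" "nm A' \<le> D'" unfolding A_def A'_def by (rule D)+
        then show ?thesis using uv AV AV' by (simp add: nm_scale add_mono mult_left_mono)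
      qed
      finally show ?thesis .
    qed
    then show "u *\<^sub>R z + v *\<^sub>R z' \<in> ?T" using zV by (auto simp: V_rules)
  qed
  moreover have "?S \<subseteq> ?T"
  proof
    fix z assume "z \<in> ?S"
    then obtain j where j: "z = (U ^^ (L * j)) x" by blast
    obtain l where l: "L = k * l" using kL by blast
    define i where "i = l * j"
    have zi: "z = (U ^^ (k * i)) x" by (simp add: j l i_def mult.assoc)
    have "nm (\<Sum>m=1..M. (U ^^ (k * m)) (x - z)) \<le> 2 * real i * nm x" for M
    proof -
      define v where "v m = (U ^^ (k * m)) x" for m
      have vV: "v m \<in> V" for m using x by (simp add: v_def Un_in)
      have "(U ^^ (k * m)) (x - z) = v m - v (m + i)" for m
        using x by (simp add: Un_diff Un_in zi v_def Un_Un distrib_left)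
      then have "(\<Sum>m=1..M. (U ^^ (k * m)) (x - z)) = (\<Sum>m=1..M. v m - v (m + i))" by simp
      also have "\<dots> = (\<Sum>m=1..i. v m) - (\<Sum>m=1..i. v (M + m))"
      proof -
        have s: "(\<Sum>m=1..a + b. v m) = (\<Sum>m=1..a. v m) + (\<Sum>m=1..b. v (a + m))" for a b
          by (induction b) (simp_all add: add.assoc)
        have "(\<Sum>m=1..i. v m) + (\<Sum>m=1..M. v (i + m)) = (\<Sum>m=1..M. v m) + (\<Sum>m=1..i. v (M + m))"
          using s[of i M] s[of M i] by (simp add: add.commute)
        then show ?thesis by (simp add: sum_subtractf add.commute algebra_simps)
      qed
      also have "nm \<dots> \<le> nm ((\<Sum>m=1..i. v m) - 0) + nm (0 - (\<Sum>m=1..i. v (M + m)))"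
        by (intro nm_diff_triangle V_rules vV)
      also have "nm (0 - (\<Sum>m=1..i. v (M + m))) = nm ((\<Sum>m=1..i. v (M + m)) - 0)"
        by (intro nm_minus_commute V_rules vV)
      also have "nm ((\<Sum>m=1..i. v m) - 0) \<le> (\<Sum>m=1..i. nm (v m))"
        unfolding diff_zero by (intro nm_sum vV)
      also have "nm ((\<Sum>m=1..i. v (M + m)) - 0) \<le> (\<Sum>m=1..i. nm (v (M + m)))"
        unfolding diff_zero by (intro nm_sum vV)
      finally show ?thesis using x by (simp add: v_def Un_nm)
    qed
    then show "z \<in> ?T" using x zi by (auto simp: Un_in)
  qed
  ultimately have "orbit_hull L x \<subseteq> ?T" unfolding orbit_hull_def by (intro hull_minimal)
  then show ?thesis using y by blast
qed

text \<open>
Replacing \<open>(U ^^ n) y\<close> by \<open>(U ^^ (n mod K)) y\<close> costs at most \<open>\<kappa>\<close>, and what results is a combination of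
averages of \<open>\<mu>\<close> over residue classes.
\<close>

lemma mavg_almost_periodic:
  assumes mu: "\<And>r. (\<lambda>N. (\<Sum>n=1..N. of_int (moebius_mu n) * of_bool (n mod K = r)) / real N) \<longlonglongrightarrow> 0"
    and K: "K > 0" and y: "y \<in> V" and ap: "\<And>j. nm ((U ^^ (K * j)) y - y) \<le> \<kappa>" and \<kappa>: "\<kappa> < \<delta>"
  shows "\<forall>\<^sub>F N in sequentially. nm (mavg (\<lambda>n. (U ^^ n) y) N) < \<delta>"
proof -
  define A where "A r N = (\<Sum>n=1..N. of_int (moebius_mu n) * of_bool (n mod K = r)) / real N" for r N
  have "(\<lambda>N. \<kappa> + (\<Sum>r<K. \<bar>A r N\<bar> * nm y)) \<longlonglongrightarrow> \<kappa> + (\<Sum>r<K. \<bar>0\<bar> * nm y)"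
    using mu unfolding A_def by (intro tendsto_intros)
  then have "\<forall>\<^sub>F N in sequentially. \<kappa> + (\<Sum>r<K. \<bar>A r N\<bar> * nm y) < \<delta>"
    using \<kappa> by (intro order_tendstoD(2)) auto
  then show ?thesis using eventually_gt_at_top[of 0]
  proof eventually_elim
    case (elim N)
    let ?\<mu> = "\<lambda>n. real_of_int (moebius_mu n)"
    define X where "X = (\<Sum>n=1..N. ?\<mu> n *\<^sub>R ((U ^^ n) y - (U ^^ (n mod K)) y))"
    define Y where "Y = (\<Sum>n=1..N. ?\<mu> n *\<^sub>R (U ^^ (n mod K)) y)"
    have X: "X \<in> V" unfolding X_def using y by (intro V_rules Un_in)
    have Y: "Y \<in> V" unfolding Y_def using y by (intro V_rules Un_in)
    note XY = X Y
    have "mavg (\<lambda>n. (U ^^ n) y) N = (1 / real N) *\<^sub>R (X + Y)"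
      unfolding mavg_def X_def Y_def sum.distrib[symmetric] scaleR_add_right[symmetric] by simp
    then have "nm (mavg (\<lambda>n. (U ^^ n) y) N) = nm (X + Y) / real N"
      using XY by (simp add: nm_scale V_rules)
    also have "\<dots> \<le> (nm X + nm Y) / real N" using XY by (intro divide_right_mono nm_triangle) auto
    also have "\<dots> = nm X / real N + nm Y / real N" by (rule add_divide_distrib)
    also have "nm X / real N \<le> \<kappa>"
    proof -
      have "nm X \<le> (\<Sum>n=1..N. nm (?\<mu> n *\<^sub>R ((U ^^ n) y - (U ^^ (n mod K)) y)))"
        unfolding X_def using y by (intro nm_sum V_rules Un_in)
      also have "\<dots> \<le> (\<Sum>n=1..N. \<kappa>)"
      proof (rule sum_mono)
        fix n
        have "(U ^^ n) y = (U ^^ (n mod K)) ((U ^^ (K * (n div K))) y)"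
          by (simp add: Un_Un)
        then have "(U ^^ n) y - (U ^^ (n mod K)) y = (U ^^ (n mod K)) ((U ^^ (K * (n div K))) y - y)"
          using y by (simp add: Un_diff Un_in)
        then have "nm ((U ^^ n) y - (U ^^ (n mod K)) y) \<le> \<kappa>"
          using y ap[of "n div K"] by (simp add: Un_nm V_rules Un_in)
        then show "nm (?\<mu> n *\<^sub>R ((U ^^ n) y - (U ^^ (n mod K)) y)) \<le> \<kappa>"
          using y by (intro order_trans[OF nm_moebius_scale] V_rules Un_in)
      qed
      finally show ?thesis using elim by (simp add: pos_divide_le_eq mult.commute)
    qed
    also have "nm Y / real N \<le> (\<Sum>r<K. \<bar>A r N\<bar> * nm y)"
    proof -
      have "(1 / real N) *\<^sub>R Y = (\<Sum>r<K. A r N *\<^sub>R (U ^^ r) y)"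
      proof -
        have "Y = (\<Sum>n=1..N. \<Sum>r<K. (?\<mu> n * of_bool (n mod K = r)) *\<^sub>R (U ^^ r) y)"
          unfolding Y_def
        proof (intro sum.cong refl)
          fix n
          have "(\<Sum>r<K. (?\<mu> n * of_bool (n mod K = r)) *\<^sub>R (U ^^ r) y) = (\<Sum>r<K. if n mod K = r then ?\<mu> n *\<^sub>R (U ^^ r) y else 0)"
            by (intro sum.cong refl) auto
          also have "\<dots> = ?\<mu> n *\<^sub>R (U ^^ (n mod K)) y" using K by (subst sum.delta') auto
          finally show "?\<mu> n *\<^sub>R (U ^^ (n mod K)) y = (\<Sum>r<K. (?\<mu> n * of_bool (n mod K = r)) *\<^sub>R (U ^^ r) y)" by simp
        qed
        also have "\<dots> = (\<Sum>r<K. \<Sum>n=1..N. (?\<mu> n * of_bool (n mod K = r)) *\<^sub>R (U ^^ r) y)" by (rule sum.swap)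
        also have "\<dots> = (\<Sum>r<K. (\<Sum>n=1..N. ?\<mu> n * of_bool (n mod K = r)) *\<^sub>R (U ^^ r) y)"
          by (simp only: scaleR_sum_left)
        finally show ?thesis by (simp add: A_def scaleR_sum_right)
      qed
      then have "nm Y / real N = nm (\<Sum>r<K. A r N *\<^sub>R (U ^^ r) y)"
        using nm_scale[OF XY(2), of "1 / real N"] by simp
      also have "\<dots> \<le> (\<Sum>r<K. nm (A r N *\<^sub>R (U ^^ r) y))"
        using y by (intro nm_sum V_rules Un_in)
      also have "\<dots> = (\<Sum>r<K. \<bar>A r N\<bar> * nm y)"
        using y by (intro sum.cong refl) (simp add: nm_scale Un_in Un_nm)
      finally show ?thesis .
    qed
    finally show ?case using elim(1) by linarith
  qed
qed

text \<open>
Write \<open>x = y + z\<close> with \<open>y\<close> a near-minimiser in the hull for \<open>K\<close>, where \<open>K\<close> nearly attains the supremum \<open>d\<close> of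
the distances. All points of that hull of norm at most \<open>d + e\<close> are then within \<open>\<kappa>\<close> of each other. This applies to \<open>y\<close> and its
translates by multiples of \<open>K\<close>, so \<open>y\<close> is almost periodic. It also applies to \<open>y\<close> and a near-minimiser \<open>y'\<close> in the smaller
hull for \<open>K * k\<close>, because the distance of that hull is at most \<open>d\<close> as well: as the sums of
\<open>(U ^^ (k * m)) (x - y')\<close> stay bounded, the averages of \<open>(U ^^ (k * m)) z\<close> are at most about \<open>\<kappa>\<close>. The correlation of
\<open>(U ^^ (p * m)) z\<close> and \<open>(U ^^ (q * m)) z\<close> depends only on \<open>k = p - q\<close>, and Katai's criterion applies to \<open>z\<close>.
\<close>

theorem mavg_orbit_tendsto_0:
  assumes mu: "\<And>K r. K > 0 \<Longrightarrow> (\<lambda>N. (\<Sum>n=1..N. of_int (moebius_mu n) * of_bool (n mod K = r)) / real N) \<longlonglongrightarrow> 0"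
    and x: "x \<in> V"
  shows "(\<lambda>N. nm (mavg (\<lambda>n. (U ^^ n) x) N)) \<longlonglongrightarrow> 0"
proof (rule tendstoI)
  fix \<delta> :: real assume \<delta>: "\<delta> > 0"
  define B where "B = 2 * nm x"
  have B0: "B \<ge> 0" using nm_nonneg[OF x] by (simp add: B_def)
  obtain P \<epsilon> where P: "finite P" "\<And>p. p \<in> P \<Longrightarrow> prime p" and \<epsilon>: "\<epsilon> > 0"
    and Katai: "\<And>x D. (\<And>n. x n \<in> V) \<Longrightarrow> (\<And>n. nm (x n) \<le> B) \<Longrightarrow> D \<ge> 0 \<Longrightarrow>
      (\<And>p q M. p \<in> P \<Longrightarrow> q \<in> P \<Longrightarrow> p \<noteq> q \<Longrightarrow>
        \<bar>\<Sum>m=1..M. ip (x (p * m)) (x (q * m))\<bar> \<le> \<epsilon> * real M + D) \<Longrightarrow>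
      \<forall>\<^sub>F N in sequentially. nm (mavg x N) < \<delta> / 2"
    by (rule Katai_criterion[of "\<delta> / 2" B]) (use \<delta> in auto)
  \<comment> \<open>A quarter of the target for the almost periodic part; below the tolerance of the criterion after multiplication by the bound B for z.\<close>
  define \<kappa> where "\<kappa> = min (\<delta> / 4) (\<epsilon> / (B + 1))"
  have \<kappa>: "\<kappa> > 0" "\<kappa> < \<delta> / 2" "\<kappa> * B \<le> \<epsilon>"
  proof -
    show "\<kappa> > 0" "\<kappa> < \<delta> / 2" using \<delta> \<epsilon> B0 by (auto simp: \<kappa>_def)
    have "\<kappa> * B \<le> \<epsilon> / (B + 1) * B" using B0 by (intro mult_right_mono) (auto simp: \<kappa>_def)
    also have "\<dots> \<le> \<epsilon>" using B0 \<epsilon> by (simp add: field_simps)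
    finally show "\<kappa> * B \<le> \<epsilon>" .
  qed
  define d where "d = (SUP K\<in>{0<..}. dist_hull K x)"
  have dle: "dist_hull K x \<le> nm x" for K by (rule dist_hull_le[OF x orbit_hull_self])
  have bdd: "bdd_above ((\<lambda>K. dist_hull K x) ` {0<..})" using dle by (intro bdd_aboveI2)
  have d_upper: "dist_hull K x \<le> d" if "K > 0" for K
    unfolding d_def by (rule cSUP_upper[OF _ bdd]) (use that in simp)
  have d0: "d \<ge> 0" using d_upper[of 1] dist_hull_nonneg[OF x, of 1] by linarith
  \<comment> \<open>With distances between d - e and d + e the parallelogram bound is at most 4 (d + e)^2 - 4 (d - e)^2 = 16 d e; the summand e^2 covers the case d < e.\<close>
  have "((\<lambda>e. 16 * (d * e + e\<^sup>2)) \<longlongrightarrow> 16 * (d * 0 + 0\<^sup>2)) (at_right 0)" by (intro tendsto_intros)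
  then have "\<forall>\<^sub>F e in at_right 0. 16 * (d * e + e\<^sup>2) < \<kappa>\<^sup>2"
    using \<kappa>(1) by (intro order_tendstoD(2)) auto
  then obtain e where e: "e > 0" "16 * (d * e + e\<^sup>2) < \<kappa>\<^sup>2"
    by (metis (mono_tags, lifting) eventually_at_right_field dense)
  obtain K where K: "K > 0" "dist_hull K x > d - e"
  proof -
    have "d - e < (SUP K\<in>{0<..}. dist_hull K x)" using e by (simp add: d_def)
    then obtain K where "K \<in> {0<..}" "d - e < dist_hull K x"
      using less_cSUP_iff[OF _ bdd] by auto
    then show ?thesis by (intro that) auto
  qed
  have close: "nm (u - v) \<le> \<kappa>"
    if "u \<in> orbit_hull K x" "v \<in> orbit_hull K x" "nm u \<le> d + e" "nm v \<le> d + e" for u v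
  proof (rule power2_le_imp_le)
    have "(nm (u - v))\<^sup>2 \<le> 4 * (d + e)\<^sup>2 - 4 * (dist_hull K x)\<^sup>2"
      by (rule near_minimisers_close[OF x that])
    also have "\<dots> \<le> 16 * (d * e + e\<^sup>2)"
    proof (cases "d \<ge> e")
      case True
      then have "(d - e)\<^sup>2 \<le> (dist_hull K x)\<^sup>2" using K by (intro power_mono) auto
      then have "4 * (d + e)\<^sup>2 - 4 * (dist_hull K x)\<^sup>2 \<le> 4 * (d + e)\<^sup>2 - 4 * (d - e)\<^sup>2" by simp
      also have "\<dots> = 16 * (d * e)" by (simp add: power2_eq_square algebra_simps)
      finally show ?thesis by (simp add: add_increasing2)
    next
      case False
      then have "(d + e)\<^sup>2 \<le> (2 * e)\<^sup>2" using d0 by (intro power_mono) auto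
      moreover have "(2 * e)\<^sup>2 = 4 * e\<^sup>2" by simp
      ultimately have "4 * (d + e)\<^sup>2 - 4 * (dist_hull K x)\<^sup>2 \<le> 16 * e\<^sup>2"
        using zero_le_power2[of "dist_hull K x"] by linarith
      then show ?thesis using d0 e by (simp add: add_increasing)
    qed
    finally show "(nm (u - v))\<^sup>2 \<le> \<kappa>\<^sup>2" using e(2) by simp
  qed (use \<kappa> in simp)
  obtain y where y: "y \<in> orbit_hull K x" "nm y < dist_hull K x + e"
    by (rule dist_hull_near[OF x e(1)], rule that)
  have yV: "y \<in> V" using orbit_hull_subset[OF x] y by blast
  have yd: "nm y \<le> d + e" using y(2) d_upper[OF K(1)] by linarith
  have part1: "\<forall>\<^sub>F N in sequentially. nm (mavg (\<lambda>n. (U ^^ n) y) N) < \<delta> / 2"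
  proof (rule mavg_almost_periodic[OF mu[OF K(1)] K(1) yV _ \<kappa>(2)])
    show "nm ((U ^^ (K * j)) y - y) \<le> \<kappa>" for j
      using yd yV by (intro close orbit_hull_invariant x y) (simp_all add: Un_nm)
  qed
  define z where "z = x - y"
  have zV: "z \<in> V" using x yV by (simp add: z_def V_rules)
  have zB: "nm z \<le> B"
  proof -
    have "nm y \<le> nm x"
    proof -
      have "orbit_hull K x \<subseteq> {w \<in> V. nm w \<le> nm x}"
        unfolding orbit_hull_def
      proof (rule hull_minimal)
        show "range (\<lambda>j. (U ^^ (K * j)) x) \<subseteq> {w \<in> V. nm w \<le> nm x}" using x by (auto simp: Un_in Un_nm)
        show "convex {w \<in> V. nm w \<le> nm x}"
        proof (rule convexI)
          fix w w' and u v :: real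
          assume w: "w \<in> {w \<in> V. nm w \<le> nm x}" "w' \<in> {w \<in> V. nm w \<le> nm x}" and uv: "0 \<le> u" "0 \<le> v" "u + v = 1"
          have "nm (u *\<^sub>R w + v *\<^sub>R w') \<le> u * nm w + v * nm w'"
            using nm_triangle[of "u *\<^sub>R w" "v *\<^sub>R w'"] w uv by (simp add: nm_scale V_rules)
          also have "\<dots> \<le> u * nm x + v * nm x" using w uv by (intro add_mono mult_left_mono) auto
          also have "\<dots> = nm x" using uv by (simp add: distrib_right[symmetric])
          finally show "u *\<^sub>R w + v *\<^sub>R w' \<in> {w \<in> V. nm w \<le> nm x}" using w by (simp add: V_rules)
        qed
      qed
      then show ?thesis using y by blast
    qed
    moreover have "nm z \<le> nm (x - 0) + nm (0 - y)" unfolding z_def using x yV by (intro nm_diff_triangle V_rules)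
    moreover have "nm (0 - y) = nm y" using nm_minus_commute[OF V_rules(1) yV] by simp
    ultimately show ?thesis by (simp add: B_def)
  qed
  have erg: "\<exists>D\<ge>0. \<forall>M. nm (\<Sum>m=1..M. (U ^^ (k * m)) z) \<le> \<kappa> * real M + D" if k: "k > 0" for k
  proof -
    have Kk: "K * k > 0" using K k by simp
    obtain y' where y': "y' \<in> orbit_hull (K * k) x" "nm y' < dist_hull (K * k) x + e"
      by (rule dist_hull_near[OF x e(1)], rule that)
    have y'K: "y' \<in> orbit_hull K x" using orbit_hull_mono[of K "K * k"] y'(1) by auto
    have y'V: "y' \<in> V" using orbit_hull_subset[OF x] y'(1) by blast
    have "nm (y' - y) \<le> \<kappa>"
      using y'(2) d_upper[OF Kk] yd by (intro close y'K y) auto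
    obtain D where D: "\<And>M. nm (\<Sum>m=1..M. (U ^^ (k * m)) (x - y')) \<le> D"
      using ergodic_average_hull[OF x _ y'(1), of k] by auto
    have "nm (\<Sum>m=1..M. (U ^^ (k * m)) z) \<le> \<kappa> * real M + D" for M
    proof -
      have zz: "z = (x - y') + (y' - y)" by (simp add: z_def)
      have "(U ^^ n) z = (U ^^ n) (x - y') + (U ^^ n) (y' - y)" for n
        unfolding zz by (rule Un_add[OF V_rules(3)[OF x y'V] V_rules(3)[OF y'V yV]])
      then have "(\<Sum>m=1..M. (U ^^ (k * m)) z) = (\<Sum>m=1..M. (U ^^ (k * m)) (x - y')) + (\<Sum>m=1..M. (U ^^ (k * m)) (y' - y))"
        by (simp only: sum.distrib)
      moreover have "nm ((\<Sum>m=1..M. (U ^^ (k * m)) (x - y')) + (\<Sum>m=1..M. (U ^^ (k * m)) (y' - y)))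
          \<le> nm (\<Sum>m=1..M. (U ^^ (k * m)) (x - y')) + nm (\<Sum>m=1..M. (U ^^ (k * m)) (y' - y))"
        using x yV y'V by (intro nm_triangle V_rules Un_in)
      moreover have "nm (\<Sum>m=1..M. (U ^^ (k * m)) (y' - y)) \<le> (\<Sum>m=1..M. nm ((U ^^ (k * m)) (y' - y)))"
        using yV y'V by (intro nm_sum V_rules Un_in)
      moreover have "(\<Sum>m=1..M. nm ((U ^^ (k * m)) (y' - y))) \<le> (\<Sum>m=1..M. \<kappa>)"
        using yV y'V \<open>nm (y' - y) \<le> \<kappa>\<close> by (intro sum_mono) (simp add: Un_nm V_rules)
      ultimately show ?thesis using D[of M] by (simp add: mult.commute)
    qed
    moreover have "D \<ge> 0" using D[of 0] by (simp add: nm_zero)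
    ultimately show ?thesis by blast
  qed
  have "\<forall>k. \<exists>D. k > 0 \<longrightarrow> D \<ge> 0 \<and> (\<forall>M. nm (\<Sum>m=1..M. (U ^^ (k * m)) z) \<le> \<kappa> * real M + D)"
    using erg by meson
  then obtain D where D: "\<And>k. k > 0 \<Longrightarrow> D k \<ge> 0"
    "\<And>k M. k > 0 \<Longrightarrow> nm (\<Sum>m=1..M. (U ^^ (k * m)) z) \<le> \<kappa> * real M + D k"
    by metis
  define L where "L = Max (insert 1 P)"
  \<comment> \<open>One constant that serves all the finitely many differences k of elements of P.\<close>
  define D0 where "D0 = (\<Sum>k\<in>{1..L}. D k) * B"
  have L: "p \<le> L" if "p \<in> P" for p unfolding L_def using P(1) that by (intro Max_ge) auto
  have D0: "D k * B \<le> D0" if "k > 0" "k \<le> L" for k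
    unfolding D0_def using that D(1) B0 by (intro mult_right_mono member_le_sum) auto
  have D00: "D0 \<ge> 0" unfolding D0_def using D(1) B0 by (intro mult_nonneg_nonneg sum_nonneg) auto
  have corr: "\<bar>\<Sum>m=1..M. ip ((U ^^ (p * m)) z) ((U ^^ (q * m)) z)\<bar> \<le> \<epsilon> * real M + D0"
    if pq: "p \<in> P" "p > q" for p q M
  proof -
    define k where "k = p - q"
    have k: "k > 0" "k \<le> L" "p = k + q" using pq L[of p] by (auto simp: k_def)
    have "ip ((U ^^ (p * m)) z) ((U ^^ (q * m)) z) = ip ((U ^^ (k * m)) z) z" for m
    proof -
      have "(U ^^ (p * m)) z = (U ^^ (q * m)) ((U ^^ (k * m)) z)"
        by (simp add: Un_Un k(3) distrib_right add.commute)
      then show ?thesis using zV by (simp add: Un_ip Un_in)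
    qed
    then have "(\<Sum>m=1..M. ip ((U ^^ (p * m)) z) ((U ^^ (q * m)) z)) = ip (\<Sum>m=1..M. (U ^^ (k * m)) z) z"
      using zV by (simp add: ip_sum_left Un_in)
    then have "\<bar>\<Sum>m=1..M. ip ((U ^^ (p * m)) z) ((U ^^ (q * m)) z)\<bar> \<le> nm (\<Sum>m=1..M. (U ^^ (k * m)) z) * nm z"
      using Cauchy_Schwarz[of "\<Sum>m=1..M. (U ^^ (k * m)) z" z] zV by (simp add: V_rules Un_in)
    also have "\<dots> \<le> (\<kappa> * real M + D k) * B"
      using D[OF k(1)] zB \<kappa> nm_nonneg[OF zV] by (intro mult_mono) auto
    also have "\<dots> = \<kappa> * B * real M + D k * B" by (simp add: algebra_simps)
    also have "\<dots> \<le> \<epsilon> * real M + D0"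
      using \<kappa>(3) D0[OF k(1,2)] by (intro add_mono mult_right_mono) auto
    finally show ?thesis .
  qed
  have part2: "\<forall>\<^sub>F N in sequentially. nm (mavg (\<lambda>n. (U ^^ n) z) N) < \<delta> / 2"
  proof (rule Katai[of _ D0])
    show "\<bar>\<Sum>m=1..M. ip ((U ^^ (p * m)) z) ((U ^^ (q * m)) z)\<bar> \<le> \<epsilon> * real M + D0"
      if "p \<in> P" "q \<in> P" "p \<noteq> q" for p q M
    proof (cases "p > q")
      case True
      then show ?thesis using corr that by blast
    next
      case False
      then have "q > p" using that by simp
      moreover have "(\<Sum>m=1..M. ip ((U ^^ (p * m)) z) ((U ^^ (q * m)) z)) = (\<Sum>m=1..M. ip ((U ^^ (q * m)) z) ((U ^^ (p * m)) z))"
        using zV by (intro sum.cong refl ip_commute Un_in)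
      ultimately show ?thesis using corr[OF that(2), of p M] by simp
    qed
  qed (use zV zB D00 in \<open>simp_all add: Un_in Un_nm\<close>)
  have split: "mavg (\<lambda>n. (U ^^ n) x) N = mavg (\<lambda>n. (U ^^ n) y) N + mavg (\<lambda>n. (U ^^ n) z) N" for N
  proof -
    have "(U ^^ n) x = (U ^^ n) y + (U ^^ n) z" for n
      using Un_add[OF yV zV, of n] by (simp add: z_def)
    then show ?thesis by (simp only: mavg_def scaleR_add_right sum.distrib)
  qed
  have mV: "mavg (\<lambda>n. (U ^^ n) w) N \<in> V" if "w \<in> V" for w N
    unfolding mavg_def using that by (intro V_rules Un_in)
  from part1 part2 show "\<forall>\<^sub>F N in sequentially. dist (nm (mavg (\<lambda>n. (U ^^ n) x) N)) 0 < \<delta>"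
  proof eventually_elim
    case (elim N)
    have "nm (mavg (\<lambda>n. (U ^^ n) x) N) \<le> nm (mavg (\<lambda>n. (U ^^ n) y) N) + nm (mavg (\<lambda>n. (U ^^ n) z) N)"
      unfolding split by (intro nm_triangle mV yV zV)
    then show ?case using elim nm_nonneg[OF mV[OF x], of N] by simp
  qed
qed

end

section \<open>Positive operators\<close>

instance complex_hilbert_space < banach ..

lemma cinner_zero_left [simp]: "cinner 0 (y :: 'h::complex_inner) = 0"
  using cinner_add_left[of 0 0 y] by simp

lemma cinner_zero_right [simp]: "cinner x (0 :: 'h::complex_inner) = 0"
  using cinner_add_right[of x 0 0] by simp

lemma is_adjoint_id: "is_adjoint id_blinfun id_blinfun"
  by (simp add: is_adjoint_def)

lemma is_adjoint_add: "is_adjoint A A' \<Longrightarrow> is_adjoint B B' \<Longrightarrow> is_adjoint (A + B) (A' + B')"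
  by (simp add: is_adjoint_def blinfun.add_left cinner_add_left cinner_add_right)

lemma is_adjoint_scaleC: "is_adjoint A A' \<Longrightarrow> is_adjoint (c *\<^sub>C A) (cnj c *\<^sub>C A')"
  by (simp add: is_adjoint_def scaleC_blinfun.rep_eq cinner_scaleC_left cinner_scaleC_right)

lemma is_adjoint_scaleR: "is_adjoint A A' \<Longrightarrow> is_adjoint (r *\<^sub>R A) (r *\<^sub>R A')"
  using is_adjoint_scaleC[of A A' "of_real r"] by (simp add: scaleR_scaleC)

lemma is_adjoint_diff:
  assumes "is_adjoint A A'" "is_adjoint B B'"
  shows "is_adjoint (A - B) (A' - B')"
  using is_adjoint_add[OF assms(1) is_adjoint_scaleR[OF assms(2), of "-1"]] by simp

lemma is_adjoint_compose: "is_adjoint A A' \<Longrightarrow> is_adjoint B B' \<Longrightarrow> is_adjoint (A o\<^sub>L B) (B' o\<^sub>L A')"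
  by (simp add: is_adjoint_def)

lemma is_adjoint_sym: "is_adjoint A B \<Longrightarrow> is_adjoint B A"
  unfolding is_adjoint_def by (metis cinner_commute)

lemma is_adjoint_sum: "(\<And>i. i \<in> I \<Longrightarrow> is_adjoint (f i) (g i)) \<Longrightarrow> is_adjoint (sum f I) (sum g I)"
  by (induction I rule: infinite_finite_induct) (auto intro!: is_adjoint_add simp: is_adjoint_def[of 0])

lemma adj_eqI: "is_adjoint T S \<Longrightarrow> adj T = S"
  unfolding adj_def by (rule the_equality) (auto intro: is_adjoint_unique)

lemma is_adjoint_inner: "is_adjoint A B \<Longrightarrow> inner (A x) y = inner x (B y)"
  by (simp add: is_adjoint_def inner_eq_Re_cinner)

abbreviation self_adj :: "('h::complex_inner \<Rightarrow>\<^sub>L 'h) \<Rightarrow> bool" where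
  "self_adj T \<equiv> is_adjoint T T"

lemma self_adj_adj_compose:
  assumes "is_adjoint A B" shows "self_adj (B o\<^sub>L A)"
  by (rule is_adjoint_compose[OF is_adjoint_sym[OF assms] assms])

lemma positive_op_iff:
  assumes "self_adj T"
  shows "positive_op T \<longleftrightarrow> (\<forall>x. inner (T x) x \<ge> 0)"
proof -
  have "Im (cinner (T x) x) = 0" for x
  proof -
    have "cinner (T x) x = cnj (cinner (T x) x)"
      using assms cinner_commute[of "T x" x] unfolding is_adjoint_def by metis
    from arg_cong[OF this, of Im] show ?thesis by simp
  qed
  then show ?thesis
    by (simp add: positive_op_def complex_nonneg_Reals_iff inner_eq_Re_cinner)
qed

text \<open>
The Cauchy--Schwarz inequality for the form \<open>inner (T x) y\<close>, applied to \<open>x\<close> and \<open>T x\<close>.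
\<close>

lemma positive_norm_bound:
  fixes T :: "'h::complex_inner \<Rightarrow>\<^sub>L 'h"
  assumes sa: "self_adj T" and pos: "\<And>x. inner (T x) x \<ge> 0" and bd: "\<And>x. inner (T x) x \<le> c * (norm x)\<^sup>2"
  shows "(norm (T x))\<^sup>2 \<le> c * inner (T x) x"
proof -
  interpret semi_inner UNIV "\<lambda>x y. inner (T x) y"
  proof
    show "inner (T x) y = inner (T y) x" for x y
      using is_adjoint_inner[OF sa, of x y] by (simp add: inner_commute)
  qed (auto simp: blinfun.add_right blinfun.scaleR_right inner_add_left pos)
  define a where "a = norm (T x)"
  have c0: "0 \<le> c * inner (T x) x"
  proof (cases "x = 0")
    case False
    have "0 \<le> c * (norm x)\<^sup>2" using pos bd order_trans by blast
    then have "c \<ge> 0" using False by (simp add: zero_le_mult_iff)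
    then show ?thesis using pos by simp
  qed (simp add: blinfun.zero_right)
  have "a\<^sup>2 = inner (T x) (T x)" by (simp add: a_def power2_norm_eq_inner)
  also have "\<dots> \<le> nm x * nm (T x)" using Cauchy_Schwarz[of x "T x"] by simp
  finally have "(a\<^sup>2)\<^sup>2 \<le> (nm x * nm (T x))\<^sup>2" by (rule power_mono) simp
  also have "\<dots> = inner (T x) x * inner (T (T x)) (T x)" by (simp add: power_mult_distrib nm_sq)
  also have "\<dots> \<le> inner (T x) x * (c * a\<^sup>2)"
    unfolding a_def by (intro mult_left_mono bd pos)
  finally have *: "a\<^sup>2 * a\<^sup>2 \<le> (c * inner (T x) x) * a\<^sup>2" by (simp add: power2_eq_square mult_ac)
  show ?thesis
  proof (cases "a = 0")
    case True
    then show ?thesis using c0 by (simp add: a_def)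
  next
    case False
    then have "a\<^sup>2 \<le> c * inner (T x) x" using * by (intro mult_right_le_imp_le[of "a\<^sup>2" "a\<^sup>2"]) auto
    then show ?thesis by (simp add: a_def)
  qed
qed

lemma inner_blinfun_le: "inner (T x) x \<le> norm T * (norm x)\<^sup>2" for T :: "'h::real_inner \<Rightarrow>\<^sub>L 'h"
proof -
  have "inner (T x) x \<le> norm (T x) * norm x" by (rule norm_cauchy_schwarz)
  also have "\<dots> \<le> (norm T * norm x) * norm x" by (intro mult_right_mono norm_blinfun) simp
  finally show ?thesis by (simp add: power2_eq_square mult.assoc)
qed

section \<open>Resolvents and monotone limits in a von Neumann algebra\<close>

locale vN_algebra =
  fixes M :: "('h::complex_hilbert_space \<Rightarrow>\<^sub>L 'h) set"
  assumes vN: "von_neumann_algebra M"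
begin

lemma M_bounded: "A \<in> M \<Longrightarrow> A \<in> bounded_ops"
  and M_id: "id_blinfun \<in> M"
  and M_add: "A \<in> M \<Longrightarrow> B \<in> M \<Longrightarrow> A + B \<in> M"
  and M_scaleC: "A \<in> M \<Longrightarrow> c *\<^sub>C A \<in> M"
  and M_compose: "A \<in> M \<Longrightarrow> B \<in> M \<Longrightarrow> A o\<^sub>L B \<in> M"
  and M_adj: "A \<in> M \<Longrightarrow> adj A \<in> M"
  using vN by (auto simp: von_neumann_algebra_def)

lemma M_scaleR: "A \<in> M \<Longrightarrow> r *\<^sub>R A \<in> M"
  by (simp add: scaleR_scaleC M_scaleC)

lemma M_zero: "0 \<in> M" using M_scaleR[OF M_id, of 0] by simp

lemma M_subspace: "subspace M"
  by (simp add: subspace_def M_zero M_add M_scaleR)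

lemma M_diff: "A \<in> M \<Longrightarrow> B \<in> M \<Longrightarrow> A - B \<in> M"
  by (rule subspace_diff[OF M_subspace])

lemma M_sum: "(\<And>i. i \<in> I \<Longrightarrow> f i \<in> M) \<Longrightarrow> sum f I \<in> M"
  by (rule subspace_sum[OF M_subspace])

lemma M_is_adjoint: "A \<in> M \<Longrightarrow> is_adjoint A (adj A)"
  by (rule is_adjoint_adj[OF M_bounded])

lemma M_self_adj: "A \<in> M \<Longrightarrow> A \<in> self_adjoint_part M \<longleftrightarrow> self_adj A"
  using M_is_adjoint[of A] adj_eqI[of A A] by (auto simp: self_adjoint_part_def)

text \<open>
Strong convergence implies weak convergence, and the algebra is closed in the weak operator topology.
\<close>

lemma M_strong_limit:
  assumes T: "\<And>n. T n \<in> M" and lim: "\<And>x. (\<lambda>n. T n x) \<longlonglongrightarrow> blinfun_apply S x"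
  shows "S \<in> M"
proof -
  have S: "S \<in> bounded_ops"
    unfolding bounded_ops_def
  proof (intro CollectI allI)
    fix c x
    have "(\<lambda>n. c *\<^sub>C T n x) \<longlonglongrightarrow> c *\<^sub>C S x"
      by (rule bounded_linear.tendsto[OF bounded_linear_scaleC lim])
    moreover have "c *\<^sub>C T n x = T n (c *\<^sub>C x)" for n
      using M_bounded[OF T[of n]] by (simp add: bounded_ops_def)
    ultimately have "(\<lambda>n. T n (c *\<^sub>C x)) \<longlonglongrightarrow> c *\<^sub>C S x" by simp
    then show "S (c *\<^sub>C x) = c *\<^sub>C S x" using LIMSEQ_unique[OF lim] by blast
  qed
  define f where "f = (\<lambda>T::'h \<Rightarrow>\<^sub>L 'h. \<lambda>(x, y). cinner (blinfun_apply T x) y)"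
  have top: "topspace weak_operator_topology = (bounded_ops :: ('h \<Rightarrow>\<^sub>L 'h) set)"
    by (simp add: weak_operator_topology_def topspace_pullback_topology)
  have "openin weak_operator_topology (bounded_ops - M)"
    using vN top unfolding von_neumann_algebra_def closedin_def by metis
  then obtain W where W: "open W" "bounded_ops - M = f -` W \<inter> bounded_ops"
    unfolding weak_operator_topology_def openin_pullback_topology f_def by auto
  have "limitin (product_topology (\<lambda>_. euclidean) UNIV) (\<lambda>n. f (T n)) (f S) sequentially"
    unfolding limitin_componentwise
  proof (intro conjI ballI)
    fix p :: "'h \<times> 'h"
    obtain x y where p: "p = (x, y)" by fastforce
    have "bounded_linear (\<lambda>z. cinner z y)"
    proof (rule bounded_linear_intro)
      show "cinner (r *\<^sub>R z) y = r *\<^sub>R cinner z y" for r and z :: 'h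
        by (simp add: scaleR_scaleC cinner_scaleC_left scaleC_complex_def)
      show "cmod (cinner z y) \<le> norm z * norm y" for z
      proof -
        define c where "c = (if cinner z y = 0 then 1 else cnj (cinner z y) / of_real (cmod (cinner z y)))"
        have c: "cmod c = 1" "c * cinner z y = of_real (cmod (cinner z y))"
          by (auto simp: c_def norm_divide complex_norm_square[symmetric] power2_eq_square mult.commute[of "cnj _"])
        have "cmod (cinner z y) = inner (c *\<^sub>C z) y"
          using c(2) by (simp add: inner_eq_Re_cinner cinner_scaleC_left)
        also have "\<dots> \<le> norm (c *\<^sub>C z) * norm y" by (rule norm_cauchy_schwarz)
        finally show ?thesis by (simp add: norm_scaleC c)
      qed
    qed (rule cinner_add_left)
    from bounded_linear.tendsto[OF this lim[of x]]
    show "limitin euclidean (\<lambda>n. f (T n) p) (f S p) sequentially"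
      by (simp add: f_def p)
  qed auto
  then have "(\<lambda>n. f (T n)) \<longlonglongrightarrow> f S"
    by (simp add: euclidean_product_topology)
  show ?thesis
  proof (rule ccontr)
    assume "S \<notin> M"
    then have "f S \<in> W" using S W by blast
    then have "\<forall>\<^sub>F n in sequentially. f (T n) \<in> W"
      by (rule topological_tendstoD[OF \<open>(\<lambda>n. f (T n)) \<longlonglongrightarrow> f S\<close> W(1)])
    then obtain n where "f (T n) \<in> W" by (auto simp: eventually_sequentially)
    then have "T n \<in> bounded_ops - M" using W(2) M_bounded[OF T[of n]] by blast
    then show False using T by blast
  qed
qed

text \<open>
\<open>R\<close> is a two-sided inverse of \<open>l + S\<close> in the algebra.
\<close>

definition res :: "('h \<Rightarrow>\<^sub>L 'h) \<Rightarrow> real \<Rightarrow> ('h \<Rightarrow>\<^sub>L 'h) \<Rightarrow> bool" where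
  "res S l R \<longleftrightarrow> R \<in> M \<and> (\<forall>x. R (l *\<^sub>R x + S x) = x) \<and> (\<forall>x. l *\<^sub>R R x + S (R x) = x)"

text \<open>
With \<open>c = l + norm S\<close> the operator \<open>T = 1 - (l + S) / c\<close> lies between \<open>0\<close> and \<open>1 - l / c < 1\<close>, so the Neumann series of
\<open>(1 - T)\<^sup>-\<^sup>1 = c (l + S)\<^sup>-\<^sup>1\<close> converges, inside the algebra.
\<close>

lemma positive_resolvent_exists:
  assumes S: "S \<in> M" and sa: "self_adj S" and pos: "\<And>x. inner (S x) x \<ge> 0" and l: "l > 0"
  obtains R where "res S l R"
proof -
  define c where "c = l + norm S"
  have c: "c > 0" using l norm_ge_zero[of S] by (simp add: c_def add_pos_nonneg)
  define T where "T = id_blinfun - (1 / c) *\<^sub>R (l *\<^sub>R id_blinfun + S)"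
  have T: "T x = x - (1 / c) *\<^sub>R (l *\<^sub>R x + S x)" for x
    by (simp add: T_def blinfun.diff_left blinfun.scaleR_left blinfun.add_left)
  have TM: "T \<in> M" unfolding T_def by (intro M_diff M_scaleR M_add M_id S)
  have Tsa: "self_adj T" unfolding T_def
    by (intro is_adjoint_diff is_adjoint_scaleR is_adjoint_add is_adjoint_id sa)
  define \<theta> where "\<theta> = 1 - l / c"
  have "l / c \<le> 1" by (subst pos_divide_le_eq[OF c]) (simp add: c_def)
  moreover have "l / c > 0" using l c by simp
  ultimately have \<theta>: "0 \<le> \<theta>" "\<theta> < 1" by (simp_all add: \<theta>_def)
  have inT: "inner (T x) x = (norm x)\<^sup>2 - (l * (norm x)\<^sup>2 + inner (S x) x) / c" for x
    by (simp add: T inner_diff_left inner_add_left power2_norm_eq_inner)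
  have T0: "inner (T x) x \<ge> 0" for x
  proof -
    have "l * (norm x)\<^sup>2 + inner (S x) x \<le> c * (norm x)\<^sup>2"
      using inner_blinfun_le[of S x] by (simp add: c_def distrib_right)
    then show ?thesis using c by (simp add: inT field_simps)
  qed
  have T1: "inner (T x) x \<le> \<theta> * (norm x)\<^sup>2" for x
    using pos[of x] c by (simp add: inT \<theta>_def field_simps)
  have nT: "norm (T x) \<le> \<theta> * norm x" for x
  proof (rule power2_le_imp_le)
    have "(norm (T x))\<^sup>2 \<le> \<theta> * inner (T x) x" by (rule positive_norm_bound[OF Tsa T0 T1])
    also have "\<dots> \<le> \<theta> * (\<theta> * (norm x)\<^sup>2)" using \<theta> T1 by (intro mult_left_mono) auto
    finally show "(norm (T x))\<^sup>2 \<le> (\<theta> * norm x)\<^sup>2" by (simp add: power2_eq_square mult_ac)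
  qed (use \<theta> in simp)
  define P where "P n = ((\<lambda>A. T o\<^sub>L A) ^^ n) id_blinfun" for n
  have P0: "P 0 = id_blinfun" and PS: "P (Suc n) = T o\<^sub>L P n" for n by (simp_all add: P_def)
  have PM: "P n \<in> M" for n by (induction n) (simp_all add: P0 PS M_id M_compose TM)
  have comm: "P n (T x) = T (P n x)" for n x by (induction n arbitrary: x) (simp_all add: P0 PS)
  have nP: "norm (P n x) \<le> \<theta> ^ n * norm x" for n x
  proof (induction n)
    case (Suc n)
    have "norm (P (Suc n) x) \<le> \<theta> * norm (P n x)" using nT[of "P n x"] by (simp add: PS)
    also have "\<dots> \<le> \<theta> * (\<theta> ^ n * norm x)" using \<theta> Suc by (intro mult_left_mono)
    finally show ?case by (simp add: mult.assoc)
  qed (simp add: P0)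
  have "summable P"
  proof (rule summable_comparison_test')
    show "summable (\<lambda>n. \<theta> ^ n)" using \<theta> by (intro summable_geometric) simp
    show "norm (P n) \<le> \<theta> ^ n" for n
      by (rule norm_blinfun_bound) (use \<theta> nP in auto)
  qed
  then obtain R where R: "P sums R" unfolding summable_def by blast
  have Rx: "(\<lambda>n. P n x) sums R x" for x
    by (rule bounded_linear.sums[OF blinfun.bounded_linear_left R])
  have RM: "R \<in> M"
  proof (rule M_strong_limit[of "\<lambda>n. \<Sum>k<n. P k"])
    show "(\<Sum>k<n. P k) \<in> M" for n by (rule M_sum[OF PM])
    show "(\<lambda>n. (\<Sum>k<n. P k) x) \<longlonglongrightarrow> R x" for x
      using Rx[of x] by (simp add: sums_def blinfun.sum_left)
  qed
  have s1: "(\<lambda>n. P (Suc n) x) sums (R x - x)" for x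
    using Rx[of x] sums_Suc_iff[of "\<lambda>n. P n x" "R x - x"] by (simp add: P0)
  have s2: "(\<lambda>n. T (P n x)) sums T (R x)" for x
    by (rule bounded_linear.sums[OF blinfun.bounded_linear_right Rx])
  have TR: "T (R x) = R x - x" for x
    using sums_unique2[OF s2[of x]] s1[of x] by (simp add: PS)
  have RT: "R (T x) = R x - x" for x
    using sums_unique2[OF Rx[of "T x"]] s1[of x] by (simp add: PS comm)
  have k1: "l *\<^sub>R x + S x = c *\<^sub>R (x - T x)" for x using c by (simp add: T)
  have "res S l ((1 / c) *\<^sub>R R)"
    unfolding res_def
  proof (intro conjI allI)
    show "(1 / c) *\<^sub>R R \<in> M" by (rule M_scaleR[OF RM])
    show "((1 / c) *\<^sub>R R) (l *\<^sub>R x + S x) = x" for x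
      unfolding k1 using c
      by (simp only: blinfun.scaleR_left blinfun.scaleR_right blinfun.diff_right RT scaleR_right_diff_distrib[symmetric]) simp
    show "l *\<^sub>R ((1 / c) *\<^sub>R R) x + S (((1 / c) *\<^sub>R R) x) = x" for x
      unfolding k1 using c
      by (simp only: blinfun.scaleR_left blinfun.scaleR_right TR scaleR_right_diff_distrib[symmetric]) simp
  qed
  then show thesis by (rule that)
qed

text \<open>
The bottom \<open>m\<close> of the numerical range belongs to the spectrum: a bounded inverse \<open>R\<close> of the positive operator
\<open>H - m\<close> would bound it below by \<open>1/k > 0\<close> and push the bottom up. So \<open>m < 0\<close> is impossible. In
this form positivity is an algebraic property, preserved by isomorphisms.
\<close>

lemma positive_if_resolvents:
  assumes H: "H \<in> M" and sa: "self_adj H"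
    and res: "\<And>l. l > 0 \<Longrightarrow> \<exists>R :: 'h \<Rightarrow>\<^sub>L 'h. \<forall>x. R (l *\<^sub>R x + H x) = x"
  shows "inner (H x) x \<ge> 0"
proof (rule ccontr)
  assume neg: "\<not> inner (H x) x \<ge> 0"
  then have x0: "x \<noteq> 0" by auto
  define Q where "Q = (\<lambda>x. inner (H x) x / (norm x)\<^sup>2) ` {x. x \<noteq> 0}"
  define m where "m = Inf Q"
  have low: "- norm H \<le> inner (H x) x / (norm x)\<^sup>2" if "x \<noteq> 0" for x
    using inner_blinfun_le[of "- H" x] that by (simp add: blinfun.minus_left pos_le_divide_eq)
  have bdd: "bdd_below Q" unfolding Q_def using low by (intro bdd_belowI2[of _ "- norm H"]) auto
  have m_le: "m * (norm y)\<^sup>2 \<le> inner (H y) y" for y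
  proof (cases "y = 0")
    case False
    then have "m \<le> inner (H y) y / (norm y)\<^sup>2" unfolding m_def using bdd by (intro cInf_lower) (auto simp: Q_def)
    then show ?thesis using False by (simp add: pos_le_divide_eq)
  qed (simp add: blinfun.zero_right)
  have mneg: "m < 0"
  proof -
    have "m * (norm x)\<^sup>2 < 0" using m_le[of x] neg by linarith
    then show ?thesis by (simp add: mult_less_0_iff)
  qed
  define P where "P = (- m) *\<^sub>R id_blinfun + H"
  have P: "P y = (- m) *\<^sub>R y + H y" for y by (simp add: P_def blinfun.add_left blinfun.diff_left blinfun.scaleR_left)
  obtain R :: "'h \<Rightarrow>\<^sub>L 'h" where R: "\<And>y. R (P y) = y" using res[of "- m"] mneg P by auto
  have Psa: "self_adj P" unfolding P_def by (intro is_adjoint_add is_adjoint_scaleR is_adjoint_id sa)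
  have Pin: "inner (P y) y = inner (H y) y - m * (norm y)\<^sup>2" for y
    by (simp add: P inner_diff_left inner_add_left power2_norm_eq_inner)
  have P0: "inner (P y) y \<ge> 0" for y using m_le[of y] by (simp add: Pin)
  define k where "k = (norm R)\<^sup>2 * norm P"
  have k: "(norm y)\<^sup>2 \<le> k * inner (P y) y" for y
  proof -
    have "norm y \<le> norm R * norm (P y)" using norm_blinfun[of R "P y"] by (simp add: R)
    then have "(norm y)\<^sup>2 \<le> (norm R * norm (P y))\<^sup>2" by (rule power_mono) simp
    also have "\<dots> \<le> (norm R)\<^sup>2 * (norm P * inner (P y) y)"
      unfolding power_mult_distrib
      by (intro mult_left_mono positive_norm_bound[OF Psa P0 inner_blinfun_le]) simp
    finally show ?thesis by (simp add: k_def mult.assoc)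
  qed
  have "k > 0"
  proof -
    have "0 < k * inner (P x) x" using k[of x] x0 by (metis less_le_trans zero_less_norm_iff zero_less_power)
    then show ?thesis using P0[of x] by (simp add: zero_less_mult_iff)
  qed
  have "m + 1 / k \<le> Inf Q"
  proof (rule cInf_greatest)
    show "Q \<noteq> {}" using x0 by (auto simp: Q_def)
    fix t assume "t \<in> Q"
    then obtain y where y: "y \<noteq> 0" "t = inner (H y) y / (norm y)\<^sup>2" by (auto simp: Q_def)
    have "(norm y)\<^sup>2 \<le> k * (inner (H y) y - m * (norm y)\<^sup>2)" using k[of y] by (simp add: Pin)
    then have "(norm y)\<^sup>2 / k \<le> inner (H y) y - m * (norm y)\<^sup>2"
      using \<open>k > 0\<close> by (simp add: pos_divide_le_eq mult.commute)
    then have "(m + 1 / k) * (norm y)\<^sup>2 \<le> inner (H y) y" by (simp add: distrib_right)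
    then show "m + 1 / k \<le> t" using y by (simp add: pos_le_divide_eq)
  qed
  then show False using \<open>k > 0\<close> by (simp add: m_def)
qed

text \<open>
For \<open>n \<le> m\<close> the increment \<open>C m - C n\<close> is a positive operator bounded by \<open>1\<close>, so the square of its norm at \<open>x\<close> is bounded by the increment of the
quadratic form at \<open>x\<close>, which is a Cauchy sequence. The limit is the least upper bound, the situation in which normality of
states can be used.
\<close>

lemma increasing_strong_limit:
  assumes C: "\<And>n. C n \<in> M" "\<And>n. self_adj (C n)" "\<And>n x. 0 \<le> inner (C n x) x"
    and up: "\<And>n x. inner (C n x) x \<le> (norm x)\<^sup>2"
    and inc: "\<And>n x. inner (C n x) x \<le> inner (C (Suc n) x) x"
  obtains L where "L \<in> M" "self_adj L" "\<And>x. (\<lambda>n. C n x) \<longlonglongrightarrow> L x"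
    "directed_in M (range C)" "is_lub_in M (range C) L" "\<And>n x. inner (C n x) x \<le> inner (L x) x"
proof -
  have mono: "inner (C n x) x \<le> inner (C m x) x" if "n \<le> m" for n m x
    using that inc by (rule lift_Suc_mono_le[rotated])
  have conv: "convergent (\<lambda>n. C n x)" for x
  proof -
    have "incseq (\<lambda>n. inner (C n x) x)" using inc by (intro incseq_SucI)
    then have "convergent (\<lambda>n. inner (C n x) x)"
      using up by (metis incseq_convergent convergentI)
    then have cau: "Cauchy (\<lambda>n. inner (C n x) x)" by (rule convergent_Cauchy)
    have diff: "(norm (C m x - C n x))\<^sup>2 \<le> inner (C m x) x - inner (C n x) x" if "n \<le> m" for n m
    proof -
      have "(norm ((C m - C n) x))\<^sup>2 \<le> 1 * inner ((C m - C n) x) x"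
      proof (rule positive_norm_bound)
        show "self_adj (C m - C n)" by (intro is_adjoint_diff C)
        show "0 \<le> inner ((C m - C n) y) y" for y
          using mono[OF that, of y] by (simp add: blinfun.diff_left inner_diff_left)
        show "inner ((C m - C n) y) y \<le> 1 * (norm y)\<^sup>2" for y
          using up[of m y] C(3)[of n y] by (simp add: blinfun.diff_left inner_diff_left)
      qed
      then show ?thesis by (simp add: blinfun.diff_left inner_diff_left)
    qed
    have "Cauchy (\<lambda>n. C n x)"
    proof (rule metric_CauchyI)
      fix e :: real assume e: "e > 0"
      then obtain N where N: "\<And>m n. m \<ge> N \<Longrightarrow> n \<ge> N \<Longrightarrow> dist (inner (C m x) x) (inner (C n x) x) < e\<^sup>2"
        using metric_CauchyD[OF cau, of "e\<^sup>2"] by auto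
      have "dist (C m x) (C n x) < e" if "m \<ge> N" "n \<ge> N" for m n
      proof -
        have "(norm (C m x - C n x))\<^sup>2 \<le> \<bar>inner (C m x) x - inner (C n x) x\<bar>"
          using diff[of n m] diff[of m n] by (cases "n \<le> m") (auto simp: norm_minus_commute)
        also have "\<dots> < e\<^sup>2" using N[OF that] by (simp add: dist_real_def)
        finally show ?thesis using e by (simp add: dist_norm power2_less_imp_less)
      qed
      then show "\<exists>N. \<forall>m\<ge>N. \<forall>n\<ge>N. dist (C m x) (C n x) < e" by blast
    qed
    then show ?thesis by (simp add: Cauchy_convergent_iff)
  qed
  define s where "s x = lim (\<lambda>n. C n x)" for x
  have s: "(\<lambda>n. C n x) \<longlonglongrightarrow> s x" for x using conv[of x] by (simp add: s_def convergent_LIMSEQ_iff)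
  have Cn: "norm (C n x) \<le> norm x" for n x
  proof (rule power2_le_imp_le)
    have "(norm (C n x))\<^sup>2 \<le> 1 * inner (C n x) x"
      by (rule positive_norm_bound[OF C(2,3)]) (use up in simp)
    then show "(norm (C n x))\<^sup>2 \<le> (norm x)\<^sup>2" using up[of n x] by linarith
  qed simp
  have "bounded_linear s"
  proof (rule bounded_linear_intro)
    show "s (x + y) = s x + s y" for x y
      by (rule LIMSEQ_unique[OF s]) (use tendsto_add[OF s[of x] s[of y]] in \<open>simp add: blinfun.add_right\<close>)
    show "s (r *\<^sub>R x) = r *\<^sub>R s x" for r x
      by (rule LIMSEQ_unique[OF s]) (use tendsto_scaleR[OF tendsto_const s[of x], of r] in \<open>simp add: blinfun.scaleR_right\<close>)
    show "norm (s x) \<le> norm x * 1" for x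
      using LIMSEQ_le_const2[OF tendsto_norm[OF s[of x]], of "norm x"] Cn by auto
  qed
  define L where "L = Blinfun s"
  have L: "(\<lambda>n. C n x) \<longlonglongrightarrow> L x" for x
    using s[of x] by (simp add: L_def bounded_linear_Blinfun_apply \<open>bounded_linear s\<close>)
  have LM: "L \<in> M" by (rule M_strong_limit[OF C(1) L])
  have inner_lim: "(\<lambda>n. inner (C n x) y) \<longlonglongrightarrow> inner (L x) y" for x y by (intro tendsto_intros L)
  have Csa: "inner (C n x) y = inner x (C n y)" for n x y by (rule is_adjoint_inner[OF C(2)])
  have Lsa': "inner (L x) y = inner x (L y)" for x y
  proof (rule LIMSEQ_unique[OF inner_lim])
    show "(\<lambda>n. inner (C n x) y) \<longlonglongrightarrow> inner x (L y)" unfolding Csa by (intro tendsto_intros L)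
  qed
  have Lsa: "self_adj L"
  proof -
    have "L = adj L"
    proof (rule blinfun_eqI)
      fix y
      have "inner x (L y) = inner x (adj L y)" for x
        using Lsa'[of x y] is_adjoint_inner[OF M_is_adjoint[OF LM], of x y] by simp
      then show "L y = adj L y" by (metis inner_eq_zero_iff inner_diff_right eq_iff_diff_eq_0)
    qed
    then show ?thesis using M_is_adjoint[OF LM] by simp
  qed
  have Lup: "inner (C n x) x \<le> inner (L x) x" for n x
    by (rule LIMSEQ_le_const[OF inner_lim]) (use mono in blast)
  have ople: "op_le A B \<longleftrightarrow> (\<forall>x. inner (A x) x \<le> inner (B x) x)" if "self_adj A" "self_adj B" for A B
    unfolding op_le_def positive_op_iff[OF is_adjoint_diff[OF that(2,1)]]
    by (simp add: blinfun.diff_left inner_diff_left)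
  have dir: "directed_in M (range C)"
    unfolding directed_in_def
  proof (intro conjI ballI)
    show "range C \<subseteq> self_adjoint_part M" using C(1,2) M_self_adj by blast
    fix A B assume "A \<in> range C" "B \<in> range C"
    then obtain i j where "A = C i" "B = C j" by blast
    then show "\<exists>D\<in>range C. op_le A D \<and> op_le B D"
      using mono by (intro bexI[of _ "C (max i j)"]) (auto simp: ople C)
  qed auto
  have lub: "is_lub_in M (range C) L"
    unfolding is_lub_in_def
  proof (intro conjI ballI impI)
    show "L \<in> self_adjoint_part M" using LM Lsa M_self_adj by blast
    show "op_le A L" if "A \<in> range C" for A using that Lup by (auto simp: ople C Lsa)
    fix K assume K: "K \<in> self_adjoint_part M" and ub: "\<forall>A\<in>range C. op_le A K"
    have Ksa: "self_adj K" using K M_self_adj by (auto simp: self_adjoint_part_def)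
    have "inner (L x) x \<le> inner (K x) x" for x
      by (rule LIMSEQ_le_const2[OF inner_lim]) (use ub in \<open>auto simp: ople C Ksa\<close>)
    then show "op_le L K" by (simp add: ople Lsa Ksa)
  qed
  show thesis by (rule that[OF LM Lsa L dir lub Lup])
qed

end

context vN_algebra
begin

text \<open>
The last claim is the variational description of the inverse: the quadratic form of \<open>R = (1 + S)\<^sup>-\<^sup>1\<close> at \<open>x\<close> is the maximum over
\<open>z\<close> of the left-hand side, attained at \<open>z = R x\<close>. It makes the monotonicity of inversion evident.
\<close>

lemma resolvent_properties:
  assumes S: "S \<in> M" "self_adj S" "\<And>x. inner (S x) x \<ge> 0" and R: "res S 1 R"
  shows "self_adj R" and "\<And>x. inner (R x) x = (norm (R x))\<^sup>2 + inner (S (R x)) (R x)"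
    and "\<And>x z. 2 * inner x z - (norm z)\<^sup>2 - inner (S z) z \<le> inner (R x) x"
proof -
  have R1: "R (x + S x) = x" and R2: "R x + S (R x) = x" for x
    using R by (auto simp: res_def)
  have Sc: "cinner (S x) y = cinner x (S y)" for x y using S(2) by (simp add: is_adjoint_def)
  show "self_adj R"
    unfolding is_adjoint_def
  proof (intro allI)
    fix x z
    have "cinner (R x) z = cinner (R x) (R z + S (R z))" by (simp only: R2)
    also have "\<dots> = cinner (R x + S (R x)) (R z)" by (simp only: cinner_add_left cinner_add_right Sc)
    also have "\<dots> = cinner x (R z)" by (simp only: R2)
    finally show "cinner (R x) z = cinner x (R z)" .
  qed
  show in1: "inner (R x) x = (norm (R x))\<^sup>2 + inner (S (R x)) (R x)" for x
  proof -
    have "inner (R x) x = inner (R x) (R x + S (R x))" by (simp only: R2)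
    then show ?thesis by (simp add: inner_add_right power2_norm_eq_inner inner_commute)
  qed
  show "2 * inner x z - (norm z)\<^sup>2 - inner (S z) z \<le> inner (R x) x" for x z
  proof -
    define y where "y = R x"
    have xy: "x = y + S y" by (simp add: y_def R2)
    have sy: "inner (S y) z = inner (S z) y" using is_adjoint_inner[OF S(2), of y z] by (simp add: inner_commute)
    have "0 \<le> inner (S (z - y)) (z - y) + (norm (z - y))\<^sup>2" using S(3) by simp
    also have "\<dots> = inner (S z) z - 2 * inner (S y) z + inner (S y) y + (norm z)\<^sup>2 - 2 * inner y z + (norm y)\<^sup>2"
      by (simp add: blinfun.diff_right inner_diff_left inner_diff_right power2_norm_eq_inner inner_commute sy[unfolded inner_commute[of "S y"]])
    also have "2 * inner (S y) z = 2 * inner x z - 2 * inner y z" by (simp add: xy inner_add_left)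
    finally show ?thesis using in1[of x] by (simp add: y_def)
  qed
qed

text \<open>
\<open>S \<mapsto> 1 - (1 + S)\<^sup>-\<^sup>1 = S (1 + S)\<^sup>-\<^sup>1\<close>. It cuts positive operators down to the interval from \<open>0\<close> to \<open>1\<close> and preserves their
order, which a spectral cut-off or the minimum with \<open>1\<close> would not.
\<close>

definition cayley :: "('h \<Rightarrow>\<^sub>L 'h) \<Rightarrow> ('h \<Rightarrow>\<^sub>L 'h)" where
  "cayley S = id_blinfun - (SOME R. res S 1 R)"

text \<open>
Everything is computed at \<open>x = y + S y\<close> with \<open>y = R x\<close>, where \<open>cayley S x = S y\<close>.
\<close>

lemma
  assumes S: "S \<in> M" "self_adj S" "\<And>x. inner (S x) x \<ge> 0"
  shows cayley_in: "cayley S \<in> M" and cayley_self_adj: "self_adj (cayley S)"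
    and cayley_nonneg: "\<And>x. inner (cayley S x) x \<ge> 0"
    and cayley_le_one: "\<And>x. inner (cayley S x) x \<le> (norm x)\<^sup>2"
    and cayley_le: "\<And>x. inner (cayley S x) x \<le> inner (S x) x"
    and cayley_ge: "\<And>c x. c > 0 \<Longrightarrow> (\<And>y. inner (S y) y \<le> c * (norm y)\<^sup>2) \<Longrightarrow>
      inner (S x) x \<le> (1 + c) * inner (cayley S x) x"
proof -
  define R where "R = (SOME R. res S 1 R)"
  have R: "res S 1 R"
    unfolding R_def using positive_resolvent_exists[OF S, of 1] by (metis someI zero_less_one)
  have c: "cayley S x = x - R x" for x by (simp add: cayley_def R_def blinfun.diff_left)
  note RP = resolvent_properties[OF S R]
  have R2: "R x + S (R x) = x" for x using R by (auto simp: res_def)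
  show "cayley S \<in> M" unfolding cayley_def R_def[symmetric] using R by (intro M_diff M_id) (simp add: res_def)
  show "self_adj (cayley S)" unfolding cayley_def R_def[symmetric] by (intro is_adjoint_diff is_adjoint_id RP(1))
  have ci: "inner (cayley S x) x = inner (S (R x)) (R x) + (norm (S (R x)))\<^sup>2" for x
  proof -
    define y where "y = R x"
    have xy: "x = y + S y" by (simp add: y_def R2)
    have "cayley S x = S y"
      unfolding c y_def[symmetric] by (rule iffD2[OF diff_eq_eq]) (subst add.commute, rule xy)
    then have "inner (cayley S x) x = inner (S y) (y + S y)" using xy by simp
    then show ?thesis by (simp add: inner_add_right power2_norm_eq_inner y_def)
  qed
  show "inner (cayley S x) x \<ge> 0" for x using ci[of x] S(3)[of "R x"] by simp
  show "inner (cayley S x) x \<le> (norm x)\<^sup>2" for x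
  proof -
    have "inner (cayley S x) x = (norm x)\<^sup>2 - inner (R x) x"
      by (simp only: c inner_diff_left power2_norm_eq_inner)
    then show ?thesis using RP(2)[of x] S(3)[of "R x"] zero_le_power2[of "norm (R x)"] by linarith
  qed
  have si: "inner (S x) x = inner (S (R x)) (R x) + 2 * (norm (S (R x)))\<^sup>2 + inner (S (S (R x))) (S (R x))" for x
  proof -
    define y where "y = R x"
    have xy: "x = y + S y" by (simp add: y_def R2)
    have "inner (S (S y)) y = inner (S y) (S y)" by (rule is_adjoint_inner[OF S(2)])
    then have "inner (S (y + S y)) (y + S y) = inner (S y) y + 2 * (norm (S y))\<^sup>2 + inner (S (S y)) (S y)"
      by (simp add: blinfun.add_right inner_add_left inner_add_right power2_norm_eq_inner)
    then show ?thesis unfolding xy[symmetric] unfolding y_def .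
  qed
  show "inner (cayley S x) x \<le> inner (S x) x" for x
    unfolding ci[of x] si[of x] using S(3)[of "S (R x)"] by simp
  show "inner (S x) x \<le> (1 + c) * inner (cayley S x) x" if c: "c > 0" and b: "\<And>y. inner (S y) y \<le> c * (norm y)\<^sup>2" for c x
  proof -
    have 1: "(norm (S (R x)))\<^sup>2 \<le> c * inner (S (R x)) (R x)" by (rule positive_norm_bound[OF S(2,3) b])
    have 2: "inner (S (S (R x))) (S (R x)) \<le> c * (norm (S (R x)))\<^sup>2" by (rule b)
    show ?thesis unfolding ci[of x] si[of x] distrib_left distrib_right using 1 2 by linarith
  qed
qed

lemma cayley_mono:
  assumes S: "S \<in> M" "self_adj S" "\<And>x. inner (S x) x \<ge> 0"
    and S': "S' \<in> M" "self_adj S'" "\<And>x. inner (S' x) x \<ge> 0"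
    and le: "\<And>x. inner (S x) x \<le> inner (S' x) x"
  shows "inner (cayley S x) x \<le> inner (cayley S' x) x"
proof -
  define R where "R = (SOME R. res S 1 R)"
  define R' where "R' = (SOME R. res S' 1 R)"
  have R: "res S 1 R" unfolding R_def using positive_resolvent_exists[OF S, of 1] by (metis someI zero_less_one)
  have R': "res S' 1 R'" unfolding R'_def using positive_resolvent_exists[OF S', of 1] by (metis someI zero_less_one)
  have "2 * inner x (R' x) - (norm (R' x))\<^sup>2 - inner (S (R' x)) (R' x) \<le> inner (R x) x"
    by (rule resolvent_properties(3)[OF S R])
  moreover have "inner (R' x) x = (norm (R' x))\<^sup>2 + inner (S' (R' x)) (R' x)"
    by (rule resolvent_properties(2)[OF S' R'])
  moreover have "inner (S (R' x)) (R' x) \<le> inner (S' (R' x)) (R' x)" by (rule le)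
  ultimately have "inner (R' x) x \<le> inner (R x) x" by (simp add: inner_commute)
  then show ?thesis by (simp add: cayley_def R_def R'_def blinfun.diff_left inner_diff_left)
qed

end

section \<open>Normal states\<close>

locale vN_state = vN_algebra M for M :: "('h::complex_hilbert_space \<Rightarrow>\<^sub>L 'h) set" +
  fixes \<rho> :: "('h \<Rightarrow>\<^sub>L 'h) \<Rightarrow> complex"
  assumes normal: "normal_state_on M \<rho>"
begin

lemma st_add: "A \<in> M \<Longrightarrow> B \<in> M \<Longrightarrow> \<rho> (A + B) = \<rho> A + \<rho> B"
  and st_scaleC: "A \<in> M \<Longrightarrow> \<rho> (c *\<^sub>C A) = c * \<rho> A"
  and st_pos: "A \<in> M \<Longrightarrow> positive_op A \<Longrightarrow> \<rho> A \<in> \<real>\<^sub>\<ge>\<^sub>0"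
  and st_id: "\<rho> id_blinfun = 1"
  using normal by (auto simp: normal_state_on_def state_on_def)

lemma st_scaleR: "A \<in> M \<Longrightarrow> \<rho> (r *\<^sub>R A) = of_real r * \<rho> A"
  by (simp add: scaleR_scaleC st_scaleC)

lemma st_zero: "\<rho> 0 = 0" using st_scaleR[OF M_id, of 0] by simp

lemma st_diff: "A \<in> M \<Longrightarrow> B \<in> M \<Longrightarrow> \<rho> (A - B) = \<rho> A - \<rho> B"
  using st_add[of A "(-1) *\<^sub>R B"] st_scaleR[of B "-1"] M_scaleR[of B "-1"] by simp

lemma st_sum: "(\<And>i. i \<in> I \<Longrightarrow> f i \<in> M) \<Longrightarrow> \<rho> (sum f I) = (\<Sum>i\<in>I. \<rho> (f i))"
proof (induction I rule: infinite_finite_induct)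
  case (insert i I)
  then have "f i \<in> M" "sum f I \<in> M" by (auto intro!: M_sum)
  with insert show ?case by (simp add: st_add)
qed (simp_all add: st_zero)

lemma st_nonneg: "A \<in> M \<Longrightarrow> self_adj A \<Longrightarrow> (\<And>x. inner (A x) x \<ge> 0) \<Longrightarrow> \<rho> A \<in> \<real>\<^sub>\<ge>\<^sub>0"
  by (rule st_pos) (simp_all add: positive_op_iff)

lemma st_mono:
  assumes "A \<in> M" "self_adj A" "B \<in> M" "self_adj B" "\<And>x. inner (A x) x \<le> inner (B x) x"
  shows "Re (\<rho> A) \<le> Re (\<rho> B)"
proof -
  have "\<rho> (B - A) \<in> \<real>\<^sub>\<ge>\<^sub>0"
    using assms by (intro st_nonneg M_diff is_adjoint_diff) (auto simp: blinfun.diff_left inner_diff_left)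
  then show ?thesis using assms by (simp add: st_diff complex_nonneg_Reals_iff)
qed

lemma st_sup:
  assumes "directed_in M D" "is_lub_in M D L"
  shows "Re (\<rho> L) = (SUP A\<in>D. Re (\<rho> A))"
  using normal assms by (auto simp: normal_state_on_def)

lemma st_sup_le:
  assumes "directed_in M (range C)" "is_lub_in M (range C) L" "\<And>n :: nat. Re (\<rho> (C n)) \<le> b"
  shows "Re (\<rho> L) \<le> b"
  unfolding st_sup[OF assms(1,2)] by (rule cSUP_least) (use assms(3) in auto)

lemma st_self_adj_real:
  assumes "A \<in> M" "self_adj A" shows "Im (\<rho> A) = 0"
proof -
  have "\<rho> (norm A *\<^sub>R id_blinfun + A) \<in> \<real>\<^sub>\<ge>\<^sub>0"
  proof (rule st_nonneg)
    show "inner ((norm A *\<^sub>R id_blinfun + A) x) x \<ge> 0" for x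
      using inner_blinfun_le[of "- A" x]
      by (simp add: blinfun.add_left blinfun.scaleR_left blinfun.minus_left inner_add_left power2_norm_eq_inner)
  qed (intro M_add M_scaleR M_id assms is_adjoint_add is_adjoint_scaleR is_adjoint_id)+
  then show ?thesis
    using assms by (simp add: st_add st_scaleR st_id M_id M_scaleR complex_nonneg_Reals_iff)
qed

lemma st_adj_Re:
  assumes A: "A \<in> M" shows "Re (\<rho> (adj A)) = Re (\<rho> A)"
proof -
  have "is_adjoint (\<i> *\<^sub>C (A - adj A)) (cnj \<i> *\<^sub>C (adj A - A))"
    by (intro is_adjoint_scaleC is_adjoint_diff M_is_adjoint[OF A] is_adjoint_sym[OF M_is_adjoint[OF A]])
  moreover have "cnj \<i> *\<^sub>C (adj A - A) = \<i> *\<^sub>C (A - adj A)"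
  proof -
    have "adj A - A = (-1) *\<^sub>C (A - adj A)"
      using scaleR_scaleC[of "-1" "A - adj A"] by simp
    then show ?thesis by (simp add: scaleC_scaleC)
  qed
  ultimately have "self_adj (\<i> *\<^sub>C (A - adj A))" by simp
  then have "Im (\<rho> (\<i> *\<^sub>C (A - adj A))) = 0"
    using A by (intro st_self_adj_real M_scaleC M_diff M_adj)
  then show ?thesis using A by (simp add: st_scaleC st_diff M_diff M_adj)
qed

text \<open>
The real part of the inner product of the GNS construction; averaging over the two orders makes symmetry immediate.
\<close>

definition gns :: "('h \<Rightarrow>\<^sub>L 'h) \<Rightarrow> ('h \<Rightarrow>\<^sub>L 'h) \<Rightarrow> real" where
  "gns A B = (Re (\<rho> (adj B o\<^sub>L A)) + Re (\<rho> (adj A o\<^sub>L B))) / 2"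

lemma adj_add: "A \<in> M \<Longrightarrow> B \<in> M \<Longrightarrow> adj (A + B) = adj A + adj B"
  by (intro adj_eqI is_adjoint_add M_is_adjoint)

lemma adj_scaleR: "A \<in> M \<Longrightarrow> adj (r *\<^sub>R A) = r *\<^sub>R adj A"
  by (intro adj_eqI is_adjoint_scaleR M_is_adjoint)

lemma gns_self: "gns A A = Re (\<rho> (adj A o\<^sub>L A))" by (simp add: gns_def)

lemma adj_compose_nonneg:
  assumes "A \<in> M"
  shows "adj A o\<^sub>L A \<in> M" "self_adj (adj A o\<^sub>L A)" "inner ((adj A o\<^sub>L A) x) x = (norm (A x))\<^sup>2"
proof -
  show "adj A o\<^sub>L A \<in> M" using assms by (intro M_compose M_adj)
  show "self_adj (adj A o\<^sub>L A)" by (rule self_adj_adj_compose[OF M_is_adjoint[OF assms]])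
  have "inner (adj A (A x)) x = inner (A x) (A x)"
    by (rule is_adjoint_inner[OF is_adjoint_sym[OF M_is_adjoint[OF assms]]])
  then show "inner ((adj A o\<^sub>L A) x) x = (norm (A x))\<^sup>2" by (simp add: power2_norm_eq_inner)
qed

lemma semi_inner_gns: "semi_inner M gns"
proof
  show "subspace M" by (rule M_subspace)
  have cadd1: "A o\<^sub>L (B + C) = (A o\<^sub>L B) + (A o\<^sub>L C)" for A B C :: "'h \<Rightarrow>\<^sub>L 'h"
    by (rule blinfun_eqI) (simp add: blinfun.add_left blinfun.add_right)
  have cadd2: "(A + B) o\<^sub>L C = (A o\<^sub>L C) + (B o\<^sub>L C)" for A B C :: "'h \<Rightarrow>\<^sub>L 'h"
    by (rule blinfun_eqI) (simp add: blinfun.add_left)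
  have cs1: "A o\<^sub>L (r *\<^sub>R B) = r *\<^sub>R (A o\<^sub>L B)" for A B :: "'h \<Rightarrow>\<^sub>L 'h" and r
    by (rule blinfun_eqI) (simp add: blinfun.scaleR_left blinfun.scaleR_right)
  have cs2: "(r *\<^sub>R A) o\<^sub>L B = r *\<^sub>R (A o\<^sub>L B)" for A B :: "'h \<Rightarrow>\<^sub>L 'h" and r
    by (rule blinfun_eqI) (simp add: blinfun.scaleR_left)
  show "gns (A + B) C = gns A C + gns B C" if "A \<in> M" "B \<in> M" "C \<in> M" for A B C
    using that by (simp add: gns_def adj_add cadd1 cadd2 st_add M_compose M_adj add_divide_distrib)
  show "gns (r *\<^sub>R A) C = r * gns A C" if "A \<in> M" "C \<in> M" for A C r
    using that by (simp add: gns_def adj_scaleR cs1 cs2 st_scaleR M_compose M_adj distrib_left[symmetric])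
  show "gns A B = gns B A" for A B by (simp add: gns_def add.commute)
  show "gns A A \<ge> 0" if "A \<in> M" for A
    using st_nonneg[OF adj_compose_nonneg(1,2)[OF that]] adj_compose_nonneg(3)[OF that]
    by (simp add: gns_self complex_nonneg_Reals_iff)
qed

text \<open>
The Cauchy--Schwarz inequality with the identity bounds the real part; applied to \<open>- i A\<close> it bounds the imaginary part.
\<close>

lemma st_norm_le:
  assumes A: "A \<in> M"
  shows "norm (\<rho> A) \<le> 2 * sqrt (Re (\<rho> (adj A o\<^sub>L A)))"
proof -
  interpret g: semi_inner M gns by (rule semi_inner_gns)
  have adj_id: "adj (id_blinfun :: 'h \<Rightarrow>\<^sub>L 'h) = id_blinfun" by (rule adj_eqI[OF is_adjoint_id])
  have cid: "id_blinfun o\<^sub>L B = B" "B o\<^sub>L id_blinfun = B" for B :: "'h \<Rightarrow>\<^sub>L 'h"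
    by (rule blinfun_eqI, simp)+
  have nid: "g.nm id_blinfun = 1" by (simp add: g.nm_def gns_self adj_id cid st_id)
  have re: "\<bar>Re (\<rho> B)\<bar> \<le> sqrt (Re (\<rho> (adj B o\<^sub>L B)))" if B: "B \<in> M" for B
  proof -
    have "gns B id_blinfun = Re (\<rho> B)" using st_adj_Re[OF B] by (simp add: gns_def adj_id cid)
    then show ?thesis
      using g.Cauchy_Schwarz[OF B M_id] by (simp add: nid) (simp add: g.nm_def gns_self)
  qed
  define B where "B = (- \<i>) *\<^sub>C A"
  have B: "B \<in> M" unfolding B_def by (rule M_scaleC[OF A])
  have "Re (\<rho> B) = Im (\<rho> A)" using A by (simp add: B_def st_scaleC)
  moreover have "adj B o\<^sub>L B = adj A o\<^sub>L A"
  proof -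
    have "adj B = cnj (- \<i>) *\<^sub>C adj A"
      unfolding B_def by (intro adj_eqI is_adjoint_scaleC M_is_adjoint A)
    moreover have "adj A (c *\<^sub>C x) = c *\<^sub>C adj A x" for c x
      using M_bounded[OF M_adj[OF A]] by (simp add: bounded_ops_def)
    ultimately show ?thesis
      by (intro blinfun_eqI) (simp add: B_def scaleC_blinfun.rep_eq scaleC_scaleC scaleC_one)
  qed
  ultimately have "\<bar>Im (\<rho> A)\<bar> \<le> sqrt (Re (\<rho> (adj A o\<^sub>L A)))" using re[OF B] by simp
  then show ?thesis using re[OF A] cmod_le[of "\<rho> A"] by linarith
qed

end

text \<open>
Otherwise there is a subsequence with \<open>\<tau>(B\<^sub>i) \<le> 2\<^sup>-\<^sup>i\<close> but \<open>\<rho>(B\<^sub>i) \<ge> \<delta>\<close>. As for a sequence of sets, one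
forms a "limes superior": \<open>D n\<close>, the increasing limit of the transforms of \<open>B\<^sub>n + \<dots> + B\<^sub>n\<^sub>+\<^sub>m\<close> under \<open>cayley\<close>, plays the role of
the union of the sets from \<open>n\<close> on, and \<open>E\<close>, the decreasing limit of the \<open>D n\<close>, that of their intersection. By
normality \<open>\<tau>(E) = 0\<close>, as in the Borel--Cantelli lemma, whence \<open>E = 0\<close>; but \<open>D n\<close> dominates \<open>B\<^sub>n / (1 + c)\<close>, so
\<open>\<rho>(E) \<ge> \<delta> / (1 + c)\<close>.
\<close>

lemma normal_state_absolutely_continuous:
  assumes "vN_state M \<tau>" "vN_state M \<rho>" and faithful: "faithful_on M \<tau>"
    and B: "\<And>n. B n \<in> M" "\<And>n. self_adj (B n)" "\<And>n x. inner (B n x) x \<ge> 0"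
    and c: "c > 0" "\<And>n x. inner (B n x) x \<le> c * (norm x)\<^sup>2"
    and lim: "(\<lambda>n. Re (\<tau> (B n))) \<longlonglongrightarrow> 0"
  shows "(\<lambda>n. Re (\<rho> (B n))) \<longlonglongrightarrow> 0"
proof (rule ccontr)
  interpret t: vN_state M \<tau> by fact
  interpret r: vN_state M \<rho> by fact
  assume "\<not> (\<lambda>n. Re (\<rho> (B n))) \<longlonglongrightarrow> 0"
  then obtain \<delta> where \<delta>: "\<delta> > 0" "\<And>N. \<exists>n\<ge>N. \<bar>Re (\<rho> (B n))\<bar> \<ge> \<delta>"
    unfolding LIMSEQ_def dist_real_def by (auto simp: not_less)
  have "\<exists>n. Re (\<tau> (B n)) \<le> (1/2) ^ k \<and> Re (\<rho> (B n)) \<ge> \<delta>" for k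
  proof -
    have "\<forall>\<^sub>F n in sequentially. Re (\<tau> (B n)) < (1/2) ^ k"
      by (rule order_tendstoD(2)[OF lim]) simp
    then obtain N where N: "\<And>n. n \<ge> N \<Longrightarrow> Re (\<tau> (B n)) < (1/2) ^ k" by (auto simp: eventually_sequentially)
    obtain n where n: "n \<ge> N" "\<bar>Re (\<rho> (B n))\<bar> \<ge> \<delta>" using \<delta>(2) by blast
    have "Re (\<rho> (B n)) \<ge> 0" using r.st_nonneg[OF B(1,2,3)] by (simp add: complex_nonneg_Reals_iff)
    then show ?thesis using n N[OF n(1)] by (intro exI[of _ n]) auto
  qed
  then obtain k where k: "\<And>i. Re (\<tau> (B (k i))) \<le> (1/2) ^ i" "\<And>i. Re (\<rho> (B (k i))) \<ge> \<delta>" by metis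
  define S where "S n m = (\<Sum>i\<in>{n..<n+m}. B (k i))" for n m
  have S: "S n m \<in> M" "self_adj (S n m)" for n m
    unfolding S_def by (intro t.M_sum B, intro is_adjoint_sum B)
  have Sin: "inner (S n m x) x = (\<Sum>i\<in>{n..<n+m}. inner (B (k i) x) x)" for n m x
    by (simp add: S_def blinfun.sum_left inner_sum_left)
  have S0: "inner (S n m x) x \<ge> 0" for n m x unfolding Sin by (intro sum_nonneg B)
  have Smono: "inner (S n m x) x \<le> inner (S n' m' x) x" if "n' \<le> n" "n + m \<le> n' + m'" for n m n' m' x
    unfolding Sin using that by (intro sum_mono2 B) auto
  define C where "C n m = t.cayley (S n m)" for n m
  have C: "C n m \<in> M" "self_adj (C n m)" "inner (C n m x) x \<ge> 0" "inner (C n m x) x \<le> (norm x)\<^sup>2"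
    "inner (C n m x) x \<le> inner (S n m x) x" for n m x
    unfolding C_def using t.cayley_in[OF S S0] t.cayley_self_adj[OF S S0] t.cayley_nonneg[OF S S0]
      t.cayley_le_one[OF S S0] t.cayley_le[OF S S0] by auto
  have Cmono: "inner (C n m x) x \<le> inner (C n' m' x) x" if "n' \<le> n" "n + m \<le> n' + m'" for n m n' m' x
    unfolding C_def by (rule t.cayley_mono[OF S S0 S S0 Smono[OF that]])
  have "\<exists>L. L \<in> M \<and> self_adj L \<and> (\<forall>x. (\<lambda>m. C n m x) \<longlonglongrightarrow> L x) \<and> directed_in M (range (C n)) \<and>
      is_lub_in M (range (C n)) L \<and> (\<forall>m x. inner (C n m x) x \<le> inner (L x) x)" for n
  proof -
    have inc: "inner (C n m x) x \<le> inner (C n (Suc m) x) x" for m x by (rule Cmono) auto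
    show ?thesis
      by (rule t.increasing_strong_limit[of "C n", OF C(1) C(2) C(3) C(4) inc]) blast
  qed
  then obtain D where D: "\<And>n. D n \<in> M" "\<And>n. self_adj (D n)" "\<And>n x. (\<lambda>m. C n m x) \<longlonglongrightarrow> D n x"
    "\<And>n. directed_in M (range (C n))" "\<And>n. is_lub_in M (range (C n)) (D n)"
    "\<And>n m x. inner (C n m x) x \<le> inner (D n x) x" by metis
  have Dlim: "(\<lambda>m. inner (C n m x) x) \<longlonglongrightarrow> inner (D n x) x" for n x by (intro tendsto_intros D)
  have D0: "inner (D n x) x \<ge> 0" for n x using C(3)[of n 0 x] D(6)[of n 0 x] by linarith
  have D1: "inner (D n x) x \<le> (norm x)\<^sup>2" for n x by (rule LIMSEQ_le_const2[OF Dlim]) (use C(4) in blast)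
  have Ddec: "inner (D (Suc n) x) x \<le> inner (D n x) x" for n x
  proof (rule LIMSEQ_le_const2[OF Dlim])
    have "inner (C (Suc n) m x) x \<le> inner (D n x) x" for m
      using Cmono[of n "Suc n" m "Suc m" x] D(6)[of n "Suc m" x] by simp
    then show "\<exists>N. \<forall>m\<ge>N. inner (C (Suc n) m x) x \<le> inner (D n x) x" by blast
  qed
  have \<tau>D: "Re (\<tau> (D n)) \<le> 2 * (1/2) ^ n" for n
  proof (rule t.st_sup_le[OF D(4,5)])
    fix m
    have "Re (\<tau> (C n m)) \<le> Re (\<tau> (S n m))" by (rule t.st_mono[OF C(1,2) S C(5)])
    also have "\<dots> = (\<Sum>i\<in>{n..<n+m}. Re (\<tau> (B (k i))))" unfolding S_def using B by (simp add: t.st_sum)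
    also have "\<dots> \<le> (\<Sum>i\<in>{n..<n+m}. (1/2) ^ i)" by (intro sum_mono k)
    also have "\<dots> \<le> 2 * (1/2) ^ n"
    proof -
      have "(\<Sum>i\<in>{n..<n+m}. (1/2::real) ^ i) = 2 * (1/2) ^ n - 2 * (1/2) ^ (n + m)"
      proof (induction m)
        case (Suc m)
        have "(\<Sum>i\<in>{n..<n+Suc m}. (1/2::real) ^ i) = (\<Sum>i\<in>{n..<n+m}. (1/2) ^ i) + (1/2) ^ (n + m)"
          by simp
        moreover have "(1/2::real) ^ (n + Suc m) = (1/2) * (1/2) ^ (n + m)" by simp
        ultimately show ?case using Suc by linarith
      qed simp
      then show ?thesis by simp
    qed
    finally show "Re (\<tau> (C n m)) \<le> 2 * (1/2) ^ n" .
  qed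
  have \<rho>D: "Re (\<rho> (D n)) \<ge> \<delta> / (1 + c)" for n
  proof -
    have S1: "S n 1 = B (k n)" by (simp add: S_def)
    have "inner (B (k n) x) x \<le> (1 + c) * inner (C n 1 x) x" for x
      unfolding C_def S1 by (rule t.cayley_ge[OF B(1,2,3) c])
    moreover have "(1 + c) * inner (C n 1 x) x \<le> (1 + c) * inner (D n x) x" for x
      using c(1) by (intro mult_left_mono D(6)) simp
    ultimately have le: "inner (B (k n) x) x \<le> (1 + c) * inner (D n x) x" for x
      by (rule order_trans)
    have "Re (\<rho> (B (k n))) \<le> Re (\<rho> ((1 + c) *\<^sub>R D n))"
    proof (rule r.st_mono[OF B(1,2)])
      show "(1 + c) *\<^sub>R D n \<in> M" by (rule t.M_scaleR[OF D(1)])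
      show "self_adj ((1 + c) *\<^sub>R D n)" by (rule is_adjoint_scaleR[OF D(2)])
      show "inner (B (k n) x) x \<le> inner (((1 + c) *\<^sub>R D n) x) x" for x
        using le[of x] by (simp add: blinfun.scaleR_left)
    qed
    also have "\<dots> = (1 + c) * Re (\<rho> (D n))" using D(1) by (simp only: r.st_scaleR) simp
    finally show ?thesis using k(2)[of n] c(1) by (simp add: pos_divide_le_eq mult.commute)
  qed
  \<comment> \<open>Normality concerns increasing limits, so the decreasing sequence is complemented.\<close>
  define F where "F n = id_blinfun - D n" for n
  have Fx: "inner (F n x) x = (norm x)\<^sup>2 - inner (D n x) x" for n x
    by (simp add: F_def blinfun.diff_left inner_diff_left power2_norm_eq_inner)
  have F: "F n \<in> M" "self_adj (F n)" for n
    unfolding F_def by (intro t.M_diff t.M_id D, intro is_adjoint_diff is_adjoint_id D)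
  obtain L where L: "L \<in> M" "self_adj L" "\<And>x. (\<lambda>n. F n x) \<longlonglongrightarrow> L x"
    "directed_in M (range F)" "is_lub_in M (range F) L" "\<And>n x. inner (F n x) x \<le> inner (L x) x"
    by (rule t.increasing_strong_limit[of F, OF F(1) F(2)]) (use D0 D1 Ddec Fx in \<open>auto\<close>)
  have L1: "inner (L x) x \<le> (norm x)\<^sup>2" for x
  proof (rule LIMSEQ_le_const2)
    show "(\<lambda>n. inner (F n x) x) \<longlonglongrightarrow> inner (L x) x" by (intro tendsto_intros L)
    show "\<exists>N. \<forall>n\<ge>N. inner (F n x) x \<le> (norm x)\<^sup>2" using D0[of _ x] by (simp add: Fx)
  qed
  define E where "E = id_blinfun - L"
  have E: "E \<in> M" "self_adj E" "inner (E x) x \<ge> 0" for x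
  proof -
    show "E \<in> M" unfolding E_def by (intro t.M_diff t.M_id L)
    show "self_adj E" unfolding E_def by (intro is_adjoint_diff is_adjoint_id L)
    show "inner (E x) x \<ge> 0"
      using L1[of x] by (simp add: E_def blinfun.diff_left inner_diff_left power2_norm_eq_inner)
  qed
  have "Re (\<tau> E) \<le> 2 * (1/2) ^ n" for n
  proof -
    have "Re (\<tau> E) \<le> Re (\<tau> (D n))"
    proof (rule t.st_mono[OF E(1,2) D(1,2)])
      show "inner (E x) x \<le> inner (D n x) x" for x
        using L(6)[of n x] Fx[of n x] by (simp add: E_def blinfun.diff_left inner_diff_left power2_norm_eq_inner)
    qed
    then show ?thesis using \<tau>D[of n] by simp
  qed
  then have ev: "\<exists>N. \<forall>n\<ge>N. Re (\<tau> E) \<le> 2 * (1/2) ^ n" by blast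
  have "(\<lambda>n. 2 * (1/2::real) ^ n) \<longlonglongrightarrow> 0" by real_asymp
  then have "Re (\<tau> E) \<le> 0" by (rule LIMSEQ_le_const[OF _ ev])
  moreover have "\<tau> E \<in> \<real>\<^sub>\<ge>\<^sub>0" by (rule t.st_nonneg[OF E])
  ultimately have "\<tau> E = 0" by (auto simp: complex_nonneg_Reals_iff complex_eq_iff)
  then have "E = 0" using faithful E positive_op_iff[OF E(2)] by (auto simp: faithful_on_def)
  then have "Re (\<rho> L) = 1" using t.M_id L(1) r.st_id by (simp add: E_def)
  moreover have "Re (\<rho> L) \<le> 1 - \<delta> / (1 + c)"
  proof (rule r.st_sup_le[OF L(4,5)])
    show "Re (\<rho> (F n)) \<le> 1 - \<delta> / (1 + c)" for n
      using \<rho>D[of n] D(1)[of n] by (simp add: F_def r.st_diff t.M_id r.st_id)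
  qed
  moreover have "\<delta> / (1 + c) > 0" using \<delta>(1) c(1) by simp
  ultimately show False by linarith
qed

text \<open>
The operator \<open>S = (norm A)\<^sup>2 - A* A\<close> is positive, so \<open>l + S\<close> is invertible in the algebra for \<open>l > 0\<close>. The automorphism
carries the inverses to inverses of \<open>l + \<alpha> S\<close>, whence \<open>\<alpha> S = (norm A)\<^sup>2 - (\<alpha> A)* (\<alpha> A)\<close> is positive.
\<close>

lemma (in vN_algebra) automorphism_contraction:
  assumes \<alpha>: "star_automorphism M \<alpha>" and A: "A \<in> M"
  shows "norm (\<alpha> A) \<le> norm A"
proof -
  have in_M: "\<alpha> X \<in> M" if "X \<in> M" for X using \<alpha> that by (auto simp: star_automorphism_def bij_betw_def)
  have add: "\<alpha> (X + Y) = \<alpha> X + \<alpha> Y" and comp: "\<alpha> (X o\<^sub>L Y) = \<alpha> X o\<^sub>L \<alpha> Y" if "X \<in> M" "Y \<in> M" for X Y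
    using \<alpha> that by (auto simp: star_automorphism_def)
  have scaleC: "\<alpha> (c *\<^sub>C X) = c *\<^sub>C \<alpha> X" and adj: "\<alpha> (adj X) = adj (\<alpha> X)" if "X \<in> M" for X c
    using \<alpha> that by (auto simp: star_automorphism_def)
  have scale: "\<alpha> (s *\<^sub>R X) = s *\<^sub>R \<alpha> X" if "X \<in> M" for X s using scaleC[OF that] by (simp add: scaleR_scaleC)
  have diff: "\<alpha> (X - Y) = \<alpha> X - \<alpha> Y" if "X \<in> M" "Y \<in> M" for X Y
    using add[OF that(1) M_scaleR[OF that(2), of "-1"]] scale[OF that(2), of "-1"] by simp
  have one: "\<alpha> id_blinfun = id_blinfun"
  proof -
    have "bij_betw \<alpha> M M" using \<alpha> by (simp add: star_automorphism_def)
    then have "id_blinfun \<in> \<alpha> ` M" using M_id by (metis bij_betw_imp_surj_on)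
    then obtain E where E: "E \<in> M" "\<alpha> E = id_blinfun" by (metis imageE)
    have "id_blinfun o\<^sub>L E = E" by (rule blinfun_eqI) simp
    then have unit: "\<alpha> id_blinfun o\<^sub>L id_blinfun = id_blinfun" using comp[OF M_id E(1)] by (simp only: E(2))
    have "\<alpha> id_blinfun o\<^sub>L id_blinfun = \<alpha> id_blinfun" by (rule blinfun_eqI) simp
    then show ?thesis by (rule trans[OF sym unit])
  qed
  define S where "S = (norm A)\<^sup>2 *\<^sub>R id_blinfun - (adj A o\<^sub>L A)"
  have AA: "adj A o\<^sub>L A \<in> M" using A by (intro M_compose M_adj)
  have inAA: "inner ((adj B o\<^sub>L B) x) x = (norm (B x))\<^sup>2" if "B \<in> M" for B x
    using is_adjoint_inner[OF is_adjoint_sym[OF M_is_adjoint[OF that]], of "B x" x]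
    by (simp add: power2_norm_eq_inner)
  have SM: "S \<in> M" unfolding S_def by (intro M_diff M_scaleR M_id AA)
  have Ssa: "self_adj S" unfolding S_def
    by (intro is_adjoint_diff is_adjoint_scaleR is_adjoint_id self_adj_adj_compose M_is_adjoint A)
  have S0: "inner (S x) x \<ge> 0" for x
  proof -
    have "(norm (A x))\<^sup>2 \<le> (norm A * norm x)\<^sup>2" by (intro power_mono norm_blinfun) simp
    then show ?thesis
      using inAA[OF A, of x]
      by (simp add: S_def blinfun.diff_left blinfun.scaleR_left inner_diff_left power2_norm_eq_inner[symmetric] power_mult_distrib)
  qed
  have \<alpha>S: "\<alpha> S = (norm A)\<^sup>2 *\<^sub>R id_blinfun - (adj (\<alpha> A) o\<^sub>L \<alpha> A)"
    unfolding S_def using A AA by (simp add: diff scale M_scaleR M_id one comp M_adj adj)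
  have \<alpha>S0: "inner (\<alpha> S x) x \<ge> 0" for x
  proof (rule positive_if_resolvents[OF in_M[OF SM]])
    have "is_adjoint (\<alpha> S) (adj (\<alpha> S))" by (rule M_is_adjoint[OF in_M[OF SM]])
    then show "self_adj (\<alpha> S)" using adj[OF SM] adj_eqI[OF Ssa] by simp
    fix l :: real assume l: "l > 0"
    obtain R where R: "res S l R" by (rule positive_resolvent_exists[OF SM Ssa S0 l])
    have RM: "R \<in> M" using R by (simp add: res_def)
    have "R o\<^sub>L (l *\<^sub>R id_blinfun + S) = id_blinfun"
      using R by (intro blinfun_eqI) (simp add: res_def blinfun.add_left blinfun.scaleR_left)
    then have "\<alpha> R o\<^sub>L \<alpha> (l *\<^sub>R id_blinfun + S) = id_blinfun"
      using comp[OF RM M_add[OF M_scaleR[OF M_id] SM], of l] one by simp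
    then have "\<alpha> R o\<^sub>L (l *\<^sub>R id_blinfun + \<alpha> S) = id_blinfun"
      using add[OF M_scaleR[OF M_id] SM, of l] scale[OF M_id, of l] one by simp
    then have "\<alpha> R (l *\<^sub>R x + \<alpha> S x) = x" for x
      by (auto dest!: arg_cong[of _ _ "\<lambda>T. blinfun_apply T x"] simp: blinfun.add_left blinfun.scaleR_left)
    then show "\<exists>R :: 'h \<Rightarrow>\<^sub>L 'h. \<forall>x. R (l *\<^sub>R x + \<alpha> S x) = x" by blast
  qed
  show ?thesis
  proof (rule norm_blinfun_bound)
    show "norm (\<alpha> A x) \<le> norm A * norm x" for x
    proof (rule power2_le_imp_le)
      show "(norm (\<alpha> A x))\<^sup>2 \<le> (norm A * norm x)\<^sup>2"
        using \<alpha>S0[of x] inAA[OF in_M[OF A], of x] unfolding \<alpha>S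
        by (simp add: blinfun.diff_left blinfun.scaleR_left inner_diff_left power2_norm_eq_inner[symmetric] power_mult_distrib)
    qed simp
  qed simp
qed

section \<open>Disjointness from trace-preserving automorphisms\<close>

lemma moebius_arithmetic_progression:
  assumes "K > 0"
  shows "(\<lambda>N. (\<Sum>n=1..N. of_int (moebius_mu n) * of_bool (n mod K = r)) / real N) \<longlonglongrightarrow> 0"
proof -
  have "moebius_orthogonal (\<lambda>n. of_bool (n mod K = r))"
    by (rule moebius_orthogonal_periodic[OF _ assms]) simp
  then have "(\<lambda>N. complex_of_real ((\<Sum>n=1..N. of_int (moebius_mu n) * of_bool (n mod K = r)) / real N)) \<longlonglongrightarrow> of_real 0"
    by (simp add: moebius_orthogonal_def)
  then show ?thesis by (simp only: tendsto_of_real_iff)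
qed

theorem proposition4p2:
  fixes M :: "('h::complex_hilbert_space \<Rightarrow>\<^sub>L 'h) set"
    and \<tau> :: "('h \<Rightarrow>\<^sub>L 'h) \<Rightarrow> complex"
    and \<alpha> :: "('h \<Rightarrow>\<^sub>L 'h) \<Rightarrow> ('h \<Rightarrow>\<^sub>L 'h)"
  assumes "finite_von_neumann_algebra M"
    and "normal_state_on M \<tau>" and "faithful_on M \<tau>" and "tracial_on M \<tau>"
    and "star_automorphism M \<alpha>"
    and "\<And>A. A \<in> M \<Longrightarrow> \<tau> (\<alpha> A) = \<tau> A"
  shows "weakly_linearly_disjoint moebius_mu M \<alpha>"
  unfolding weakly_linearly_disjoint_def
proof (intro allI impI ballI)
  fix \<rho> A
  assume \<rho>: "normal_state_on M \<rho>" and A: "A \<in> M"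
  have vN: "von_neumann_algebra M" using assms(1) by (simp add: finite_von_neumann_algebra_def)
  interpret t: vN_state M \<tau> using vN assms(2) by unfold_locales
  interpret r: vN_state M \<rho> using vN \<rho> by unfold_locales
  have in_M: "\<alpha> X \<in> M" if "X \<in> M" for X using assms(5) that by (auto simp: star_automorphism_def bij_betw_def)
  have comp: "\<alpha> (X o\<^sub>L Y) = \<alpha> X o\<^sub>L \<alpha> Y" if "X \<in> M" "Y \<in> M" for X Y
    using assms(5) that by (auto simp: star_automorphism_def)
  have adj: "\<alpha> (adj X) = adj (\<alpha> X)" if "X \<in> M" for X
    using assms(5) that by (auto simp: star_automorphism_def)
  interpret g: semi_inner M t.gns by (rule t.semi_inner_gns)
  interpret u: semi_inner_isometry M t.gns \<alpha>
  proof
    show "\<alpha> (X + Y) = \<alpha> X + \<alpha> Y" if "X \<in> M" "Y \<in> M" for X Y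
      using assms(5) that by (auto simp: star_automorphism_def)
    show "\<alpha> (s *\<^sub>R X) = s *\<^sub>R \<alpha> X" if "X \<in> M" for X s
      using assms(5) that by (auto simp: star_automorphism_def scaleR_scaleC)
    have "\<tau> (adj (\<alpha> Y) o\<^sub>L \<alpha> X) = \<tau> (adj Y o\<^sub>L X)" if "X \<in> M" "Y \<in> M" for X Y
      using comp[OF t.M_adj[OF that(2)] that(1)] adj[OF that(2)] assms(6)[OF t.M_compose[OF t.M_adj[OF that(2)] that(1)]]
      by simp
    then show "t.gns (\<alpha> X) (\<alpha> Y) = t.gns X Y" if "X \<in> M" "Y \<in> M" for X Y
      using that by (simp add: t.gns_def)
  qed (rule in_M)
  define T where "T N = g.mavg (\<lambda>n. (\<alpha> ^^ n) A) N" for N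
  have orbit: "(\<alpha> ^^ n) A \<in> M" for n by (rule u.Un_in[OF A])
  have TM: "T N \<in> M" for N unfolding T_def g.mavg_def by (intro t.M_scaleR t.M_sum orbit)
  have norm_orbit: "norm ((\<alpha> ^^ n) A) \<le> norm A" for n
  proof (induction n)
    case (Suc n)
    then show ?case using t.automorphism_contraction[OF assms(5) orbit[of n]] by simp
  qed simp
  have norm_T: "norm (T N) \<le> norm A" for N
  proof (cases "N = 0")
    case False
    have "norm (\<Sum>n=1..N. of_int (moebius_mu n) *\<^sub>R (\<alpha> ^^ n) A) \<le> (\<Sum>n=1..N. norm A)"
    proof (rule sum_norm_le)
      fix n
      have "\<bar>real_of_int (moebius_mu n)\<bar> \<le> 1" using abs_moebius_mu_le[of n] by linarith
      then have "\<bar>real_of_int (moebius_mu n)\<bar> * norm ((\<alpha> ^^ n) A) \<le> 1 * norm A"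
        using norm_orbit by (intro mult_mono) auto
      then show "norm (of_int (moebius_mu n) *\<^sub>R (\<alpha> ^^ n) A) \<le> norm A" by simp
    qed
    then show ?thesis using False by (simp add: T_def g.mavg_def pos_divide_le_eq mult.commute)
  qed (simp add: T_def g.mavg_def)
  have "(\<lambda>N. g.nm (T N)) \<longlonglongrightarrow> 0"
    unfolding T_def by (rule u.mavg_orbit_tendsto_0[OF moebius_arithmetic_progression A])
  then have "(\<lambda>N. (g.nm (T N))\<^sup>2) \<longlonglongrightarrow> 0\<^sup>2" by (intro tendsto_intros)
  then have \<tau>lim: "(\<lambda>N. Re (\<tau> (adj (T N) o\<^sub>L T N))) \<longlonglongrightarrow> 0"
    by (simp add: g.nm_sq TM t.gns_self)
  have \<rho>lim: "(\<lambda>N. Re (\<rho> (adj (T N) o\<^sub>L T N))) \<longlonglongrightarrow> 0"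
  proof (rule normal_state_absolutely_continuous[OF t.vN_state_axioms r.vN_state_axioms assms(3), where c = "(norm A)\<^sup>2 + 1"])
    show "inner ((adj (T N) o\<^sub>L T N) x) x \<le> ((norm A)\<^sup>2 + 1) * (norm x)\<^sup>2" for N x
    proof -
      have "norm (T N x) \<le> norm A * norm x"
        by (rule order_trans[OF norm_blinfun mult_right_mono[OF norm_T norm_ge_zero]])
      then have "(norm (T N x))\<^sup>2 \<le> (norm A * norm x)\<^sup>2" by (rule power_mono) simp
      then show ?thesis
        unfolding t.adj_compose_nonneg(3)[OF TM] by (simp add: power_mult_distrib distrib_right add_increasing2)
    qed
    show "(norm A)\<^sup>2 + 1 > 0" by (simp add: add_nonneg_pos)
    show "inner ((adj (T N) o\<^sub>L T N) x) x \<ge> 0" for N x unfolding t.adj_compose_nonneg(3)[OF TM] by simp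
  qed (intro t.adj_compose_nonneg TM \<tau>lim)+
  have "(\<lambda>N. 2 * sqrt (Re (\<rho> (adj (T N) o\<^sub>L T N)))) \<longlonglongrightarrow> 2 * sqrt 0"
    by (intro tendsto_intros \<rho>lim)
  then have lim: "(\<lambda>N. 2 * sqrt (Re (\<rho> (adj (T N) o\<^sub>L T N)))) \<longlonglongrightarrow> 0" by simp
  have "(\<lambda>N. \<rho> (T N)) \<longlonglongrightarrow> 0"
    by (rule Lim_null_comparison[OF _ lim]) (rule always_eventually, rule allI, rule r.st_norm_le[OF TM])
  moreover have "\<rho> (T N) = (1 / of_nat N) * (\<Sum>n=1..N. of_int (moebius_mu n) * \<rho> ((\<alpha> ^^ n) A))" for N
  proof -
    have "\<rho> (T N) = of_real (1 / real N) * \<rho> (\<Sum>n=1..N. of_int (moebius_mu n) *\<^sub>R (\<alpha> ^^ n) A)"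
      unfolding T_def g.mavg_def by (intro r.st_scaleR t.M_sum t.M_scaleR orbit)
    moreover have "\<rho> (\<Sum>n=1..N. of_int (moebius_mu n) *\<^sub>R (\<alpha> ^^ n) A)
        = (\<Sum>n=1..N. of_int (moebius_mu n) * \<rho> ((\<alpha> ^^ n) A))"
      using orbit by (simp add: r.st_sum t.M_scaleR r.st_scaleR)
    ultimately show ?thesis by simp
  qed
  ultimately show "(\<lambda>N. (1 / of_nat N) * (\<Sum>n=1..N. of_int (moebius_mu n) * \<rho> ((\<alpha> ^^ n) A))) \<longlonglongrightarrow> 0"
    by simp
qed

end
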